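(* Let $G$ be a finite group, $u\in G$ a central element with $u^2=1$, $U=\langle u\rangle$, and $V\neq0$ a finite-dimensional representation of $G$ over a field $k$ on which $u$ acts as $-1$. Let $H=k[G]\ltimes\wedge V$ be the corresponding modified supergroup algebra, where the characteristic of $k$ is zero or does not divide $\dim H$. Then there is a group isomorphism $$H^2_L(H)\cong S^2(V^* )^G\times H^2(G/U,k^\cdot).$$
   Context: Modified supergroup algebra: $k[G]\ltimes\wedge V$ is the Hopf algebra which as an algebra is the smash product of $k[G]$ with the exterior algebra $\wedge V$ (so $gvg^{-1}=g.v$ for $g\in G$, $v\in V$), in which the elements of $G$ are grouplike and $\Delta(v)=v\otimes 1+u\otimes v$ for $v\in V$. Second lazy cohomology group: a left $2$-cocycle on $H$ is a normalized convolution invertible $\sigma\in(H\otimes H)^*$ with $\sum\sigma(a_{(1)},b_{(1)})\sigma(a_{(2)}b_{(2)},c)=\sum\sigma(b_{(1)},c_{(1)})\sigma(a,b_{(2)}c_{(2)})$ for all $a,b,c\in H$. It is lazy if $\sum\sigma(a_{(1)},b_{(1)})a_{(2)}b_{(2)}=\sum\sigma(a_{(2)},b_{(2)})a_{(1)}b_{(1)}$ for all $a,b\in H$. Lazy cocycles form a group $Z^2_L(H)$ under convolution. For a normalized convolution invertible $\gamma\in H^*$ put $\partial(\gamma)(a,b)=\sum\gamma(a_{(1)})\gamma(b_{(1)})\gamma^{-1}(a_{(2)}b_{(2)})$. The lazy coboundaries, i.e. the $\partial(\gamma)$ with $\gamma$ central in $H^*$, form a central subgroup $B^2_L(H)$ of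 $Z^2_L(H)$, and $H^2_L(H)=Z^2_L(H)/B^2_L(H)$. $S^2(V^* )^G$ is the additive group of symmetric $n\times n$ matrices $\Sigma$ over $k$ ($n=\dim V$) with $\rho(g)^t\Sigma\rho(g)=\Sigma$ for all $g\in G$, where $\rho(g)$ is the matrix of $g$ on $V$ in a fixed basis $v_1,\dots,v_n$, $g.v_i=\sum_j\rho(g)_{ji}v_j$. $H^2(G/U,k^\cdot)$ is group cohomology with trivial action on $k^\cdot=k\setminus\{0\}$. *)

theory Defs
  imports
    "Jordan_Normal_Form.Matrix"
    "HOL-Algebra.Algebra"
begin

section \<open>Finite-dimensional algebras and bialgebras with a chosen basis\<close>

text \<open>
  A vector space with finite basis indexed by \<open>I\<close> is the space of coefficient functions that
  vanish outside \<open>I\<close>; its tensor square is the same construction on \<open>I \<times> I\<close>, and its dual is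
  identified with the functions on \<open>I\<close> (values on basis elements), again extended by \<open>0\<close>.
  An algebra is given by its structure constants: \<open>structc A i j\<close> is the coefficient function of
  the product of the basis elements \<open>i\<close> and \<open>j\<close>.
\<close>

definition vecs :: "'i set \<Rightarrow> ('i \<Rightarrow> 'k::field) set" where
  "vecs I = {a. \<forall>i. i \<notin> I \<longrightarrow> a i = 0}"

definition bvec :: "'i \<Rightarrow> 'i \<Rightarrow> 'k::field" where
  "bvec i = (\<lambda>j. if j = i then 1 else 0)"

record ('i, 'k) alg =
  basis :: "'i set"
  structc :: "'i \<Rightarrow> 'i \<Rightarrow> 'i \<Rightarrow> 'k"
  unitv :: "'i \<Rightarrow> 'k"

text \<open>\<open>comulc H i\<close> is the coefficient function of the coproduct of the basis element \<open>i\<close>.\<close>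

record ('i, 'k) bialg = "('i, 'k) alg" +
  comulc :: "'i \<Rightarrow> 'i \<times> 'i \<Rightarrow> 'k"
  counitc :: "'i \<Rightarrow> 'k"

definition amul :: "('i, 'k::field, 'm) alg_scheme \<Rightarrow> ('i \<Rightarrow> 'k) \<Rightarrow> ('i \<Rightarrow> 'k) \<Rightarrow> 'i \<Rightarrow> 'k" where
  "amul A a b = (\<lambda>r. \<Sum>i\<in>basis A. \<Sum>j\<in>basis A. a i * b j * structc A i j r)"

definition aprod :: "('i, 'k::field, 'm) alg_scheme \<Rightarrow> ('i \<Rightarrow> 'k) list \<Rightarrow> 'i \<Rightarrow> 'k" where
  "aprod A xs = foldr (amul A) xs (unitv A)"

definition alg_tensor :: "('i, 'k::field, 'm) alg_scheme \<Rightarrow> ('j, 'k, 'n) alg_scheme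
    \<Rightarrow> ('i \<times> 'j, 'k) alg" where
  "alg_tensor A B =
     \<lparr> basis = basis A \<times> basis B,
       structc = (\<lambda>(i, j) (p, q) (r, s). structc A i p r * structc B j q s),
       unitv = (\<lambda>(r, s). unitv A r * unitv B s) \<rparr>"

definition comul :: "('i, 'k::field, 'm) bialg_scheme \<Rightarrow> ('i \<Rightarrow> 'k) \<Rightarrow> 'i \<times> 'i \<Rightarrow> 'k" where
  "comul H a = (\<lambda>t. \<Sum>i\<in>basis H. a i * comulc H i t)"

definition dim_alg :: "('i, 'k::field, 'm) alg_scheme \<Rightarrow> nat" where
  "dim_alg A = card (basis A)"

section \<open>Convolution algebras\<close>

text \<open>The multiplicative monoid of the algebra dual to the coalgebra with basis \<open>I\<close>,
  comultiplication \<open>d\<close> and counit \<open>e\<close>.\<close>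

definition conv_monoid ::
  "'i set \<Rightarrow> ('i \<Rightarrow> 'i \<times> 'i \<Rightarrow> 'k::field) \<Rightarrow> ('i \<Rightarrow> 'k) \<Rightarrow> ('i \<Rightarrow> 'k) monoid" where
  "conv_monoid I d e =
     \<lparr> carrier = vecs I,
       monoid.mult = (\<lambda>\<phi> \<psi> i. if i \<in> I then \<Sum>(p, q)\<in>I \<times> I. d i (p, q) * \<phi> p * \<psi> q else 0),
       one = (\<lambda>i. if i \<in> I then e i else 0) \<rparr>"

definition dual :: "('i, 'k::field, 'm) bialg_scheme \<Rightarrow> ('i \<Rightarrow> 'k) monoid" where
  "dual H = conv_monoid (basis H) (comulc H) (counitc H)"

text \<open>\<open>(H \<otimes> H)\<^sup>*\<close>, where \<open>H \<otimes> H\<close> carries the tensor product coalgebra structure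
  \<open>\<Delta>(a \<otimes> b) = \<Sum> (a\<^sub>1 \<otimes> b\<^sub>1) \<otimes> (a\<^sub>2 \<otimes> b\<^sub>2)\<close>.\<close>

definition dual2 :: "('i, 'k::field, 'm) bialg_scheme \<Rightarrow> ('i \<times> 'i \<Rightarrow> 'k) monoid" where
  "dual2 H = conv_monoid (basis H \<times> basis H)
     (\<lambda>(i, j) ((p, q), (p', q')). comulc H i (p, p') * comulc H j (q, q'))
     (\<lambda>(i, j). counitc H i * counitc H j)"

definition ev :: "('i, 'k::field, 'm) bialg_scheme \<Rightarrow> ('i \<Rightarrow> 'k) \<Rightarrow> ('i \<Rightarrow> 'k) \<Rightarrow> 'k" where
  "ev H \<phi> a = (\<Sum>i\<in>basis H. \<phi> i * a i)"

definition ev2 ::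
  "('i, 'k::field, 'm) bialg_scheme \<Rightarrow> ('i \<times> 'i \<Rightarrow> 'k) \<Rightarrow> ('i \<Rightarrow> 'k) \<Rightarrow> ('i \<Rightarrow> 'k) \<Rightarrow> 'k" where
  "ev2 H \<sigma> a b = (\<Sum>i\<in>basis H. \<Sum>j\<in>basis H. \<sigma> (i, j) * a i * b j)"

section \<open>Second lazy cohomology\<close>

text \<open>In the sums below a pair \<open>(i, i')\<close> runs over the tensor basis of \<open>H \<otimes> H\<close> and
  \<open>comul H a (i, i')\<close> is the corresponding coefficient of \<open>\<Delta>(a) = \<Sum> a\<^sub>1 \<otimes> a\<^sub>2\<close>.\<close>

definition normalized2 :: "('i, 'k::field, 'm) bialg_scheme \<Rightarrow> ('i \<times> 'i \<Rightarrow> 'k) \<Rightarrow> bool" where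
  "normalized2 H \<sigma> \<longleftrightarrow> (\<forall>a\<in>vecs (basis H).
     ev2 H \<sigma> a (unitv H) = ev H (counitc H) a \<and> ev2 H \<sigma> (unitv H) a = ev H (counitc H) a)"

definition left_cocycle :: "('i, 'k::field, 'm) bialg_scheme \<Rightarrow> ('i \<times> 'i \<Rightarrow> 'k) \<Rightarrow> bool" where
  "left_cocycle H \<sigma> \<longleftrightarrow> \<sigma> \<in> Units (dual2 H) \<and> normalized2 H \<sigma> \<and>
     (\<forall>a\<in>vecs (basis H). \<forall>b\<in>vecs (basis H). \<forall>c\<in>vecs (basis H).
        (\<Sum>(i, i')\<in>basis H \<times> basis H. \<Sum>(j, j')\<in>basis H \<times> basis H.
           comul H a (i, i') * comul H b (j, j') * \<sigma> (i, j) * ev2 H \<sigma> (structc H i' j') c) =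
        (\<Sum>(i, i')\<in>basis H \<times> basis H. \<Sum>(j, j')\<in>basis H \<times> basis H.
           comul H b (i, i') * comul H c (j, j') * \<sigma> (i, j) * ev2 H \<sigma> a (structc H i' j')))"

definition lazy :: "('i, 'k::field, 'm) bialg_scheme \<Rightarrow> ('i \<times> 'i \<Rightarrow> 'k) \<Rightarrow> bool" where
  "lazy H \<sigma> \<longleftrightarrow>
     (\<forall>a\<in>vecs (basis H). \<forall>b\<in>vecs (basis H). \<forall>r\<in>basis H.
        (\<Sum>(i, i')\<in>basis H \<times> basis H. \<Sum>(j, j')\<in>basis H \<times> basis H.
           comul H a (i, i') * comul H b (j, j') * \<sigma> (i, j) * structc H i' j' r) =
        (\<Sum>(i, i')\<in>basis H \<times> basis H. \<Sum>(j, j')\<in>basis H \<times> basis H.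
           comul H a (i, i') * comul H b (j, j') * \<sigma> (i', j') * structc H i j r))"

definition lazy_Z2 :: "('i, 'k::field, 'm) bialg_scheme \<Rightarrow> ('i \<times> 'i \<Rightarrow> 'k) monoid" where
  "lazy_Z2 H = (dual2 H)\<lparr> carrier := {\<sigma>. left_cocycle H \<sigma> \<and> lazy H \<sigma>} \<rparr>"

definition lazy_cobound ::
  "('i, 'k::field, 'm) bialg_scheme \<Rightarrow> ('i \<Rightarrow> 'k) \<Rightarrow> 'i \<times> 'i \<Rightarrow> 'k" where
  "lazy_cobound H \<gamma> = (\<lambda>(i, j). if (i, j) \<in> basis H \<times> basis H
     then \<Sum>(p, p')\<in>basis H \<times> basis H. \<Sum>(q, q')\<in>basis H \<times> basis H.
            comulc H i (p, p') * comulc H j (q, q') * \<gamma> p * \<gamma> q *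
            ev H (inv\<^bsub>dual H\<^esub> \<gamma>) (structc H p' q')
     else 0)"

definition lazy_B2 :: "('i, 'k::field, 'm) bialg_scheme \<Rightarrow> ('i \<times> 'i \<Rightarrow> 'k) set" where
  "lazy_B2 H = {lazy_cobound H \<gamma> | \<gamma>. \<gamma> \<in> Units (dual H) \<and> ev H \<gamma> (unitv H) = 1 \<and>
     (\<forall>\<phi>\<in>carrier (dual H). \<gamma> \<otimes>\<^bsub>dual H\<^esub> \<phi> = \<phi> \<otimes>\<^bsub>dual H\<^esub> \<gamma>)}"

definition lazy_H2 :: "('i, 'k::field, 'm) bialg_scheme \<Rightarrow> ('i \<times> 'i \<Rightarrow> 'k) set monoid" where
  "lazy_H2 H = lazy_Z2 H Mod lazy_B2 H"

section \<open>Representations and modified supergroup algebras\<close>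

locale linear_rep = group G + vector_space scale
  for G :: "('g, 'm) monoid_scheme" (structure)
    and scale :: "'k::field \<Rightarrow> 'v::ab_group_add \<Rightarrow> 'v" +
  fixes act :: "'g \<Rightarrow> 'v \<Rightarrow> 'v"
  assumes act_linear: "g \<in> carrier G \<Longrightarrow> Vector_Spaces.linear scale scale (act g)"
    and act_one: "act \<one> v = v"
    and act_mult: "g \<in> carrier G \<Longrightarrow> h \<in> carrier G \<Longrightarrow> act (g \<otimes> h) v = act g (act h v)"

definition is_ordered_basis :: "('k::field \<Rightarrow> 'v::ab_group_add \<Rightarrow> 'v) \<Rightarrow> 'v list \<Rightarrow> bool" where
  "is_ordered_basis scale vs \<longleftrightarrow>
     distinct vs \<and> \<not> module.dependent scale (set vs) \<and> module.span scale (set vs) = UNIV"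

text \<open>The entry \<open>(j, i)\<close> is the coefficient of \<open>vs ! j\<close> in \<open>act g (vs ! i)\<close>.\<close>

definition rep_matrix :: "('k::field \<Rightarrow> 'v::ab_group_add \<Rightarrow> 'v) \<Rightarrow> ('g \<Rightarrow> 'v \<Rightarrow> 'v) \<Rightarrow> 'v list
    \<Rightarrow> 'g \<Rightarrow> 'k mat" where
  "rep_matrix scale act vs g = mat (length vs) (length vs)
     (\<lambda>(j, i). module.representation scale (set vs) (act g (vs ! i)) (vs ! j))"

text \<open>The exterior algebra on \<open>v\<^sub>0, \<dots>, v\<^bsub>n-1\<^esub>\<close>: the basis element \<open>S \<subseteq> {..<n}\<close> is the wedge
  product of the \<open>v\<^sub>i\<close>, \<open>i \<in> S\<close>, in increasing order. The sign counts inversions.\<close>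

definition ext_alg :: "nat \<Rightarrow> (nat set, 'k::field) alg" where
  "ext_alg n =
     \<lparr> basis = Pow {..<n},
       structc = (\<lambda>S T R. if S \<inter> T = {} \<and> R = S \<union> T
                          then (- 1) ^ card {(s, t). s \<in> S \<and> t \<in> T \<and> t < s} else 0),
       unitv = bvec {} \<rparr>"

definition ext_vector :: "nat \<Rightarrow> 'k::field vec \<Rightarrow> nat set \<Rightarrow> 'k" where
  "ext_vector n w = (\<lambda>S. \<Sum>j<n. (w $ j) * bvec {j} S)"

text \<open>The action of \<open>g\<close> on the exterior algebra by algebra automorphisms, on a basis element.\<close>

definition ext_act :: "nat \<Rightarrow> ('g \<Rightarrow> 'k::field mat) \<Rightarrow> 'g \<Rightarrow> nat set \<Rightarrow> nat set \<Rightarrow> 'k" where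
  "ext_act n \<rho> g S =
     aprod (ext_alg n) (map (\<lambda>i. ext_vector n (col (\<rho> g) i)) (sorted_list_of_set S))"

text \<open>The smash product of the exterior algebra with the group algebra. The pair \<open>(S, g)\<close> stands
  for \<open>v\<^sub>S g\<close>, and \<open>v\<^sub>S g \<cdot> v\<^sub>T h = v\<^sub>S \<and> (g.v\<^sub>T) gh\<close>.\<close>

definition smash_alg :: "('g, 'm) monoid_scheme \<Rightarrow> nat \<Rightarrow> ('g \<Rightarrow> 'k::field mat)
    \<Rightarrow> (nat set \<times> 'g, 'k) alg" where
  "smash_alg G n \<rho> =
     \<lparr> basis = Pow {..<n} \<times> carrier G,
       structc = (\<lambda>(S, g) (T, h) (R, f).
         if f = g \<otimes>\<^bsub>G\<^esub> h then amul (ext_alg n) (bvec S) (ext_act n \<rho> g T) R else 0),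
       unitv = bvec ({}, \<one>\<^bsub>G\<^esub>) \<rparr>"

text \<open>The coproduct is the multiplicative extension of \<open>\<Delta>(g) = g \<otimes> g\<close> and
  \<open>\<Delta>(v\<^sub>i) = v\<^sub>i \<otimes> 1 + u \<otimes> v\<^sub>i\<close>, the products being taken in the algebra \<open>H \<otimes> H\<close>. The counit is
  \<open>1\<close> on \<open>G\<close> and \<open>0\<close> on \<open>V\<close>.\<close>

definition supergroup_alg :: "('g, 'm) monoid_scheme \<Rightarrow> 'g \<Rightarrow> nat \<Rightarrow> ('g \<Rightarrow> 'k::field mat)
    \<Rightarrow> (nat set \<times> 'g, 'k) bialg" where
  "supergroup_alg G u n \<rho> = alg.extend (smash_alg G n \<rho>)
     (let A = smash_alg G n \<rho>; A2 = alg_tensor A A in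
      \<lparr> comulc = (\<lambda>(S, g). aprod A2
          (map (\<lambda>i t. bvec (({i}, \<one>\<^bsub>G\<^esub>), ({}, \<one>\<^bsub>G\<^esub>)) t + bvec (({}, u), ({i}, \<one>\<^bsub>G\<^esub>)) t)
               (sorted_list_of_set S) @
           [bvec (({}, g), ({}, g))])),
        counitc = (\<lambda>(S, g). if S = {} then 1 else 0) \<rparr>)"

section \<open>Invariant symmetric forms and group cohomology\<close>

definition sym_invariants ::
  "('g, 'm) monoid_scheme \<Rightarrow> nat \<Rightarrow> ('g \<Rightarrow> 'k::field mat) \<Rightarrow> 'k mat monoid" where
  "sym_invariants G n \<rho> =
     \<lparr> carrier = {S \<in> carrier_mat n n. transpose_mat S = S \<and>
                    (\<forall>g\<in>carrier G. transpose_mat (\<rho> g) * S * \<rho> g = S)},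
       monoid.mult = (+), one = 0\<^sub>m n n \<rparr>"

definition nonzero_group :: "'k::field monoid" where
  "nonzero_group = \<lparr> carrier = UNIV - {0}, monoid.mult = (*), one = 1 \<rparr>"

text \<open>Second cohomology of the group \<open>Q\<close> with coefficients in the abelian group \<open>A\<close>, written
  multiplicatively, with trivial action, from the inhomogeneous bar complex.\<close>

definition grp_Z2 :: "('q, 'm) monoid_scheme \<Rightarrow> ('a, 'n) monoid_scheme \<Rightarrow> ('q \<times> 'q \<Rightarrow> 'a) monoid" where
  "grp_Z2 Q A = (product_group (carrier Q \<times> carrier Q) (\<lambda>_. A))
     \<lparr> carrier := {f \<in> carrier Q \<times> carrier Q \<rightarrow>\<^sub>E carrier A.
          \<forall>x\<in>carrier Q. \<forall>y\<in>carrier Q. \<forall>z\<in>carrier Q.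
            f (y, z) \<otimes>\<^bsub>A\<^esub> f (x, y \<otimes>\<^bsub>Q\<^esub> z) = f (x \<otimes>\<^bsub>Q\<^esub> y, z) \<otimes>\<^bsub>A\<^esub> f (x, y)} \<rparr>"

definition grp_B2 :: "('q, 'm) monoid_scheme \<Rightarrow> ('a, 'n) monoid_scheme \<Rightarrow> ('q \<times> 'q \<Rightarrow> 'a) set" where
  "grp_B2 Q A =
     {\<lambda>(x, y)\<in>carrier Q \<times> carrier Q. c x \<otimes>\<^bsub>A\<^esub> c y \<otimes>\<^bsub>A\<^esub> inv\<^bsub>A\<^esub> c (x \<otimes>\<^bsub>Q\<^esub> y) | c.
        c \<in> carrier Q \<rightarrow>\<^sub>E carrier A}"

definition grp_H2 ::
  "('q, 'm) monoid_scheme \<Rightarrow> ('a, 'n) monoid_scheme \<Rightarrow> ('q \<times> 'q \<Rightarrow> 'a) set monoid" where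
  "grp_H2 Q A = grp_Z2 Q A Mod grp_B2 Q A"

end

theory Submission
  imports Defs "HOL-Library.Function_Algebras"
begin

text \<open>
  Write \<open>v\<^sub>S g\<close> for the basis elements of \<open>H = k[G] \<ltimes> \<and>V\<close>. The elements \<open>v\<^sub>i \<otimes> 1\<close> and \<open>u \<otimes> v\<^sub>j\<close> of
  \<open>H \<otimes> H\<close> anticommute, so \<open>\<Delta>(v\<^sub>S g)\<close> is the sum over all decompositions \<open>S = P \<union> Q\<close> of
  \<open>\<plusminus> v\<^sub>P u\<^bsup>|Q|\<^esup> g \<otimes> v\<^sub>Q g\<close>, the sign being that of the shuffle.

  A lazy cocycle \<open>\<sigma>\<close> is the same thing as an associative product on the coalgebra \<open>H\<close> that is
  a map of bicomodules: the product is \<open>a \<bullet> b = \<Sum> \<sigma>(a\<^sub>1, b\<^sub>1) a\<^sub>2 b\<^sub>2\<close>, and \<open>\<sigma>\<close> is recovered by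
  applying the counit (\<open>tw_assoc\<close>, \<open>tw_compat_left\<close>, \<open>Z_of_product\<close>). Laziness in low degree forces \<open>\<sigma>\<close>
  to vanish on \<open>G \<times> V\<close> and \<open>V \<times> G\<close> and to be \<open>U\<close>-invariant on \<open>G \<times> G\<close> (\<open>Z_mixed\<close>). The twisted
  algebra is therefore generated by \<open>G\<close> and \<open>V\<close> with \<open>g \<bullet> h = \<sigma>(g, h) gh\<close>, \<open>g \<bullet> v = (g.v) \<bullet> g\<close> and
  \<open>v \<bullet> w + w \<bullet> v = \<sigma>(v, w) + \<sigma>(w, v)\<close>: it is a Clifford algebra smashed with a twisted group algebra
  of \<open>G/U\<close>. Conjugation with \<open>g\<close> shows that the symmetric form \<open>(\<sigma>(v, w) + \<sigma>(w, v)) / 2\<close> is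
  \<open>G\<close>-invariant (\<open>form_invariant\<close>). This form and the class of the restriction of \<open>\<sigma>\<close> to \<open>G\<close> are
  multiplicative in \<open>\<sigma>\<close> (\<open>Z_conv_low\<close>) and trivial on coboundaries (\<open>B2_low\<close>); they define the
  homomorphism \<open>Psi\<close>.

  \<open>Psi\<close> is surjective. Choose a lower triangular matrix \<open>B\<close> with \<open>B + B\<^sup>t = 2 \<Sigma>\<close> and let
  \<open>v\<^sub>i\<close> act on the exterior algebra by exterior multiplication plus contraction with the row \<open>B\<^sub>i\<close>. These
  operators satisfy the Clifford relations for \<open>\<Sigma>\<close>, and since \<open>B\<close> is triangular the ordered product of
  the \<open>v\<^sub>i\<close>, \<open>i \<in> S\<close>, still sends \<open>1\<close> to \<open>v\<^sub>S\<close>. The Clifford algebra thus lives on the vector space \<open>H\<close>,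
  with the same coproduct formula. As \<open>v \<otimes> 1\<close> and \<open>u \<otimes> w\<close> anticommute, the coproduct is
  multiplicative from the algebra of \<open>B + B'\<close> to the tensor product of those of \<open>B\<close> and \<open>B'\<close>
  (\<open>coproduct_mulB\<close>). For \<open>B' = 0\<close> or \<open>B = 0\<close> this says that the product is a bicomodule map, and for
  \<open>B' = -B\<close> it gives the inverse of the resulting cocycle (\<open>tc_Z\<close>). That \<open>H\<close> is a bialgebra at all is the
  case \<open>B = B' = 0\<close>.

  The kernel of \<open>Psi\<close> consists of coboundaries (\<open>kernel_in_B2\<close>). If both invariants of \<open>\<sigma>\<close> are
  trivial, then, after rescaling the elements of \<open>G\<close>, the generators of the twisted algebra satisfy the
  relations of \<open>H\<close>. This yields an algebra map \<open>\<phi>\<close> from \<open>H\<close> to the twisted algebra, which is a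
  bicomodule map because it is one on generators. Hence \<open>\<phi>(a) = \<Sum> f(a\<^sub>1) a\<^sub>2 = \<Sum> a\<^sub>1 f(a\<^sub>2)\<close> for the
  functional \<open>f = \<epsilon> \<circ> \<phi>\<close>, which is central and satisfies \<open>f(ab) = \<Sum> f(a\<^sub>1) f(b\<^sub>1) \<sigma>(a\<^sub>2, b\<^sub>2)\<close>; that is,
  \<open>\<sigma> = \<partial>(f\<^sup>-\<^sup>1)\<close>. It is invertible because its product with the functional for \<open>\<sigma>\<^sup>-\<^sup>1\<close> is a
  character of \<open>H\<close> that is trivial on the generators.

  Every statement about ordered products rests on one computation: the product of a generator with an
  ordered monomial is a combination of ordered monomials whose coefficients are the same in every algebra
  in which the Clifford relations hold (\<open>mult_ordered\<close>, \<open>lift_lam\<close>).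
\<close>

section \<open>Coefficient vectors and linear operators\<close>

lemma sum_fun_ap: "(\<Sum>i\<in>I. f i) x = (\<Sum>i\<in>I. f i x :: 'k::comm_monoid_add)"
  by (induction I rule: infinite_finite_induct) auto

definition sc :: "'k::field \<Rightarrow> ('b \<Rightarrow> 'k) \<Rightarrow> 'b \<Rightarrow> 'k" where
  "sc c a = (\<lambda>x. c * a x)"

lemma sc_ap [simp]: "sc c a x = c * a x"
  by (simp add: sc_def)

lemma sc_add: "sc c (a + b) = sc c a + sc c b"
  by (simp add: fun_eq_iff algebra_simps)

lemma sc_add_left: "sc (c + d) a = sc c a + sc d a"
  by (simp add: fun_eq_iff algebra_simps)

lemma sc_uminus_left: "sc (- c) a = - sc c a"
  by (simp add: fun_eq_iff)

lemma sc_sc [simp]: "sc c (sc d a) = sc (c * d) a"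
  by (simp add: fun_eq_iff)

lemma sc_one [simp]: "sc 1 a = a"
  by (simp add: fun_eq_iff)

lemma sc_zero [simp]: "sc 0 a = 0" "sc c 0 = 0"
  by (simp_all add: fun_eq_iff)

lemma sc_sum: "sc c (\<Sum>i\<in>I. f i) = (\<Sum>i\<in>I. sc c (f i))"
  by (simp add: fun_eq_iff sum_fun_ap sum_distrib_left)

lemma sc_sum_left: "sc (\<Sum>i\<in>I. f i) a = (\<Sum>i\<in>I. sc (f i) a)"
  by (simp add: fun_eq_iff sum_fun_ap sum_distrib_right)

lemma bvec_ap: "bvec i j = (if j = i then 1 else 0)"
  by (simp add: bvec_def)

lemma bvec_same [simp]: "bvec i i = 1"
  by (simp add: bvec_def)

definition linop :: "(('b \<Rightarrow> 'k::field) \<Rightarrow> 'd \<Rightarrow> 'k) \<Rightarrow> bool" where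
  "linop f \<longleftrightarrow> (\<forall>a b. f (a + b) = f a + f b) \<and> (\<forall>c a. f (sc c a) = sc c (f a))"

lemma linopI:
  "(\<And>a b. f (a + b) = f a + f b) \<Longrightarrow> (\<And>c a. f (sc c a) = sc c (f a)) \<Longrightarrow> linop f"
  by (simp add: linop_def)

lemma linop_add: "linop f \<Longrightarrow> f (a + b) = f a + f b"
  by (simp add: linop_def)

lemma linop_sc: "linop f \<Longrightarrow> f (sc c a) = sc c (f a)"
  by (simp add: linop_def)

lemma linop_0: "linop f \<Longrightarrow> f 0 = 0"
  using linop_sc[of f 0 0] by simp

lemma linop_sum: "linop f \<Longrightarrow> f (\<Sum>i\<in>I. g i) = (\<Sum>i\<in>I. f (g i))"
  by (induction I rule: infinite_finite_induct) (auto simp: linop_0 linop_add)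

lemma linop_id: "linop (\<lambda>a. a)"
  by (simp add: linop_def)

lemma linop_comp: "linop f \<Longrightarrow> linop g \<Longrightarrow> linop (\<lambda>a. f (g a))"
  by (simp add: linop_def)

lemma linop_plus: "linop f \<Longrightarrow> linop g \<Longrightarrow> linop (\<lambda>a. f a + g a)"
  by (simp add: linop_def sc_add add_ac)

lemma linop_scale: "linop f \<Longrightarrow> linop (\<lambda>a. sc c (f a))"
  by (simp add: linop_def sc_add mult_ac)

lemma linop_setsum: "(\<And>i. i \<in> I \<Longrightarrow> linop (f i)) \<Longrightarrow> linop (\<lambda>a. \<Sum>i\<in>I. f i a)"
  by (simp add: linop_def sum.distrib sc_sum)

lemma linop_coeff: "linop (\<lambda>a. sc (a i) b)"
  by (auto simp: linop_def sc_def fun_eq_iff algebra_simps)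

lemma linop_foldr: "(\<And>i. i \<in> set xs \<Longrightarrow> linop (F i)) \<Longrightarrow> linop (foldr F xs)"
  by (induction xs) (auto simp: linop_def)

lemma vecs_0 [simp]: "0 \<in> vecs I"
  by (simp add: vecs_def)

lemma vecs_add: "a \<in> vecs I \<Longrightarrow> b \<in> vecs I \<Longrightarrow> a + b \<in> vecs I"
  by (simp add: vecs_def)

lemma vecs_sc: "a \<in> vecs I \<Longrightarrow> sc c a \<in> vecs I"
  by (simp add: vecs_def)

lemma vecs_sum: "(\<And>j. j \<in> J \<Longrightarrow> f j \<in> vecs I) \<Longrightarrow> (\<Sum>j\<in>J. f j) \<in> vecs I"
  by (simp add: vecs_def sum_fun_ap)

lemma vecs_bvec: "i \<in> I \<Longrightarrow> bvec i \<in> vecs I"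
  by (auto simp: vecs_def bvec_def)

lemma vec_expand:
  assumes "finite I" "a \<in> vecs I"
  shows "a = (\<Sum>i\<in>I. sc (a i) (bvec i))"
proof
  fix x
  have "(\<Sum>i\<in>I. sc (a i) (bvec i)) x = (\<Sum>i\<in>I. if x = i then a i else 0)"
    unfolding sum_fun_ap by (rule sum.cong) (auto simp: bvec_def)
  also have "\<dots> = a x"
    using assms by (auto simp: vecs_def)
  finally show "a x = (\<Sum>i\<in>I. sc (a i) (bvec i)) x" ..
qed

lemma linop_expand:
  assumes "finite I" "a \<in> vecs I" "linop f"
  shows "f a = (\<Sum>i\<in>I. sc (a i) (f (bvec i)))"
  using arg_cong[OF vec_expand[OF assms(1,2)], of f]
  by (simp only: linop_sum[OF assms(3)] linop_sc[OF assms(3)])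

lemma linop_eqI:
  assumes "finite I" "a \<in> vecs I" "linop f" "linop g" "\<And>i. i \<in> I \<Longrightarrow> f (bvec i) = g (bvec i)"
  shows "f a = g a"
  using assms by (simp add: linop_expand[of I])

lemma linop_vecs:
  assumes "finite I" "a \<in> vecs I" "linop f" "\<And>i. i \<in> I \<Longrightarrow> f (bvec i) \<in> vecs J"
  shows "f a \<in> vecs J"
  using assms by (simp add: linop_expand[of I] vecs_sum vecs_sc)

definition tens :: "('a \<Rightarrow> 'k::field) \<Rightarrow> ('b \<Rightarrow> 'k) \<Rightarrow> 'a \<times> 'b \<Rightarrow> 'k" where
  "tens a b = (\<lambda>(x, y). a x * b y)"

lemma tens_ap [simp]: "tens a b (x, y) = a x * b y"
  by (simp add: tens_def)

lemma bvec_pair: "bvec (x, y) = tens (bvec x) (bvec y)"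
  by (auto simp: bvec_def tens_def fun_eq_iff)

lemma vecs_tens: "a \<in> vecs I \<Longrightarrow> b \<in> vecs J \<Longrightarrow> tens a b \<in> vecs (I \<times> J)"
  by (auto simp: vecs_def tens_def)

lemma tens_sc: "tens (sc c a) b = sc c (tens a b)" "tens a (sc c b) = sc c (tens a b)"
  by (auto simp: fun_eq_iff)

lemma tens_sum_left: "tens (\<Sum>i\<in>I. f i) b = (\<Sum>i\<in>I. tens (f i) b)"
  by (auto simp: fun_eq_iff sum_fun_ap sum_distrib_right)

lemma tens_sum_right: "tens b (\<Sum>i\<in>I. f i) = (\<Sum>i\<in>I. tens b (f i))"
  by (auto simp: fun_eq_iff sum_fun_ap sum_distrib_left)

text \<open>The operators \<open>A \<otimes> id\<close> and \<open>id \<otimes> A\<close> on a tensor product, whose elements are coefficient functions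
  on pairs.\<close>

definition on_left :: "(('a \<Rightarrow> 'k::field) \<Rightarrow> 'c \<Rightarrow> 'k) \<Rightarrow> ('a \<times> 'b \<Rightarrow> 'k) \<Rightarrow> 'c \<times> 'b \<Rightarrow> 'k" where
  "on_left A w = (\<lambda>(x, y). A (\<lambda>x'. w (x', y)) x)"

definition on_right :: "(('b \<Rightarrow> 'k::field) \<Rightarrow> 'c \<Rightarrow> 'k) \<Rightarrow> ('a \<times> 'b \<Rightarrow> 'k) \<Rightarrow> 'a \<times> 'c \<Rightarrow> 'k" where
  "on_right A w = (\<lambda>(x, y). A (\<lambda>y'. w (x, y')) y)"

lemma linop_on_left:
  fixes A :: "('a \<Rightarrow> 'k::field) \<Rightarrow> 'c \<Rightarrow> 'k"
  assumes "linop A"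
  shows "linop (on_left A :: ('a \<times> 'b \<Rightarrow> 'k) \<Rightarrow> _)"
proof (rule linopI; rule ext; clarify)
  fix a b :: "'a \<times> 'b \<Rightarrow> 'k" and x y
  have "(\<lambda>x'. (a + b) (x', y)) = (\<lambda>x'. a (x', y)) + (\<lambda>x'. b (x', y))"
    by (simp add: fun_eq_iff)
  then show "on_left A (a + b) (x, y) = (on_left A a + on_left A b) (x, y)"
    by (simp add: on_left_def linop_add[OF assms])
next
  fix c and a :: "'a \<times> 'b \<Rightarrow> 'k" and x y
  have "(\<lambda>x'. sc c a (x', y)) = sc c (\<lambda>x'. a (x', y))"
    by (simp add: fun_eq_iff)
  then show "on_left A (sc c a) (x, y) = sc c (on_left A a) (x, y)"
    by (simp add: on_left_def linop_sc[OF assms] del: sc_ap) simp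
qed

lemma linop_on_right:
  fixes A :: "('b \<Rightarrow> 'k::field) \<Rightarrow> 'c \<Rightarrow> 'k"
  assumes "linop A"
  shows "linop (on_right A :: ('a \<times> 'b \<Rightarrow> 'k) \<Rightarrow> _)"
proof (rule linopI; rule ext; clarify)
  fix a b :: "'a \<times> 'b \<Rightarrow> 'k" and x y
  have "(\<lambda>x'. (a + b) (x, x')) = (\<lambda>x'. a (x, x')) + (\<lambda>x'. b (x, x'))"
    by (simp add: fun_eq_iff)
  then show "on_right A (a + b) (x, y) = (on_right A a + on_right A b) (x, y)"
    by (simp add: on_right_def linop_add[OF assms])
next
  fix c and a :: "'a \<times> 'b \<Rightarrow> 'k" and x y
  have "(\<lambda>x'. sc c a (x, x')) = sc c (\<lambda>x'. a (x, x'))"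
    by (simp add: fun_eq_iff)
  then show "on_right A (sc c a) (x, y) = sc c (on_right A a) (x, y)"
    by (simp add: on_right_def linop_sc[OF assms] del: sc_ap) simp
qed

lemma on_left_tens: "linop A \<Longrightarrow> on_left A (tens a b) = tens (A a) b"
proof -
  assume A: "linop A"
  have "A (\<lambda>x'. a x' * b y) x = A a x * b y" for x y
  proof -
    have "(\<lambda>x'. a x' * b y) = sc (b y) a"
      by (simp add: fun_eq_iff mult.commute)
    then show ?thesis
      by (simp add: linop_sc[OF A] mult.commute)
  qed
  then show ?thesis
    by (auto simp: on_left_def fun_eq_iff)
qed

lemma on_right_tens: "linop A \<Longrightarrow> on_right A (tens a b) = tens a (A b)"
proof -
  assume A: "linop A"
  have "A (\<lambda>y'. a x * b y') y = a x * A b y" for x y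
  proof -
    have "(\<lambda>y'. a x * b y') = sc (a x) b"
      by (simp add: fun_eq_iff)
    then show ?thesis
      by (simp add: linop_sc[OF A])
  qed
  then show ?thesis
    by (auto simp: on_right_def fun_eq_iff)
qed

text \<open>Operators on a tensor product only have to be compared on pure tensors of basis vectors.\<close>

lemma linop_tens_eqI:
  assumes "finite I" "finite J" "w \<in> vecs (I \<times> J)" "linop f" "linop g"
    and "\<And>x y. x \<in> I \<Longrightarrow> y \<in> J \<Longrightarrow> f (tens (bvec x) (bvec y)) = g (tens (bvec x) (bvec y))"
  shows "f w = g w"
  by (rule linop_eqI[of "I \<times> J"]) (use assms in \<open>auto simp: bvec_pair\<close>)

lemma linop_tens_vecs:
  assumes "finite I" "finite J" "w \<in> vecs (I \<times> J)" "linop f"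
    and "\<And>x y. x \<in> I \<Longrightarrow> y \<in> J \<Longrightarrow> f (tens (bvec x) (bvec y)) \<in> vecs K"
  shows "f w \<in> vecs K"
  by (rule linop_vecs[of "I \<times> J"]) (use assms in \<open>auto simp: bvec_pair\<close>)

definition linf :: "(('b \<Rightarrow> 'k::field) \<Rightarrow> 'k) \<Rightarrow> bool" where
  "linf f \<longleftrightarrow> (\<forall>a b. f (a + b) = f a + f b) \<and> (\<forall>c a. f (sc c a) = c * f a)"

lemma linf_mult: "linf f \<Longrightarrow> linf (\<lambda>a. f a * c)" "linf f \<Longrightarrow> linf (\<lambda>a. c * f a)"
  by (simp_all add: linf_def algebra_simps)

lemma linf_ap: "linf (\<lambda>a. a i)"
  by (simp add: linf_def)

lemma linf_sum: "(\<And>i. i \<in> I \<Longrightarrow> linf (f i)) \<Longrightarrow> linf (\<lambda>a. \<Sum>i\<in>I. f i a)"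
  by (simp add: linf_def sum.distrib sum_distrib_left)

lemma linf_expand:
  assumes "finite I" "a \<in> vecs I" "linf f"
  shows "f a = (\<Sum>i\<in>I. a i * f (bvec i))"
proof -
  have 0: "f 0 = 0"
    using assms(3) sc_zero(1)[of 0] unfolding linf_def by (metis mult_zero_left)
  have "f (\<Sum>i\<in>J. sc (a i) (bvec i)) = (\<Sum>i\<in>J. a i * f (bvec i))" for J
    using assms(3) 0 by (induction J rule: infinite_finite_induct) (auto simp: linf_def)
  then show ?thesis
    using vec_expand[OF assms(1,2)] by metis
qed

lemma linf_eqI:
  assumes "finite I" "a \<in> vecs I" "linf f" "linf g" "\<And>i. i \<in> I \<Longrightarrow> f (bvec i) = g (bvec i)"
  shows "f a = g a"
  using assms by (simp add: linf_expand[of I])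

section \<open>Convolution algebras\<close>

lemma sum_prod_split: "finite I \<Longrightarrow> finite J \<Longrightarrow> (\<Sum>x\<in>I \<times> J. f x) = (\<Sum>i\<in>I. \<Sum>j\<in>J. f (i, j))"
  by (simp add: sum.cartesian_product)

lemma sum_rot3: "(\<Sum>a\<in>A. \<Sum>b\<in>B. \<Sum>c\<in>C. f a b c) = (\<Sum>b\<in>B. \<Sum>c\<in>C. \<Sum>a\<in>A. f a b c)"
  by (subst sum.swap) (rule sum.cong[OF refl], rule sum.swap)

text \<open>A finite-dimensional coalgebra by structure constants: \<open>d i (p, q)\<close> is the coefficient of
  \<open>p \<otimes> q\<close> in the coproduct of the basis element \<open>i\<close>. These axioms make the dual space a monoid under
  convolution.\<close>

locale coalg =
  fixes J :: "'j set" and d :: "'j \<Rightarrow> 'j \<times> 'j \<Rightarrow> 'k::field" and e :: "'j \<Rightarrow> 'k"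
  assumes fin: "finite J"
    and coassoc: "\<lbrakk>i \<in> J; q \<in> J; r \<in> J; s \<in> J\<rbrakk> \<Longrightarrow>
      (\<Sum>p\<in>J. d i (p, q) * d p (r, s)) = (\<Sum>p\<in>J. d i (r, p) * d p (s, q))"
    and counit_left: "\<lbrakk>i \<in> J; q \<in> J\<rbrakk> \<Longrightarrow> (\<Sum>p\<in>J. d i (p, q) * e p) = (if q = i then 1 else 0)"
    and counit_right: "\<lbrakk>i \<in> J; p \<in> J\<rbrakk> \<Longrightarrow> (\<Sum>q\<in>J. d i (p, q) * e q) = (if p = i then 1 else 0)"
begin

abbreviation M where "M \<equiv> conv_monoid J d e"

lemma mult_in: "i \<in> J \<Longrightarrow> (\<phi> \<otimes>\<^bsub>M\<^esub> \<psi>) i = (\<Sum>p\<in>J. \<Sum>q\<in>J. d i (p, q) * \<phi> p * \<psi> q)"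
  by (simp add: conv_monoid_def sum_prod_split[OF fin fin] split_def)

lemma mult_out: "i \<notin> J \<Longrightarrow> (\<phi> \<otimes>\<^bsub>M\<^esub> \<psi>) i = 0"
  by (simp add: conv_monoid_def)

lemma carrier_M: "carrier M = vecs J"
  by (simp add: conv_monoid_def)

lemma one_in: "i \<in> J \<Longrightarrow> \<one>\<^bsub>M\<^esub> i = e i" and one_out: "i \<notin> J \<Longrightarrow> \<one>\<^bsub>M\<^esub> i = 0"
  by (simp_all add: conv_monoid_def)

lemma conv_eqI:
  assumes "\<phi> \<in> vecs J" "\<psi> \<in> vecs J" "\<And>i. i \<in> J \<Longrightarrow> \<phi> i = \<psi> i"
  shows "\<phi> = \<psi>"
proof
  fix i show "\<phi> i = \<psi> i"
    using assms by (cases "i \<in> J") (simp_all add: vecs_def)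
qed

lemma mult_vecs: "\<phi> \<otimes>\<^bsub>M\<^esub> \<psi> \<in> vecs J"
  by (simp add: vecs_def mult_out)

lemma conv_assoc: "(\<phi> \<otimes>\<^bsub>M\<^esub> \<psi>) \<otimes>\<^bsub>M\<^esub> \<chi> = \<phi> \<otimes>\<^bsub>M\<^esub> (\<psi> \<otimes>\<^bsub>M\<^esub> \<chi>)"
proof (rule conv_eqI[OF mult_vecs mult_vecs])
  fix i assume i: "i \<in> J"
  have "((\<phi> \<otimes>\<^bsub>M\<^esub> \<psi>) \<otimes>\<^bsub>M\<^esub> \<chi>) i =
      (\<Sum>p\<in>J. \<Sum>q\<in>J. \<Sum>r\<in>J. \<Sum>s\<in>J. d i (p, q) * d p (r, s) * (\<phi> r * \<psi> s * \<chi> q))"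
    by (simp add: mult_in i sum_distrib_left sum_distrib_right mult_ac)
  also have "\<dots> = (\<Sum>q\<in>J. \<Sum>r\<in>J. \<Sum>s\<in>J. (\<Sum>p\<in>J. d i (p, q) * d p (r, s)) * (\<phi> r * \<psi> s * \<chi> q))"
    by (subst sum_rot3) (simp add: sum_distrib_right, rule sum.cong[OF refl], rule sum.cong[OF refl], rule sum.swap)
  also have "\<dots> = (\<Sum>q\<in>J. \<Sum>r\<in>J. \<Sum>s\<in>J. (\<Sum>p\<in>J. d i (r, p) * d p (s, q)) * (\<phi> r * \<psi> s * \<chi> q))"
    by (intro sum.cong refl arg_cong2[where f = "(*)"] coassoc) (simp_all add: i)
  also have "\<dots> = (\<Sum>r\<in>J. \<Sum>s\<in>J. \<Sum>q\<in>J. \<Sum>p\<in>J. d i (r, p) * d p (s, q) * (\<phi> r * \<psi> s * \<chi> q))"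
    by (subst sum_rot3) (simp add: sum_distrib_right)
  also have "\<dots> = (\<Sum>r\<in>J. \<Sum>p\<in>J. \<Sum>s\<in>J. \<Sum>q\<in>J. d i (r, p) * d p (s, q) * (\<phi> r * \<psi> s * \<chi> q))"
    by (rule sum.cong[OF refl], subst (2) sum_rot3) (rule refl)
  also have "\<dots> = (\<phi> \<otimes>\<^bsub>M\<^esub> (\<psi> \<otimes>\<^bsub>M\<^esub> \<chi>)) i"
    by (simp add: mult_in i sum_distrib_left sum_distrib_right mult_ac)
  finally show "((\<phi> \<otimes>\<^bsub>M\<^esub> \<psi>) \<otimes>\<^bsub>M\<^esub> \<chi>) i = (\<phi> \<otimes>\<^bsub>M\<^esub> (\<psi> \<otimes>\<^bsub>M\<^esub> \<chi>)) i" .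
qed

lemma one_vecs: "\<one>\<^bsub>M\<^esub> \<in> vecs J"
  by (simp add: vecs_def one_out)

lemma one_conv: assumes "\<phi> \<in> vecs J" shows "\<one>\<^bsub>M\<^esub> \<otimes>\<^bsub>M\<^esub> \<phi> = \<phi>"
proof (rule conv_eqI[OF mult_vecs assms])
  fix i assume i: "i \<in> J"
  have "(\<one>\<^bsub>M\<^esub> \<otimes>\<^bsub>M\<^esub> \<phi>) i = (\<Sum>q\<in>J. (\<Sum>p\<in>J. d i (p, q) * e p) * \<phi> q)"
    by (simp add: mult_in i one_in sum_distrib_right) (rule sum.swap)
  also have "\<dots> = (\<Sum>q\<in>J. if q = i then \<phi> q else 0)"
    by (intro sum.cong refl) (simp add: counit_left i)
  also have "\<dots> = \<phi> i"
    by (simp add: fin i)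
  finally show "(\<one>\<^bsub>M\<^esub> \<otimes>\<^bsub>M\<^esub> \<phi>) i = \<phi> i" .
qed

lemma conv_one: assumes "\<phi> \<in> vecs J" shows "\<phi> \<otimes>\<^bsub>M\<^esub> \<one>\<^bsub>M\<^esub> = \<phi>"
proof (rule conv_eqI[OF mult_vecs assms])
  fix i assume i: "i \<in> J"
  have "(\<phi> \<otimes>\<^bsub>M\<^esub> \<one>\<^bsub>M\<^esub>) i = (\<Sum>p\<in>J. (\<Sum>q\<in>J. d i (p, q) * e q) * \<phi> p)"
    by (simp add: mult_in i one_in sum_distrib_right sum_distrib_left mult_ac)
  also have "\<dots> = (\<Sum>q\<in>J. if q = i then \<phi> q else 0)"
    by (intro sum.cong refl) (simp add: counit_right i)
  also have "\<dots> = \<phi> i"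
    by (simp add: fin i)
  finally show "(\<phi> \<otimes>\<^bsub>M\<^esub> \<one>\<^bsub>M\<^esub>) i = \<phi> i" .
qed

lemma monoid_M: "monoid M"
  by (rule monoidI) (auto simp: carrier_M mult_vecs one_vecs conv_assoc one_conv conv_one)

end

text \<open>The coproduct of a tensor product of coalgebras, with the middle factors interchanged.\<close>

definition tensd :: "('i \<Rightarrow> 'i \<times> 'i \<Rightarrow> 'k::field) \<Rightarrow> ('j \<Rightarrow> 'j \<times> 'j \<Rightarrow> 'k)
    \<Rightarrow> 'i \<times> 'j \<Rightarrow> ('i \<times> 'j) \<times> ('i \<times> 'j) \<Rightarrow> 'k" where
  "tensd d d' = (\<lambda>(i, j) ((p, q), (p', q')). d i (p, p') * d' j (q, q'))"

lemma tensd_ap [simp]: "tensd d d' (i, j) ((p, q), (p', q')) = d i (p, p') * d' j (q, q')"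
  by (simp add: tensd_def)

lemma coalg_tens:
  fixes d :: "'i \<Rightarrow> 'i \<times> 'i \<Rightarrow> 'k::field" and d' :: "'j \<Rightarrow> 'j \<times> 'j \<Rightarrow> 'k"
  assumes "coalg I d e" "coalg J d' e'"
  shows "coalg (I \<times> J) (tensd d d') (\<lambda>(i, j). e i * e' j)"
proof -
  interpret A: coalg I d e by fact
  interpret B: coalg J d' e' by fact
  have *: "(\<Sum>x\<in>I \<times> J. F (fst x) * F' (snd x)) = (\<Sum>i\<in>I. F i) * (\<Sum>j\<in>J. F' j)"
    for F :: "_ \<Rightarrow> 'k" and F' :: "_ \<Rightarrow> 'k"
    by (simp add: sum_prod_split A.fin B.fin sum_product)
  show ?thesis
  proof
    show "finite (I \<times> J)"
      using A.fin B.fin by simp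
  next
    fix i q r s assume "i \<in> I \<times> J" "q \<in> I \<times> J" "r \<in> I \<times> J" "s \<in> I \<times> J"
    then obtain i1 i2 q1 q2 r1 r2 s1 s2 where
      [simp]: "i = (i1, i2)" "q = (q1, q2)" "r = (r1, r2)" "s = (s1, s2)" and
      mem: "i1 \<in> I" "i2 \<in> J" "q1 \<in> I" "q2 \<in> J" "r1 \<in> I" "r2 \<in> J" "s1 \<in> I" "s2 \<in> J"
      by auto
    have "(\<Sum>p\<in>I \<times> J. tensd d d' i (p, q) * tensd d d' p (r, s)) =
        (\<Sum>p\<in>I \<times> J. (d i1 (fst p, q1) * d (fst p) (r1, s1)) * (d' i2 (snd p, q2) * d' (snd p) (r2, s2)))"
      by (intro sum.cong refl) auto
    also have "\<dots> = (\<Sum>p\<in>I \<times> J. (d i1 (r1, fst p) * d (fst p) (s1, q1)) * (d' i2 (r2, snd p) * d' (snd p) (s2, q2)))"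
      using mem by (subst (1 2) *) (simp add: A.coassoc B.coassoc)
    also have "\<dots> = (\<Sum>p\<in>I \<times> J. tensd d d' i (r, p) * tensd d d' p (s, q))"
      by (intro sum.cong refl) auto
    finally show "(\<Sum>p\<in>I \<times> J. tensd d d' i (p, q) * tensd d d' p (r, s)) = (\<Sum>p\<in>I \<times> J. tensd d d' i (r, p) * tensd d d' p (s, q))" .
  next
    fix i q assume "i \<in> I \<times> J" "q \<in> I \<times> J"
    then obtain i1 i2 q1 q2 where [simp]: "i = (i1, i2)" "q = (q1, q2)" and
      mem: "i1 \<in> I" "i2 \<in> J" "q1 \<in> I" "q2 \<in> J" by auto
    have "(\<Sum>p\<in>I \<times> J. tensd d d' i (p, q) * (case p of (i, j) \<Rightarrow> e i * e' j)) =
       (\<Sum>p\<in>I \<times> J. (d i1 (fst p, q1) * e (fst p)) * (d' i2 (snd p, q2) * e' (snd p)))"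
      by (intro sum.cong refl) auto
    also have "\<dots> = (if q = i then 1 else 0)"
      using mem by (subst *) (auto simp: A.counit_left B.counit_left)
    finally show "(\<Sum>p\<in>I \<times> J. tensd d d' i (p, q) * (case p of (i, j) \<Rightarrow> e i * e' j)) = (if q = i then 1 else 0)" .
  next
    fix i q assume "i \<in> I \<times> J" "q \<in> I \<times> J"
    then obtain i1 i2 q1 q2 where [simp]: "i = (i1, i2)" "q = (q1, q2)" and
      mem: "i1 \<in> I" "i2 \<in> J" "q1 \<in> I" "q2 \<in> J" by auto
    have "(\<Sum>p\<in>I \<times> J. tensd d d' i (q, p) * (case p of (i, j) \<Rightarrow> e i * e' j)) =
       (\<Sum>p\<in>I \<times> J. (d i1 (q1, fst p) * e (fst p)) * (d' i2 (q2, snd p) * e' (snd p)))"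
      by (intro sum.cong refl) auto
    also have "\<dots> = (if q = i then 1 else 0)"
      using mem by (subst *) (auto simp: A.counit_right B.counit_right)
    finally show "(\<Sum>p\<in>I \<times> J. tensd d d' i (q, p) * (case p of (i, j) \<Rightarrow> e i * e' j)) = (if q = i then 1 else 0)" .
  qed
qed

section \<open>Pullbacks along coalgebra maps\<close>

text \<open>\<open>F\<close> is the matrix of a linear map between coalgebras. Composition with a coalgebra map is
  multiplicative for convolution; for a bialgebra this applies to \<open>m\<close>, \<open>m \<otimes> id\<close> and \<open>id \<otimes> m\<close>.\<close>

definition coalg_map ::
  "'j set \<Rightarrow> ('j \<Rightarrow> 'j \<times> 'j \<Rightarrow> 'k::field) \<Rightarrow> 'l set \<Rightarrow> ('l \<Rightarrow> 'l \<times> 'l \<Rightarrow> 'k) \<Rightarrow> ('j \<Rightarrow> 'l \<Rightarrow> 'k) \<Rightarrow> bool" where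
  "coalg_map J d K d' F \<longleftrightarrow> (\<forall>j\<in>J. \<forall>p\<in>K. \<forall>q\<in>K.
     (\<Sum>k\<in>K. F j k * d' k (p, q)) = (\<Sum>p'\<in>J. \<Sum>q'\<in>J. d j (p', q') * (F p' p * F q' q)))"

lemma sum_rot4: "(\<Sum>a\<in>A. \<Sum>b\<in>B. \<Sum>c\<in>C. \<Sum>d\<in>D. f a b c d) = (\<Sum>c\<in>C. \<Sum>d\<in>D. \<Sum>a\<in>A. \<Sum>b\<in>B. f a b c d)"
proof -
  have "(\<Sum>a\<in>A. \<Sum>b\<in>B. \<Sum>c\<in>C. \<Sum>d\<in>D. f a b c d) = (\<Sum>a\<in>A. \<Sum>c\<in>C. \<Sum>d\<in>D. \<Sum>b\<in>B. f a b c d)"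
    by (rule sum.cong[OF refl], rule sum_rot3)
  also have "\<dots> = (\<Sum>c\<in>C. \<Sum>d\<in>D. \<Sum>a\<in>A. \<Sum>b\<in>B. f a b c d)"
    by (rule sum_rot3)
  finally show ?thesis .
qed

definition pull :: "'j set \<Rightarrow> 'l set \<Rightarrow> ('j \<Rightarrow> 'l \<Rightarrow> 'k::field) \<Rightarrow> ('l \<Rightarrow> 'k) \<Rightarrow> 'j \<Rightarrow> 'k" where
  "pull J K F f = (\<lambda>j. if j \<in> J then \<Sum>k\<in>K. F j k * f k else 0)"

lemma pull_vecs: "pull J K F f \<in> vecs J"
  by (simp add: vecs_def pull_def)

lemma pull_conv:
  assumes "coalg J d e" "coalg K d' e'" "coalg_map J d K d' F"
  shows "pull J K F (f \<otimes>\<^bsub>conv_monoid K d' e'\<^esub> g) =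
    pull J K F f \<otimes>\<^bsub>conv_monoid J d e\<^esub> pull J K F g"
proof -
  interpret A: coalg J d e by fact
  interpret B: coalg K d' e' by fact
  show ?thesis
  proof (rule A.conv_eqI[OF pull_vecs A.mult_vecs])
    fix j assume j: "j \<in> J"
    have "pull J K F (f \<otimes>\<^bsub>B.M\<^esub> g) j = (\<Sum>k\<in>K. \<Sum>p\<in>K. \<Sum>q\<in>K. F j k * d' k (p, q) * (f p * g q))"
      by (simp add: pull_def j B.mult_in sum_distrib_left mult_ac)
    also have "\<dots> = (\<Sum>p\<in>K. \<Sum>q\<in>K. (\<Sum>k\<in>K. F j k * d' k (p, q)) * (f p * g q))"
      by (subst sum_rot3) (simp add: sum_distrib_right)
    also have "\<dots> = (\<Sum>p\<in>K. \<Sum>q\<in>K. (\<Sum>p'\<in>J. \<Sum>q'\<in>J. d j (p', q') * (F p' p * F q' q)) * (f p * g q))"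
      using assms(3) j by (intro sum.cong refl arg_cong2[where f = "(*)"]) (simp_all add: coalg_map_def)
    also have "\<dots> = (\<Sum>p\<in>K. \<Sum>q\<in>K. \<Sum>p'\<in>J. \<Sum>q'\<in>J. d j (p', q') * (F p' p * F q' q) * (f p * g q))"
      by (simp add: sum_distrib_right)
    also have "\<dots> = (\<Sum>p\<in>K. \<Sum>p'\<in>J. \<Sum>q'\<in>J. \<Sum>q\<in>K. d j (p', q') * (F p' p * F q' q) * (f p * g q))"
      by (rule sum.cong[OF refl], rule sum_rot3)
    also have "\<dots> = (\<Sum>p'\<in>J. \<Sum>q'\<in>J. \<Sum>p\<in>K. \<Sum>q\<in>K. d j (p', q') * (F p' p * F q' q) * (f p * g q))"
      by (rule sum_rot3)
    also have "\<dots> = (pull J K F f \<otimes>\<^bsub>A.M\<^esub> pull J K F g) j"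
      by (simp add: A.mult_in j pull_def sum_distrib_left sum_distrib_right mult_ac)
    finally show "pull J K F (f \<otimes>\<^bsub>B.M\<^esub> g) j = (pull J K F f \<otimes>\<^bsub>A.M\<^esub> pull J K F g) j" .
  qed
qed

definition tensF :: "('i \<Rightarrow> 'l \<Rightarrow> 'k::field) \<Rightarrow> ('j \<Rightarrow> 'm \<Rightarrow> 'k) \<Rightarrow> 'i \<times> 'j \<Rightarrow> 'l \<times> 'm \<Rightarrow> 'k" where
  "tensF F F' = (\<lambda>(i, j) (l, m). F i l * F' j m)"

lemma coalg_map_tens:
  fixes F :: "'i \<Rightarrow> 'l \<Rightarrow> 'k::field" and F' :: "'j \<Rightarrow> 'm \<Rightarrow> 'k"
  assumes fin: "finite I" "finite J" "finite K" "finite L"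
    and F: "coalg_map I d K d1 F" and F': "coalg_map J d' L d1' F'"
  shows "coalg_map (I \<times> J) (tensd d d') (K \<times> L) (tensd d1 d1') (tensF F F')"
  unfolding coalg_map_def
proof clarify
  fix i j p1 p2 q1 q2 assume mem: "i \<in> I" "j \<in> J" "p1 \<in> K" "p2 \<in> L" "q1 \<in> K" "q2 \<in> L"
  have "(\<Sum>k\<in>K \<times> L. tensF F F' (i, j) k * tensd d1 d1' k ((p1, p2), (q1, q2))) =
      (\<Sum>k\<in>K. F i k * d1 k (p1, q1)) * (\<Sum>l\<in>L. F' j l * d1' l (p2, q2))"
    by (simp add: sum_prod_split fin tensF_def sum_product mult_ac)
  also have "\<dots> = (\<Sum>p'\<in>I. \<Sum>q'\<in>I. d i (p', q') * (F p' p1 * F q' q1)) *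
      (\<Sum>p'\<in>J. \<Sum>q'\<in>J. d' j (p', q') * (F' p' p2 * F' q' q2))"
    using F F' mem by (simp add: coalg_map_def)
  also have "\<dots> = (\<Sum>a\<in>I. \<Sum>b\<in>J. (\<Sum>q'\<in>I. d i (a, q') * (F a p1 * F q' q1)) * (\<Sum>q'\<in>J. d' j (b, q') * (F' b p2 * F' q' q2)))"
    by (rule sum_product)
  also have "\<dots> = (\<Sum>a\<in>I. \<Sum>b\<in>J. \<Sum>a'\<in>I. \<Sum>b'\<in>J. (d i (a, a') * (F a p1 * F a' q1)) * (d' j (b, b') * (F' b p2 * F' b' q2)))"
    by (simp only: sum_product)
  also have "\<dots> = (\<Sum>p'\<in>I \<times> J. \<Sum>q'\<in>I \<times> J. tensd d d' (i, j) (p', q') *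
      (tensF F F' p' (p1, p2) * tensF F F' q' (q1, q2)))"
    by (simp add: sum_prod_split fin tensF_def mult_ac)
  finally show "(\<Sum>k\<in>K \<times> L. tensF F F' (i, j) k * tensd d1 d1' k ((p1, p2), (q1, q2))) = \<dots>" .
qed

definition idF :: "'i \<Rightarrow> 'i \<Rightarrow> 'k::field" where
  "idF i j = (if j = i then 1 else 0)"

lemma coalg_map_id: "finite I \<Longrightarrow> coalg_map I d I d idF"
  unfolding coalg_map_def
proof clarify
  fix j p q assume I: "finite I" "j \<in> I" "p \<in> I" "q \<in> I"
  have "(\<Sum>k\<in>I. idF j k * d k (p, q)) = (\<Sum>k\<in>I. if k = j then d k (p, q) else 0)"
    by (rule sum.cong) (auto simp: idF_def)
  moreover have "(\<Sum>q'\<in>I. d j (p', q') * (idF p' p * idF q' q)) = (if p' = p then d j (p, q) else 0)" for p'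
  proof -
    have "(\<Sum>q'\<in>I. d j (p', q') * (idF p' p * idF q' q)) = (\<Sum>q'\<in>I. if q' = q then idF p' p * d j (p', q) else 0)"
      by (rule sum.cong) (auto simp: idF_def)
    then show ?thesis
      using I by (auto simp: idF_def)
  qed
  ultimately show "(\<Sum>k\<in>I. idF j k * d k (p, q)) = (\<Sum>p'\<in>I. \<Sum>q'\<in>I. d j (p', q') * (idF p' p * idF q' q))"
    using I by simp
qed

locale coalg2 = A: coalg I d e + B: coalg J d' e'
  for I :: "'i set" and d :: "'i \<Rightarrow> 'i \<times> 'i \<Rightarrow> 'k::field" and e
    and J :: "'j set" and d' :: "'j \<Rightarrow> 'j \<times> 'j \<Rightarrow> 'k" and e'
begin

sublocale T: coalg "I \<times> J" "tensd d d'" "\<lambda>(i, j). e i * e' j"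
  by (rule coalg_tens) (rule A.coalg_axioms B.coalg_axioms)+

lemma one_tens: "\<one>\<^bsub>T.M\<^esub> = tens \<one>\<^bsub>A.M\<^esub> \<one>\<^bsub>B.M\<^esub>"
  by (auto simp: fun_eq_iff conv_monoid_def)

lemma mult_tens_in:
  assumes "i \<in> I" "j \<in> J"
  shows "(\<phi> \<otimes>\<^bsub>T.M\<^esub> \<psi>) (i, j) = (\<Sum>p\<in>I. \<Sum>p'\<in>I. \<Sum>q\<in>J. \<Sum>q'\<in>J.
     d i (p, p') * d' j (q, q') * \<phi> (p, q) * \<psi> (p', q'))"
proof -
  have "(\<phi> \<otimes>\<^bsub>T.M\<^esub> \<psi>) (i, j) = (\<Sum>p\<in>I. \<Sum>q\<in>J. \<Sum>p'\<in>I. \<Sum>q'\<in>J.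
     d i (p, p') * d' j (q, q') * \<phi> (p, q) * \<psi> (p', q'))"
    using assms by (simp add: T.mult_in sum_prod_split A.fin B.fin)
  also have "\<dots> = (\<Sum>p\<in>I. \<Sum>p'\<in>I. \<Sum>q\<in>J. \<Sum>q'\<in>J.
     d i (p, p') * d' j (q, q') * \<phi> (p, q) * \<psi> (p', q'))"
    by (rule sum.cong[OF refl], rule sum.swap)
  finally show ?thesis .
qed

lemma tens_conv: "tens \<phi> \<phi>' \<otimes>\<^bsub>T.M\<^esub> tens \<psi> \<psi>' = tens (\<phi> \<otimes>\<^bsub>A.M\<^esub> \<psi>) (\<phi>' \<otimes>\<^bsub>B.M\<^esub> \<psi>')"
proof (rule T.conv_eqI[OF T.mult_vecs vecs_tens[OF A.mult_vecs B.mult_vecs]], clarify)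
  fix i j assume ij: "i \<in> I" "j \<in> J"
  have "(tens \<phi> \<phi>' \<otimes>\<^bsub>T.M\<^esub> tens \<psi> \<psi>') (i, j) = (\<Sum>p\<in>I. \<Sum>p'\<in>I. (d i (p, p') * \<phi> p * \<psi> p') *
      (\<Sum>q\<in>J. \<Sum>q'\<in>J. d' j (q, q') * \<phi>' q * \<psi>' q'))"
    using ij by (simp add: mult_tens_in sum_distrib_left mult_ac)
  also have "\<dots> = tens (\<phi> \<otimes>\<^bsub>A.M\<^esub> \<psi>) (\<phi>' \<otimes>\<^bsub>B.M\<^esub> \<psi>') (i, j)"
    using ij by (simp add: A.mult_in B.mult_in sum_distrib_right)
  finally show "(tens \<phi> \<phi>' \<otimes>\<^bsub>T.M\<^esub> tens \<psi> \<psi>') (i, j) = tens (\<phi> \<otimes>\<^bsub>A.M\<^esub> \<psi>) (\<phi>' \<otimes>\<^bsub>B.M\<^esub> \<psi>') (i, j)" .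
qed

text \<open>Multiplying with a functional that lives on one tensor factor leaves the other variable
  untouched.\<close>

lemma tens_one_conv:
  assumes "i \<in> I" "j \<in> J"
  shows "(tens \<phi> \<one>\<^bsub>B.M\<^esub> \<otimes>\<^bsub>T.M\<^esub> \<theta>) (i, j) = (\<phi> \<otimes>\<^bsub>A.M\<^esub> (\<lambda>q. \<theta> (q, j))) i"
proof -
  have "(tens \<phi> \<one>\<^bsub>B.M\<^esub> \<otimes>\<^bsub>T.M\<^esub> \<theta>) (i, j) =
      (\<Sum>p\<in>I. \<Sum>p'\<in>I. d i (p, p') * \<phi> p * (\<Sum>q\<in>J. \<Sum>q'\<in>J. d' j (q, q') * \<one>\<^bsub>B.M\<^esub> q * \<theta> (p', q')))"
    using assms by (simp add: mult_tens_in sum_distrib_left mult_ac)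
  also have "\<dots> = (\<Sum>p\<in>I. \<Sum>p'\<in>I. d i (p, p') * \<phi> p * \<theta> (p', j))"
  proof (intro sum.cong refl arg_cong2[where f = "(*)"])
    fix p'
    show "(\<Sum>q\<in>J. \<Sum>q'\<in>J. d' j (q, q') * \<one>\<^bsub>B.M\<^esub> q * \<theta> (p', q')) = \<theta> (p', j)"
      using arg_cong[OF B.one_conv[of "\<lambda>q. if q \<in> J then \<theta> (p', q) else 0"], of "\<lambda>f. f j"] assms
      by (simp add: B.mult_in vecs_def)
  qed
  finally show ?thesis
    using assms by (simp add: A.mult_in)
qed

lemma conv_tens_one:
  assumes "i \<in> I" "j \<in> J"
  shows "(\<theta> \<otimes>\<^bsub>T.M\<^esub> tens \<phi> \<one>\<^bsub>B.M\<^esub>) (i, j) = ((\<lambda>q. \<theta> (q, j)) \<otimes>\<^bsub>A.M\<^esub> \<phi>) i"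
proof -
  have "(\<theta> \<otimes>\<^bsub>T.M\<^esub> tens \<phi> \<one>\<^bsub>B.M\<^esub>) (i, j) =
      (\<Sum>p\<in>I. \<Sum>p'\<in>I. d i (p, p') * \<phi> p' * (\<Sum>q\<in>J. \<Sum>q'\<in>J. d' j (q, q') * \<theta> (p, q) * \<one>\<^bsub>B.M\<^esub> q'))"
    using assms by (simp add: mult_tens_in sum_distrib_left mult_ac)
  also have "\<dots> = (\<Sum>p\<in>I. \<Sum>p'\<in>I. d i (p, p') * \<phi> p' * \<theta> (p, j))"
  proof (intro sum.cong refl arg_cong2[where f = "(*)"])
    fix p
    show "(\<Sum>q\<in>J. \<Sum>q'\<in>J. d' j (q, q') * \<theta> (p, q) * \<one>\<^bsub>B.M\<^esub> q') = \<theta> (p, j)"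
      using arg_cong[OF B.conv_one[of "\<lambda>q. if q \<in> J then \<theta> (p, q) else 0"], of "\<lambda>f. f j"] assms
      by (simp add: B.mult_in vecs_def)
  qed
  finally show ?thesis
    using assms by (simp add: A.mult_in mult_ac)
qed

lemma one_tens_conv:
  assumes "i \<in> I" "j \<in> J"
  shows "(tens \<one>\<^bsub>A.M\<^esub> \<phi> \<otimes>\<^bsub>T.M\<^esub> \<theta>) (i, j) = (\<phi> \<otimes>\<^bsub>B.M\<^esub> (\<lambda>q. \<theta> (i, q))) j"
proof -
  have "(tens \<one>\<^bsub>A.M\<^esub> \<phi> \<otimes>\<^bsub>T.M\<^esub> \<theta>) (i, j) =
      (\<Sum>q\<in>J. \<Sum>q'\<in>J. \<Sum>p\<in>I. \<Sum>p'\<in>I. d i (p, p') * d' j (q, q') * tens \<one>\<^bsub>A.M\<^esub> \<phi> (p, q) * \<theta> (p', q'))"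
    using assms by (simp only: mult_tens_in) (rule sum_rot4)
  also have "\<dots> =
      (\<Sum>q\<in>J. \<Sum>q'\<in>J. d' j (q, q') * \<phi> q * (\<Sum>p\<in>I. \<Sum>p'\<in>I. d i (p, p') * \<one>\<^bsub>A.M\<^esub> p * \<theta> (p', q')))"
    by (simp add: sum_distrib_left mult_ac)
  also have "\<dots> = (\<Sum>q\<in>J. \<Sum>q'\<in>J. d' j (q, q') * \<phi> q * \<theta> (i, q'))"
  proof (intro sum.cong refl arg_cong2[where f = "(*)"])
    fix q'
    show "(\<Sum>p\<in>I. \<Sum>p'\<in>I. d i (p, p') * \<one>\<^bsub>A.M\<^esub> p * \<theta> (p', q')) = \<theta> (i, q')"
      using arg_cong[OF A.one_conv[of "\<lambda>q. if q \<in> I then \<theta> (q, q') else 0"], of "\<lambda>f. f i"] assms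
      by (simp add: A.mult_in vecs_def)
  qed
  finally show ?thesis
    using assms by (simp add: B.mult_in)
qed

lemma conv_one_tens:
  assumes "i \<in> I" "j \<in> J"
  shows "(\<theta> \<otimes>\<^bsub>T.M\<^esub> tens \<one>\<^bsub>A.M\<^esub> \<phi>) (i, j) = ((\<lambda>q. \<theta> (i, q)) \<otimes>\<^bsub>B.M\<^esub> \<phi>) j"
proof -
  have "(\<theta> \<otimes>\<^bsub>T.M\<^esub> tens \<one>\<^bsub>A.M\<^esub> \<phi>) (i, j) =
      (\<Sum>q\<in>J. \<Sum>q'\<in>J. \<Sum>p\<in>I. \<Sum>p'\<in>I. d i (p, p') * d' j (q, q') * \<theta> (p, q) * tens \<one>\<^bsub>A.M\<^esub> \<phi> (p', q'))"
    using assms by (simp only: mult_tens_in) (rule sum_rot4)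
  also have "\<dots> =
      (\<Sum>q\<in>J. \<Sum>q'\<in>J. d' j (q, q') * \<phi> q' * (\<Sum>p\<in>I. \<Sum>p'\<in>I. d i (p, p') * \<theta> (p, q) * \<one>\<^bsub>A.M\<^esub> p'))"
    by (simp add: sum_distrib_left mult_ac)
  also have "\<dots> = (\<Sum>q\<in>J. \<Sum>q'\<in>J. d' j (q, q') * \<phi> q' * \<theta> (i, q))"
  proof (intro sum.cong refl arg_cong2[where f = "(*)"])
    fix q
    show "(\<Sum>p\<in>I. \<Sum>p'\<in>I. d i (p, p') * \<theta> (p, q) * \<one>\<^bsub>A.M\<^esub> p') = \<theta> (i, q)"
      using arg_cong[OF A.conv_one[of "\<lambda>p. if p \<in> I then \<theta> (p, q) else 0"], of "\<lambda>f. f i"] assms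
      by (simp add: A.mult_in vecs_def)
  qed
  finally show ?thesis
    using assms by (simp add: B.mult_in mult_ac)
qed

end

section \<open>Lazy cocycles of a finite-dimensional bialgebra\<close>

text \<open>Passing to the inverse preserves commutation; this gives laziness of inverse cocycles and
  centrality of inverse functionals.\<close>

lemma (in monoid) inv_commute:
  assumes "x \<in> carrier G" "x' \<in> carrier G" "y \<in> carrier G"
    and "x \<otimes> x' = \<one>" "x' \<otimes> x = \<one>" "x \<otimes> y = y \<otimes> x"
  shows "x' \<otimes> y = y \<otimes> x'"
proof -
  have "x' \<otimes> y = x' \<otimes> (y \<otimes> (x \<otimes> x'))"
    using assms(1-4) by simp
  also have "\<dots> = x' \<otimes> (x \<otimes> y) \<otimes> x'"
    unfolding assms(6) using assms(1-3) by (simp add: m_assoc)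
  also have "\<dots> = (x' \<otimes> x) \<otimes> (y \<otimes> x')"
    using assms(1-3) by (simp add: m_assoc)
  finally show ?thesis
    using assms(1-3,5) by simp
qed

text \<open>The axioms of a bialgebra whose unit is a basis element.\<close>

locale fin_bialg =
  fixes H :: "('i, 'k::field, 'm) bialg_scheme" and one :: 'i
  assumes coalg_H: "coalg (basis H) (comulc H) (counitc H)"
    and one_basis: "one \<in> basis H"
    and unitv_eq: "unitv H = bvec one"
    and structc_vecs: "i \<in> basis H \<Longrightarrow> j \<in> basis H \<Longrightarrow> structc H i j \<in> vecs (basis H)"
    and structc_assoc: "\<lbrakk>i \<in> basis H; j \<in> basis H; k \<in> basis H; s \<in> basis H\<rbrakk> \<Longrightarrow>
      (\<Sum>r\<in>basis H. structc H i j r * structc H r k s) = (\<Sum>r\<in>basis H. structc H j k r * structc H i r s)"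
    and one_structc: "j \<in> basis H \<Longrightarrow> structc H one j = bvec j"
    and structc_one: "i \<in> basis H \<Longrightarrow> structc H i one = bvec i"
    and comul_mult: "\<lbrakk>i \<in> basis H; j \<in> basis H; p \<in> basis H; q \<in> basis H\<rbrakk> \<Longrightarrow>
      (\<Sum>r\<in>basis H. structc H i j r * comulc H r (p, q)) =
      (\<Sum>p1\<in>basis H. \<Sum>q1\<in>basis H. \<Sum>p2\<in>basis H. \<Sum>q2\<in>basis H.
         comulc H i (p1, q1) * comulc H j (p2, q2) * structc H p1 p2 p * structc H q1 q2 q)"
    and counit_mult: "\<lbrakk>i \<in> basis H; j \<in> basis H\<rbrakk> \<Longrightarrow>
      (\<Sum>r\<in>basis H. structc H i j r * counitc H r) = counitc H i * counitc H j"
    and comul_one: "p \<in> basis H \<Longrightarrow> q \<in> basis H \<Longrightarrow>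
      comulc H one (p, q) = (if p = one \<and> q = one then 1 else 0)"
    and counit_one: "counitc H one = 1"
begin

abbreviation "I \<equiv> basis H"
abbreviation "c \<equiv> structc H"
abbreviation "d \<equiv> comulc H"
abbreviation "eps \<equiv> counitc H"

sublocale C1: coalg I d eps
  by (rule coalg_H)
sublocale C12: coalg2 I d eps I d eps
  by unfold_locales
sublocale C13: coalg2 I d eps "I \<times> I" "tensd d d" "\<lambda>(i, j). eps i * eps j"
  by unfold_locales
sublocale C31: coalg2 "I \<times> I" "tensd d d" "\<lambda>(i, j). eps i * eps j" I d eps
  by unfold_locales

abbreviation star1 (infixl \<open>\<star>\<^sub>1\<close> 70) where "f \<star>\<^sub>1 g \<equiv> f \<otimes>\<^bsub>C1.M\<^esub> g"
abbreviation star2 (infixl \<open>\<star>\<^sub>2\<close> 70) where "f \<star>\<^sub>2 g \<equiv> f \<otimes>\<^bsub>C12.T.M\<^esub> g"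
abbreviation star3 (infixl \<open>\<star>\<^sub>3\<close> 70) where "f \<star>\<^sub>3 g \<equiv> f \<otimes>\<^bsub>C13.T.M\<^esub> g"
abbreviation star4 (infixl \<open>\<star>\<^sub>4\<close> 70) where "f \<star>\<^sub>4 g \<equiv> f \<otimes>\<^bsub>C31.T.M\<^esub> g"
abbreviation "e1 \<equiv> \<one>\<^bsub>C1.M\<^esub>"
abbreviation "e2 \<equiv> \<one>\<^bsub>C12.T.M\<^esub>"

lemma dual_eq: "dual H = C1.M"
  by (simp add: dual_def)

lemma dual2_eq: "dual2 H = C12.T.M"
  by (simp add: dual2_def tensd_def)

lemma finI: "finite I"
  by (rule C1.fin)

subsection \<open>Composition with products\<close>

text \<open>\<open>pm\<close>, \<open>D1\<close> and \<open>D3\<close> compose a functional with \<open>m\<close>, \<open>m \<otimes> id\<close> and \<open>id \<otimes> m\<close>, and \<open>ra\<close> rebrackets a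
  functional of three arguments. They turn the cocycle condition into the equation
  \<open>(\<sigma> \<otimes> \<epsilon>) \<star> \<sigma>(m \<otimes> id) = (\<epsilon> \<otimes> \<sigma>) \<star> \<sigma>(id \<otimes> m)\<close> in the dual of \<open>H \<otimes> H \<otimes> H\<close>, so that computations with
  cocycles become computations in a monoid.\<close>

definition pm :: "('i \<Rightarrow> 'k) \<Rightarrow> 'i \<times> 'i \<Rightarrow> 'k" where
  "pm = pull (I \<times> I) I (\<lambda>(i, j). c i j)"

definition D1 :: "('i \<times> 'i \<Rightarrow> 'k) \<Rightarrow> ('i \<times> 'i) \<times> 'i \<Rightarrow> 'k" where
  "D1 = pull ((I \<times> I) \<times> I) (I \<times> I) (tensF (\<lambda>(i, j). c i j) idF)"

definition D3 :: "('i \<times> 'i \<Rightarrow> 'k) \<Rightarrow> 'i \<times> ('i \<times> 'i) \<Rightarrow> 'k" where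
  "D3 = pull (I \<times> (I \<times> I)) (I \<times> I) (tensF idF (\<lambda>(i, j). c i j))"

definition ra :: "(('i \<times> 'i) \<times> 'i \<Rightarrow> 'k) \<Rightarrow> 'i \<times> ('i \<times> 'i) \<Rightarrow> 'k" where
  "ra f = (\<lambda>(i, (j, k)). f ((i, j), k))"

lemma ra_ap [simp]: "ra f (i, (j, k)) = f ((i, j), k)"
  by (simp add: ra_def)

lemma ra_vecs: "f \<in> vecs ((I \<times> I) \<times> I) \<Longrightarrow> ra f \<in> vecs (I \<times> (I \<times> I))"
  by (auto simp: vecs_def ra_def)

lemma pm_vecs: "pm f \<in> vecs (I \<times> I)" and D1_vecs: "D1 s \<in> vecs ((I \<times> I) \<times> I)"
  and D3_vecs: "D3 s \<in> vecs (I \<times> (I \<times> I))"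
  unfolding pm_def D1_def D3_def by (rule pull_vecs)+

lemma pm_ap: "i \<in> I \<Longrightarrow> j \<in> I \<Longrightarrow> pm f (i, j) = (\<Sum>r\<in>I. c i j r * f r)"
  by (simp add: pm_def pull_def)

lemma sum_idF: "i \<in> I \<Longrightarrow> (\<Sum>r\<in>I. idF i r * f r) = f i"
proof -
  assume "i \<in> I"
  have "(\<Sum>r\<in>I. idF i r * f r) = (\<Sum>r\<in>I. if r = i then f r else 0)"
    by (rule sum.cong) (auto simp: idF_def)
  then show ?thesis
    using \<open>i \<in> I\<close> by (simp add: finI)
qed

lemma D1_ap: "i \<in> I \<Longrightarrow> j \<in> I \<Longrightarrow> k \<in> I \<Longrightarrow> D1 s ((i, j), k) = pm (\<lambda>r. s (r, k)) (i, j)"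
  by (simp add: D1_def pm_def pull_def tensF_def sum_prod_split finI mult.assoc sum_idF flip: sum_distrib_left)

lemma D3_ap: "i \<in> I \<Longrightarrow> j \<in> I \<Longrightarrow> k \<in> I \<Longrightarrow> D3 s (i, (j, k)) = pm (\<lambda>r. s (i, r)) (j, k)"
  by (simp add: D3_def pm_def pull_def tensF_def sum_prod_split finI mult.assoc sum_idF flip: sum_distrib_left)

lemma coalg_map_c: "coalg_map (I \<times> I) (tensd d d) I d (\<lambda>(i, j). c i j)"
  unfolding coalg_map_def
proof clarify
  fix i j p q assume mem: "i \<in> I" "j \<in> I" "p \<in> I" "q \<in> I"
  have "(\<Sum>k\<in>I. c i j k * d k (p, q)) = (\<Sum>p1\<in>I. \<Sum>q1\<in>I. \<Sum>p2\<in>I. \<Sum>q2\<in>I.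
      d i (p1, q1) * d j (p2, q2) * c p1 p2 p * c q1 q2 q)"
    using mem by (rule comul_mult)
  also have "\<dots> = (\<Sum>p1\<in>I. \<Sum>p2\<in>I. \<Sum>q1\<in>I. \<Sum>q2\<in>I.
      d i (p1, q1) * d j (p2, q2) * c p1 p2 p * c q1 q2 q)"
    by (rule sum.cong[OF refl], rule sum.swap)
  also have "\<dots> = (\<Sum>p'\<in>I \<times> I. \<Sum>q'\<in>I \<times> I. tensd d d (i, j) (p', q') *
      ((case p' of (i, j) \<Rightarrow> c i j) p * (case q' of (i, j) \<Rightarrow> c i j) q))"
    by (simp add: sum_prod_split finI mult.assoc)
  finally show "(\<Sum>k\<in>I. c i j k * d k (p, q)) = \<dots>" .
qed

lemma pm_conv: "pm (f \<star>\<^sub>1 g) = pm f \<star>\<^sub>2 pm g"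
  unfolding pm_def by (rule pull_conv) (rule C12.T.coalg_axioms C1.coalg_axioms coalg_map_c)+

lemma D1_conv: "D1 (s \<star>\<^sub>2 t) = D1 s \<star>\<^sub>4 D1 t"
  unfolding D1_def
  by (rule pull_conv[OF C31.T.coalg_axioms C12.T.coalg_axioms])
     (intro coalg_map_tens coalg_map_c coalg_map_id finI finite_cartesian_product)

lemma D3_conv: "D3 (s \<star>\<^sub>2 t) = D3 s \<star>\<^sub>3 D3 t"
  unfolding D3_def
  by (rule pull_conv[OF C13.T.coalg_axioms C12.T.coalg_axioms])
     (intro coalg_map_tens coalg_map_c coalg_map_id finI finite_cartesian_product)

lemma ra_conv: "ra (f \<star>\<^sub>4 g) = ra f \<star>\<^sub>3 ra g"
  by (rule C13.T.conv_eqI[OF ra_vecs[OF C31.T.mult_vecs] C13.T.mult_vecs])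
     (auto simp: C13.T.mult_in C31.T.mult_in sum_prod_split finI mult.assoc)

lemma pm_one: "pm e1 = e2"
  by (rule C12.T.conv_eqI[OF pm_vecs C12.T.one_vecs])
     (auto simp: pm_ap C1.one_in C12.T.one_in counit_mult)

text \<open>Associativity of \<open>H\<close>, seen from the dual side.\<close>

lemma ra_D1_pm: "ra (D1 (pm f)) = D3 (pm f)"
proof (rule C13.T.conv_eqI[OF ra_vecs[OF D1_vecs] D3_vecs], clarify)
  fix i j k assume [simp]: "i \<in> I" "j \<in> I" "k \<in> I"
  have "ra (D1 (pm f)) (i, j, k) = (\<Sum>r\<in>I. \<Sum>s\<in>I. c i j r * (c r k s * f s))"
    by (simp add: D1_ap pm_ap sum_distrib_left)
  also have "\<dots> = (\<Sum>s\<in>I. (\<Sum>r\<in>I. c i j r * c r k s) * f s)"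
    by (subst sum.swap) (simp add: sum_distrib_right mult.assoc)
  also have "\<dots> = (\<Sum>s\<in>I. (\<Sum>r\<in>I. c j k r * c i r s) * f s)"
    by (intro sum.cong refl arg_cong2[where f = "(*)"] structc_assoc) simp_all
  also have "\<dots> = (\<Sum>r\<in>I. \<Sum>s\<in>I. c j k r * (c i r s * f s))"
    by (subst sum.swap) (simp add: sum_distrib_right mult.assoc)
  also have "\<dots> = D3 (pm f) (i, j, k)"
    by (simp add: D3_ap pm_ap sum_distrib_left)
  finally show "ra (D1 (pm f)) (i, j, k) = D3 (pm f) (i, j, k)" .
qed

lemma conv1_cong: "(\<And>i. i \<in> I \<Longrightarrow> f i = f' i) \<Longrightarrow> (\<And>i. i \<in> I \<Longrightarrow> g i = g' i) \<Longrightarrow> f \<star>\<^sub>1 g = f' \<star>\<^sub>1 g'"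
  by (rule C1.conv_eqI[OF C1.mult_vecs C1.mult_vecs]) (simp add: C1.mult_in)

lemma conv2_cong:
  "(\<And>i j. i \<in> I \<Longrightarrow> j \<in> I \<Longrightarrow> f (i, j) = f' (i, j)) \<Longrightarrow> (\<And>i j. i \<in> I \<Longrightarrow> j \<in> I \<Longrightarrow> g (i, j) = g' (i, j)) \<Longrightarrow>
    f \<star>\<^sub>2 g = f' \<star>\<^sub>2 g'"
  by (rule C12.T.conv_eqI[OF C12.T.mult_vecs C12.T.mult_vecs]) (auto simp: C12.mult_tens_in)

subsection \<open>The cocycle and laziness conditions as identities between functionals\<close>

definition lz :: "('i \<times> 'i \<Rightarrow> 'k) \<Rightarrow> bool" where
  "lz s \<longleftrightarrow> (\<forall>f. s \<star>\<^sub>2 pm f = pm f \<star>\<^sub>2 s)"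

definition coc :: "('i \<times> 'i \<Rightarrow> 'k) \<Rightarrow> bool" where
  "coc s \<longleftrightarrow> (\<forall>i\<in>I. \<forall>j\<in>I. \<forall>k\<in>I.
     (s \<star>\<^sub>2 pm (\<lambda>r. s (r, k))) (i, j) = (s \<star>\<^sub>2 pm (\<lambda>r. s (i, r))) (j, k))"

definition nrm :: "('i \<times> 'i \<Rightarrow> 'k) \<Rightarrow> bool" where
  "nrm s \<longleftrightarrow> (\<forall>i\<in>I. s (i, one) = eps i \<and> s (one, i) = eps i)"

lemma tens_one_D1:
  assumes "i \<in> I" "j \<in> I" "k \<in> I"
  shows "(tens s e1 \<star>\<^sub>4 D1 t) ((i, j), k) = (s \<star>\<^sub>2 pm (\<lambda>r. t (r, k))) (i, j)"
  using assms by (simp add: C31.tens_one_conv) (rule arg_cong[of _ _ "\<lambda>f. f (i, j)"], rule conv2_cong, simp_all add: D1_ap)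

lemma D1_tens_one:
  assumes "i \<in> I" "j \<in> I" "k \<in> I"
  shows "(D1 t \<star>\<^sub>4 tens s e1) ((i, j), k) = (pm (\<lambda>r. t (r, k)) \<star>\<^sub>2 s) (i, j)"
  using assms by (simp add: C31.conv_tens_one) (rule arg_cong[of _ _ "\<lambda>f. f (i, j)"], rule conv2_cong, simp_all add: D1_ap)

lemma one_tens_D3:
  assumes "i \<in> I" "j \<in> I" "k \<in> I"
  shows "(tens e1 s \<star>\<^sub>3 D3 t) (i, (j, k)) = (s \<star>\<^sub>2 pm (\<lambda>r. t (i, r))) (j, k)"
  using assms by (simp add: C13.one_tens_conv) (rule arg_cong[of _ _ "\<lambda>f. f (j, k)"], rule conv2_cong, simp_all add: D3_ap)

lemma D3_one_tens:
  assumes "i \<in> I" "j \<in> I" "k \<in> I"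
  shows "(D3 t \<star>\<^sub>3 tens e1 s) (i, (j, k)) = (pm (\<lambda>r. t (i, r)) \<star>\<^sub>2 s) (j, k)"
  using assms by (simp add: C13.conv_one_tens) (rule arg_cong[of _ _ "\<lambda>f. f (j, k)"], rule conv2_cong, simp_all add: D3_ap)

lemma coc_iff: "coc s \<longleftrightarrow> ra (tens s e1) \<star>\<^sub>3 ra (D1 s) = tens e1 s \<star>\<^sub>3 D3 s"
proof
  assume "coc s"
  then show "ra (tens s e1) \<star>\<^sub>3 ra (D1 s) = tens e1 s \<star>\<^sub>3 D3 s"
    by (intro C13.T.conv_eqI[OF C13.T.mult_vecs C13.T.mult_vecs])
      (auto simp: one_tens_D3 tens_one_D1 coc_def simp flip: ra_conv)
next
  assume *: "ra (tens s e1) \<star>\<^sub>3 ra (D1 s) = tens e1 s \<star>\<^sub>3 D3 s"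
  show "coc s"
    unfolding coc_def
  proof (intro ballI)
    fix i j k assume "i \<in> I" "j \<in> I" "k \<in> I"
    then show "(s \<star>\<^sub>2 pm (\<lambda>r. s (r, k))) (i, j) = (s \<star>\<^sub>2 pm (\<lambda>r. s (i, r))) (j, k)"
      using arg_cong[OF *, of "\<lambda>f. f (i, j, k)"]
      by (simp add: one_tens_D3 tens_one_D1 flip: ra_conv)
  qed
qed

text \<open>For a fixed third argument \<open>c\<close>, the functional \<open>\<tau>(m \<otimes> id)\<close> is the composition of \<open>\<tau>(-, c)\<close> with
  the product, and a lazy \<open>\<sigma>\<close> commutes with it.\<close>

lemma lz_comm12: assumes "lz s" shows "tens s e1 \<star>\<^sub>4 D1 t = D1 t \<star>\<^sub>4 tens s e1"
  using assms by (intro C31.T.conv_eqI[OF C31.T.mult_vecs C31.T.mult_vecs])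
    (auto simp: tens_one_D1 D1_tens_one lz_def)

lemma lz_comm23: assumes "lz s" shows "tens e1 s \<star>\<^sub>3 D3 t = D3 t \<star>\<^sub>3 tens e1 s"
  using assms by (intro C13.T.conv_eqI[OF C13.T.mult_vecs C13.T.mult_vecs])
    (auto simp: one_tens_D3 D3_one_tens lz_def)

lemma comul_bvec: "i \<in> I \<Longrightarrow> comul H (bvec i) = d i"
proof
  fix t assume i: "i \<in> I"
  have "comul H (bvec i) t = (\<Sum>j\<in>I. if j = i then d j t else 0)"
    unfolding comul_def by (rule sum.cong) (auto simp: bvec_def)
  then show "comul H (bvec i) t = d i t"
    using i by (simp add: finI)
qed

lemma sum_bvec: "i \<in> I \<Longrightarrow> (\<Sum>j\<in>I. f j * bvec i j) = f i"
proof -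
  assume i: "i \<in> I"
  have "(\<Sum>j\<in>I. f j * bvec i j) = (\<Sum>j\<in>I. if j = i then f j else 0)"
    by (rule sum.cong) (auto simp: bvec_def)
  then show ?thesis
    using i by (simp add: finI)
qed

lemma ev2_bvec_right: "k \<in> I \<Longrightarrow> ev2 H s a (bvec k) = (\<Sum>i\<in>I. s (i, k) * a i)"
  by (simp add: ev2_def sum_bvec)

lemma ev2_bvec_left: "k \<in> I \<Longrightarrow> ev2 H s (bvec k) a = (\<Sum>i\<in>I. s (k, i) * a i)"
proof -
  assume k: "k \<in> I"
  have "ev2 H s (bvec k) a = (\<Sum>i\<in>I. (\<Sum>j\<in>I. s (i, j) * a j) * bvec k i)"
    by (simp add: ev2_def sum_distrib_right sum_distrib_left mult_ac)
  then show ?thesis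
    by (simp add: sum_bvec[OF k])
qed

lemma ev_bvec: "k \<in> I \<Longrightarrow> ev H f (bvec k) = f k"
  by (simp add: ev_def sum_bvec)

lemma linf_comul: "linf (\<lambda>a. comul H a t)"
  unfolding comul_def by (intro linf_sum linf_mult linf_ap)

lemma linf_ev2: "linf (\<lambda>a. ev2 H s a b)" "linf (\<lambda>b. ev2 H s a b)"
  unfolding ev2_def by (intro linf_sum linf_mult linf_ap)+

lemma normalized2_iff: "normalized2 H s \<longleftrightarrow> nrm s"
proof
  assume *: "normalized2 H s"
  show "nrm s"
    unfolding nrm_def
  proof (intro ballI)
    fix i assume i: "i \<in> I"
    have "ev2 H s (bvec i) (bvec one) = ev H eps (bvec i)" "ev2 H s (bvec one) (bvec i) = ev H eps (bvec i)"
      using * vecs_bvec[OF i] unfolding normalized2_def unitv_eq by blast+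
    then show "s (i, one) = eps i \<and> s (one, i) = eps i"
      using i one_basis by (simp add: ev2_bvec_right ev_bvec sum_bvec)
  qed
next
  assume *: "nrm s"
  show "normalized2 H s"
    unfolding normalized2_def unitv_eq
  proof (intro ballI conjI)
    fix a :: "'i \<Rightarrow> 'k"
    show "ev2 H s a (bvec one) = ev H eps a" "ev2 H s (bvec one) a = ev H eps a"
      using * one_basis by (simp_all add: ev2_bvec_right ev2_bvec_left ev_def nrm_def)
  qed
qed

lemma conv_pm_bvec:
  assumes "a \<in> I" "b \<in> I"
  shows "(\<Sum>(i, i')\<in>I \<times> I. \<Sum>(j, j')\<in>I \<times> I. comul H (bvec a) (i, i') * comul H (bvec b) (j, j') * s (i, j) *
     f i' j') = (s \<star>\<^sub>2 (\<lambda>(i, j). f i j)) (a, b)"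
  using assms by (simp add: C12.mult_tens_in comul_bvec sum_prod_split finI)

lemma pm_bvec_conv:
  assumes "a \<in> I" "b \<in> I"
  shows "(\<Sum>(i, i')\<in>I \<times> I. \<Sum>(j, j')\<in>I \<times> I. comul H (bvec a) (i, i') * comul H (bvec b) (j, j') * s (i', j') *
     f i j) = ((\<lambda>(i, j). f i j) \<star>\<^sub>2 s) (a, b)"
  using assms by (simp add: C12.mult_tens_in comul_bvec sum_prod_split finI mult_ac)

text \<open>Both sides are trilinear, so the condition can be tested on basis elements.\<close>

lemma cocycle_eq_iff:
  "(\<forall>a\<in>vecs I. \<forall>b\<in>vecs I. \<forall>x\<in>vecs I.
        (\<Sum>(i, i')\<in>I \<times> I. \<Sum>(j, j')\<in>I \<times> I.
           comul H a (i, i') * comul H b (j, j') * s (i, j) * ev2 H s (c i' j') x) =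
        (\<Sum>(i, i')\<in>I \<times> I. \<Sum>(j, j')\<in>I \<times> I.
           comul H b (i, i') * comul H x (j, j') * s (i, j) * ev2 H s a (c i' j'))) \<longleftrightarrow> coc s"
  (is "(\<forall>a\<in>_. \<forall>b\<in>_. \<forall>x\<in>_. ?L a b x = ?R a b x) \<longleftrightarrow> _")
proof -
  have L: "?L (bvec a) (bvec b) (bvec k) = (s \<star>\<^sub>2 pm (\<lambda>r. s (r, k))) (a, b)"
    if "a \<in> I" "b \<in> I" "k \<in> I" for a b k
    unfolding conv_pm_bvec[OF that(1,2), of s]
    by (rule arg_cong[of _ _ "\<lambda>f. f (a, b)"], rule conv2_cong)
       (simp_all add: pm_ap ev2_bvec_right that mult.commute)
  have R: "?R (bvec a) (bvec b) (bvec k) = (s \<star>\<^sub>2 pm (\<lambda>r. s (a, r))) (b, k)"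
    if "a \<in> I" "b \<in> I" "k \<in> I" for a b k
    unfolding conv_pm_bvec[OF that(2,3), of s]
    by (rule arg_cong[of _ _ "\<lambda>f. f (b, k)"], rule conv2_cong)
       (simp_all add: pm_ap ev2_bvec_left that mult.commute)
  have lin: "linf (\<lambda>a. ?L a b x)" "linf (\<lambda>b. ?L a b x)" "linf (\<lambda>x. ?L a b x)"
     "linf (\<lambda>a. ?R a b x)" "linf (\<lambda>b. ?R a b x)" "linf (\<lambda>x. ?R a b x)" for a b x
    by (simp_all only: sum_prod_split finI split_beta fst_conv snd_conv,
        (intro linf_sum linf_mult linf_comul linf_ev2)+)
  show ?thesis
  proof
    assume *: "\<forall>a\<in>vecs I. \<forall>b\<in>vecs I. \<forall>x\<in>vecs I. ?L a b x = ?R a b x"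
    show "coc s"
      unfolding coc_def
    proof (intro ballI)
      fix i j k assume mem: "i \<in> I" "j \<in> I" "k \<in> I"
      have "?L (bvec i) (bvec j) (bvec k) = ?R (bvec i) (bvec j) (bvec k)"
        using * mem[THEN vecs_bvec] by blast
      then show "(s \<star>\<^sub>2 pm (\<lambda>r. s (r, k))) (i, j) = (s \<star>\<^sub>2 pm (\<lambda>r. s (i, r))) (j, k)"
        unfolding L[OF mem] R[OF mem] .
    qed
  next
    assume *: "coc s"
    have 1: "?L (bvec i) (bvec j) (bvec k) = ?R (bvec i) (bvec j) (bvec k)"
      if mem: "i \<in> I" "j \<in> I" "k \<in> I" for i j k
      unfolding L[OF mem] R[OF mem] using * mem by (simp add: coc_def)
    have 2: "?L (bvec i) (bvec j) x = ?R (bvec i) (bvec j) x" if "i \<in> I" "j \<in> I" "x \<in> vecs I" for i j x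
      by (rule linf_eqI[OF finI that(3) lin(3) lin(6)]) (rule 1[OF that(1,2)])
    have 3: "?L (bvec i) b x = ?R (bvec i) b x" if "i \<in> I" "b \<in> vecs I" "x \<in> vecs I" for i b x
      by (rule linf_eqI[OF finI that(2) lin(2) lin(5)]) (rule 2[OF that(1) _ that(3)])
    show "\<forall>a\<in>vecs I. \<forall>b\<in>vecs I. \<forall>x\<in>vecs I. ?L a b x = ?R a b x"
    proof (intro ballI)
      fix a b x :: "'i \<Rightarrow> 'k" assume v: "a \<in> vecs I" "b \<in> vecs I" "x \<in> vecs I"
      show "?L a b x = ?R a b x"
        by (rule linf_eqI[OF finI v(1) lin(1) lin(4)]) (rule 3[OF _ v(2,3)])
    qed
  qed
qed

lemma left_cocycle_iff: "left_cocycle H s \<longleftrightarrow> s \<in> Units C12.T.M \<and> nrm s \<and> coc s"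
  unfolding left_cocycle_def cocycle_eq_iff normalized2_iff dual2_eq ..

lemma linf_pm: "linf (\<lambda>f. pm f x)"
proof (cases "x \<in> I \<times> I")
  case True
  then show ?thesis
    unfolding pm_def pull_def by simp (intro linf_sum linf_mult linf_ap)
next
  case False
  then show ?thesis
    unfolding pm_def pull_def linf_def by simp
qed

lemma linf_conv_pm:
  assumes "i \<in> I" "j \<in> I"
  shows "linf (\<lambda>f. (s \<star>\<^sub>2 pm f) (i, j))" "linf (\<lambda>f. (pm f \<star>\<^sub>2 s) (i, j))"
  unfolding C12.mult_tens_in[OF assms] by (intro linf_sum linf_mult linf_pm)+

lemma pm_cong: "(\<And>r. r \<in> I \<Longrightarrow> f r = g r) \<Longrightarrow> pm f = pm g"
  unfolding pm_def pull_def by (intro ext if_cong refl sum.cong arg_cong2[where f = "(*)"])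

lemma lzI:
  assumes "\<And>i j r. i \<in> I \<Longrightarrow> j \<in> I \<Longrightarrow> r \<in> I \<Longrightarrow> (s \<star>\<^sub>2 pm (bvec r)) (i, j) = (pm (bvec r) \<star>\<^sub>2 s) (i, j)"
  shows "lz s"
  unfolding lz_def
proof
  fix f show "s \<star>\<^sub>2 pm f = pm f \<star>\<^sub>2 s"
  proof (rule C12.T.conv_eqI[OF C12.T.mult_vecs C12.T.mult_vecs], clarify)
    fix i j assume ij: "i \<in> I" "j \<in> I"
    let ?g = "\<lambda>r. if r \<in> I then f r else 0"
    have "(s \<star>\<^sub>2 pm ?g) (i, j) = (pm ?g \<star>\<^sub>2 s) (i, j)"
      by (rule linf_eqI[OF finI _ linf_conv_pm[OF ij]]) (simp_all add: vecs_def assms ij)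
    moreover have "pm ?g = pm f"
      by (rule pm_cong) simp
    ultimately show "(s \<star>\<^sub>2 pm f) (i, j) = (pm f \<star>\<^sub>2 s) (i, j)"
      by simp
  qed
qed

lemma lazy_iff: "lazy H s \<longleftrightarrow> lz s"
proof -
  let ?L = "\<lambda>r a b. (\<Sum>(i, i')\<in>I \<times> I. \<Sum>(j, j')\<in>I \<times> I.
           comul H a (i, i') * comul H b (j, j') * s (i, j) * c i' j' r)"
  let ?R = "\<lambda>r a b. (\<Sum>(i, i')\<in>I \<times> I. \<Sum>(j, j')\<in>I \<times> I.
           comul H a (i, i') * comul H b (j, j') * s (i', j') * c i j r)"
  have L: "?L r (bvec a) (bvec b) = (s \<star>\<^sub>2 pm (bvec r)) (a, b)" if "a \<in> I" "b \<in> I" "r \<in> I" for a b r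
    unfolding conv_pm_bvec[OF that(1,2), of s]
    by (rule arg_cong[of _ _ "\<lambda>f. f (a, b)"], rule conv2_cong) (simp_all add: pm_ap sum_bvec that)
  have R: "?R r (bvec a) (bvec b) = (pm (bvec r) \<star>\<^sub>2 s) (a, b)" if "a \<in> I" "b \<in> I" "r \<in> I" for a b r
    unfolding pm_bvec_conv[OF that(1,2), of s "\<lambda>i j. c i j r"]
    by (rule arg_cong[of _ _ "\<lambda>f. f (a, b)"], rule conv2_cong) (simp_all add: pm_ap sum_bvec that)
  have lin: "linf (\<lambda>a. ?L r a b)" "linf (\<lambda>b. ?L r a b)" "linf (\<lambda>a. ?R r a b)" "linf (\<lambda>b. ?R r a b)" for r a b
    by (simp_all only: sum_prod_split finI split_beta fst_conv snd_conv,
        (intro linf_sum linf_mult linf_comul)+)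
  show ?thesis
  proof
    assume *: "lazy H s"
    show "lz s"
    proof (rule lzI)
      fix i j r assume mem: "i \<in> I" "j \<in> I" "r \<in> I"
      have "?L r (bvec i) (bvec j) = ?R r (bvec i) (bvec j)"
        using * mem(1,2)[THEN vecs_bvec] mem(3) unfolding lazy_def by blast
      then show "(s \<star>\<^sub>2 pm (bvec r)) (i, j) = (pm (bvec r) \<star>\<^sub>2 s) (i, j)"
        unfolding L[OF mem] R[OF mem] .
    qed
  next
    assume *: "lz s"
    have 1: "?L r (bvec i) (bvec j) = ?R r (bvec i) (bvec j)" if mem: "i \<in> I" "j \<in> I" "r \<in> I" for i j r
      unfolding L[OF mem] R[OF mem] using * by (simp add: lz_def)
    have 2: "?L r (bvec i) b = ?R r (bvec i) b" if "i \<in> I" "b \<in> vecs I" "r \<in> I" for i b r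
      by (rule linf_eqI[OF finI that(2) lin(2) lin(4)]) (rule 1[OF that(1) _ that(3)])
    show "lazy H s"
      unfolding lazy_def
    proof (intro ballI)
      fix a b :: "'i \<Rightarrow> 'k" and r assume v: "a \<in> vecs I" "b \<in> vecs I" "r \<in> I"
      show "?L r a b = ?R r a b"
        by (rule linf_eqI[OF finI v(1) lin(1) lin(3)]) (rule 2[OF _ v(2,3)])
    qed
  qed
qed

definition Z :: "('i \<times> 'i \<Rightarrow> 'k) set" where
  "Z = {s. left_cocycle H s \<and> lazy H s}"

lemma Z_iff: "s \<in> Z \<longleftrightarrow> s \<in> Units C12.T.M \<and> nrm s \<and> coc s \<and> lz s"
  unfolding Z_def left_cocycle_iff lazy_iff by blast

end

lemma sum_rot5: "(\<Sum>a\<in>A. \<Sum>b\<in>B. \<Sum>c\<in>C. \<Sum>d\<in>D. \<Sum>e\<in>E. f a b c d e) =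
    (\<Sum>b\<in>B. \<Sum>c\<in>C. \<Sum>d\<in>D. \<Sum>e\<in>E. \<Sum>a\<in>A. f a b c d e)"
proof -
  have "(\<Sum>a\<in>A. \<Sum>b\<in>B. \<Sum>c\<in>C. \<Sum>d\<in>D. \<Sum>e\<in>E. f a b c d e) =
      (\<Sum>b\<in>B. \<Sum>c\<in>C. \<Sum>a\<in>A. \<Sum>d\<in>D. \<Sum>e\<in>E. f a b c d e)"
    by (rule sum_rot3)
  also have "\<dots> = (\<Sum>b\<in>B. \<Sum>c\<in>C. \<Sum>d\<in>D. \<Sum>e\<in>E. \<Sum>a\<in>A. f a b c d e)"
    by (intro sum.cong[OF refl] sum_rot3)
  finally show ?thesis .
qed

context fin_bialg begin

subsection \<open>The group of lazy cocycles\<close>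

abbreviation "e3 \<equiv> \<one>\<^bsub>C13.T.M\<^esub>"

lemma e1_idem: "e1 \<star>\<^sub>1 e1 = e1"
  by (rule C1.one_conv[OF C1.one_vecs])

lemma ra_one: "ra \<one>\<^bsub>C31.T.M\<^esub> = e3"
  by (auto simp: fun_eq_iff conv_monoid_def mult.assoc)

lemma ra_tens_conv: "ra (tens s e1) \<star>\<^sub>3 ra (tens t e1) = ra (tens (s \<star>\<^sub>2 t) e1)"
  by (simp add: C31.tens_conv e1_idem flip: ra_conv)

lemma one_tens_mult: "tens e1 s \<star>\<^sub>3 tens e1 t = tens e1 (s \<star>\<^sub>2 t)"
  by (simp add: C13.tens_conv e1_idem)

lemma D1_one: "D1 e2 = \<one>\<^bsub>C31.T.M\<^esub>"
proof (rule C31.T.conv_eqI[OF D1_vecs C31.T.one_vecs], clarify)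
  fix i j k assume mem: "i \<in> I" "j \<in> I" "k \<in> I"
  have "(\<Sum>r\<in>I. c i j r * (eps r * eps k)) = (\<Sum>r\<in>I. c i j r * eps r) * eps k"
    by (simp add: sum_distrib_right mult.assoc)
  with mem show "D1 e2 ((i, j), k) = \<one>\<^bsub>C31.T.M\<^esub> ((i, j), k)"
    by (simp add: D1_ap pm_ap C12.T.one_in C31.T.one_in counit_mult)
qed

lemma D3_one: "D3 e2 = e3"
proof (rule C13.T.conv_eqI[OF D3_vecs C13.T.one_vecs], clarify)
  fix i j k assume mem: "i \<in> I" "j \<in> I" "k \<in> I"
  have "(\<Sum>r\<in>I. c j k r * (eps i * eps r)) = eps i * (\<Sum>r\<in>I. c j k r * eps r)"
    by (simp add: sum_distrib_left mult_ac)
  with mem show "D3 e2 (i, (j, k)) = e3 (i, (j, k))"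
    by (simp add: D3_ap pm_ap C12.T.one_in C13.T.one_in counit_mult)
qed

lemma conv2_at_one:
  assumes "i \<in> I"
  shows "(s \<star>\<^sub>2 t) (i, one) = ((\<lambda>p. s (p, one)) \<star>\<^sub>1 (\<lambda>p. t (p, one))) i"
    and "(s \<star>\<^sub>2 t) (one, i) = ((\<lambda>p. s (one, p)) \<star>\<^sub>1 (\<lambda>p. t (one, p))) i"
proof -
  have *: "(\<Sum>q\<in>I. \<Sum>q'\<in>I. d one (q, q') * F q q') = F one one" for F :: "'i \<Rightarrow> 'i \<Rightarrow> 'k"
  proof -
    have "(\<Sum>q\<in>I. \<Sum>q'\<in>I. d one (q, q') * F q q') = (\<Sum>q\<in>I. \<Sum>q'\<in>I. if q' = one then (if q = one then F one one else 0) else 0)"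
      by (intro sum.cong refl) (auto simp: comul_one)
    then show ?thesis
      using one_basis by (simp add: finI)
  qed
  have "(s \<star>\<^sub>2 t) (i, one) = (\<Sum>p\<in>I. \<Sum>p'\<in>I. d i (p, p') * (\<Sum>q\<in>I. \<Sum>q'\<in>I. d one (q, q') * (s (p, q) * t (p', q'))))"
    using assms one_basis by (simp add: C12.mult_tens_in sum_distrib_left mult_ac)
  also have "\<dots> = ((\<lambda>p. s (p, one)) \<star>\<^sub>1 (\<lambda>p. t (p, one))) i"
    unfolding * using assms by (simp add: C1.mult_in mult_ac)
  finally show "(s \<star>\<^sub>2 t) (i, one) = ((\<lambda>p. s (p, one)) \<star>\<^sub>1 (\<lambda>p. t (p, one))) i" .
  have "(s \<star>\<^sub>2 t) (one, i) = (\<Sum>p\<in>I. \<Sum>p'\<in>I. d one (p, p') * (\<Sum>q\<in>I. \<Sum>q'\<in>I. d i (q, q') * (s (p, q) * t (p', q'))))"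
    using assms one_basis by (simp add: C12.mult_tens_in sum_distrib_left mult_ac)
  also have "\<dots> = ((\<lambda>p. s (one, p)) \<star>\<^sub>1 (\<lambda>p. t (one, p))) i"
    unfolding * using assms by (simp add: C1.mult_in mult_ac)
  finally show "(s \<star>\<^sub>2 t) (one, i) = ((\<lambda>p. s (one, p)) \<star>\<^sub>1 (\<lambda>p. t (one, p))) i" .
qed

lemma nrm_slices:
  assumes "nrm s"
  shows "(\<lambda>p. s (p, one)) \<star>\<^sub>1 f = e1 \<star>\<^sub>1 f" "(\<lambda>p. s (one, p)) \<star>\<^sub>1 f = e1 \<star>\<^sub>1 f"
  by (rule conv1_cong; use assms in \<open>simp add: nrm_def C1.one_in\<close>)+

lemma nrm_conv: assumes "nrm s" "nrm t" shows "nrm (s \<star>\<^sub>2 t)"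
proof -
  have "(e1 \<star>\<^sub>1 (\<lambda>p. t (p, one))) = e1 \<star>\<^sub>1 e1" "(e1 \<star>\<^sub>1 (\<lambda>p. t (one, p))) = e1 \<star>\<^sub>1 e1"
    by (rule conv1_cong; use assms(2) in \<open>simp add: nrm_def C1.one_in\<close>)+
  then show ?thesis
    unfolding nrm_def by (simp add: conv2_at_one nrm_slices[OF assms(1)] e1_idem C1.one_in)
qed

lemma nrm_inverse:
  assumes "nrm s" "t \<in> vecs (I \<times> I)" "s \<star>\<^sub>2 t = e2"
  shows "nrm t"
  unfolding nrm_def
proof
  fix i assume i: "i \<in> I"
  have v: "(\<lambda>p. t (p, one)) \<in> vecs I" "(\<lambda>p. t (one, p)) \<in> vecs I"
    using assms(2) by (auto simp: vecs_def)
  have "t (i, one) = (s \<star>\<^sub>2 t) (i, one)" "t (one, i) = (s \<star>\<^sub>2 t) (one, i)"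
    unfolding conv2_at_one[OF i] nrm_slices[OF assms(1)] by (simp_all add: C1.one_conv v)
  then show "t (i, one) = eps i \<and> t (one, i) = eps i"
    using i one_basis by (simp add: assms(3) C12.T.one_in counit_one)
qed

text \<open>By laziness the inner factors \<open>\<tau> \<otimes> \<epsilon>\<close> and \<open>\<sigma>(m \<otimes> id)\<close> can be interchanged, which separates the
  product into the cocycle conditions of the two factors.\<close>

lemma coc_conv:
  assumes "coc s" "coc t" "lz t"
  shows "coc (s \<star>\<^sub>2 t)"
proof -
  have 12: "ra (tens t e1) \<star>\<^sub>3 ra (D1 s) = ra (D1 s) \<star>\<^sub>3 ra (tens t e1)"
    by (simp add: lz_comm12[OF assms(3)] flip: ra_conv)
  have 23: "tens e1 t \<star>\<^sub>3 D3 s = D3 s \<star>\<^sub>3 tens e1 t"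
    by (rule lz_comm23[OF assms(3)])
  have "ra (tens (s \<star>\<^sub>2 t) e1) \<star>\<^sub>3 ra (D1 (s \<star>\<^sub>2 t)) =
      ra (tens s e1) \<star>\<^sub>3 (ra (tens t e1) \<star>\<^sub>3 ra (D1 s)) \<star>\<^sub>3 ra (D1 t)"
    by (simp add: D1_conv ra_conv C13.T.conv_assoc flip: ra_tens_conv)
  also have "\<dots> = (ra (tens s e1) \<star>\<^sub>3 ra (D1 s)) \<star>\<^sub>3 (ra (tens t e1) \<star>\<^sub>3 ra (D1 t))"
    unfolding 12 by (simp add: C13.T.conv_assoc)
  also have "\<dots> = (tens e1 s \<star>\<^sub>3 D3 s) \<star>\<^sub>3 (tens e1 t \<star>\<^sub>3 D3 t)"
    using assms(1,2) by (simp add: coc_iff)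
  also have "\<dots> = tens e1 s \<star>\<^sub>3 (tens e1 t \<star>\<^sub>3 D3 s) \<star>\<^sub>3 D3 t"
    unfolding 23 by (simp add: C13.T.conv_assoc)
  also have "\<dots> = tens e1 (s \<star>\<^sub>2 t) \<star>\<^sub>3 D3 (s \<star>\<^sub>2 t)"
    by (simp add: D3_conv C13.T.conv_assoc flip: one_tens_mult)
  finally show ?thesis
    by (simp add: coc_iff)
qed

lemma lz_conv: "lz s \<Longrightarrow> lz t \<Longrightarrow> lz (s \<star>\<^sub>2 t)"
  unfolding lz_def by (simp add: C12.T.conv_assoc) (simp flip: C12.T.conv_assoc)

lemma lz_inverse:
  assumes "lz s" "s \<in> vecs (I \<times> I)" "t \<in> vecs (I \<times> I)" "s \<star>\<^sub>2 t = e2" "t \<star>\<^sub>2 s = e2"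
  shows "lz t"
  unfolding lz_def
proof
  fix f
  show "t \<star>\<^sub>2 pm f = pm f \<star>\<^sub>2 t"
    by (rule monoid.inv_commute[OF C12.T.monoid_M, where x = s])
       (use assms in \<open>simp_all add: C12.T.carrier_M pm_vecs lz_def\<close>)
qed

text \<open>Inverting the cocycle condition reverses the order of the factors; by laziness they commute, so
  the order can be restored.\<close>

lemma coc_inverse:
  assumes "coc s" "lz s" "t \<in> vecs (I \<times> I)" "s \<in> vecs (I \<times> I)" "s \<star>\<^sub>2 t = e2" "t \<star>\<^sub>2 s = e2"
  shows "coc t"
proof -
  let ?A = "ra (tens s e1)" and ?B = "ra (D1 s)" and ?C = "tens e1 s" and ?D = "D3 s"
  let ?A' = "ra (tens t e1)" and ?B' = "ra (D1 t)" and ?C' = "tens e1 t" and ?D' = "D3 t"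
  have A: "?A \<star>\<^sub>3 ?A' = e3" "?A' \<star>\<^sub>3 ?A = e3"
    by (simp_all add: ra_tens_conv assms(5,6) ra_one flip: C31.one_tens)
  have B: "?B \<star>\<^sub>3 ?B' = e3" "?B' \<star>\<^sub>3 ?B = e3"
    by (simp_all add: assms(5,6) D1_one ra_one flip: ra_conv D1_conv)
  have C: "?C \<star>\<^sub>3 ?C' = e3" "?C' \<star>\<^sub>3 ?C = e3"
    by (simp_all add: one_tens_mult assms(5,6) flip: C13.one_tens)
  have D: "?D \<star>\<^sub>3 ?D' = e3" "?D' \<star>\<^sub>3 ?D = e3"
    by (simp_all add: assms(5,6) D3_one flip: D3_conv)
  have v: "?B \<in> vecs (I \<times> I \<times> I)" "?B' \<in> vecs (I \<times> I \<times> I)" "?D \<in> vecs (I \<times> I \<times> I)"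
    "?D' \<in> vecs (I \<times> I \<times> I)" "?A \<in> vecs (I \<times> I \<times> I)" "?C \<in> vecs (I \<times> I \<times> I)"
    using assms(3,4) by (auto intro!: ra_vecs D1_vecs D3_vecs vecs_tens C1.one_vecs)
  have AB: "?A \<star>\<^sub>3 ?B = ?B \<star>\<^sub>3 ?A"
    by (simp add: lz_comm12[OF assms(2)] flip: ra_conv)
  have CD: "?C \<star>\<^sub>3 ?D = ?D \<star>\<^sub>3 ?C"
    by (rule lz_comm23[OF assms(2)])
  have eq: "?B \<star>\<^sub>3 ?A = ?D \<star>\<^sub>3 ?C"
    using assms(1) AB CD by (simp add: coc_iff)
  have 1: "(?A' \<star>\<^sub>3 ?B') \<star>\<^sub>3 (?B \<star>\<^sub>3 ?A) = e3"
  proof -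
    have "(?A' \<star>\<^sub>3 ?B') \<star>\<^sub>3 (?B \<star>\<^sub>3 ?A) = ?A' \<star>\<^sub>3 ((?B' \<star>\<^sub>3 ?B) \<star>\<^sub>3 ?A)"
      by (simp only: C13.T.conv_assoc)
    then show ?thesis
      by (simp add: B A C13.T.one_conv v)
  qed
  have 2: "(?D \<star>\<^sub>3 ?C) \<star>\<^sub>3 (?C' \<star>\<^sub>3 ?D') = e3"
  proof -
    have "(?D \<star>\<^sub>3 ?C) \<star>\<^sub>3 (?C' \<star>\<^sub>3 ?D') = ?D \<star>\<^sub>3 ((?C \<star>\<^sub>3 ?C') \<star>\<^sub>3 ?D')"
      by (simp only: C13.T.conv_assoc)
    then show ?thesis
      by (simp add: C D C13.T.one_conv v)
  qed
  have "?A' \<star>\<^sub>3 ?B' = (?A' \<star>\<^sub>3 ?B') \<star>\<^sub>3 ((?D \<star>\<^sub>3 ?C) \<star>\<^sub>3 (?C' \<star>\<^sub>3 ?D'))"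
    by (simp add: 2 C13.T.conv_one C13.T.mult_vecs)
  also have "\<dots> = ((?A' \<star>\<^sub>3 ?B') \<star>\<^sub>3 (?B \<star>\<^sub>3 ?A)) \<star>\<^sub>3 (?C' \<star>\<^sub>3 ?D')"
    by (simp only: eq C13.T.conv_assoc)
  also have "\<dots> = ?C' \<star>\<^sub>3 ?D'"
    by (simp add: 1 C13.T.one_conv C13.T.mult_vecs)
  finally show ?thesis
    by (simp add: coc_iff)
qed

lemma Units_vecs: "s \<in> Units C12.T.M \<Longrightarrow> s \<in> vecs (I \<times> I)"
  by (simp add: Units_def C12.T.carrier_M)

lemma Units2I:
  "s \<in> vecs (I \<times> I) \<Longrightarrow> t \<in> vecs (I \<times> I) \<Longrightarrow> s \<star>\<^sub>2 t = e2 \<Longrightarrow> t \<star>\<^sub>2 s = e2 \<Longrightarrow> s \<in> Units C12.T.M"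
  unfolding Units_def C12.T.carrier_M by auto

lemma Units1I:
  "f \<in> vecs I \<Longrightarrow> g \<in> vecs I \<Longrightarrow> f \<star>\<^sub>1 g = e1 \<Longrightarrow> g \<star>\<^sub>1 f = e1 \<Longrightarrow> f \<in> Units C1.M"
  unfolding Units_def C1.carrier_M by auto

lemma inv1:
  assumes "f \<in> Units C1.M"
  shows "f \<in> vecs I" "inv\<^bsub>C1.M\<^esub> f \<in> vecs I" "f \<star>\<^sub>1 inv\<^bsub>C1.M\<^esub> f = e1" "inv\<^bsub>C1.M\<^esub> f \<star>\<^sub>1 f = e1"
  using monoid.Units_closed[OF C1.monoid_M assms] monoid.Units_inv_closed[OF C1.monoid_M assms]
    monoid.Units_r_inv[OF C1.monoid_M assms] monoid.Units_l_inv[OF C1.monoid_M assms]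
  by (simp_all add: C1.carrier_M)

lemma Z_mult: "s \<in> Z \<Longrightarrow> t \<in> Z \<Longrightarrow> s \<star>\<^sub>2 t \<in> Z"
  unfolding Z_iff by (simp add: nrm_conv coc_conv lz_conv monoid.Units_m_closed[OF C12.T.monoid_M])

lemma Z_inverse:
  assumes "s \<in> Z" "t \<in> vecs (I \<times> I)" "s \<star>\<^sub>2 t = e2" "t \<star>\<^sub>2 s = e2"
  shows "t \<in> Z"
proof -
  have "s \<in> vecs (I \<times> I)"
    using assms(1) by (simp add: Z_iff Units_vecs)
  then show ?thesis
    using assms nrm_inverse[of s t] lz_inverse[of s t] coc_inverse[of s t] Units2I[of t s]
    by (simp add: Z_iff)
qed

lemma e2_Z: "e2 \<in> Z"
proof -
  have "coc e2"
    unfolding coc_iff by (simp add: D1_one D3_one ra_one C13.T.conv_one C13.T.one_vecs flip: C31.one_tens C13.one_tens)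
  moreover have "nrm e2"
    using one_basis by (simp add: nrm_def C12.T.one_in counit_one)
  moreover have "lz e2"
    by (simp add: lz_def C12.T.one_conv C12.T.conv_one pm_vecs)
  ultimately show ?thesis
    unfolding Z_iff using monoid.Units_one_closed[OF C12.T.monoid_M] by simp
qed

lemma lazy_Z2_eq: "lazy_Z2 H = (units_of C12.T.M)\<lparr>carrier := Z\<rparr>"
  unfolding lazy_Z2_def dual2_eq Z_def units_of_def conv_monoid_def by simp

lemma carrier_Z2: "carrier (lazy_Z2 H) = Z"
  and mult_Z2: "x \<otimes>\<^bsub>lazy_Z2 H\<^esub> y = x \<star>\<^sub>2 y"
  and one_Z2: "\<one>\<^bsub>lazy_Z2 H\<^esub> = e2"
  unfolding lazy_Z2_eq by (simp_all add: units_of_def)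

lemma Z_has_inverse:
  assumes "s \<in> Z"
  obtains t where "t \<in> Z" "s \<star>\<^sub>2 t = e2" "t \<star>\<^sub>2 s = e2"
proof -
  from assms obtain t where "t \<in> vecs (I \<times> I)" "s \<star>\<^sub>2 t = e2" "t \<star>\<^sub>2 s = e2"
    unfolding Z_iff Units_def C12.T.carrier_M by auto
  with Z_inverse[OF assms this] that show ?thesis
    by blast
qed

lemma Z_vecs: "s \<in> Z \<Longrightarrow> s \<in> vecs (I \<times> I)"
  by (simp add: Z_iff Units_vecs)

lemma group_Z2: "group (lazy_Z2 H)"
proof (rule groupI)
  fix x assume "x \<in> carrier (lazy_Z2 H)"
  then show "\<exists>y\<in>carrier (lazy_Z2 H). y \<otimes>\<^bsub>lazy_Z2 H\<^esub> x = \<one>\<^bsub>lazy_Z2 H\<^esub>"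
    unfolding carrier_Z2 mult_Z2 one_Z2 by (metis Z_has_inverse)
qed (auto simp: carrier_Z2 mult_Z2 one_Z2 Z_mult e2_Z C12.T.conv_assoc C12.T.one_conv Z_vecs)

subsection \<open>Lazy coboundaries\<close>

definition central :: "('i \<Rightarrow> 'k) \<Rightarrow> bool" where
  "central g \<longleftrightarrow> (\<forall>f. g \<star>\<^sub>1 f = f \<star>\<^sub>1 g)"

lemma centralD: "central g \<Longrightarrow> g \<star>\<^sub>1 f = f \<star>\<^sub>1 g"
  unfolding central_def by blast

lemma central_iff: "central g \<longleftrightarrow> (\<forall>f\<in>vecs I. g \<star>\<^sub>1 f = f \<star>\<^sub>1 g)"
proof
  assume *: "\<forall>f\<in>vecs I. g \<star>\<^sub>1 f = f \<star>\<^sub>1 g"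
  show "central g"
    unfolding central_def
  proof
    fix f :: "'i \<Rightarrow> 'k"
    let ?f = "\<lambda>i. if i \<in> I then f i else 0"
    have "g \<star>\<^sub>1 ?f = ?f \<star>\<^sub>1 g"
      using * by (simp add: vecs_def)
    moreover have "g \<star>\<^sub>1 ?f = g \<star>\<^sub>1 f" "?f \<star>\<^sub>1 g = f \<star>\<^sub>1 g"
      by (rule conv1_cong; simp)+
    ultimately show "g \<star>\<^sub>1 f = f \<star>\<^sub>1 g"
      by simp
  qed
qed (use centralD in blast)

lemma central_inverse:
  assumes "central g" "g \<in> vecs I" "h \<in> vecs I" "g \<star>\<^sub>1 h = e1" "h \<star>\<^sub>1 g = e1"
  shows "central h"
  unfolding central_iff
proof
  fix f :: "'i \<Rightarrow> 'k" assume f: "f \<in> vecs I"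
  show "h \<star>\<^sub>1 f = f \<star>\<^sub>1 h"
    by (rule monoid.inv_commute[OF C1.monoid_M, where x = g, OF _ _ _ _ _ centralD[OF assms(1)]])
       (use assms f in \<open>simp_all add: C1.carrier_M\<close>)
qed

lemma tens_central:
  assumes "central g" "g \<in> vecs I"
  shows "tens g g \<star>\<^sub>2 t = t \<star>\<^sub>2 tens g g"
proof -
  have 1: "tens g e1 \<star>\<^sub>2 t = t \<star>\<^sub>2 tens g e1" for t
    by (rule C12.T.conv_eqI[OF C12.T.mult_vecs C12.T.mult_vecs], clarify)
       (simp add: C12.tens_one_conv C12.conv_tens_one centralD[OF assms(1)])
  have 2: "tens e1 g \<star>\<^sub>2 t = t \<star>\<^sub>2 tens e1 g" for t
    by (rule C12.T.conv_eqI[OF C12.T.mult_vecs C12.T.mult_vecs], clarify)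
       (simp add: C12.one_tens_conv C12.conv_one_tens centralD[OF assms(1)])
  have 3: "tens g g = tens g e1 \<star>\<^sub>2 tens e1 g"
    by (simp add: C12.tens_conv C1.one_conv C1.conv_one assms)
  have "tens g g \<star>\<^sub>2 t = tens g e1 \<star>\<^sub>2 (t \<star>\<^sub>2 tens e1 g)"
    unfolding 3 C12.T.conv_assoc 2[of t] ..
  also have "\<dots> = t \<star>\<^sub>2 (tens g e1 \<star>\<^sub>2 tens e1 g)"
    unfolding C12.T.conv_assoc[symmetric] 1[of t] ..
  finally show ?thesis
    unfolding 3 .
qed

lemma cobound_eq: "lazy_cobound H g = tens g g \<star>\<^sub>2 pm (inv\<^bsub>C1.M\<^esub> g)"
proof (rule C12.T.conv_eqI[OF _ C12.T.mult_vecs])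
  show "lazy_cobound H g \<in> vecs (I \<times> I)"
    by (auto simp: vecs_def lazy_cobound_def)
  fix x assume "x \<in> I \<times> I"
  then obtain i j where [simp]: "x = (i, j)" and mem: "i \<in> I" "j \<in> I"
    by auto
  show "lazy_cobound H g x = (tens g g \<star>\<^sub>2 pm (inv\<^bsub>C1.M\<^esub> g)) x"
    using mem by (simp add: lazy_cobound_def C12.mult_tens_in dual_eq ev_def pm_ap sum_prod_split finI mult_ac cong: sum.cong)
qed

lemma B2_iff: "s \<in> lazy_B2 H \<longleftrightarrow>
    (\<exists>g \<in> Units C1.M. g one = 1 \<and> central g \<and> s = tens g g \<star>\<^sub>2 pm (inv\<^bsub>C1.M\<^esub> g))"
  unfolding lazy_B2_def dual_eq central_iff C1.carrier_M unitv_eq ev_bvec[OF one_basis] cobound_eq[symmetric]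
  by auto

lemma pm_inverse: "f \<star>\<^sub>1 g = e1 \<Longrightarrow> pm f \<star>\<^sub>2 pm g = e2"
  by (simp add: pm_one flip: pm_conv)

lemma tens_inverse: "f \<star>\<^sub>1 g = e1 \<Longrightarrow> tens f f \<star>\<^sub>2 tens g g = e2"
  by (simp add: C12.tens_conv C12.one_tens)

lemma pm_at_one: "i \<in> I \<Longrightarrow> pm f (i, one) = f i" "i \<in> I \<Longrightarrow> pm f (one, i) = f i"
  using one_basis by (simp_all add: pm_ap structc_one one_structc) (simp_all add: sum_bvec mult.commute)

text \<open>For \<open>\<sigma> = (\<gamma> \<otimes> \<gamma>) \<star> \<gamma>\<^sup>-\<^sup>1(m)\<close> the factors \<open>\<gamma>\<^sup>-\<^sup>1(m) \<otimes> \<epsilon>\<close> and \<open>\<gamma>(m) \<otimes> \<gamma>\<close> in the middle cancel, and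
  both sides of the cocycle condition become \<open>(\<gamma> \<otimes> \<gamma> \<otimes> \<gamma>) \<star> \<gamma>\<^sup>-\<^sup>1(m(m \<otimes> id))\<close>. Centrality of \<open>\<gamma>\<close> gives
  laziness.\<close>

lemma cobound_Z:
  assumes U: "g \<in> Units C1.M" and one: "g one = 1" and cent: "central g"
  shows "tens g g \<star>\<^sub>2 pm (inv\<^bsub>C1.M\<^esub> g) \<in> Z"
proof -
  define h where "h = inv\<^bsub>C1.M\<^esub> g"
  note inv = inv1[OF U, folded h_def]
  have ch: "central h"
    using central_inverse[OF cent] inv by blast
  let ?S = "tens g g" and ?T = "pm h"
  have gv: "?S \<in> vecs (I \<times> I)"
    by (rule vecs_tens) (rule inv(1))+
  have unit: "?S \<star>\<^sub>2 ?T \<in> Units C12.T.M"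
  proof (rule monoid.Units_m_closed[OF C12.T.monoid_M])
    show "?S \<in> Units C12.T.M"
      by (rule Units2I[OF gv vecs_tens[OF inv(2) inv(2)]]) (rule tens_inverse inv(3,4))+
    show "?T \<in> Units C12.T.M"
      by (rule Units2I[OF pm_vecs pm_vecs]) (rule pm_inverse inv(3,4))+
  qed
  have nrm: "nrm (?S \<star>\<^sub>2 ?T)"
    unfolding nrm_def
  proof
    fix i assume i: "i \<in> I"
    have "(\<lambda>p. ?S (p, one)) \<star>\<^sub>1 (\<lambda>p. ?T (p, one)) = g \<star>\<^sub>1 h"
      "(\<lambda>p. ?S (one, p)) \<star>\<^sub>1 (\<lambda>p. ?T (one, p)) = g \<star>\<^sub>1 h"
      by (rule conv1_cong; simp add: one pm_at_one)+
    then show "(?S \<star>\<^sub>2 ?T) (i, one) = eps i \<and> (?S \<star>\<^sub>2 ?T) (one, i) = eps i"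
      using i by (simp add: conv2_at_one inv C1.one_in)
  qed
  have lz: "lz (?S \<star>\<^sub>2 ?T)"
    unfolding lz_def
  proof
    fix f
    have "?T \<star>\<^sub>2 pm f = pm f \<star>\<^sub>2 ?T"
      unfolding pm_conv[symmetric] centralD[OF ch, of f] ..
    then have "?S \<star>\<^sub>2 ?T \<star>\<^sub>2 pm f = (?S \<star>\<^sub>2 pm f) \<star>\<^sub>2 ?T"
      by (simp only: C12.T.conv_assoc)
    then show "?S \<star>\<^sub>2 ?T \<star>\<^sub>2 pm f = pm f \<star>\<^sub>2 (?S \<star>\<^sub>2 ?T)"
      by (simp only: C12.T.conv_assoc tens_central[OF cent inv(1), of "pm f"])
  qed
  have coc: "coc (?S \<star>\<^sub>2 ?T)"
  proof -
    have D1S: "D1 ?S = tens (pm g) g"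
    proof (rule C31.T.conv_eqI[OF D1_vecs vecs_tens[OF pm_vecs inv(1)]], clarify)
      fix i j k assume "i \<in> I" "j \<in> I" "k \<in> I"
      then show "D1 ?S ((i, j), k) = tens (pm g) g ((i, j), k)"
        by (simp add: D1_ap pm_ap sum_distrib_right sum_distrib_left mult_ac)
    qed
    have D3S: "D3 ?S = tens g (pm g)"
    proof (rule C13.T.conv_eqI[OF D3_vecs vecs_tens[OF inv(1) pm_vecs]], clarify)
      fix i j k assume "i \<in> I" "j \<in> I" "k \<in> I"
      then show "D3 ?S (i, (j, k)) = tens g (pm g) (i, (j, k))"
        by (simp add: D3_ap pm_ap sum_distrib_right sum_distrib_left mult_ac)
    qed
    have 1: "tens ?T e1 \<star>\<^sub>4 tens (pm g) g = tens e2 g"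
      by (simp add: C31.tens_conv pm_inverse inv C1.one_conv)
    have 2: "tens e1 ?T \<star>\<^sub>3 tens g (pm g) = tens g e2"
      by (simp add: C13.tens_conv pm_inverse inv C1.one_conv)
    have 3: "tens ?S e1 \<star>\<^sub>4 tens e2 g = tens ?S g" "tens e1 ?S \<star>\<^sub>3 tens g e2 = tens g ?S"
      by (simp_all add: C31.tens_conv C13.tens_conv C1.one_conv inv C12.T.conv_one gv)
    have "ra (tens (?S \<star>\<^sub>2 ?T) e1) \<star>\<^sub>3 ra (D1 (?S \<star>\<^sub>2 ?T)) =
        ra (tens ?S e1 \<star>\<^sub>4 (tens ?T e1 \<star>\<^sub>4 tens (pm g) g) \<star>\<^sub>4 D1 ?T)"
      by (simp add: D1_conv ra_conv C13.T.conv_assoc D1S flip: ra_tens_conv)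
    also have "\<dots> = ra (tens ?S g) \<star>\<^sub>3 D3 ?T"
      by (simp add: 1 3 ra_conv ra_D1_pm)
    also have "ra (tens ?S g) = tens g ?S"
      by (auto simp: fun_eq_iff)
    also have "\<dots> \<star>\<^sub>3 D3 ?T = tens e1 ?S \<star>\<^sub>3 (tens e1 ?T \<star>\<^sub>3 tens g (pm g)) \<star>\<^sub>3 D3 ?T"
      by (simp add: 2 3)
    also have "\<dots> = tens e1 (?S \<star>\<^sub>2 ?T) \<star>\<^sub>3 D3 (?S \<star>\<^sub>2 ?T)"
      by (simp add: D3_conv C13.T.conv_assoc D3S flip: one_tens_mult)
    finally show ?thesis
      by (simp add: coc_iff)
  qed
  show ?thesis
    using unit nrm lz coc by (simp add: Z_iff h_def)
qed

lemma B2_subset_Z: "lazy_B2 H \<subseteq> Z"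
  using cobound_Z by (auto simp: B2_iff)

text \<open>The coboundary in question is that of the inverse of \<open>f\<close>.\<close>

lemma cobound_if_twisted_character:
  assumes "f \<in> Units C1.M" "f one = 1" "central f" "s \<in> vecs (I \<times> I)"
    and "pm f = tens f f \<star>\<^sub>2 s"
  shows "s \<in> lazy_B2 H"
proof -
  let ?g = "inv\<^bsub>C1.M\<^esub> f"
  note inv = inv1[OF assms(1)]
  have U: "?g \<in> Units C1.M"
    by (rule Units1I) (rule inv)+
  have "inv\<^bsub>C1.M\<^esub> ?g = f"
    using monoid.Units_inv_inv[OF C1.monoid_M assms(1)] .
  moreover have "tens ?g ?g \<star>\<^sub>2 pm f = (tens ?g ?g \<star>\<^sub>2 tens f f) \<star>\<^sub>2 s"
    unfolding assms(5) by (simp only: C12.T.conv_assoc)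
  then have "tens ?g ?g \<star>\<^sub>2 pm f = s"
    by (simp add: tens_inverse inv C12.T.one_conv assms(4))
  moreover have "?g one = 1"
  proof -
    have "(f \<star>\<^sub>1 ?g) one = (\<Sum>p\<in>I. \<Sum>q\<in>I. if q = one then (if p = one then f one * ?g one else 0) else 0)"
      using one_basis by (simp add: C1.mult_in) (intro sum.cong refl, auto simp: comul_one)
    also have "\<dots> = ?g one"
      using one_basis by (simp add: finI assms(2))
    finally show ?thesis
      using inv one_basis by (simp add: C1.one_in counit_one)
  qed
  moreover have "central ?g"
    using central_inverse[OF assms(3)] inv by blast
  ultimately show ?thesis
    unfolding B2_iff using U by (intro bexI[of _ ?g]) simp_all
qed

subsection \<open>Twisted products\<close>

text \<open>The structure constants of the product \<open>a \<bullet> b = \<Sum> \<sigma>(a\<^sub>1, b\<^sub>1) a\<^sub>2 b\<^sub>2\<close>, expressed through its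
  pairing with the dual basis: composing a functional \<open>f\<close> with this product gives \<open>\<sigma> \<star> f(m)\<close>.\<close>

definition tw :: "('i \<times> 'i \<Rightarrow> 'k) \<Rightarrow> 'i \<Rightarrow> 'i \<Rightarrow> 'i \<Rightarrow> 'k" where
  "tw s i j = (\<lambda>r. if r \<in> I then (s \<star>\<^sub>2 pm (bvec r)) (i, j) else 0)"

lemma tw_vecs: "tw s i j \<in> vecs I"
  by (simp add: vecs_def tw_def)

lemma tw_pair:
  assumes "i \<in> I" "j \<in> I"
  shows "(\<Sum>r\<in>I. tw s i j r * f r) = (s \<star>\<^sub>2 pm f) (i, j)"
proof -
  let ?g = "\<lambda>r. if r \<in> I then f r else 0"
  have "(s \<star>\<^sub>2 pm ?g) (i, j) = (\<Sum>r\<in>I. ?g r * (s \<star>\<^sub>2 pm (bvec r)) (i, j))"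
    by (rule linf_expand[OF finI _ linf_conv_pm(1)[OF assms]]) (simp add: vecs_def)
  moreover have "pm ?g = pm f"
    by (rule pm_cong) simp
  ultimately show ?thesis
    by (simp add: tw_def mult.commute)
qed

lemma tw_assoc:
  assumes "coc s" "i \<in> I" "j \<in> I" "k \<in> I" "r \<in> I"
  shows "(\<Sum>x\<in>I. tw s i j x * tw s x k r) = (\<Sum>x\<in>I. tw s j k x * tw s i x r)"
proof -
  let ?T = "s \<star>\<^sub>2 pm (bvec r)"
  have "(\<Sum>x\<in>I. tw s i j x * tw s x k r) = (s \<star>\<^sub>2 pm (\<lambda>x. ?T (x, k))) (i, j)"
    using assms by (simp add: tw_def flip: tw_pair)
  also have "\<dots> = (ra (tens s e1) \<star>\<^sub>3 ra (D1 ?T)) (i, (j, k))"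
    using assms by (simp add: tens_one_D1 flip: ra_conv)
  also have "\<dots> = ((ra (tens s e1) \<star>\<^sub>3 ra (D1 s)) \<star>\<^sub>3 D3 (pm (bvec r))) (i, (j, k))"
    by (simp add: D1_conv ra_conv ra_D1_pm C13.T.conv_assoc)
  also have "\<dots> = (tens e1 s \<star>\<^sub>3 D3 ?T) (i, (j, k))"
    using assms(1) by (simp add: coc_iff D3_conv C13.T.conv_assoc)
  also have "\<dots> = (s \<star>\<^sub>2 pm (\<lambda>x. ?T (i, x))) (j, k)"
    using assms by (simp add: one_tens_D3)
  also have "\<dots> = (\<Sum>x\<in>I. tw s j k x * tw s i x r)"
    using assms by (simp add: tw_def flip: tw_pair)
  finally show ?thesis .
qed

lemma bvec_conv_bvec:
  assumes "r \<in> I" "p \<in> I" "q \<in> I"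
  shows "(bvec p \<star>\<^sub>1 bvec q) r = d r (p, q)"
  using assms by (simp add: C1.mult_in sum_bvec)

text \<open>\<open>compat P P1 P2\<close> means \<open>\<Delta>(P(a, b)) = \<Sum> P1(a\<^sub>1, b\<^sub>1) \<otimes> P2(a\<^sub>2, b\<^sub>2)\<close>. The product \<open>P\<close> is a right,
  respectively left, comodule map if this holds for \<open>P, P, c\<close>, respectively \<open>P, c, P\<close>.\<close>

definition compat ::
  "('i \<Rightarrow> 'i \<Rightarrow> 'i \<Rightarrow> 'k) \<Rightarrow> ('i \<Rightarrow> 'i \<Rightarrow> 'i \<Rightarrow> 'k) \<Rightarrow> ('i \<Rightarrow> 'i \<Rightarrow> 'i \<Rightarrow> 'k) \<Rightarrow> bool" where
  "compat P P1 P2 \<longleftrightarrow> (\<forall>i\<in>I. \<forall>j\<in>I. \<forall>p\<in>I. \<forall>q\<in>I.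
     (\<Sum>r\<in>I. P i j r * d r (p, q)) = (\<Sum>p1\<in>I. \<Sum>q1\<in>I. \<Sum>p2\<in>I. \<Sum>q2\<in>I.
        d i (p1, q1) * d j (p2, q2) * P1 p1 p2 p * P2 q1 q2 q))"

text \<open>Dually, the two compatibilities say \<open>\<sigma> \<star> (f \<star> h)(m) = (\<sigma> \<star> f(m)) \<star> h(m)\<close> and
  \<open>\<sigma> \<star> (f \<star> h)(m) = f(m) \<star> (\<sigma> \<star> h(m))\<close>. The first is associativity, the second is laziness.\<close>

lemma tw_compat_right: "compat (tw s) (tw s) c"
  unfolding compat_def
proof (intro ballI)
  fix i j p q assume mem: "i \<in> I" "j \<in> I" "p \<in> I" "q \<in> I"
  have "(\<Sum>r\<in>I. tw s i j r * d r (p, q)) = (s \<star>\<^sub>2 pm (\<lambda>r. d r (p, q))) (i, j)"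
    using mem by (simp add: tw_pair)
  also have "pm (\<lambda>r. d r (p, q)) = pm (bvec p) \<star>\<^sub>2 pm (bvec q)"
    unfolding pm_conv[symmetric] using mem by (intro pm_cong) (simp add: bvec_conv_bvec)
  also have "(s \<star>\<^sub>2 (pm (bvec p) \<star>\<^sub>2 pm (bvec q))) (i, j) = ((s \<star>\<^sub>2 pm (bvec p)) \<star>\<^sub>2 pm (bvec q)) (i, j)"
    by (simp only: C12.T.conv_assoc)
  also have "\<dots> = (\<Sum>p1\<in>I. \<Sum>q1\<in>I. \<Sum>p2\<in>I. \<Sum>q2\<in>I.
        d i (p1, q1) * d j (p2, q2) * tw s p1 p2 p * c q1 q2 q)"
    unfolding C12.mult_tens_in[OF mem(1,2), of "s \<star>\<^sub>2 pm (bvec p)"] using mem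
    by (intro sum.cong refl arg_cong2[where f = "(*)"]) (simp_all add: tw_def pm_ap sum_bvec)
  finally show "(\<Sum>r\<in>I. tw s i j r * d r (p, q)) = \<dots>" .
qed

lemma tw_compat_left: assumes "lz s" shows "compat (tw s) c (tw s)"
  unfolding compat_def
proof (intro ballI)
  fix i j p q assume mem: "i \<in> I" "j \<in> I" "p \<in> I" "q \<in> I"
  have "(\<Sum>r\<in>I. tw s i j r * d r (p, q)) = (s \<star>\<^sub>2 pm (\<lambda>r. d r (p, q))) (i, j)"
    using mem by (simp add: tw_pair)
  also have "pm (\<lambda>r. d r (p, q)) = pm (bvec p) \<star>\<^sub>2 pm (bvec q)"
    unfolding pm_conv[symmetric] using mem by (intro pm_cong) (simp add: bvec_conv_bvec)
  also have "s \<star>\<^sub>2 (pm (bvec p) \<star>\<^sub>2 pm (bvec q)) = pm (bvec p) \<star>\<^sub>2 (s \<star>\<^sub>2 pm (bvec q))"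
    using assms unfolding lz_def by (metis C12.T.conv_assoc[of s] C12.T.conv_assoc[of _ s])
  also have "\<dots> (i, j) = (\<Sum>p1\<in>I. \<Sum>q1\<in>I. \<Sum>p2\<in>I. \<Sum>q2\<in>I.
        d i (p1, q1) * d j (p2, q2) * c p1 p2 p * tw s q1 q2 q)"
    unfolding C12.mult_tens_in[OF mem(1,2), of "pm (bvec p)"] using mem
    by (intro sum.cong refl arg_cong2[where f = "(*)"]) (simp_all add: tw_def pm_ap sum_bvec)
  finally show "(\<Sum>r\<in>I. tw s i j r * d r (p, q)) = \<dots>" .
qed

lemma tw_counit:
  assumes "s \<in> vecs (I \<times> I)" "i \<in> I" "j \<in> I"
  shows "(\<Sum>r\<in>I. tw s i j r * eps r) = s (i, j)"
proof -
  have "pm eps = e2"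
    unfolding pm_one[symmetric] by (rule pm_cong) (simp add: C1.one_in)
  then show ?thesis
    using assms by (simp add: tw_pair C12.T.conv_one)
qed

text \<open>Apply the counit to the first tensor factor of the compatibility with the coproduct.\<close>

lemma compat_sum_left:
  assumes "compat P P1 P2" "i \<in> I" "j \<in> I" "q \<in> I"
  shows "P i j q = ((\<lambda>(a, b). \<Sum>p\<in>I. P1 a b p * eps p) \<star>\<^sub>2 (\<lambda>(a, b). P2 a b q)) (i, j)"
proof -
  have "P i j q = (\<Sum>r\<in>I. P i j r * (\<Sum>p\<in>I. d r (p, q) * eps p))"
  proof -
    have "(\<Sum>r\<in>I. P i j r * (\<Sum>p\<in>I. d r (p, q) * eps p)) = (\<Sum>r\<in>I. if r = q then P i j q else 0)"
      using assms(4) by (intro sum.cong refl) (auto simp: C1.counit_left)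
    then show ?thesis
      using assms(4) by (simp add: finI)
  qed
  also have "\<dots> = (\<Sum>p\<in>I. (\<Sum>r\<in>I. P i j r * d r (p, q)) * eps p)"
    unfolding sum_distrib_left sum_distrib_right mult.assoc by (rule sum.swap)
  also have "\<dots> = (\<Sum>p\<in>I. (\<Sum>p1\<in>I. \<Sum>q1\<in>I. \<Sum>p2\<in>I. \<Sum>q2\<in>I.
        d i (p1, q1) * d j (p2, q2) * P1 p1 p2 p * P2 q1 q2 q) * eps p)"
    by (rule sum.cong[OF refl], rule arg_cong2[where f = "(*)", OF _ refl]) (use assms in \<open>simp add: compat_def\<close>)
  also have "\<dots> = (\<Sum>p\<in>I. \<Sum>p1\<in>I. \<Sum>q1\<in>I. \<Sum>p2\<in>I. \<Sum>q2\<in>I.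
        d i (p1, q1) * d j (p2, q2) * (P1 p1 p2 p * eps p) * P2 q1 q2 q)"
    by (simp add: sum_distrib_right sum_distrib_left mult_ac)
  also have "\<dots> = (\<Sum>p1\<in>I. \<Sum>q1\<in>I. \<Sum>p2\<in>I. \<Sum>q2\<in>I. \<Sum>p\<in>I.
        d i (p1, q1) * d j (p2, q2) * (P1 p1 p2 p * eps p) * P2 q1 q2 q)"
    by (rule sum_rot5)
  also have "\<dots> = ((\<lambda>(a, b). \<Sum>p\<in>I. P1 a b p * eps p) \<star>\<^sub>2 (\<lambda>(a, b). P2 a b q)) (i, j)"
    using assms by (simp add: C12.mult_tens_in sum_distrib_left sum_distrib_right)
  finally show ?thesis .
qed

lemma compat_sum_right:
  assumes "compat P P1 P2" "i \<in> I" "j \<in> I" "p \<in> I"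
  shows "P i j p = ((\<lambda>(a, b). P1 a b p) \<star>\<^sub>2 (\<lambda>(a, b). \<Sum>q\<in>I. P2 a b q * eps q)) (i, j)"
proof -
  have "P i j p = (\<Sum>r\<in>I. P i j r * (\<Sum>q\<in>I. d r (p, q) * eps q))"
  proof -
    have "(\<Sum>r\<in>I. P i j r * (\<Sum>q\<in>I. d r (p, q) * eps q)) = (\<Sum>r\<in>I. if r = p then P i j p else 0)"
      using assms(4) by (intro sum.cong refl) (auto simp: C1.counit_right)
    then show ?thesis
      using assms(4) by (simp add: finI)
  qed
  also have "\<dots> = (\<Sum>q\<in>I. (\<Sum>r\<in>I. P i j r * d r (p, q)) * eps q)"
    unfolding sum_distrib_left sum_distrib_right mult.assoc by (rule sum.swap)
  also have "\<dots> = (\<Sum>q\<in>I. (\<Sum>p1\<in>I. \<Sum>q1\<in>I. \<Sum>p2\<in>I. \<Sum>q2\<in>I.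
        d i (p1, q1) * d j (p2, q2) * P1 p1 p2 p * P2 q1 q2 q) * eps q)"
    by (rule sum.cong[OF refl], rule arg_cong2[where f = "(*)", OF _ refl]) (use assms in \<open>simp add: compat_def\<close>)
  also have "\<dots> = (\<Sum>q\<in>I. \<Sum>p1\<in>I. \<Sum>q1\<in>I. \<Sum>p2\<in>I. \<Sum>q2\<in>I.
        d i (p1, q1) * d j (p2, q2) * P1 p1 p2 p * (P2 q1 q2 q * eps q))"
    by (simp add: sum_distrib_right sum_distrib_left mult_ac)
  also have "\<dots> = (\<Sum>p1\<in>I. \<Sum>q1\<in>I. \<Sum>p2\<in>I. \<Sum>q2\<in>I. \<Sum>q\<in>I.
        d i (p1, q1) * d j (p2, q2) * P1 p1 p2 p * (P2 q1 q2 q * eps q))"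
    by (rule sum_rot5)
  also have "\<dots> = ((\<lambda>(a, b). P1 a b p) \<star>\<^sub>2 (\<lambda>(a, b). \<Sum>q\<in>I. P2 a b q * eps q)) (i, j)"
    using assms by (simp add: C12.mult_tens_in sum_distrib_left sum_distrib_right)
  finally show ?thesis .
qed

text \<open>The two expressions of the product through \<open>s\<close>, obtained from the two compatibilities, agree:
  this is laziness. The cocycle identity is the counit applied to associativity.\<close>

lemma Z_of_product:
  assumes assoc: "\<And>i j k r. \<lbrakk>i \<in> I; j \<in> I; k \<in> I; r \<in> I\<rbrakk> \<Longrightarrow>
      (\<Sum>x\<in>I. P i j x * P x k r) = (\<Sum>x\<in>I. P j k x * P i x r)"
    and unit: "\<And>i. i \<in> I \<Longrightarrow> P one i = bvec i" "\<And>i. i \<in> I \<Longrightarrow> P i one = bvec i"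
    and compat: "compat P P c" "compat P c P"
    and s: "\<And>i j. i \<in> I \<Longrightarrow> j \<in> I \<Longrightarrow> s (i, j) = (\<Sum>r\<in>I. P i j r * eps r)"
    and U: "s \<in> Units C12.T.M"
  shows "s \<in> Z"
proof -
  have L: "P i j r = (s \<star>\<^sub>2 pm (bvec r)) (i, j)" if "i \<in> I" "j \<in> I" "r \<in> I" for i j r
    unfolding compat_sum_left[OF compat(1) that]
    by (rule arg_cong[of _ _ "\<lambda>f. f (i, j)"], rule conv2_cong) (simp_all add: s pm_ap sum_bvec that)
  have R: "P i j r = (pm (bvec r) \<star>\<^sub>2 s) (i, j)" if "i \<in> I" "j \<in> I" "r \<in> I" for i j r
    unfolding compat_sum_right[OF compat(2) that]
    by (rule arg_cong[of _ _ "\<lambda>f. f (i, j)"], rule conv2_cong) (simp_all add: s pm_ap sum_bvec that)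
  have P: "(\<Sum>x\<in>I. P i j x * f x) = (s \<star>\<^sub>2 pm f) (i, j)" if "i \<in> I" "j \<in> I" for i j f
    unfolding tw_pair[OF that, symmetric] by (intro sum.cong refl) (simp add: tw_def L that)
  have "lz s"
    by (rule lzI) (metis L R)
  moreover have "nrm s"
    unfolding nrm_def using one_basis by (simp add: s unit) (simp add: sum_bvec mult.commute)
  moreover have "coc s"
    unfolding coc_def
  proof (intro ballI)
    fix i j k assume mem: "i \<in> I" "j \<in> I" "k \<in> I"
    have "(s \<star>\<^sub>2 pm (\<lambda>r. s (r, k))) (i, j) = (\<Sum>x\<in>I. \<Sum>r\<in>I. P i j x * P x k r * eps r)"
      using mem by (simp add: s sum_distrib_left mult.assoc flip: P)
    also have "\<dots> = (\<Sum>r\<in>I. (\<Sum>x\<in>I. P i j x * P x k r) * eps r)"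
      by (subst sum.swap) (simp add: sum_distrib_right)
    also have "\<dots> = (\<Sum>r\<in>I. (\<Sum>x\<in>I. P j k x * P i x r) * eps r)"
      using mem by (intro sum.cong refl arg_cong2[where f = "(*)"] assoc)
    also have "\<dots> = (\<Sum>x\<in>I. \<Sum>r\<in>I. P j k x * P i x r * eps r)"
      by (subst sum.swap) (simp add: sum_distrib_right)
    also have "\<dots> = (s \<star>\<^sub>2 pm (\<lambda>r. s (i, r))) (j, k)"
      using mem by (simp add: s sum_distrib_left mult.assoc flip: P)
    finally show "(s \<star>\<^sub>2 pm (\<lambda>r. s (r, k))) (i, j) = (s \<star>\<^sub>2 pm (\<lambda>r. s (i, r))) (j, k)" .
  qed
  ultimately show ?thesis
    using U by (simp add: Z_iff)
qed

end

section \<open>Ordered monomials in anticommuting operators\<close>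

text \<open>The sign of moving \<open>v\<^sub>i\<close> to its place in the ordered product \<open>v\<^sub>S\<close>.\<close>

definition sg :: "nat \<Rightarrow> nat set \<Rightarrow> 'k::field" where
  "sg i S = (- 1) ^ card {t \<in> S. t < i}"

lemma sg_cong: "S \<inter> {..<i} = T \<inter> {..<i} \<Longrightarrow> sg i S = sg i T"
proof -
  assume "S \<inter> {..<i} = T \<inter> {..<i}"
  then have "{t \<in> S. t < i} = {t \<in> T. t < i}"
    by auto
  then show ?thesis
    by (simp add: sg_def)
qed

lemma sg_insert: "m \<notin> S \<Longrightarrow> sg i (insert m S) = (if m < i then - sg i S else sg i S)"
proof (cases "m < i")
  case True
  assume "m \<notin> S"
  then have "card (insert m {t \<in> S. t < i}) = Suc (card {t \<in> S. t < i})"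
    by simp
  moreover have "{t \<in> insert m S. t < i} = insert m {t \<in> S. t < i}"
    using True by auto
  ultimately show ?thesis
    using True by (simp add: sg_def)
next
  case False
  then show ?thesis
    by (auto intro!: sg_cong)
qed

lemma sg_remove: "m \<in> S \<Longrightarrow> sg i (S - {m}) = (if m < i then - sg i S else sg i S)"
proof -
  assume "m \<in> S"
  then have "insert m (S - {m}) = S"
    by blast
  then have "sg i S = (if m < i then - sg i (S - {m}) else sg i (S - {m}) :: 'a)"
    using sg_insert[of m "S - {m}" i] by simp
  then show ?thesis
    by simp
qed

lemma sg_empty [simp]: "sg i {} = 1"
  by (simp add: sg_def)

lemma sg_square [simp]: "sg i S * sg i S = 1" "sg i S * (sg i S * x) = x"
  by (simp_all add: sg_def flip: power_mult_distrib mult.assoc)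

lemma sg_min: "(\<And>s. s \<in> S \<Longrightarrow> i \<le> s) \<Longrightarrow> sg i S = 1"
proof -
  assume "\<And>s. s \<in> S \<Longrightarrow> i \<le> s"
  then have "{t \<in> S. t < i} = {}"
    by fastforce
  then show ?thesis
    by (simp only: sg_def) simp
qed

text \<open>The ordered product of the operators \<open>F i\<close>, \<open>i \<in> S\<close>, with the smallest index applied last.\<close>

definition opS :: "(nat \<Rightarrow> 'a \<Rightarrow> 'a) \<Rightarrow> nat set \<Rightarrow> 'a \<Rightarrow> 'a" where
  "opS F S = foldr F (sorted_list_of_set S)"

lemma opS_empty [simp]: "opS F {} w = w"
  by (simp add: opS_def)

lemma opS_insert: "finite S \<Longrightarrow> (\<And>s. s \<in> S \<Longrightarrow> m < s) \<Longrightarrow> opS F (insert m S) w = F m (opS F S w)"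
proof -
  assume *: "finite S" "\<And>s. s \<in> S \<Longrightarrow> m < s"
  then have "m \<notin> S"
    by blast
  then have "sorted_list_of_set (insert m S) = insort m (sorted_list_of_set S)"
    using * by simp
  also have "\<dots> = m # sorted_list_of_set S"
    by (rule insort_is_Cons) (use * less_imp_le in auto)
  finally show ?thesis
    by (simp add: opS_def)
qed

lemma opS_closed:
  assumes "finite S" "w \<in> W" "\<And>i w. i \<in> S \<Longrightarrow> w \<in> W \<Longrightarrow> F i w \<in> W"
  shows "opS F S w \<in> W"
  using assms by (induction S rule: finite_linorder_min_induct) (simp_all add: opS_insert)

lemma opS_cong:
  assumes "finite S" "w \<in> W" "\<And>i w. i \<in> S \<Longrightarrow> w \<in> W \<Longrightarrow> F i w \<in> W" "\<And>i w. i \<in> S \<Longrightarrow> w \<in> W \<Longrightarrow> F i w = F' i w"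
  shows "opS F S w = opS F' S w"
  using assms
proof (induction S rule: finite_linorder_min_induct)
  case (insert b A)
  then have "opS F A w = opS F' A w"
    by auto
  moreover have "opS F A w \<in> W"
    using insert by (intro opS_closed) auto
  ultimately show ?case
    using insert by (simp add: opS_insert)
qed simp

text \<open>Moving an operator through an ordered monomial.\<close>

lemma opS_intertwine:
  assumes "finite S" "w \<in> W" "\<And>i w. i \<in> S \<Longrightarrow> w \<in> W \<Longrightarrow> F i w \<in> W"
    and "\<And>i w. i \<in> S \<Longrightarrow> w \<in> W \<Longrightarrow> f (F i w) = F' i (f w)"
  shows "f (opS F S w) = opS F' S (f w)"
  using assms
proof (induction S rule: finite_linorder_min_induct)
  case (insert b A)
  then have "f (opS F A w) = opS F' A (f w)"
    by auto
  moreover have "opS F A w \<in> W"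
    using insert by (intro opS_closed) auto
  ultimately show ?case
    using insert by (simp add: opS_insert)
qed simp

lemma linop_opS: "finite S \<Longrightarrow> (\<And>i. i \<in> S \<Longrightarrow> linop (F i)) \<Longrightarrow> linop (opS F S)"
  unfolding opS_def by (rule linop_foldr) simp

text \<open>Operators that satisfy the Clifford relations of the symmetric form \<open>B + B\<^sup>t\<close> on the subspace \<open>W\<close>.
  A matrix \<open>B\<close> with this symmetrisation is fixed and taken lower triangular, since a generator with
  smaller index than all factors of an ordered monomial is multiplied to it without correction term.\<close>

locale clifford_ops =
  fixes n :: nat and B :: "nat \<Rightarrow> nat \<Rightarrow> 'k::field"
    and F :: "nat \<Rightarrow> ('b \<Rightarrow> 'k) \<Rightarrow> 'b \<Rightarrow> 'k" and W :: "('b \<Rightarrow> 'k) set"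
  assumes lin: "i < n \<Longrightarrow> linop (F i)"
    and closed: "i < n \<Longrightarrow> w \<in> W \<Longrightarrow> F i w \<in> W"
    and rel: "i < n \<Longrightarrow> j < n \<Longrightarrow> w \<in> W \<Longrightarrow> F i (F j w) + F j (F i w) = sc (B i j + B j i) w"
    and tri: "i < j \<Longrightarrow> B i j = 0"
    and two: "(2::'k) \<noteq> 0"
begin

lemma square:
  assumes "i < n" "w \<in> W"
  shows "F i (F i w) = sc (B i i) w"
proof
  fix x
  have "F i (F i w) x + F i (F i w) x = (B i i + B i i) * w x"
    using arg_cong[OF rel[OF assms(1,1,2)], of "\<lambda>f. f x"] by simp
  then have "2 * (F i (F i w) x - B i i * w x) = 0"
    by (simp add: algebra_simps)
  then show "F i (F i w) x = sc (B i i) w x"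
    using two by simp
qed

lemma ordered_closed: "S \<subseteq> {..<n} \<Longrightarrow> w \<in> W \<Longrightarrow> opS F S w \<in> W"
  by (rule opS_closed) (auto simp: closed finite_subset)

text \<open>The generator \<open>F i\<close> is moved past the smaller factors one at a time. Each exchange changes the sign
  and leaves a correction term in which the factor \<open>F j\<close> is removed; if \<open>F i\<close> meets itself, the square is
  the scalar \<open>B i i\<close>. Nothing depends on the particular operators.\<close>

lemma mult_ordered:
  assumes "S \<subseteq> {..<n}" "i < n" "w \<in> W"
  shows "F i (opS F S w) = (if i \<in> S then 0 else sc (sg i S) (opS F (insert i S) w)) +
    (\<Sum>j\<in>S. sc (B i j * sg j S) (opS F (S - {j}) w))"
proof -
  have "finite S"
    using assms(1) finite_subset by blast
  then show ?thesis
    using assms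
  proof (induction S arbitrary: i rule: finite_linorder_min_induct)
    case empty
    then show ?case
      using opS_insert[of "{}" i F w] by simp
  next
    case (insert m A)
    let ?S = "insert m A"
    have A: "A \<subseteq> {..<n}" "m < n" "finite A" "m \<notin> A" "\<And>s. s \<in> A \<Longrightarrow> m < s"
      using insert by auto
    have S: "opS F ?S w = F m (opS F A w)"
      using A by (simp add: opS_insert)
    have sgm: "sg m ?S = (1::'k)"
      by (rule sg_min) (use A in force)
    consider "i < m" | "i = m" | "m < i"
      by linarith
    then show ?case
    proof cases
      case 1
      then have "i \<notin> ?S" "\<And>s. s \<in> ?S \<Longrightarrow> i < s"
        using A(5) by fastforce+
      moreover have "sg i ?S = (1::'k)"
        by (rule sg_min) (use calculation in force)
      moreover have "(\<Sum>j\<in>?S. sc (B i j * sg j ?S) (opS F (?S - {j}) w)) = 0"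
        using calculation by (intro sum.neutral) (simp add: tri)
      moreover have "opS F (insert i ?S) w = F i (opS F ?S w)"
        using calculation A(3) by (intro opS_insert) auto
      ultimately show ?thesis
        by (simp only: if_False sc_one add_0_right)
    next
      case 2
      have "(\<Sum>j\<in>A. sc (B m j * sg j ?S) (opS F (?S - {j}) w)) = 0"
        using A by (intro sum.neutral) (simp add: tri)
      moreover have "?S - {m} = A"
        using A by auto
      moreover have "F m (F m (opS F A w)) = sc (B m m) (opS F A w)"
        using A insert.prems by (intro square ordered_closed) auto
      ultimately show ?thesis
        unfolding S 2 by (simp only: sum.insert[OF A(3,4)] sgm mult_1_right insertI1 if_True add_0_left add_0_right)
    next
      case 3
      let ?y = "opS F A w"
      have "F i (F m ?y) + F m (F i ?y) = sc (B i m + B m i) ?y"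
        using A insert.prems by (intro rel ordered_closed) auto
      then have 4: "F i (F m ?y) = sc (B i m) ?y - F m (F i ?y)"
        using 3 by (simp add: tri eq_diff_eq)
      have 5: "F m (if i \<in> A then 0 else sc (sg i A) (opS F (insert i A) w)) =
          - (if i \<in> ?S then 0 else sc (sg i ?S) (opS F (insert i ?S) w))"
      proof (cases "i \<in> A")
        case True
        then show ?thesis
          by (simp add: linop_0[OF lin[OF A(2)]])
      next
        case False
        have "opS F (insert m (insert i A)) w = F m (opS F (insert i A) w)"
          by (rule opS_insert) (use A 3 in auto)
        then show ?thesis
          using False 3 A(4) by (simp add: linop_sc[OF lin[OF A(2)]] insert_commute sg_insert sc_uminus_left)
      qed
      have 6: "F m (sc (B i j * sg j A) (opS F (A - {j}) w)) = - sc (B i j * sg j ?S) (opS F (?S - {j}) w)"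
        if j: "j \<in> A" for j
      proof -
        have "?S - {j} = insert m (A - {j})"
          using j A by auto
        then have "opS F (?S - {j}) w = F m (opS F (A - {j}) w)"
          using opS_insert[of "A - {j}" m F w] A by auto
        moreover have "sg j ?S = (- sg j A :: 'k)"
          using A j by (simp add: sg_insert)
        ultimately show ?thesis
          by (simp add: linop_sc[OF lin[OF A(2)]] sc_uminus_left)
      qed
      have "F m (F i ?y) = F m ((if i \<in> A then 0 else sc (sg i A) (opS F (insert i A) w)) +
          (\<Sum>j\<in>A. sc (B i j * sg j A) (opS F (A - {j}) w)))"
        by (simp only: insert.IH[OF A(1) insert.prems(2,3)])
      also have "\<dots> = - (if i \<in> ?S then 0 else sc (sg i ?S) (opS F (insert i ?S) w)) +
          (\<Sum>j\<in>A. - sc (B i j * sg j ?S) (opS F (?S - {j}) w))"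
        unfolding linop_add[OF lin[OF A(2)]] linop_sum[OF lin[OF A(2)]] 5
        by (intro arg_cong2[where f = "(+)"] refl sum.cong 6)
      finally have "F i (opS F ?S w) = sc (B i m) ?y + (if i \<in> ?S then 0 else sc (sg i ?S) (opS F (insert i ?S) w)) +
          (\<Sum>j\<in>A. sc (B i j * sg j ?S) (opS F (?S - {j}) w))"
        unfolding S 4 sum_negf by (simp only: diff_conv_add_uminus minus_add minus_minus add_ac)
      moreover have "(\<Sum>j\<in>?S. sc (B i j * sg j ?S) (opS F (?S - {j}) w)) =
          sc (B i m) ?y + (\<Sum>j\<in>A. sc (B i j * sg j ?S) (opS F (?S - {j}) w))"
        using A by (simp add: sgm)
      ultimately show ?thesis
        by (simp only: add_ac)
    qed
  qed
qed

end

section \<open>The Clifford operators on the exterior algebra\<close>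

text \<open>Exterior multiplication by \<open>v\<^sub>i\<close> and contraction with the \<open>i\<close>-th dual basis vector. The group element
  in the second component is carried along as a label.\<close>

definition wdg :: "nat \<Rightarrow> (nat set \<times> 'g \<Rightarrow> 'k::field) \<Rightarrow> nat set \<times> 'g \<Rightarrow> 'k" where
  "wdg i a = (\<lambda>(S, g). if i \<in> S then sg i S * a (S - {i}, g) else 0)"

definition ctr :: "nat \<Rightarrow> (nat set \<times> 'g \<Rightarrow> 'k::field) \<Rightarrow> nat set \<times> 'g \<Rightarrow> 'k" where
  "ctr i a = (\<lambda>(S, g). if i \<in> S then 0 else sg i S * a (insert i S, g))"

text \<open>Left multiplication by \<open>v\<^sub>i\<close> in the Clifford algebra, transported to the exterior algebra.\<close>

definition lam :: "nat \<Rightarrow> (nat \<Rightarrow> nat \<Rightarrow> 'k::field) \<Rightarrow> nat \<Rightarrow> (nat set \<times> 'g \<Rightarrow> 'k) \<Rightarrow> nat set \<times> 'g \<Rightarrow> 'k" where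
  "lam n B i a = wdg i a + (\<Sum>j<n. sc (B i j) (ctr j a))"

lemma linop_wdg: "linop (wdg i)" and linop_ctr: "linop (ctr i)"
  by (auto simp: linop_def wdg_def ctr_def fun_eq_iff algebra_simps)

lemma linop_lam: "linop (lam n B i)"
  unfolding lam_def by (intro linop_plus linop_setsum linop_scale linop_wdg linop_ctr)

lemma wdg_wdg: "wdg i (wdg j a) + wdg j (wdg i a) = 0"
proof -
  have "S - {i} - {j} = S - {j} - {i}" for S
    by blast
  then show ?thesis
    by (cases i j rule: linorder_cases) (auto simp: wdg_def fun_eq_iff sg_remove)
qed

lemma ctr_ctr: "ctr i (ctr j a) + ctr j (ctr i a) = 0"
  by (cases i j rule: linorder_cases)
     (auto simp: ctr_def fun_eq_iff sg_insert insert_commute algebra_simps)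

lemma wdg_ctr: "wdg i (ctr j a) + ctr j (wdg i a) = (if i = j then a else 0)"
proof -
  consider "i = j" | "i < j" | "j < i"
    by linarith
  then show ?thesis
  proof cases
    case 1
    have "insert j S - {j} = S" if "j \<notin> S" for S :: "nat set"
      using that by auto
    then show ?thesis
      by (auto simp: wdg_def ctr_def fun_eq_iff sg_remove sg_insert insert_absorb 1)
  qed (auto simp: wdg_def ctr_def fun_eq_iff sg_remove sg_insert insert_Diff_if)
qed

lemma lam_rel:
  assumes "i < n" "j < n"
  shows "lam n B i (lam n B j a) + lam n B j (lam n B i a) = sc (B i j + B j i) a"
proof -
  let ?K = "\<lambda>i a. \<Sum>l<n. sc (B i l) (ctr l a)"
  have WK: "wdg i (?K j a) + ?K j (wdg i a) = sc (B j i) a" if "i < n" for i j a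
  proof -
    have "wdg i (?K j a) + ?K j (wdg i a) = (\<Sum>l<n. sc (B j l) (wdg i (ctr l a) + ctr l (wdg i a)))"
      by (simp add: linop_sum[OF linop_wdg] linop_sc[OF linop_wdg] sc_add sum.distrib del: sc_ap)
    also have "\<dots> = (\<Sum>l<n. if l = i then sc (B j i) a else 0)"
      by (intro sum.cong refl) (simp add: wdg_ctr)
    finally show ?thesis
      using that by simp
  qed
  have KK: "?K i (?K j a) + ?K j (?K i a) = 0"
  proof -
    have "?K i (?K j a) = (\<Sum>l<n. \<Sum>m<n. sc (B i l * B j m) (ctr l (ctr m a)))" for i j
      by (simp add: linop_sum[OF linop_ctr] linop_sc[OF linop_ctr] sc_sum del: sc_ap)
    moreover have "(\<Sum>l<n. \<Sum>m<n. sc (B i l * B j m) (ctr l (ctr m a))) + (\<Sum>l<n. \<Sum>m<n. sc (B j l * B i m) (ctr l (ctr m a))) = 0"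
    proof -
      have "(\<Sum>l<n. \<Sum>m<n. sc (B j l * B i m) (ctr l (ctr m a))) = (\<Sum>l<n. \<Sum>m<n. sc (B i l * B j m) (ctr m (ctr l a)))"
        by (subst sum.swap) (simp add: mult.commute)
      then have "(\<Sum>l<n. \<Sum>m<n. sc (B i l * B j m) (ctr l (ctr m a))) + (\<Sum>l<n. \<Sum>m<n. sc (B j l * B i m) (ctr l (ctr m a))) =
         (\<Sum>l<n. \<Sum>m<n. sc (B i l * B j m) (ctr l (ctr m a) + ctr m (ctr l a)))"
        by (simp only: sc_add sum.distrib)
      then show ?thesis
        by (simp add: ctr_ctr)
    qed
    ultimately show ?thesis
      by simp
  qed
  have "linop (?K i)" for i
    by (intro linop_setsum linop_scale linop_ctr)
  note Kadd = linop_add[OF this]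
  have "lam n B i (lam n B j a) + lam n B j (lam n B i a) =
     (wdg i (wdg j a) + wdg j (wdg i a)) + (wdg i (?K j a) + ?K j (wdg i a)) +
     (wdg j (?K i a) + ?K i (wdg j a)) + (?K i (?K j a) + ?K j (?K i a))"
    unfolding lam_def Kadd linop_add[OF linop_wdg] by (simp only: add_ac)
  also have "\<dots> = sc (B j i) a + sc (B i j) a"
    unfolding wdg_wdg WK[OF assms(1)] WK[OF assms(2)] KK by simp
  finally show ?thesis
    by (simp add: sc_add_left add.commute)
qed

lemma wdg_bvec: "wdg i (bvec (S, g)) = (if i \<in> S then 0 else sc (sg i S) (bvec (insert i S, g)))"
proof -
  have "i \<in> T \<and> T - {i} = S \<longleftrightarrow> i \<notin> S \<and> T = insert i S" for T
    by auto
  then show ?thesis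
    by (auto simp: wdg_def bvec_def fun_eq_iff sg_insert)
qed

lemma ctr_bvec: "ctr i (bvec (S, g)) = (if i \<in> S then sc (sg i S) (bvec (S - {i}, g)) else 0)"
proof -
  have "i \<notin> T \<and> insert i T = S \<longleftrightarrow> i \<in> S \<and> T = S - {i}" for T
    by auto
  then show ?thesis
    by (auto simp: ctr_def bvec_def fun_eq_iff sg_remove)
qed

lemma lam_bvec:
  assumes "S \<subseteq> {..<n}"
  shows "lam n B i (bvec (S, g)) = (if i \<in> S then 0 else sc (sg i S) (bvec (insert i S, g))) +
    (\<Sum>j\<in>S. sc (B i j * sg j S) (bvec (S - {j}, g)))"
proof -
  have "(\<Sum>j<n. sc (B i j) (ctr j (bvec (S, g)))) = (\<Sum>j\<in>S. sc (B i j * sg j S) (bvec (S - {j}, g)))"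
    by (rule sum.mono_neutral_cong_right) (use assms in \<open>auto simp: ctr_bvec\<close>)
  then show ?thesis
    by (simp add: lam_def wdg_bvec)
qed

lemma lam_bvec_min:
  assumes "S \<subseteq> {..<n}" "\<And>s. s \<in> S \<Longrightarrow> i < s" "\<And>i j. i < j \<Longrightarrow> B i j = 0"
  shows "lam n B i (bvec (S, g)) = bvec (insert i S, g)"
proof -
  have "i \<notin> S"
    using assms(2) by blast
  moreover have "sg i S = (1::'a)"
    by (rule sg_min) (use assms(2) in force)
  moreover have "(\<Sum>j\<in>S. sc (B i j * sg j S) (bvec (S - {j}, g))) = 0"
    by (rule sum.neutral) (use assms in simp)
  ultimately show ?thesis
    using assms(1) by (simp add: lam_bvec)
qed

text \<open>This is where triangularity of \<open>B\<close> enters: ordered products in the Clifford algebra are the usual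
  basis vectors of the exterior algebra.\<close>

lemma opS_lam_bvec:
  assumes "S \<subseteq> {..<n}" "\<And>i j. i < j \<Longrightarrow> B i j = 0"
  shows "opS (lam n B) S (bvec ({}, g)) = bvec (S, g)"
proof -
  have "finite S"
    using assms(1) finite_subset by blast
  then show ?thesis
    using assms(1)
    by (induction S rule: finite_linorder_min_induct) (simp_all add: opS_insert lam_bvec_min assms(2))
qed

text \<open>The linear map that sends \<open>v\<^sub>S g\<close> to the ordered monomial \<open>F\<^sub>S\<close> applied to \<open>w g\<close>.\<close>

definition lift :: "(nat set \<times> 'g) set \<Rightarrow> (nat \<Rightarrow> ('b \<Rightarrow> 'k::field) \<Rightarrow> 'b \<Rightarrow> 'k) \<Rightarrow> ('g \<Rightarrow> 'b \<Rightarrow> 'k)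
    \<Rightarrow> (nat set \<times> 'g \<Rightarrow> 'k) \<Rightarrow> 'b \<Rightarrow> 'k" where
  "lift I F w a = (\<Sum>x\<in>I. sc (a x) (opS F (fst x) (w (snd x))))"

lemma linop_lift: "linop (lift I F w)"
  unfolding lift_def by (intro linop_setsum linop_coeff)

lemma lift_bvec: "finite I \<Longrightarrow> (S, g) \<in> I \<Longrightarrow> lift I F w (bvec (S, g)) = opS F S (w g)"
proof -
  assume *: "finite I" "(S, g) \<in> I"
  have "lift I F w (bvec (S, g)) = (\<Sum>x\<in>I. if x = (S, g) then opS F S (w g) else 0)"
    unfolding lift_def by (intro sum.cong refl) (auto simp: bvec_def)
  then show ?thesis
    using * by simp
qed

lemma vecsD: "a \<in> vecs I \<Longrightarrow> x \<notin> I \<Longrightarrow> a x = 0"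
  by (simp add: vecs_def)

lemma vecsI: "(\<And>x. x \<notin> I \<Longrightarrow> a x = 0) \<Longrightarrow> a \<in> vecs I"
  by (simp add: vecs_def)

lemma lam_vecs:
  assumes "i < n" "a \<in> vecs (Pow {..<n} \<times> A)" 
  shows "lam n B i a \<in> vecs (Pow {..<n} \<times> A)"
proof -
  have "wdg i a (S, g) = 0" if "(S, g) \<notin> Pow {..<n} \<times> A" for S g
  proof (cases "i \<in> S")
    case True
    then have "(S - {i}, g) \<notin> Pow {..<n} \<times> A"
      using that assms(1) by auto
    then have "a (S - {i}, g) = 0"
      by (rule vecsD[OF assms(2)])
    then show ?thesis
      by (simp add: wdg_def)
  qed (simp add: wdg_def)
  then have "wdg i a \<in> vecs (Pow {..<n} \<times> A)"
    by (intro vecsI) (metis surj_pair)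
  moreover have "ctr j a \<in> vecs (Pow {..<n} \<times> A)" for j
    using assms by (auto simp: vecs_def ctr_def)
  ultimately show ?thesis
    unfolding lam_def by (intro vecs_add vecs_sum vecs_sc)
qed

text \<open>The universal property of the Clifford algebra: by \<open>mult_ordered\<close>, multiplication by \<open>v\<^sub>i\<close> has the
  same coefficients with respect to the ordered monomials in \<open>F\<close> as with respect to the basis \<open>v\<^sub>S\<close>.\<close>

lemma (in clifford_ops) lift_lam:
  assumes "finite A" "\<And>g. g \<in> A \<Longrightarrow> w g \<in> W" "i < n" "a \<in> vecs (Pow {..<n} \<times> A)"
  shows "lift (Pow {..<n} \<times> A) F w (lam n B i a) = F i (lift (Pow {..<n} \<times> A) F w a)"
proof (rule linop_eqI[OF _ assms(4) linop_comp[OF linop_lift linop_lam] linop_comp[OF lin[OF assms(3)] linop_lift]])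
  show fin: "finite (Pow {..<n} \<times> A)"
    using assms(1) by simp
  fix x assume "x \<in> Pow {..<n} \<times> A"
  then obtain S g where [simp]: "x = (S, g)" and S: "S \<subseteq> {..<n}" and g: "g \<in> A"
    by auto
  have b: "lift (Pow {..<n} \<times> A) F w (bvec (T, g)) = opS F T (w g)" if "T \<subseteq> {..<n}" for T
    using that g by (intro lift_bvec[OF fin]) auto
  let ?L = "lift (Pow {..<n} \<times> A) F w"
  have "?L (if i \<in> S then 0 else sc (sg i S) (bvec (insert i S, g))) =
      (if i \<in> S then 0 else sc (sg i S) (opS F (insert i S) (w g)))"
    using S assms(3) b[of "insert i S"] by (simp add: linop_0[OF linop_lift] linop_sc[OF linop_lift])
  moreover have "?L (\<Sum>j\<in>S. sc (B i j * sg j S) (bvec (S - {j}, g))) =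
      (\<Sum>j\<in>S. sc (B i j * sg j S) (opS F (S - {j}) (w g)))"
    unfolding linop_sum[OF linop_lift] linop_sc[OF linop_lift]
    by (rule sum.cong[OF refl], subst b) (use S in auto)
  ultimately have "?L (lam n B i (bvec (S, g))) =
      (if i \<in> S then 0 else sc (sg i S) (opS F (insert i S) (w g))) +
      (\<Sum>j\<in>S. sc (B i j * sg j S) (opS F (S - {j}) (w g)))"
    unfolding lam_bvec[OF S] linop_add[OF linop_lift] by simp
  also have "\<dots> = F i (opS F S (w g))"
    using mult_ordered[OF S assms(3), of "w g"] assms(2) g by simp
  finally show "lift (Pow {..<n} \<times> A) F w (lam n B i (bvec x)) = F i (lift (Pow {..<n} \<times> A) F w (bvec x))"
    using S by (simp add: b)
qed

section \<open>Clifford algebras with a group action\<close>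

text \<open>The data of the theorem in coordinates: column \<open>i\<close> of \<open>\<rho> g\<close> holds the coordinates of \<open>g.v\<^sub>i\<close>.\<close>

locale supergroup = group G
  for G :: "('g, 'm) monoid_scheme" (structure) +
  fixes u :: 'g and n :: nat and \<rho> :: "'g \<Rightarrow> 'k::field mat"
  assumes finite_G: "finite (carrier G)"
    and u_in: "u \<in> carrier G"
    and u_central: "g \<in> carrier G \<Longrightarrow> u \<otimes> g = g \<otimes> u"
    and u_square: "u \<otimes> u = \<one>"
    and rho_carrier: "g \<in> carrier G \<Longrightarrow> \<rho> g \<in> carrier_mat n n"
    and rho_mult: "g \<in> carrier G \<Longrightarrow> h \<in> carrier G \<Longrightarrow> \<rho> (g \<otimes> h) = \<rho> g * \<rho> h"
    and rho_one: "\<rho> \<one> = 1\<^sub>m n"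
    and rho_u: "\<rho> u = - 1\<^sub>m n"
    and two: "(2::'k) \<noteq> 0"
    and n_pos: "0 < n"
begin

abbreviation "I \<equiv> Pow {..<n} \<times> carrier G"

lemma finI: "finite I"
  using finite_G by simp

text \<open>The operator that belongs to the vector \<open>g.v\<^sub>i\<close> if \<open>F l\<close> belongs to \<open>v\<^sub>l\<close>.\<close>

definition comb :: "(nat \<Rightarrow> ('b \<Rightarrow> 'k) \<Rightarrow> 'b \<Rightarrow> 'k) \<Rightarrow> 'g \<Rightarrow> nat \<Rightarrow> ('b \<Rightarrow> 'k) \<Rightarrow> 'b \<Rightarrow> 'k" where
  "comb F g i w = (\<Sum>l<n. sc (\<rho> g $$ (l, i)) (F l w))"

text \<open>Lower triangular matrices whose symmetrisation is \<open>G\<close>-invariant.\<close>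

definition good :: "(nat \<Rightarrow> nat \<Rightarrow> 'k) \<Rightarrow> bool" where
  "good B \<longleftrightarrow> (\<forall>i j. i < j \<longrightarrow> B i j = 0) \<and>
     (\<forall>g\<in>carrier G. \<forall>i<n. \<forall>j<n. (\<Sum>l<n. \<Sum>m<n. \<rho> g $$ (l, i) * \<rho> g $$ (m, j) * (B l m + B m l)) = B i j + B j i)"

lemma good_zero: "good (\<lambda>_ _. 0)"
  by (simp add: good_def)

lemma rho_mult_entry:
  assumes "g \<in> carrier G" "h \<in> carrier G" "l < n" "i < n"
  shows "\<rho> (g \<otimes> h) $$ (l, i) = (\<Sum>m<n. \<rho> g $$ (l, m) * \<rho> h $$ (m, i))"
  using rho_carrier[OF assms(1)] rho_carrier[OF assms(2)] assms
  by (simp add: rho_mult scalar_prod_def atLeast0LessThan)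

lemma linop_comb: "(\<And>i. i < n \<Longrightarrow> linop (F i)) \<Longrightarrow> linop (comb F g i)"
  unfolding comb_def by (intro linop_setsum linop_scale) simp

lemma comb_vecs: "(\<And>i. i < n \<Longrightarrow> F i w \<in> vecs J) \<Longrightarrow> comb F g i w \<in> vecs J"
  unfolding comb_def by (intro vecs_sum vecs_sc) simp

lemma comb_one: "i < n \<Longrightarrow> comb F \<one> i w = F i w"
proof -
  assume i: "i < n"
  have "comb F \<one> i w = (\<Sum>l<n. if l = i then F i w else 0)"
    unfolding comb_def rho_one by (intro sum.cong refl) (use i in auto)
  then show ?thesis
    using i by simp
qed

lemma comb_u: "i < n \<Longrightarrow> comb F u i w = - F i w"
proof -
  assume i: "i < n"
  have "comb F u i w = (\<Sum>l<n. if l = i then - F i w else 0)"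
    unfolding comb_def rho_u by (intro sum.cong refl) (use i in \<open>auto simp: sc_uminus_left\<close>)
  then show ?thesis
    using i by simp
qed

lemma comb_intertwine:
  assumes "linop f" "g \<in> carrier G" "h \<in> carrier G" "i < n"
    and "\<And>l. l < n \<Longrightarrow> f (F l w) = comb F' g l w'"
  shows "f (comb F h i w) = comb F' (g \<otimes> h) i w'"
proof -
  have "f (comb F h i w) = (\<Sum>l<n. \<Sum>m<n. sc (\<rho> g $$ (m, l) * \<rho> h $$ (l, i)) (F' m w'))"
    unfolding comb_def linop_sum[OF assms(1)] linop_sc[OF assms(1)]
    by (intro sum.cong refl) (use assms(5) in \<open>simp add: comb_def sc_sum mult.commute\<close>)
  also have "\<dots> = (\<Sum>m<n. sc (\<Sum>l<n. \<rho> g $$ (m, l) * \<rho> h $$ (l, i)) (F' m w'))"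
    by (subst sum.swap) (simp only: sc_sum_left)
  also have "\<dots> = comb F' (g \<otimes> h) i w'"
    unfolding comb_def by (intro sum.cong refl) (use assms in \<open>simp add: rho_mult_entry\<close>)
  finally show ?thesis .
qed

text \<open>The anticommutator is bilinear in the two vectors.\<close>

lemma comb_anticommutator:
  fixes F :: "nat \<Rightarrow> ('b \<Rightarrow> 'k) \<Rightarrow> 'b \<Rightarrow> 'k"
  assumes lin: "\<And>l. l < n \<Longrightarrow> linop (F l)"
    and rel: "\<And>l m. l < n \<Longrightarrow> m < n \<Longrightarrow> F l (F m w) + F m (F l w) = sc (q l m) w"
  shows "comb F g i (comb F g j w) + comb F g j (comb F g i w) =
    sc (\<Sum>l<n. \<Sum>m<n. \<rho> g $$ (l, i) * \<rho> g $$ (m, j) * q l m) w"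
proof -
  have *: "comb F g i (comb F g j w) = (\<Sum>l<n. \<Sum>m<n. sc (\<rho> g $$ (l, i) * \<rho> g $$ (m, j)) (F l (F m w)))" for i j
    unfolding comb_def
    by (intro sum.cong refl) (simp only: linop_sum[OF lin] linop_sc[OF lin] sc_sum sc_sc lessThan_iff)
  have "comb F g j (comb F g i w) = (\<Sum>l<n. \<Sum>m<n. sc (\<rho> g $$ (l, i) * \<rho> g $$ (m, j)) (F m (F l w)))"
    unfolding * by (subst sum.swap) (simp only: mult.commute)
  then have "comb F g i (comb F g j w) + comb F g j (comb F g i w) =
      (\<Sum>l<n. \<Sum>m<n. sc (\<rho> g $$ (l, i) * \<rho> g $$ (m, j)) (F l (F m w) + F m (F l w)))"
    unfolding * by (simp only: sum.distrib sc_add)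
  also have "\<dots> = (\<Sum>l<n. \<Sum>m<n. sc (\<rho> g $$ (l, i) * \<rho> g $$ (m, j) * q l m) w)"
    by (intro sum.cong refl) (simp only: rel lessThan_iff sc_sc)
  finally show ?thesis
    by (simp only: sc_sum_left)
qed

lemma comb_ops:
  fixes F :: "nat \<Rightarrow> ('b \<Rightarrow> 'k) \<Rightarrow> 'b \<Rightarrow> 'k"
  assumes "clifford_ops n B F (vecs J)" "good B" "g \<in> carrier G"
  shows "clifford_ops n B (comb F g) (vecs J)"
proof -
  interpret clifford_ops n B F "vecs J" by fact
  show ?thesis
  proof
    fix i j and w :: "'b \<Rightarrow> 'k" assume ij: "i < n" "j < n" and w: "w \<in> vecs J"
    have "comb F g i (comb F g j w) + comb F g j (comb F g i w) =
        sc (\<Sum>l<n. \<Sum>m<n. \<rho> g $$ (l, i) * \<rho> g $$ (m, j) * (B l m + B m l)) w"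
      by (rule comb_anticommutator) (simp_all only: lin rel w)
    then show "comb F g i (comb F g j w) + comb F g j (comb F g i w) = sc (B i j + B j i) w"
      using assms(2,3) ij by (simp add: good_def)
  qed (use lin closed tri two in \<open>auto intro: linop_comb comb_vecs\<close>)
qed

lemma lam_ops: "good B \<Longrightarrow> clifford_ops n B (lam n B) (vecs I)"
  by unfold_locales (use lam_rel in \<open>auto simp: good_def two intro: linop_lam lam_vecs\<close>)

subsection \<open>The action of the group on the Clifford algebra\<close>

text \<open>Left multiplication by \<open>g\<close> in the smash product. A triangular \<open>B\<close> is rarely invariant, so this is in general not the
  usual action on the exterior algebra: \<open>g\<close> maps \<open>v\<^sub>S h\<close> to the ordered Clifford product of the \<open>g.v\<^sub>i\<close>, \<open>i \<in> S\<close>,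
  times \<open>gh\<close>.\<close>

definition gam :: "(nat \<Rightarrow> nat \<Rightarrow> 'k) \<Rightarrow> 'g \<Rightarrow> (nat set \<times> 'g \<Rightarrow> 'k) \<Rightarrow> nat set \<times> 'g \<Rightarrow> 'k" where
  "gam B g = lift I (comb (lam n B) g) (\<lambda>h. bvec ({}, g \<otimes> h))"

lemma linop_gam: "linop (gam B g)"
  unfolding gam_def by (rule linop_lift)

lemma gam_bvec: "S \<subseteq> {..<n} \<Longrightarrow> h \<in> carrier G \<Longrightarrow>
    gam B g (bvec (S, h)) = opS (comb (lam n B) g) S (bvec ({}, g \<otimes> h))"
  unfolding gam_def by (rule lift_bvec[OF finI]) simp

lemma gam_bvec_empty: "h \<in> carrier G \<Longrightarrow> gam B g (bvec ({}, h)) = bvec ({}, g \<otimes> h)"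
  by (simp add: gam_bvec)

lemma bvec_empty_vecs: "g \<in> carrier G \<Longrightarrow> bvec ({}, g) \<in> vecs I"
  by (rule vecs_bvec) simp

lemma gam_lam:
  assumes "good B" "g \<in> carrier G" "i < n" "a \<in> vecs I"
  shows "gam B g (lam n B i a) = comb (lam n B) g i (gam B g a)"
proof -
  interpret clifford_ops n B "comb (lam n B) g" "vecs I"
    using comb_ops lam_ops assms by blast
  show ?thesis
    unfolding gam_def by (rule lift_lam[OF finite_G _ assms(3,4)]) (use assms(2) in \<open>simp add: bvec_empty_vecs\<close>)
qed

lemma gam_vecs:
  assumes "good B" "g \<in> carrier G" "a \<in> vecs I"
  shows "gam B g a \<in> vecs I"
proof (rule linop_vecs[OF finI assms(3) linop_gam])
  interpret clifford_ops n B "comb (lam n B) g" "vecs I"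
    using comb_ops lam_ops assms by blast
  fix x assume "x \<in> I"
  then obtain S h where "x = (S, h)" "S \<subseteq> {..<n}" "h \<in> carrier G"
    by auto
  then show "gam B g (bvec x) \<in> vecs I"
    using assms(2) by (simp add: gam_bvec ordered_closed bvec_empty_vecs)
qed

lemma gam_gam:
  assumes "good B" "g \<in> carrier G" "h \<in> carrier G" "a \<in> vecs I"
  shows "gam B g (gam B h a) = gam B (g \<otimes> h) a"
proof (rule linop_eqI[OF finI assms(4) linop_comp[OF linop_gam linop_gam] linop_gam])
  fix x assume "x \<in> I"
  then obtain S k where [simp]: "x = (S, k)" and S: "S \<subseteq> {..<n}" "k \<in> carrier G"
    by auto
  interpret clifford_ops n B "comb (lam n B) h" "vecs I"
    using comb_ops lam_ops assms by blast
  have "gam B g (gam B h (bvec (S, k))) = gam B g (opS (comb (lam n B) h) S (bvec ({}, h \<otimes> k)))"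
    using S by (simp add: gam_bvec)
  also have "\<dots> = opS (comb (lam n B) (g \<otimes> h)) S (gam B g (bvec ({}, h \<otimes> k)))"
  proof (rule opS_intertwine[where W = "vecs I"])
    show "finite S"
      using S(1) finite_subset by blast
    show "bvec ({}, h \<otimes> k) \<in> vecs I"
      using assms S by (simp add: bvec_empty_vecs)
    fix i and w :: "nat set \<times> 'g \<Rightarrow> 'k" assume "i \<in> S" and w: "w \<in> vecs I"
    then have i: "i < n"
      using S(1) by auto
    show "comb (lam n B) h i w \<in> vecs I"
      using i w by (rule closed)
    show "gam B g (comb (lam n B) h i w) = comb (lam n B) (g \<otimes> h) i (gam B g w)"
      by (rule comb_intertwine[OF linop_gam assms(2,3) i]) (simp add: gam_lam assms w)
  qed
  also have "\<dots> = gam B (g \<otimes> h) (bvec (S, k))"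
    using assms S by (simp add: gam_bvec gam_bvec_empty m_assoc)
  finally show "gam B g (gam B h (bvec x)) = gam B (g \<otimes> h) (bvec x)"
    by simp
qed

lemma good_tri: "good B \<Longrightarrow> i < j \<Longrightarrow> B i j = 0"
  by (simp add: good_def)

lemma gam_one:
  assumes "good B" "a \<in> vecs I"
  shows "gam B \<one> a = a"
proof (rule linop_eqI[OF finI assms(2) linop_gam linop_id])
  fix x assume "x \<in> I"
  then obtain S k where [simp]: "x = (S, k)" and S: "S \<subseteq> {..<n}" "k \<in> carrier G"
    by auto
  have "finite S"
    using S(1) finite_subset by blast
  then have "opS (comb (lam n B) \<one>) S (bvec ({}, k)) = opS (lam n B) S (bvec ({}, k))"
    by (rule opS_cong[where W = "vecs I"])
       (use S in \<open>auto simp: comb_one bvec_empty_vecs lam_vecs intro!: comb_vecs\<close>)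
  then show "gam B \<one> (bvec x) = bvec x"
    using S opS_lam_bvec[of S n B k] good_tri[OF assms(1)] by (simp add: gam_bvec)
qed

lemma gam_u_lam:
  assumes "good B" "i < n" "a \<in> vecs I"
  shows "gam B u (lam n B i a) = - lam n B i (gam B u a)"
  using assms by (simp add: gam_lam u_in comb_u)

lemma gam_u_u: "good B \<Longrightarrow> a \<in> vecs I \<Longrightarrow> gam B u (gam B u a) = a"
  by (simp add: gam_gam u_in u_square gam_one)

lemma gam_u_comm: "good B \<Longrightarrow> g \<in> carrier G \<Longrightarrow> a \<in> vecs I \<Longrightarrow> gam B u (gam B g a) = gam B g (gam B u a)"
  by (simp add: gam_gam u_in u_central)

subsection \<open>The product\<close>

text \<open>The product of the Clifford smash product: \<open>v\<^sub>S g\<close> acts by \<open>gam\<close> followed by the ordered product of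
  the operators \<open>lam\<close>.\<close>

definition mulB :: "(nat \<Rightarrow> nat \<Rightarrow> 'k) \<Rightarrow> (nat set \<times> 'g \<Rightarrow> 'k) \<Rightarrow> (nat set \<times> 'g \<Rightarrow> 'k) \<Rightarrow> nat set \<times> 'g \<Rightarrow> 'k" where
  "mulB B a b = lift I (lam n B) (\<lambda>g. gam B g b) a"

lemma mulB_bvec: "S \<subseteq> {..<n} \<Longrightarrow> g \<in> carrier G \<Longrightarrow> mulB B (bvec (S, g)) b = opS (lam n B) S (gam B g b)"
  unfolding mulB_def by (rule lift_bvec[OF finI]) simp

lemma linop_mulB_left: "linop (\<lambda>a. mulB B a b)"
  unfolding mulB_def by (rule linop_lift)

lemma linop_mulB_right: "linop (mulB B a)"
proof -
  have "linop (\<lambda>b. lift I (lam n B) (\<lambda>g. gam B g b) a)"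
    unfolding lift_def
  proof (intro linop_setsum linop_scale)
    fix x assume "x \<in> I"
    then have "fst x \<subseteq> {..<n}"
      by auto
    then have "finite (fst x)"
      by (rule finite_subset) simp
    then show "linop (\<lambda>b. opS (lam n B) (fst x) (gam B (snd x) b))"
      by (intro linop_comp[OF linop_opS linop_gam] linop_lam)
  qed
  then show ?thesis
    by (simp add: mulB_def[abs_def])
qed

lemma mulB_vecs:
  assumes "good B" "a \<in> vecs I" "b \<in> vecs I"
  shows "mulB B a b \<in> vecs I"
proof (rule linop_vecs[OF finI assms(2) linop_mulB_left])
  interpret clifford_ops n B "lam n B" "vecs I"
    by (rule lam_ops) fact
  fix x assume "x \<in> I"
  then obtain S g where "x = (S, g)" "S \<subseteq> {..<n}" "g \<in> carrier G"
    by auto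
  then show "mulB B (bvec x) b \<in> vecs I"
    using assms by (simp add: mulB_bvec ordered_closed gam_vecs)
qed

end

text \<open>Operators \<open>F\<close> and \<open>E\<close> that satisfy the relations of the Clifford smash product,
  together with a family \<open>w\<close> of vectors on which the group part acts as on the group algebra.\<close>

locale clifford_rep = supergroup G u n \<rho> + clifford_ops n B F "vecs J"
  for G :: "('g, 'm) monoid_scheme" (structure) and u n and \<rho> :: "'g \<Rightarrow> 'k::field mat"
    and B and F :: "nat \<Rightarrow> ('b \<Rightarrow> 'k) \<Rightarrow> 'b \<Rightarrow> 'k" and J +
  fixes E :: "'g \<Rightarrow> ('b \<Rightarrow> 'k) \<Rightarrow> 'b \<Rightarrow> 'k" and w :: "'g \<Rightarrow> 'b \<Rightarrow> 'k"
  assumes good: "good B"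
    and linE: "g \<in> carrier G \<Longrightarrow> linop (E g)"
    and EF: "g \<in> carrier G \<Longrightarrow> i < n \<Longrightarrow> v \<in> vecs J \<Longrightarrow> E g (F i v) = comb F g i (E g v)"
    and w_vecs: "g \<in> carrier G \<Longrightarrow> w g \<in> vecs J"
    and Ew: "g \<in> carrier G \<Longrightarrow> h \<in> carrier G \<Longrightarrow> E g (w h) = w (g \<otimes> h)"
begin

abbreviation "L \<equiv> lift I F w"

lemma L_lam: "i < n \<Longrightarrow> a \<in> vecs I \<Longrightarrow> L (lam n B i a) = F i (L a)"
  by (rule lift_lam[OF finite_G]) (simp_all add: w_vecs)

text \<open>Both sides send \<open>v\<^sub>S h\<close> to the ordered product of the operators of \<open>g.v\<^sub>i\<close>, \<open>i \<in> S\<close>, applied to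
  \<open>w (gh)\<close>.\<close>

lemma L_gam:
  assumes "g \<in> carrier G" "a \<in> vecs I"
  shows "L (gam B g a) = E g (L a)"
proof (rule linop_eqI[OF finI assms(2) linop_comp[OF linop_lift linop_gam] linop_comp[OF linE[OF assms(1)] linop_lift]])
  fix x assume "x \<in> I"
  then obtain S h where [simp]: "x = (S, h)" and S: "S \<subseteq> {..<n}" and h: "h \<in> carrier G"
    by auto
  have fin: "finite S"
    using S finite_subset by blast
  interpret c: clifford_ops n B "comb (lam n B) g" "vecs I"
    using comb_ops lam_ops good assms(1) by blast
  have "L (gam B g (bvec (S, h))) = L (opS (comb (lam n B) g) S (bvec ({}, g \<otimes> h)))"
    using S h by (simp add: gam_bvec)
  also have "\<dots> = opS (comb F g) S (L (bvec ({}, g \<otimes> h)))"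
  proof (rule opS_intertwine[OF fin, where W = "vecs I"])
    show "bvec ({}, g \<otimes> h) \<in> vecs I"
      using assms h by (simp add: bvec_empty_vecs)
    fix i and v :: "nat set \<times> 'g \<Rightarrow> 'k" assume "i \<in> S" and v: "v \<in> vecs I"
    then have i: "i < n"
      using S by auto
    show "comb (lam n B) g i v \<in> vecs I"
      using i v by (rule c.closed)
    show "L (comb (lam n B) g i v) = comb F g i (L v)"
      unfolding comb_def linop_sum[OF linop_lift] linop_sc[OF linop_lift]
      by (intro sum.cong refl) (simp add: L_lam v)
  qed
  also have "L (bvec ({}, g \<otimes> h)) = w (g \<otimes> h)"
    using assms h by (simp add: lift_bvec[OF finI])
  also have "\<dots> = E g (w h)"
    using assms h by (simp add: Ew)
  also have "opS (comb F g) S (E g (w h)) = E g (opS F S (w h))"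
    by (rule opS_intertwine[OF fin, where W = "vecs J", symmetric])
       (use S h w_vecs closed EF assms(1) in auto)
  also have "\<dots> = E g (L (bvec x))"
    using S h by (simp add: lift_bvec[OF finI])
  finally show "L (gam B g (bvec x)) = E g (L (bvec x))"
    by simp
qed

lemma L_opS_lam: "S \<subseteq> {..<n} \<Longrightarrow> a \<in> vecs I \<Longrightarrow> L (opS (lam n B) S a) = opS F S (L a)"
  by (rule opS_intertwine[where W = "vecs I"]) (auto simp: L_lam lam_vecs intro: finite_subset)

lemma L_mulB:
  assumes "S \<subseteq> {..<n}" "g \<in> carrier G" "b \<in> vecs I"
  shows "L (mulB B (bvec (S, g)) b) = opS F S (E g (L b))"
  using assms by (simp add: mulB_bvec L_opS_lam gam_vecs good L_gam)

end

context supergroup begin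

lemma lam_rep:
  assumes "good B" "c \<in> vecs I"
  shows "clifford_rep G u n \<rho> B (lam n B) I (gam B) (\<lambda>g. gam B g c)"
proof -
  interpret clifford_ops n B "lam n B" "vecs I"
    by (rule lam_ops) fact
  show ?thesis
    by unfold_locales (use assms in \<open>auto simp: linop_gam gam_lam gam_vecs gam_gam\<close>)
qed

text \<open>The left regular representation is itself a \<open>clifford_rep\<close> with \<open>w g = g \<bullet> c\<close>; its \<open>lift\<close> is right
  multiplication by \<open>c\<close>, and \<open>L_mulB\<close> becomes associativity.\<close>

lemma mulB_assoc:
  assumes "good B" "a \<in> vecs I" "b \<in> vecs I" "c \<in> vecs I"
  shows "mulB B (mulB B a b) c = mulB B a (mulB B b c)"
proof (rule linop_eqI[OF finI assms(2) linop_comp[OF linop_mulB_left linop_mulB_left] linop_mulB_left])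
  interpret clifford_rep G u n \<rho> B "lam n B" I "gam B" "\<lambda>g. gam B g c"
    by (rule lam_rep) fact+
  fix x assume "x \<in> I"
  then obtain S g where "x = (S, g)" "S \<subseteq> {..<n}" "g \<in> carrier G"
    by auto
  then show "mulB B (mulB B (bvec x) b) c = mulB B (bvec x) (mulB B b c)"
    using L_mulB[of S g b] assms by (simp add: mulB_bvec[of S g B "mulB B b c"] flip: mulB_def)
qed

lemma mulB_one_left: "good B \<Longrightarrow> b \<in> vecs I \<Longrightarrow> mulB B (bvec ({}, \<one>)) b = b"
  by (simp add: mulB_bvec gam_one)

lemma mulB_one_right:
  assumes "good B" "a \<in> vecs I"
  shows "mulB B a (bvec ({}, \<one>)) = a"
proof (rule linop_eqI[OF finI assms(2) linop_mulB_left linop_id])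
  fix x assume "x \<in> I"
  then obtain S g where "x = (S, g)" "S \<subseteq> {..<n}" "g \<in> carrier G"
    by auto
  then show "mulB B (bvec x) (bvec ({}, \<one>)) = bvec x"
    using opS_lam_bvec[of S n B g] good_tri[OF assms(1)] by (simp add: mulB_bvec gam_bvec)
qed

end

section \<open>The coproduct\<close>

text \<open>The sign with which \<open>v\<^sub>P v\<^sub>Q\<close> equals \<open>v\<^bsub>P \<union> Q\<^esub>\<close> in the exterior algebra.\<close>

definition esign :: "nat set \<Rightarrow> nat set \<Rightarrow> 'k::field" where
  "esign P Q = (- 1) ^ card {(s, t). s \<in> P \<and> t \<in> Q \<and> t < s}"

lemma finite_inversions: "finite P \<Longrightarrow> finite {(s :: nat, t). s \<in> P \<and> t \<in> Q \<and> t < s}"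
proof -
  assume P: "finite P"
  have "{(s, t). s \<in> P \<and> t \<in> Q \<and> t < s} \<subseteq> Sigma P (\<lambda>s. {..<s})"
    by auto
  moreover have "finite (Sigma P (\<lambda>s. {..<s}))"
    using P by (intro finite_SigmaI) simp_all
  ultimately show ?thesis
    by (rule finite_subset)
qed

lemma esign_Un_left: "finite P \<Longrightarrow> finite P' \<Longrightarrow> P \<inter> P' = {} \<Longrightarrow> esign (P \<union> P') Q = esign P Q * esign P' Q"
proof -
  assume *: "finite P" "finite P'" "P \<inter> P' = {}"
  have "{(s, t). s \<in> P \<union> P' \<and> t \<in> Q \<and> t < s} =
      {(s, t). s \<in> P \<and> t \<in> Q \<and> t < s} \<union> {(s, t). s \<in> P' \<and> t \<in> Q \<and> t < s}"
    by auto
  moreover have "card ({(s, t). s \<in> P \<and> t \<in> Q \<and> t < s} \<union> {(s, t). s \<in> P' \<and> t \<in> Q \<and> t < s}) =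
      card {(s, t). s \<in> P \<and> t \<in> Q \<and> t < s} + card {(s, t). s \<in> P' \<and> t \<in> Q \<and> t < s}"
    using * by (intro card_Un_disjoint finite_inversions) auto
  ultimately show ?thesis
    by (simp add: esign_def power_add)
qed

lemma esign_Un_right: "finite P \<Longrightarrow> Q \<inter> Q' = {} \<Longrightarrow> esign P (Q \<union> Q') = esign P Q * esign P Q'"
proof -
  assume *: "finite P" "Q \<inter> Q' = {}"
  have "{(s, t). s \<in> P \<and> t \<in> Q \<union> Q' \<and> t < s} =
      {(s, t). s \<in> P \<and> t \<in> Q \<and> t < s} \<union> {(s, t). s \<in> P \<and> t \<in> Q' \<and> t < s}"
    by auto
  moreover have "card ({(s, t). s \<in> P \<and> t \<in> Q \<and> t < s} \<union> {(s, t). s \<in> P \<and> t \<in> Q' \<and> t < s}) =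
      card {(s, t). s \<in> P \<and> t \<in> Q \<and> t < s} + card {(s, t). s \<in> P \<and> t \<in> Q' \<and> t < s}"
    using * by (intro card_Un_disjoint finite_inversions) auto
  ultimately show ?thesis
    by (simp add: esign_def power_add)
qed

lemma esign_singleton_left: "esign {m} Q = sg m Q"
proof -
  have "{(s, t). s \<in> {m} \<and> t \<in> Q \<and> t < s} = Pair m ` {t \<in> Q. t < m}"
    by auto
  then show ?thesis
    by (simp add: esign_def sg_def card_image inj_on_def)
qed

lemma esign_singleton_right_min: "finite P \<Longrightarrow> (\<And>s. s \<in> P \<Longrightarrow> m < s) \<Longrightarrow> esign P {m} = (- 1) ^ card P"
proof -
  assume *: "finite P" "\<And>s. s \<in> P \<Longrightarrow> m < s"
  have "{(s, t). s \<in> P \<and> t \<in> {m} \<and> t < s} = (\<lambda>s. (s, m)) ` P"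
    using * by auto
  then show ?thesis
    by (simp add: esign_def card_image inj_on_def)
qed

lemma esign_empty [simp]: "esign {} Q = 1" "esign P {} = 1"
  by (simp_all add: esign_def)

lemma esign_insert_left: "finite P \<Longrightarrow> m \<notin> P \<Longrightarrow> esign (insert m P) Q = sg m Q * esign P Q"
  using esign_Un_left[of "{m}" P Q] by (simp add: esign_singleton_left)

lemma esign_insert_left_min:
  "finite P \<Longrightarrow> m \<notin> P \<Longrightarrow> (\<And>t. t \<in> Q \<Longrightarrow> m < t) \<Longrightarrow> esign (insert m P) Q = esign P Q"
  by (subst esign_insert_left) (simp_all add: sg_min less_imp_le)

lemma esign_insert_right_min:
  "finite P \<Longrightarrow> m \<notin> Q \<Longrightarrow> (\<And>s. s \<in> P \<Longrightarrow> m < s) \<Longrightarrow> esign P (insert m Q) = (- 1) ^ card P * esign P Q"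
  using esign_Un_right[of P "{m}" Q] by (simp add: esign_singleton_right_min)

lemma tens_add: "tens (a + a') b = tens a b + tens a' b" "tens a (b + b') = tens a b + tens a b'"
  by (auto simp: fun_eq_iff algebra_simps)

lemma tens_uminus: "tens (- a) b = - tens a b" "tens a (- b) = - tens a b"
  by (auto simp: fun_eq_iff)

lemma sum_Pow_insert:
  assumes "finite A" "m \<notin> A"
  shows "(\<Sum>P\<in>Pow (insert m A). f P) = (\<Sum>P\<in>Pow A. f P) + (\<Sum>P\<in>Pow A. f (insert m P) :: 'c::comm_monoid_add)"
proof -
  have "inj_on (insert m) (Pow A)"
    using assms(2) by (auto simp: inj_on_def)
  moreover have "Pow A \<inter> insert m ` Pow A = {}"
    using assms(2) by auto
  ultimately show ?thesis
    using assms by (simp add: Pow_insert sum.union_disjoint sum.reindex)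
qed

text \<open>A binomial theorem: the operators \<open>A \<otimes> id\<close> and \<open>C \<otimes> A'\<close>, whose sum is \<open>D\<close>, anticommute, so the
  ordered product of the \<open>D i\<close> is the signed sum over all ways of choosing one of the two in each factor.
  It yields the coproduct of \<open>v\<^sub>S g\<close>, and its analogues for twisted products.\<close>

lemma binomial_tens:
  fixes A :: "nat \<Rightarrow> ('a \<Rightarrow> 'k::field) \<Rightarrow> 'a \<Rightarrow> 'k" and A' :: "nat \<Rightarrow> ('b \<Rightarrow> 'k) \<Rightarrow> 'b \<Rightarrow> 'k"
  assumes "finite S" "a \<in> vecs J" "b \<in> vecs K"
    and "\<And>i. i \<in> S \<Longrightarrow> linop (D i)" "\<And>i. i \<in> S \<Longrightarrow> linop (A i)"
    and "\<And>i x y. i \<in> S \<Longrightarrow> x \<in> vecs J \<Longrightarrow> y \<in> vecs K \<Longrightarrow> D i (tens x y) = tens (A i x) y + tens (C x) (A' i y)"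
    and "\<And>i x. i \<in> S \<Longrightarrow> x \<in> vecs J \<Longrightarrow> A i x \<in> vecs J" "\<And>x. x \<in> vecs J \<Longrightarrow> C x \<in> vecs J"
    and "\<And>i y. i \<in> S \<Longrightarrow> y \<in> vecs K \<Longrightarrow> A' i y \<in> vecs K"
    and "\<And>i x. i \<in> S \<Longrightarrow> x \<in> vecs J \<Longrightarrow> C (A i x) = - A i (C x)"
  shows "opS D S (tens a b) = (\<Sum>P\<in>Pow S. sc (esign P (S - P))
    (tens (opS A P ((C ^^ card (S - P)) a)) (opS A' (S - P) b)))"
  using assms
proof (induction S rule: finite_linorder_min_induct)
  case empty
  then show ?case
    by simp
next
  case (insert m S)
  note ins = insert and pr = insert.prems
  have Cpow: "(C ^^ k) a \<in> vecs J" for k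
    by (induction k) (simp_all add: ins)
  have AP: "opS A P x \<in> vecs J" if "P \<subseteq> S" "x \<in> vecs J" for P x
    using that ins by (intro opS_closed) (auto intro: finite_subset)
  have AQ: "opS A' Q y \<in> vecs K" if "Q \<subseteq> S" "y \<in> vecs K" for Q y
    using that ins by (intro opS_closed) (auto intro: finite_subset)
  have CA: "C (opS A P x) = sc ((- 1) ^ card P) (opS A P (C x))" if "P \<subseteq> S" "x \<in> vecs J" for P x
  proof -
    have "finite P"
      using that ins(1) finite_subset by blast
    then show ?thesis
      using that(1)
    proof (induction P rule: finite_linorder_min_induct)
      case (insert p P)
      then have "opS A P x \<in> vecs J"
        using AP that by auto
      moreover have "linop (A p)" "p \<in> S"
        using insert ins by auto
      moreover have "p \<notin> P"
        using insert by blast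
      moreover have "opS A (insert p P) y = A p (opS A P y)" for y
        using insert by (intro opS_insert) auto
      moreover have "C (opS A P x) = sc ((- 1) ^ card P) (opS A P (C x))"
        using insert by auto
      moreover have "C (A p (opS A P x)) = - A p (C (opS A P x))"
        using calculation(1,3) by (intro pr(9)) auto
      moreover have "(- 1 :: 'k) ^ card (insert p P) = - ((- 1) ^ card P)"
        using insert(1) \<open>p \<notin> P\<close> by simp
      ultimately show ?case
        by (simp only: linop_sc sc_uminus_left)
    qed simp
  qed
  let ?t = "\<lambda>P. tens (opS A P ((C ^^ card (S - P)) a)) (opS A' (S - P) b)"
  have m: "m \<notin> S" "\<And>s. s \<in> S \<Longrightarrow> m < s"
    using ins by auto
  have linD: "linop (D m)"
    using ins by simp
  have "opS D (insert m S) (tens a b) = D m (\<Sum>P\<in>Pow S. sc (esign P (S - P)) (?t P))"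
  proof -
    have "opS D S (tens a b) = (\<Sum>P\<in>Pow S. sc (esign P (S - P)) (?t P))"
      using pr by (intro ins(3)) auto
    moreover have "opS D (insert m S) (tens a b) = D m (opS D S (tens a b))"
      using ins(1) m by (intro opS_insert) auto
    ultimately show ?thesis
      by (simp only:)
  qed
  also have "\<dots> = (\<Sum>P\<in>Pow S. sc (esign P (S - P)) (D m (?t P)))"
    by (simp only: linop_sum[OF linD] linop_sc[OF linD])
  also have "\<dots> = (\<Sum>P\<in>Pow S. sc (esign P (insert m S - P)) (tens (opS A P ((C ^^ card (insert m S - P)) a)) (opS A' (insert m S - P) b))) +
      (\<Sum>P\<in>Pow S. sc (esign (insert m P) (insert m S - insert m P))
        (tens (opS A (insert m P) ((C ^^ card (insert m S - insert m P)) a)) (opS A' (insert m S - insert m P) b)))"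
    unfolding sum.distrib[symmetric]
  proof (intro sum.cong refl)
    fix P assume "P \<in> Pow S"
    then have P: "P \<subseteq> S" and fP: "finite P"
      using ins(1) finite_subset by auto
    have S1: "insert m S - P = insert m (S - P)" and S2: "insert m S - insert m P = S - P"
      using P m by auto
    have c: "card (insert m (S - P)) = Suc (card (S - P))"
      using ins(1) m by simp
    have e1: "esign P (insert m (S - P)) = ((- 1) ^ card P * esign P (S - P) :: 'k)"
      by (rule esign_insert_right_min) (use P m fP in auto)
    have e2: "esign (insert m P) (S - P) = (esign P (S - P) :: 'k)"
      by (rule esign_insert_left_min) (use P m fP in auto)
    have o1: "opS A (insert m P) x = A m (opS A P x)" for x
      by (rule opS_insert) (use P m fP in auto)
    have o2: "opS A' (insert m (S - P)) x = A' m (opS A' (S - P) x)" for x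
      by (rule opS_insert) (use ins(1) m in auto)
    have D: "D m (?t P) = tens (A m (opS A P ((C ^^ card (S - P)) a))) (opS A' (S - P) b) +
        tens (C (opS A P ((C ^^ card (S - P)) a))) (A' m (opS A' (S - P) b))"
      using AP[OF P Cpow] AQ[of "S - P" b] pr(2) by (intro pr(5)) auto
    show "sc (esign P (S - P)) (D m (?t P)) =
       sc (esign P (insert m S - P)) (tens (opS A P ((C ^^ card (insert m S - P)) a)) (opS A' (insert m S - P) b)) +
       sc (esign (insert m P) (insert m S - insert m P))
        (tens (opS A (insert m P) ((C ^^ card (insert m S - insert m P)) a)) (opS A' (insert m S - insert m P) b))"
      unfolding S1 S2 c e1 e2 o1 o2 D CA[OF P Cpow] sc_add tens_sc sc_sc
      by (simp only: funpow.simps comp_apply mult.commute add.commute)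
  qed
  also have "\<dots> = (\<Sum>P\<in>Pow (insert m S). sc (esign P (insert m S - P))
    (tens (opS A P ((C ^^ card (insert m S - P)) a)) (opS A' (insert m S - P) b)))"
    by (rule sum_Pow_insert[symmetric]) (use ins(1) m in auto)
  finally show ?case .
qed

lemma on_left_vecs:
  assumes "finite I" "finite J" "v \<in> vecs (I \<times> J)" "linop A" "\<And>a. a \<in> vecs I \<Longrightarrow> A a \<in> vecs I"
  shows "on_left A v \<in> vecs (I \<times> J)"
  by (rule linop_tens_vecs[OF assms(1,2,3) linop_on_left[OF assms(4)]])
     (simp add: on_left_tens assms vecs_tens vecs_bvec)

lemma on_right_vecs:
  assumes "finite I" "finite J" "v \<in> vecs (I \<times> J)" "linop A" "\<And>a. a \<in> vecs J \<Longrightarrow> A a \<in> vecs J"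
  shows "on_right A v \<in> vecs (I \<times> J)"
  by (rule linop_tens_vecs[OF assms(1,2,3) linop_on_right[OF assms(4)]])
     (simp add: on_right_tens assms vecs_tens vecs_bvec)

lemma good_add_aux: "(a + b) + (c + d) = (a + c) + (b + d :: 'a::comm_monoid_add)"
  by (simp add: add_ac)

lemma cross_cancel: "(x + - p + q + y) + (x' + - q + p + y') = (x + x') + (y + y' :: 'a::ab_group_add)"
  by simp

context supergroup begin

text \<open>Multiplication by \<open>u\<^sup>k\<close>.\<close>

definition ushift :: "nat \<Rightarrow> 'g \<Rightarrow> 'g" where
  "ushift k g = (if even k then g else u \<otimes> g)"

lemma ushift_in [simp]: "g \<in> carrier G \<Longrightarrow> ushift k g \<in> carrier G"
  by (simp add: ushift_def u_in)

lemma ushift_0 [simp]: "ushift 0 g = g"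
  by (simp add: ushift_def)

lemma ushift_Suc: "g \<in> carrier G \<Longrightarrow> ushift (Suc k) g = u \<otimes> ushift k g"
  by (simp add: ushift_def u_in u_square m_assoc[symmetric])

lemma ushift_ushift: "g \<in> carrier G \<Longrightarrow> ushift k (ushift l g) = ushift (k + l) g"
  by (auto simp: ushift_def u_in u_square m_assoc[symmetric])

text \<open>The explicit coproduct of \<open>H\<close>.\<close>

definition dl :: "nat set \<times> 'g \<Rightarrow> (nat set \<times> 'g) \<times> (nat set \<times> 'g) \<Rightarrow> 'k" where
  "dl = (\<lambda>(S, g). \<Sum>P\<in>Pow S. sc (esign P (S - P)) (tens (bvec (P, ushift (card (S - P)) g)) (bvec (S - P, g))))"

lemma dl_eq: "dl (S, g) = (\<Sum>P\<in>Pow S. sc (esign P (S - P)) (tens (bvec (P, ushift (card (S - P)) g)) (bvec (S - P, g))))"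
  by (simp add: dl_def)

lemma dl_vecs: "x \<in> I \<Longrightarrow> dl x \<in> vecs (I \<times> I)"
  by (cases x) (auto simp: dl_eq subset_iff intro!: vecs_sum vecs_sc vecs_tens vecs_bvec)

lemma good_sum: "good B \<Longrightarrow> good B' \<Longrightarrow> good (\<lambda>i j. B i j + B' i j)"
  unfolding good_def by (simp add: distrib_left good_add_aux sum.distrib)

lemma sum_bvec_left: "x \<in> I \<Longrightarrow> (\<Sum>p\<in>I. bvec x p * f p) = (f x :: 'k)"
proof -
  assume x: "x \<in> I"
  have "(\<Sum>p\<in>I. bvec x p * f p) = (\<Sum>p\<in>I. if p = x then f p else 0)"
    by (rule sum.cong) (auto simp: bvec_def)
  then show ?thesis
    using x finI by simp
qed

lemma dl_sum:
  assumes "S \<subseteq> {..<n}" "g \<in> carrier G"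
  shows "(\<Sum>p\<in>I. \<Sum>q\<in>I. dl (S, g) (p, q) * f p q) =
    (\<Sum>P\<in>Pow S. esign P (S - P) * f (P, ushift (card (S - P)) g) (S - P, g))"
proof -
  have "(\<Sum>p\<in>I. \<Sum>q\<in>I. dl (S, g) (p, q) * f p q) = (\<Sum>p\<in>I. \<Sum>q\<in>I. \<Sum>P\<in>Pow S. esign P (S - P) *
     (bvec (P, ushift (card (S - P)) g) p * (bvec (S - P, g) q * f p q)))"
    by (simp add: dl_eq sum_fun_ap sum_distrib_right mult.assoc)
  also have "\<dots> = (\<Sum>P\<in>Pow S. \<Sum>p\<in>I. \<Sum>q\<in>I. esign P (S - P) *
     (bvec (P, ushift (card (S - P)) g) p * (bvec (S - P, g) q * f p q)))"
    by (rule sum_rot3[symmetric])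
  also have "\<dots> = (\<Sum>P\<in>Pow S. esign P (S - P) * (\<Sum>p\<in>I. bvec (P, ushift (card (S - P)) g) p *
     (\<Sum>q\<in>I. bvec (S - P, g) q * f p q)))"
    by (simp only: sum_distrib_left)
  also have "\<dots> = (\<Sum>P\<in>Pow S. esign P (S - P) * f (P, ushift (card (S - P)) g) (S - P, g))"
  proof (intro sum.cong refl arg_cong2[where f = "(*)"])
    fix P assume "P \<in> Pow S"
    then have 1: "(S - P, g) \<in> I" "(P, ushift (card (S - P)) g) \<in> I"
      using assms by auto
    show "(\<Sum>p\<in>I. bvec (P, ushift (card (S - P)) g) p * (\<Sum>q\<in>I. bvec (S - P, g) q * f p q)) =
        f (P, ushift (card (S - P)) g) (S - P, g)"
      by (subst sum_bvec_left[OF 1(2)], rule sum_bvec_left[OF 1(1)])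
  qed
  finally show ?thesis .
qed

text \<open>Left multiplication by \<open>v\<^sub>i \<otimes> 1 + u \<otimes> v\<^sub>i\<close> and by \<open>g \<otimes> g\<close> on the tensor product of the algebras
  of \<open>B\<close> and \<open>B'\<close>.\<close>

definition dop :: "(nat \<Rightarrow> nat \<Rightarrow> 'k) \<Rightarrow> (nat \<Rightarrow> nat \<Rightarrow> 'k) \<Rightarrow> nat
    \<Rightarrow> ((nat set \<times> 'g) \<times> (nat set \<times> 'g) \<Rightarrow> 'k) \<Rightarrow> (nat set \<times> 'g) \<times> (nat set \<times> 'g) \<Rightarrow> 'k" where
  "dop B B' i v = on_left (lam n B i) v + on_left (gam B u) (on_right (lam n B' i) v)"

definition egam :: "(nat \<Rightarrow> nat \<Rightarrow> 'k) \<Rightarrow> (nat \<Rightarrow> nat \<Rightarrow> 'k) \<Rightarrow> 'g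
    \<Rightarrow> ((nat set \<times> 'g) \<times> (nat set \<times> 'g) \<Rightarrow> 'k) \<Rightarrow> (nat set \<times> 'g) \<times> (nat set \<times> 'g) \<Rightarrow> 'k" where
  "egam B B' g v = on_left (gam B g) (on_right (gam B' g) v)"

abbreviation "gg g \<equiv> tens (bvec ({}, g)) (bvec ({}, g))"

lemma linop_dop: "linop (dop B B' i)"
  unfolding dop_def by (intro linop_plus linop_comp[OF linop_on_left linop_on_right, OF linop_gam linop_lam] linop_on_left[OF linop_lam])

lemma linop_egam: "linop (egam B B' i)"
  unfolding egam_def by (rule linop_comp[OF linop_on_left linop_on_right, OF linop_gam linop_gam])

lemma dop_tens: "dop B B' i (tens a b) = tens (lam n B i a) b + tens (gam B u a) (lam n B' i b)"
  by (simp add: dop_def on_left_tens on_right_tens linop_lam linop_gam)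

lemma egam_tens: "egam B B' g (tens a b) = tens (gam B g a) (gam B' g b)"
  by (simp add: egam_def on_left_tens on_right_tens linop_gam)

text \<open>The mixed terms in the anticommutators cancel since \<open>u\<close> anticommutes with vectors, so the forms of
  the two factors add up.\<close>

lemma dop_rep:
  assumes B: "good B" "good B'"
  shows "clifford_rep G u n \<rho> (\<lambda>i j. B i j + B' i j) (dop B B') (I \<times> I) (egam B B') gg"
proof
  show "linop (dop B B' i)" for i
    by (rule linop_dop)
  fix g h assume g: "g \<in> carrier G" and h: "h \<in> carrier G"
  show "egam B B' g (gg h) = gg (g \<otimes> h)"
    using h by (simp add: egam_tens gam_bvec_empty)
next
  fix g assume g: "g \<in> carrier G"
  show "linop (egam B B' g)"
    by (rule linop_egam)
  show "gg g \<in> vecs (I \<times> I)"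
    using g by (intro vecs_tens bvec_empty_vecs)
next
  note [simp] = linop_lam linop_gam lam_vecs gam_vecs u_in B
  fix i j and v :: "(nat set \<times> 'g) \<times> (nat set \<times> 'g) \<Rightarrow> 'k"
  assume i: "i < n" and v: "v \<in> vecs (I \<times> I)"
  show "dop B B' i v \<in> vecs (I \<times> I)"
    unfolding dop_def using i v by (intro vecs_add on_left_vecs on_right_vecs finI) simp_all
  show "dop B B' i (dop B B' j v) + dop B B' j (dop B B' i v) = sc (B i j + B' i j + (B j i + B' j i)) v"
    if j: "j < n"
  proof (rule linop_tens_eqI[OF finI finI v])
    show "linop (\<lambda>v. dop B B' i (dop B B' j v) + dop B B' j (dop B B' i v))"
      "linop (sc (B i j + B' i j + (B j i + B' j i)))"
      by (intro linop_plus linop_comp[OF linop_dop linop_dop]) (rule linop_scale[OF linop_id])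
    fix x y assume "x \<in> I" "y \<in> I"
    then have [simp]: "bvec x \<in> vecs I" "bvec y \<in> vecs I"
      by (simp_all only: vecs_bvec)
    let ?a = "bvec x :: _ \<Rightarrow> 'k" and ?b = "bvec y :: _ \<Rightarrow> 'k"
    have *: "dop B B' i (dop B B' j (tens ?a ?b)) = tens (lam n B i (lam n B j ?a)) ?b
       + - tens (lam n B j (gam B u ?a)) (lam n B' i ?b) + tens (lam n B i (gam B u ?a)) (lam n B' j ?b)
       + tens ?a (lam n B' i (lam n B' j ?b))" if "i < n" "j < n" for i j
      unfolding dop_tens linop_add[OF linop_dop] using that
      by (simp only: gam_u_lam gam_u_u tens_uminus B \<open>bvec x \<in> vecs I\<close> add.assoc)
    have "dop B B' i (dop B B' j (tens ?a ?b)) + dop B B' j (dop B B' i (tens ?a ?b)) =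
      (tens (lam n B i (lam n B j ?a)) ?b + tens (lam n B j (lam n B i ?a)) ?b) +
      (tens ?a (lam n B' i (lam n B' j ?b)) + tens ?a (lam n B' j (lam n B' i ?b)))"
      unfolding *[OF i j] *[OF j i] by (rule cross_cancel)
    also have "\<dots> = sc (B i j + B' i j + (B j i + B' j i)) (tens ?a ?b)"
      unfolding tens_add[symmetric] lam_rel[OF i j] tens_sc sc_add_left[symmetric]
      by (simp only: good_add_aux)
    finally show "dop B B' i (dop B B' j (tens ?a ?b)) + dop B B' j (dop B B' i (tens ?a ?b)) =
      sc (B i j + B' i j + (B j i + B' j i)) (tens ?a ?b)" .
  qed
  fix g assume g: "g \<in> carrier G"
  show "egam B B' g (dop B B' i v) = comb (dop B B') g i (egam B B' g v)"
  proof (rule linop_tens_eqI[OF finI finI v])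
    show "linop (\<lambda>v. egam B B' g (dop B B' i v))" "linop (\<lambda>v. comb (dop B B') g i (egam B B' g v))"
      by (rule linop_comp[OF linop_egam linop_dop], rule linop_comp[OF linop_comb linop_egam], rule linop_dop)
    fix x y assume "x \<in> I" "y \<in> I"
    then have xy: "bvec x \<in> vecs I" "bvec y \<in> vecs I"
      by (simp_all only: vecs_bvec)
    let ?a = "bvec x :: _ \<Rightarrow> 'k" and ?b = "bvec y :: _ \<Rightarrow> 'k"
    have "comb (dop B B') g i (egam B B' g (tens ?a ?b)) =
       tens (comb (lam n B) g i (gam B g ?a)) (gam B' g ?b) +
       tens (gam B u (gam B g ?a)) (comb (lam n B') g i (gam B' g ?b))"
      unfolding comb_def egam_tens dop_tens
      by (simp only: sc_add sum.distrib tens_sum_left tens_sum_right tens_sc)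
    also have "\<dots> = egam B B' g (dop B B' i (tens ?a ?b))"
      unfolding dop_tens linop_add[OF linop_egam] egam_tens
      by (simp only: gam_lam gam_u_comm B g i xy)
    finally show "egam B B' g (dop B B' i (tens ?a ?b)) = comb (dop B B') g i (egam B B' g (tens ?a ?b))" ..
  qed
qed (use two good_tri[OF B(1)] good_tri[OF B(2)] good_sum[OF B] in auto)

lemma gam_u_pow: "good B \<Longrightarrow> g \<in> carrier G \<Longrightarrow> a \<in> vecs I \<Longrightarrow> (gam B u ^^ k) (gam B g a) = gam B (ushift k g) a"
  by (induction k) (simp_all add: ushift_Suc gam_gam u_in)

lemma dop_ordered:
  assumes B: "good B" "good B'" and S: "S \<subseteq> {..<n}" and g: "g \<in> carrier G" and ab: "a \<in> vecs I" "b \<in> vecs I"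
  shows "opS (dop B B') S (egam B B' g (tens a b)) = (\<Sum>P\<in>Pow S. sc (esign P (S - P))
    (tens (mulB B (bvec (P, ushift (card (S - P)) g)) a) (mulB B' (bvec (S - P, g)) b)))"
proof -
  have "opS (dop B B') S (tens (gam B g a) (gam B' g b)) = (\<Sum>P\<in>Pow S. sc (esign P (S - P))
     (tens (opS (lam n B) P ((gam B u ^^ card (S - P)) (gam B g a))) (opS (lam n B') (S - P) (gam B' g b))))"
    by (rule binomial_tens[where J = I and K = I])
       (use S B ab g in \<open>auto simp: gam_vecs linop_dop linop_lam dop_tens lam_vecs u_in gam_u_lam intro: finite_subset\<close>)
  also have "\<dots> = (\<Sum>P\<in>Pow S. sc (esign P (S - P))
    (tens (mulB B (bvec (P, ushift (card (S - P)) g)) a) (mulB B' (bvec (S - P, g)) b)))"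
    using S g by (intro sum.cong refl) (auto simp: gam_u_pow B ab mulB_bvec subset_trans[of _ S])
  finally show ?thesis
    by (simp add: egam_tens)
qed

lemma dop_ordered_gg:
  assumes "good B" "good B'" "S \<subseteq> {..<n}" "g \<in> carrier G"
  shows "opS (dop B B') S (gg g) = dl (S, g)"
proof -
  have 1: "gg g = egam B B' g (gg \<one>)"
    using assms by (simp add: egam_tens gam_bvec_empty)
  have 2: "mulB B (bvec (P, h)) (bvec ({}, \<one>)) = bvec (P, h)"
    if "good B" "P \<subseteq> S" "h \<in> carrier G" for B P h
    using that assms(3) by (intro mulB_one_right vecs_bvec) auto
  show ?thesis
    unfolding dl_eq 1 dop_ordered[OF assms bvec_empty_vecs[OF one_closed] bvec_empty_vecs[OF one_closed]]
    using assms(1,2,4) by (intro sum.cong refl) (simp add: 2)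
qed

text \<open>By \<open>dop_rep\<close> and the universal property, the linear map that sends \<open>v\<^sub>S g\<close> to its coproduct
  intertwines the product for \<open>B + B'\<close> with the product in the tensor product of the algebras of \<open>B\<close> and
  \<open>B'\<close>. Both sides are expanded here in coordinates.\<close>

lemma coproduct_mulB:
  assumes B: "good B" "good B'" and S: "S \<subseteq> {..<n}" "T \<subseteq> {..<n}" and g: "g \<in> carrier G" "h \<in> carrier G"
  shows "(\<Sum>r\<in>I. mulB (\<lambda>i j. B i j + B' i j) (bvec (S, g)) (bvec (T, h)) r * dl r (p, q)) =
    (\<Sum>P\<in>Pow S. \<Sum>Q\<in>Pow T. esign P (S - P) * esign Q (T - Q) *
      (mulB B (bvec (P, ushift (card (S - P)) g)) (bvec (Q, ushift (card (T - Q)) h)) p *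
       mulB B' (bvec (S - P, g)) (bvec (T - Q, h)) q))"
proof -
  interpret clifford_rep G u n \<rho> "\<lambda>i j. B i j + B' i j" "dop B B'" "I \<times> I" "egam B B'" gg
    by (rule dop_rep) fact+
  have L: "L a = (\<Sum>r\<in>I. sc (a r) (dl r))" for a
    unfolding lift_def using B by (intro sum.cong refl) (auto simp: dop_ordered_gg)
  have "(\<Sum>r\<in>I. mulB (\<lambda>i j. B i j + B' i j) (bvec (S, g)) (bvec (T, h)) r * dl r (p, q)) =
      L (mulB (\<lambda>i j. B i j + B' i j) (bvec (S, g)) (bvec (T, h))) (p, q)"
    by (simp add: L sum_fun_ap)
  also have "L (mulB (\<lambda>i j. B i j + B' i j) (bvec (S, g)) (bvec (T, h))) = opS (dop B B') S (egam B B' g (dl (T, h)))"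
    using S g B by (subst L_mulB) (simp_all add: vecs_bvec lift_bvec[OF finI] dop_ordered_gg)
  also have "dl (T, h) = (\<Sum>Q\<in>Pow T. sc (esign Q (T - Q)) (tens (bvec (Q, ushift (card (T - Q)) h)) (bvec (T - Q, h))))"
    by (rule dl_eq)
  also have "opS (dop B B') S (egam B B' g \<dots>) = (\<Sum>Q\<in>Pow T. sc (esign Q (T - Q))
      (opS (dop B B') S (egam B B' g (tens (bvec (Q, ushift (card (T - Q)) h)) (bvec (T - Q, h))))))"
  proof -
    have "linop (opS (dop B B') S)"
      using S finite_subset by (intro linop_opS linop_dop) blast
    then show ?thesis
      by (simp only: linop_sum[OF linop_egam] linop_sc[OF linop_egam] linop_sum linop_sc)
  qed
  also have "\<dots> = (\<Sum>Q\<in>Pow T. sc (esign Q (T - Q)) (\<Sum>P\<in>Pow S. sc (esign P (S - P))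
    (tens (mulB B (bvec (P, ushift (card (S - P)) g)) (bvec (Q, ushift (card (T - Q)) h)))
      (mulB B' (bvec (S - P, g)) (bvec (T - Q, h))))))"
    using S g B by (intro sum.cong refl arg_cong2[where f = sc] dop_ordered) (auto intro!: vecs_bvec)
  also have "\<dots> (p, q) = (\<Sum>Q\<in>Pow T. \<Sum>P\<in>Pow S. esign P (S - P) * esign Q (T - Q) *
      (mulB B (bvec (P, ushift (card (S - P)) g)) (bvec (Q, ushift (card (T - Q)) h)) p *
       mulB B' (bvec (S - P, g)) (bvec (T - Q, h)) q))"
    by (simp add: sum_fun_ap sum_distrib_left mult_ac)
  also have "\<dots> = (\<Sum>P\<in>Pow S. \<Sum>Q\<in>Pow T. esign P (S - P) * esign Q (T - Q) *
      (mulB B (bvec (P, ushift (card (S - P)) g)) (bvec (Q, ushift (card (T - Q)) h)) p *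
       mulB B' (bvec (S - P, g)) (bvec (T - Q, h)) q))"
    by (rule sum.swap)
  finally show ?thesis .
qed

end

section \<open>Modified supergroup algebras as bialgebras\<close>

lemma linop_amul_left: "linop (\<lambda>a. amul A a b)"
  by (rule linopI) (auto simp: amul_def fun_eq_iff algebra_simps sum.distrib sum_distrib_left)

lemma linop_amul_right: "linop (amul A a)"
  by (rule linopI) (auto simp: amul_def fun_eq_iff algebra_simps sum.distrib sum_distrib_left)

lemma amul_bvec:
  assumes "finite (basis A)" "i \<in> basis A"
  shows "amul A (bvec i) b r = (\<Sum>j\<in>basis A. b j * structc A i j r)"
proof -
  have "amul A (bvec i) b r = (\<Sum>i'\<in>basis A. if i' = i then \<Sum>j\<in>basis A. b j * structc A i j r else 0)"
    unfolding amul_def by (intro sum.cong refl) (auto simp: bvec_def)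
  then show ?thesis
    using assms by simp
qed

lemma amul_bvec_bvec:
  assumes "finite (basis A)" "i \<in> basis A" "j \<in> basis A"
  shows "amul A (bvec i) (bvec j) = structc A i j"
proof
  fix r
  have "amul A (bvec i) (bvec j) r = (\<Sum>j'\<in>basis A. if j' = j then structc A i j r else 0)"
    unfolding amul_bvec[OF assms(1,2)] by (intro sum.cong refl) (auto simp: bvec_def)
  then show "amul A (bvec i) (bvec j) r = structc A i j r"
    using assms by simp
qed

lemma amul_alg_tensor:
  assumes "finite (basis A)" "finite (basis B)"
  shows "amul (alg_tensor A B) (tens a b) (tens a' b') = tens (amul A a a') (amul B b b')"
proof (rule ext, clarify)
  fix r s
  have "amul (alg_tensor A B) (tens a b) (tens a' b') (r, s) =
     (\<Sum>i\<in>basis A. \<Sum>j\<in>basis B. \<Sum>p\<in>basis A. \<Sum>q\<in>basis B.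
       (a i * a' p * structc A i p r) * (b j * b' q * structc B j q s))"
    by (simp add: amul_def alg_tensor_def sum_prod_split assms mult_ac)
  also have "\<dots> = (\<Sum>i\<in>basis A. \<Sum>p\<in>basis A. a i * a' p * structc A i p r) *
      (\<Sum>j\<in>basis B. \<Sum>q\<in>basis B. b j * b' q * structc B j q s)"
    by (simp only: sum_product)
  finally show "amul (alg_tensor A B) (tens a b) (tens a' b') (r, s) = tens (amul A a a') (amul B b b') (r, s)"
    by (simp add: amul_def)
qed

subsection \<open>The exterior algebra\<close>

lemma ext_alg_simps:
  "basis (ext_alg n) = Pow {..<n}" "unitv (ext_alg n) = bvec {}"
  "structc (ext_alg n) S T R = (if S \<inter> T = {} \<and> R = S \<union> T then esign S T else 0)"
  by (simp_all add: ext_alg_def esign_def)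

lemma amul_ext_bvec:
  assumes "S \<subseteq> {..<n}" "b \<in> vecs (Pow {..<n})"
  shows "amul (ext_alg n) (bvec S) b R = (if S \<subseteq> R then esign S (R - S) * b (R - S) else 0)"
proof -
  have "amul (ext_alg n) (bvec S) b R = (\<Sum>T\<in>Pow {..<n}. b T * structc (ext_alg n) S T R)"
    using assms(1) by (subst amul_bvec) (simp_all add: ext_alg_simps)
  also have "\<dots> = (\<Sum>T\<in>Pow {..<n}. if T = R - S then (if S \<subseteq> R then esign S (R - S) * b (R - S) else 0) else 0)"
    by (intro sum.cong refl) (auto simp: ext_alg_simps)
  also have "\<dots> = (if S \<subseteq> R then esign S (R - S) * b (R - S) else 0)"
    using assms(2) by (auto simp: vecs_def)
  finally show ?thesis .
qed

lemma opS_wdg: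
  fixes b :: "nat set \<Rightarrow> 'k::field"
  assumes "finite S"
  shows "opS wdg S (tens b (bvec k)) (R, f) = (if S \<subseteq> R then esign S (R - S) * b (R - S) * bvec k f else 0)"
  using assms
proof (induction S arbitrary: R rule: finite_linorder_min_induct)
  case empty
  then show ?case
    by simp
next
  case (insert m S)
  have m: "m \<notin> S"
    using insert.hyps(2) by blast
  have "opS wdg (insert m S) (tens b (bvec k)) (R, f) =
      (if m \<in> R then sg m R * opS wdg S (tens b (bvec k)) (R - {m}, f) else 0)"
    by (subst opS_insert) (use insert.hyps in \<open>auto simp: wdg_def\<close>)
  also have "\<dots> = (if insert m S \<subseteq> R then esign (insert m S) (R - insert m S) * b (R - insert m S) * bvec k f else 0)"
  proof (cases "m \<in> R \<and> S \<subseteq> R - {m}")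
    case True
    then have "insert m S \<subseteq> R" "R - {m} - S = R - insert m S"
      by auto
    moreover have "esign (insert m S) (R - insert m S) = (sg m (R - insert m S) * esign S (R - insert m S) :: 'k)"
      using insert.hyps m by (intro esign_insert_left) auto
    moreover have "sg m R = (sg m (R - insert m S) :: 'k)"
      using insert.hyps(2) by (intro sg_cong) force
    ultimately show ?thesis
      using True by (simp add: insert.IH mult.assoc)
  next
    case False
    then show ?thesis
      using m by (auto simp: insert.IH)
  qed
  finally show ?case .
qed

lemma tens_amul_ext:
  assumes "S \<subseteq> {..<n}" "b \<in> vecs (Pow {..<n})"
  shows "tens (amul (ext_alg n) (bvec S) b) (bvec k) = opS wdg S (tens b (bvec k))"
proof -
  have "finite S"
    using assms(1) finite_subset by blast
  then show ?thesis
    by (auto simp: fun_eq_iff opS_wdg amul_ext_bvec[OF assms])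
qed

lemma amul_ext_vecs: "amul (ext_alg n) a b \<in> vecs (Pow {..<n})"
  by (auto simp: vecs_def amul_def ext_alg_simps intro!: sum.neutral)

lemma tens_amul_ext_vector:
  assumes "b \<in> vecs (Pow {..<n})"
  shows "tens (amul (ext_alg n) (ext_vector n v) b) (bvec k) = (\<Sum>l<n. sc (v $ l) (wdg l (tens b (bvec k))))"
proof -
  have "ext_vector n v = (\<Sum>l<n. sc (v $ l) (bvec {l}))"
    by (simp add: ext_vector_def fun_eq_iff sum_fun_ap)
  then have "amul (ext_alg n) (ext_vector n v) b = (\<Sum>l<n. sc (v $ l) (amul (ext_alg n) (bvec {l}) b))"
    by (simp only: linop_sum[OF linop_amul_left] linop_sc[OF linop_amul_left])
  then have "tens (amul (ext_alg n) (ext_vector n v) b) (bvec k) =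
      (\<Sum>l<n. sc (v $ l) (tens (amul (ext_alg n) (bvec {l}) b) (bvec k)))"
    by (simp only: tens_sum_left tens_sc)
  also have "\<dots> = (\<Sum>l<n. sc (v $ l) (wdg l (tens b (bvec k))))"
  proof (intro sum.cong refl arg_cong2[where f = sc])
    fix l assume "l \<in> {..<n}"
    then show "tens (amul (ext_alg n) (bvec {l}) b) (bvec k) = wdg l (tens b (bvec k))"
      using tens_amul_ext[of "{l}" n b k] opS_insert[of "{}" l wdg] assms by simp
  qed
  finally show ?thesis .
qed

abbreviation zero_form :: "nat \<Rightarrow> nat \<Rightarrow> 'k::field" where
  "zero_form \<equiv> \<lambda>_ _. 0"

lemma lam_zero_form: "lam n zero_form = wdg"
  by (simp add: lam_def fun_eq_iff sum_fun_ap)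

context supergroup begin

abbreviation "Sm \<equiv> smash_alg G n \<rho>"
abbreviation "H \<equiv> supergroup_alg G u n \<rho>"

lemma basis_Sm: "basis Sm = I" and unitv_Sm: "unitv Sm = bvec ({}, \<one>)"
  by (simp_all add: smash_alg_def)

lemma basis_H: "basis H = I" and unitv_H: "unitv H = bvec ({}, \<one>)" and structc_H: "structc H = structc Sm"
  and counitc_H: "counitc H (S, g) = (if S = {} then 1 else 0)"
  and comulc_H: "comulc H (S, g) = aprod (alg_tensor Sm Sm)
      (map (\<lambda>i t. bvec (({i}, \<one>), ({}, \<one>)) t + bvec (({}, u), ({i}, \<one>)) t) (sorted_list_of_set S) @
           [bvec (({}, g), ({}, g))])"
  by (simp_all add: supergroup_alg_def smash_alg_def alg.defs Let_def)

text \<open>The action of \<open>g\<close> on \<open>v\<^sub>S\<close> is defined as an iterated product in the exterior algebra; multiplication by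
  a vector is an exterior multiplication operator.\<close>

lemma tens_ext_act:
  assumes "S \<subseteq> {..<n}" "g \<in> carrier G"
  shows "tens (ext_act n \<rho> g S) (bvec k) = opS (comb wdg g) S (bvec ({}, k)) \<and> ext_act n \<rho> g S \<in> vecs (Pow {..<n})"
proof -
  have fin: "finite S"
    using assms(1) finite_subset by blast
  let ?f = "\<lambda>i. ext_vector n (col (\<rho> g) i)"
  have "tens (foldr (amul (ext_alg n)) (map ?f xs) (bvec {})) (bvec k) = foldr (comb wdg g) xs (bvec ({}, k)) \<and>
      foldr (amul (ext_alg n)) (map ?f xs) (bvec {}) \<in> vecs (Pow {..<n})" if "set xs \<subseteq> {..<n}" for xs
    using that
  proof (induction xs)
    case Nil
    then show ?case
      by (simp add: vecs_bvec bvec_pair)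
  next
    case (Cons i xs)
    then have i: "i < n" and v: "foldr (amul (ext_alg n)) (map ?f xs) (bvec {}) \<in> vecs (Pow {..<n})"
      by auto
    have "col (\<rho> g) i $ l = \<rho> g $$ (l, i)" if "l < n" for l
      using rho_carrier[OF assms(2)] i that by simp
    then have "(\<Sum>l<n. sc (col (\<rho> g) i $ l) w) = (\<Sum>l<n. sc (\<rho> g $$ (l, i)) w)" for w :: "nat set \<times> 'g \<Rightarrow> 'k"
      by (intro sum.cong refl) simp
    then show ?case
      using Cons i rho_carrier[OF assms(2)] by (simp add: tens_amul_ext_vector[OF v] amul_ext_vecs comb_def)
  qed
  from this[of "sorted_list_of_set S"] show ?thesis
    using assms(1) fin by (simp add: ext_act_def aprod_def ext_alg_simps opS_def)
qed

text \<open>\<open>H\<close> is the Clifford smash product for the form \<open>0\<close>.\<close>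

lemma structc_eq:
  assumes "x \<in> I" "y \<in> I"
  shows "structc Sm x y = mulB zero_form (bvec x) (bvec y)"
proof -
  obtain S g T h where [simp]: "x = (S, g)" "y = (T, h)" and S: "S \<subseteq> {..<n}" "T \<subseteq> {..<n}"
    and g: "g \<in> carrier G" "h \<in> carrier G"
    using assms by auto
  have "structc Sm (S, g) (T, h) = tens (amul (ext_alg n) (bvec S) (ext_act n \<rho> g T)) (bvec (g \<otimes> h))"
    by (auto simp: smash_alg_def fun_eq_iff bvec_def)
  also have "\<dots> = opS wdg S (opS (comb wdg g) T (bvec ({}, g \<otimes> h)))"
    by (simp add: tens_amul_ext S tens_ext_act[OF S(2) g(1), THEN conjunct1] tens_ext_act[OF S(2) g(1), THEN conjunct2])
  also have "\<dots> = mulB zero_form (bvec x) (bvec y)"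
    using S g by (simp add: mulB_bvec gam_bvec lam_zero_form)
  finally show ?thesis
    by simp
qed

lemma amul_Sm:
  assumes "x \<in> I" "b \<in> vecs I"
  shows "amul Sm (bvec x) b = mulB zero_form (bvec x) b"
proof (rule linop_eqI[OF finI assms(2) linop_amul_right linop_mulB_right])
  fix y assume "y \<in> I"
  then show "amul Sm (bvec x) (bvec y) = mulB zero_form (bvec x) (bvec y)"
    using assms(1) finI by (simp add: amul_bvec_bvec basis_Sm structc_eq)
qed

lemma amul_Sm_generators:
  assumes "b \<in> vecs I"
  shows "amul Sm (bvec ({}, \<one>)) b = b" "amul Sm (bvec ({}, u)) b = gam zero_form u b"
    "i < n \<Longrightarrow> amul Sm (bvec ({i}, \<one>)) b = wdg i b"
proof -
  show "amul Sm (bvec ({}, \<one>)) b = b"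
    using assms by (simp add: amul_Sm mulB_one_left good_zero)
  show "amul Sm (bvec ({}, u)) b = gam zero_form u b"
    using assms by (simp add: amul_Sm mulB_bvec u_in)
  show "amul Sm (bvec ({i}, \<one>)) b = wdg i b" if "i < n"
    using assms that opS_insert[of "{}" i wdg b]
    by (simp add: amul_Sm mulB_bvec gam_one good_zero lam_zero_form)
qed

lemma amul_Sm2:
  assumes "i < n" "v \<in> vecs (I \<times> I)"
  shows "amul (alg_tensor Sm Sm) (\<lambda>t. bvec (({i}, \<one>), ({}, \<one>)) t + bvec (({}, u), ({i}, \<one>)) t) v = dop zero_form zero_form i v"
proof (rule linop_tens_eqI[OF finI finI assms(2) linop_amul_right linop_dop])
  fix x y assume xy: "x \<in> I" "y \<in> I"
  have v: "bvec x \<in> vecs I" "bvec y \<in> vecs I"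
    using xy by (simp_all only: vecs_bvec)
  have fin: "finite (basis Sm)"
    using finI by (simp add: basis_Sm)
  have *: "(\<lambda>t. bvec (({i}, \<one>), ({}, \<one>)) t + bvec (({}, u), ({i}, \<one>)) t) =
      tens (bvec ({i}, \<one>)) (bvec ({}, \<one>)) + tens (bvec ({}, u)) (bvec ({i}, \<one>))"
    by (simp add: bvec_pair plus_fun_def)
  have "amul (alg_tensor Sm Sm) (\<lambda>t. bvec (({i}, \<one>), ({}, \<one>)) t + bvec (({}, u), ({i}, \<one>)) t) (tens (bvec x) (bvec y)) =
      tens (amul Sm (bvec ({i}, \<one>)) (bvec x)) (amul Sm (bvec ({}, \<one>)) (bvec y)) +
      tens (amul Sm (bvec ({}, u)) (bvec x)) (amul Sm (bvec ({i}, \<one>)) (bvec y))"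
    by (simp only: * linop_add[OF linop_amul_left] amul_alg_tensor[OF fin fin])
  also have "\<dots> = dop zero_form zero_form i (tens (bvec x) (bvec y))"
    unfolding dop_tens lam_zero_form by (simp only: amul_Sm_generators v assms(1))
  finally show "amul (alg_tensor Sm Sm) (\<lambda>t. bvec (({i}, \<one>), ({}, \<one>)) t + bvec (({}, u), ({i}, \<one>)) t)
      (tens (bvec x) (bvec y)) = dop zero_form zero_form i (tens (bvec x) (bvec y))" .
qed

lemma comulc_eq:
  assumes "x \<in> I"
  shows "comulc H x = dl x"
proof -
  obtain S g where [simp]: "x = (S, g)" and S: "S \<subseteq> {..<n}" and g: "g \<in> carrier G"
    using assms by auto
  have fin: "finite (basis Sm)" "finite S"
    using finite_subset[OF S] finite_G by (simp_all add: basis_Sm)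
  have unit: "unitv (alg_tensor Sm Sm) = tens (bvec ({}, \<one>)) (bvec ({}, \<one>))"
    by (auto simp: alg_tensor_def unitv_Sm fun_eq_iff)
  have "amul (alg_tensor Sm Sm) (bvec (({}, g), ({}, g))) (unitv (alg_tensor Sm Sm)) = gg g"
    unfolding unit bvec_pair[of "({}, g)"] amul_alg_tensor[OF fin(1,1)]
    using g by (simp add: amul_Sm bvec_empty_vecs mulB_bvec gam_bvec_empty)
  then have "comulc H (S, g) = foldr (amul (alg_tensor Sm Sm))
      (map (\<lambda>i t. bvec (({i}, \<one>), ({}, \<one>)) t + bvec (({}, u), ({i}, \<one>)) t) (sorted_list_of_set S)) (gg g)"
    by (simp add: comulc_H aprod_def)
  also have "\<dots> = opS (\<lambda>i. amul (alg_tensor Sm Sm) (\<lambda>t. bvec (({i}, \<one>), ({}, \<one>)) t + bvec (({}, u), ({i}, \<one>)) t)) S (gg g)"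
    by (simp add: opS_def foldr_map comp_def)
  also have "\<dots> = opS (dop zero_form zero_form) S (gg g)"
  proof (rule opS_cong[where W = "vecs (I \<times> I)"])
    interpret clifford_rep G u n \<rho> "\<lambda>i j. 0 + 0" "dop zero_form zero_form" "I \<times> I" "egam zero_form zero_form" gg
      using dop_rep[OF good_zero good_zero] .
    fix i and v :: "(nat set \<times> 'g) \<times> (nat set \<times> 'g) \<Rightarrow> 'k"
    assume "i \<in> S" and v: "v \<in> vecs (I \<times> I)"
    then have i: "i < n"
      using S by auto
    show "amul (alg_tensor Sm Sm) (\<lambda>t. bvec (({i}, \<one>), ({}, \<one>)) t + bvec (({}, u), ({i}, \<one>)) t) v = dop zero_form zero_form i v"
      by (rule amul_Sm2[OF i v])
    then show "amul (alg_tensor Sm Sm) (\<lambda>t. bvec (({i}, \<one>), ({}, \<one>)) t + bvec (({}, u), ({i}, \<one>)) t) v \<in> vecs (I \<times> I)"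
      using closed[OF i v] by simp
  next
    show "gg g \<in> vecs (I \<times> I)"
      using g by (intro vecs_tens bvec_empty_vecs)
  qed (rule fin)
  also have "\<dots> = dl x"
    using S g by (simp add: dop_ordered_gg good_zero)
  finally show ?thesis
    by simp
qed

subsection \<open>Bialgebra axioms\<close>

lemma dl_ap:
  assumes "S \<subseteq> {..<n}"
  shows "dl (S, g) ((P, a), (Q, b)) =
    (if P \<union> Q = S \<and> P \<inter> Q = {} \<and> b = g \<and> a = ushift (card Q) g then esign P Q else 0)"
proof -
  have "finite (Pow S)"
    using finite_subset[OF assms] by simp
  moreover have "dl (S, g) ((P, a), (Q, b)) = (\<Sum>P'\<in>Pow S. if P' = P then
      (if Q = S - P \<and> b = g \<and> a = ushift (card Q) g then esign P Q else 0) else 0)"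
    unfolding dl_eq sum_fun_ap by (intro sum.cong refl) (auto simp: bvec_def)
  ultimately have "dl (S, g) ((P, a), (Q, b)) = (if P \<subseteq> S \<and> Q = S - P \<and> b = g \<and> a = ushift (card Q) g then esign P Q else 0)"
    by simp
  moreover have "P \<subseteq> S \<and> Q = S - P \<longleftrightarrow> P \<union> Q = S \<and> P \<inter> Q = {}"
    by auto
  ultimately show ?thesis
    by auto
qed

lemma sum_single:
  assumes "finite A" "p \<in> A" "\<And>x. x \<in> A \<Longrightarrow> x \<noteq> p \<Longrightarrow> f x = 0"
  shows "(\<Sum>x\<in>A. f x) = (f p :: 'c::comm_monoid_add)"
proof -
  have "(\<Sum>x\<in>A. f x) = (\<Sum>x\<in>A. if x = p then f p else 0)"
    by (intro sum.cong refl) (use assms(3) in auto)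
  then show ?thesis
    using assms by simp
qed

lemma finite_sub: "S \<subseteq> {..<n} \<Longrightarrow> finite S"
  using finite_subset[of S "{..<n}"] by simp

text \<open>Both sides are supported on the decompositions \<open>S = R \<union> T \<union> Q\<close>, each with one nonzero summand; the
  signs agree because \<open>esign\<close> is multiplicative in either argument.\<close>

lemma dl_coassoc:
  assumes "i \<in> I" "q \<in> I" "r \<in> I" "s \<in> I"
  shows "(\<Sum>p\<in>I. dl i (p, q) * dl p (r, s)) = (\<Sum>p\<in>I. dl i (r, p) * dl p (s, q))"
proof -
  obtain S g Q b R a T f where [simp]: "i = (S, g)" "q = (Q, b)" "r = (R, a)" "s = (T, f)"
    and sub: "S \<subseteq> {..<n}" "Q \<subseteq> {..<n}" "R \<subseteq> {..<n}" "T \<subseteq> {..<n}"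
    and mem: "g \<in> carrier G" "b \<in> carrier G" "a \<in> carrier G" "f \<in> carrier G"
    using assms by auto
  note fin = sub[THEN finite_sub]
  have L: "(\<Sum>p\<in>I. dl i (p, q) * dl p (r, s)) = dl (S, g) ((R \<union> T, ushift (card Q) g), (Q, b)) * dl (R \<union> T, ushift (card Q) g) ((R, a), (T, f))"
    by (rule trans[OF sum_single[OF finI, of "(R \<union> T, ushift (card Q) g)"]])
       (use sub mem in \<open>auto simp: dl_ap split: if_splits\<close>)
  have R: "(\<Sum>p\<in>I. dl i (r, p) * dl p (s, q)) = dl (S, g) ((R, a), (T \<union> Q, g)) * dl (T \<union> Q, g) ((T, f), (Q, b))"
    by (rule trans[OF sum_single[OF finI, of "(T \<union> Q, g)"]])
       (use sub mem in \<open>auto simp: dl_ap split: if_splits\<close>)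
  show ?thesis
  proof (cases "R \<union> T \<union> Q = S \<and> R \<inter> T = {} \<and> R \<inter> Q = {} \<and> T \<inter> Q = {} \<and> b = g \<and> f = ushift (card Q) g \<and> a = ushift (card T) (ushift (card Q) g)")
    case True
    then have "card (T \<union> Q) = card T + card Q" "a = ushift (card (T \<union> Q)) g"
      using fin mem by (simp_all add: card_Un_disjoint ushift_ushift)
    moreover have "esign (R \<union> T) Q = (esign R Q * esign T Q :: 'k)" "esign R (T \<union> Q) = (esign R T * esign R Q :: 'k)"
      using True fin by (simp_all add: esign_Un_left esign_Un_right)
    ultimately show ?thesis
      unfolding L R using True sub by (auto simp: dl_ap Un_assoc)
  next
    case False
    have 1: "dl (S, g) ((R \<union> T, ushift (card Q) g), (Q, b)) * dl (R \<union> T, ushift (card Q) g) ((R, a), (T, f)) = 0"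
      using False sub by (auto simp: dl_ap)
    have 2: "dl (S, g) ((R, a), (T \<union> Q, g)) * dl (T \<union> Q, g) ((T, f), (Q, b)) = 0"
    proof (rule ccontr)
      assume "dl (S, g) ((R, a), (T \<union> Q, g)) * dl (T \<union> Q, g) ((T, f), (Q, b)) \<noteq> 0"
      then have *: "R \<union> (T \<union> Q) = S" "R \<inter> (T \<union> Q) = {}" "a = ushift (card (T \<union> Q)) g" "T \<inter> Q = {}" "b = g" "f = ushift (card Q) g"
        using sub by (auto simp: dl_ap split: if_splits)
      then have "card (T \<union> Q) = card T + card Q"
        using fin by (simp add: card_Un_disjoint)
      then have "a = ushift (card T) (ushift (card Q) g)"
        using * mem by (simp add: ushift_ushift)
      then show False
        using False * by blast
    qed
    show ?thesis
      unfolding L R 1 2 ..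
  qed
qed

abbreviation cou :: "nat set \<times> 'g \<Rightarrow> 'k" where
  "cou x \<equiv> if fst x = {} then 1 else 0"

lemma dl_counit:
  assumes "i \<in> I" "q \<in> I"
  shows "(\<Sum>p\<in>I. dl i (p, q) * cou p) = (if q = i then 1 else 0)"
    and "(\<Sum>p\<in>I. dl i (q, p) * cou p) = (if q = i then 1 else 0)"
proof -
  obtain S g Q b where [simp]: "i = (S, g)" "q = (Q, b)"
    and sub: "S \<subseteq> {..<n}" "Q \<subseteq> {..<n}" and mem: "g \<in> carrier G" "b \<in> carrier G"
    using assms by auto
  have "(\<Sum>p\<in>I. dl i (p, q) * cou p) = dl (S, g) (({}, ushift (card Q) g), (Q, b))"
    by (rule trans[OF sum_single[OF finI, of "({}, ushift (card Q) g)"]])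
       (use sub mem in \<open>auto simp: dl_ap split: if_splits\<close>)
  then show "(\<Sum>p\<in>I. dl i (p, q) * cou p) = (if q = i then 1 else 0)"
    using sub by (auto simp: dl_ap)
  have "(\<Sum>p\<in>I. dl i (q, p) * cou p) = dl (S, g) ((Q, b), ({}, g))"
    by (rule trans[OF sum_single[OF finI, of "({}, g)"]])
       (use sub mem in \<open>auto simp: dl_ap split: if_splits\<close>)
  then show "(\<Sum>p\<in>I. dl i (q, p) * cou p) = (if q = i then 1 else 0)"
    using sub by (auto simp: dl_ap)
qed

lemma counitc_eq: "counitc H = cou"
  by (auto simp: counitc_H fun_eq_iff)

lemma ordered_wdg_at_empty:
  fixes v :: "nat set \<times> 'g \<Rightarrow> 'k"
  assumes "finite S" "S \<noteq> {}"
  shows "opS wdg S v ({}, f) = 0" and "opS (comb wdg g) S v ({}, f) = 0"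
proof -
  have S: "S = insert (Min S) (S - {Min S})"
    using Min_in[OF assms] by blast
  have less: "\<And>s. s \<in> S - {Min S} \<Longrightarrow> Min S < s"
    using Min_le[OF assms(1)] by (metis DiffE insertI1 order_le_imp_less_or_eq)
  have "opS F S v = F (Min S) (opS F (S - {Min S}) v)" for F :: "nat \<Rightarrow> (nat set \<times> 'g \<Rightarrow> 'k) \<Rightarrow> _"
    by (subst S, rule opS_insert) (use assms less in auto)
  then show "opS wdg S v ({}, f) = 0" and "opS (comb wdg g) S v ({}, f) = 0"
    by (simp_all add: wdg_def comb_def sum_fun_ap)
qed

lemma mulB_zero_at_empty:
  assumes "S \<subseteq> {..<n}" "g \<in> carrier G" "T \<subseteq> {..<n}" "h \<in> carrier G"
  shows "mulB zero_form (bvec (S, g)) (bvec (T, h)) ({}, f) = (if S = {} \<and> T = {} \<and> f = g \<otimes> h then 1 else 0)"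
proof (cases "S = {}")
  case True
  have "opS (comb wdg g) T (bvec ({}, g \<otimes> h)) ({}, f) = 0" if "T \<noteq> {}"
    using that assms finite_sub by (intro ordered_wdg_at_empty(2)) auto
  then show ?thesis
    using True assms by (cases "T = {}") (simp_all add: mulB_bvec gam_bvec lam_zero_form bvec_ap)
next
  case False
  then show ?thesis
    using assms finite_sub by (simp add: mulB_bvec lam_zero_form ordered_wdg_at_empty)
qed

lemma sum_cou: "(\<Sum>r\<in>I. f r * cou r) = (\<Sum>g\<in>carrier G. f ({}, g))"
proof -
  have "(\<Sum>r\<in>I. f r * cou r) = (\<Sum>S\<in>Pow {..<n}. \<Sum>g\<in>carrier G. f (S, g) * cou (S, g))"
    by (rule sum_prod_split) (simp_all add: finite_G)
  also have "\<dots> = (\<Sum>S\<in>Pow {..<n}. if S = {} then \<Sum>g\<in>carrier G. f ({}, g) else 0)"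
    by (intro sum.cong refl) auto
  finally show ?thesis
    by simp
qed

text \<open>Coassociativity is checked on coefficients; associativity and multiplicativity of the coproduct
  are the case \<open>B = B' = 0\<close> of \<open>mulB_assoc\<close> and \<open>coproduct_mulB\<close>.\<close>

lemma fin_bialg_H: "fin_bialg H ({}, \<one>)"
proof
  show "finite (basis H)"
    using finI by (simp add: basis_H)
  fix i j k r :: "nat set \<times> 'g"
  {
    fix q s assume "i \<in> basis H" "q \<in> basis H" "r \<in> basis H" "s \<in> basis H"
    then show "(\<Sum>p\<in>basis H. comulc H i (p, q) * comulc H p (r, s)) = (\<Sum>p\<in>basis H. comulc H i (r, p) * comulc H p (s, q))"
      unfolding basis_H using dl_coassoc[of i q r s] by (simp only: comulc_eq cong: sum.cong)
  }
  {
    fix q assume "i \<in> basis H" "q \<in> basis H"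
    then show "(\<Sum>p\<in>basis H. comulc H i (p, q) * counitc H p) = (if q = i then 1 else 0)"
      unfolding basis_H counitc_eq using dl_counit(1)[of i q] by (simp only: comulc_eq)
  }
  {
    fix p assume "i \<in> basis H" "p \<in> basis H"
    then show "(\<Sum>q\<in>basis H. comulc H i (p, q) * counitc H q) = (if p = i then 1 else 0)"
      unfolding basis_H counitc_eq using dl_counit(2)[of i p] by (simp only: comulc_eq)
  }
  show "({}, \<one>) \<in> basis H"
    by (simp add: basis_H)
  show "unitv H = bvec ({}, \<one>)"
    by (rule unitv_H)
  show "counitc H ({}, \<one>) = 1"
    by (simp add: counitc_H)
  show "comulc H ({}, \<one>) (p, q) = (if p = ({}, \<one>) \<and> q = ({}, \<one>) then 1 else 0)"
    if "p \<in> basis H" "q \<in> basis H" for p q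
    by (simp add: comulc_eq dl_eq bvec_ap)
  show "structc H ({}, \<one>) j = bvec j" if "j \<in> basis H"
    using that by (simp add: structc_H structc_eq basis_H mulB_one_left good_zero vecs_bvec)
  show "structc H i ({}, \<one>) = bvec i" if "i \<in> basis H"
    using that by (simp add: structc_H structc_eq basis_H mulB_one_right good_zero vecs_bvec)
  assume ij: "i \<in> basis H" "j \<in> basis H"
  have m: "mulB zero_form (bvec i) (bvec j) \<in> vecs I" if "i \<in> I" "j \<in> I" for i j
    using that by (intro mulB_vecs good_zero vecs_bvec)
  show "structc H i j \<in> vecs (basis H)"
    using ij m by (simp add: structc_H structc_eq basis_H)
  {
    fix s assume k: "k \<in> basis H" "s \<in> basis H"
    note mem = ij[unfolded basis_H] k[unfolded basis_H]
    have "mulB zero_form (mulB zero_form (bvec i) (bvec j)) (bvec k) = (\<Sum>r\<in>I. sc (mulB zero_form (bvec i) (bvec j) r) (mulB zero_form (bvec r) (bvec k)))"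
      by (rule linop_expand[OF finI m linop_mulB_left]) (rule mem)+
    moreover have "mulB zero_form (bvec i) (mulB zero_form (bvec j) (bvec k)) = (\<Sum>r\<in>I. sc (mulB zero_form (bvec j) (bvec k) r) (mulB zero_form (bvec i) (bvec r)))"
      by (rule linop_expand[OF finI m linop_mulB_right]) (rule mem)+
    moreover have "mulB zero_form (mulB zero_form (bvec i) (bvec j)) (bvec k) = mulB zero_form (bvec i) (mulB zero_form (bvec j) (bvec k))"
      by (rule mulB_assoc[OF good_zero]) (rule vecs_bvec mem)+
    ultimately have "(\<Sum>r\<in>I. sc (mulB zero_form (bvec i) (bvec j) r) (mulB zero_form (bvec r) (bvec k))) s =
       (\<Sum>r\<in>I. sc (mulB zero_form (bvec j) (bvec k) r) (mulB zero_form (bvec i) (bvec r))) s"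
      by simp
    then show "(\<Sum>r\<in>basis H. structc H i j r * structc H r k s) = (\<Sum>r\<in>basis H. structc H j k r * structc H i r s)"
      unfolding basis_H structc_H using mem by (simp add: structc_eq sum_fun_ap cong: sum.cong)
  }
  obtain S g T h where [simp]: "i = (S, g)" "j = (T, h)" and sub: "S \<subseteq> {..<n}" "T \<subseteq> {..<n}"
    and mem: "g \<in> carrier G" "h \<in> carrier G"
    using ij by (auto simp: basis_H)
  {
    have "(\<Sum>r\<in>I. structc Sm i j r * cou r) = (\<Sum>f\<in>carrier G. structc Sm i j ({}, f))"
      by (rule sum_cou)
    also have "\<dots> = (\<Sum>f\<in>carrier G. if f = g \<otimes> h then (if S = {} \<and> T = {} then 1 else 0) else 0)"
      using sub mem by (intro sum.cong refl) (auto simp: structc_eq mulB_zero_at_empty)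
    also have "\<dots> = cou i * cou j"
      using mem finite_G by simp
    finally show "(\<Sum>r\<in>basis H. structc H i j r * counitc H r) = counitc H i * counitc H j"
      by (simp only: basis_H structc_H counitc_eq)
  }
  fix p q assume pq: "p \<in> basis H" "q \<in> basis H"
  have "(\<Sum>r\<in>I. structc Sm i j r * dl r (p, q)) = (\<Sum>P\<in>Pow S. \<Sum>Q\<in>Pow T. esign P (S - P) * esign Q (T - Q) *
      (mulB zero_form (bvec (P, ushift (card (S - P)) g)) (bvec (Q, ushift (card (T - Q)) h)) p *
       mulB zero_form (bvec (S - P, g)) (bvec (T - Q, h)) q))"
    using coproduct_mulB[OF good_zero good_zero sub mem] sub mem by (simp add: structc_eq)
  also have "\<dots> = (\<Sum>p1\<in>I. \<Sum>q1\<in>I. dl (S, g) (p1, q1) * (\<Sum>p2\<in>I. \<Sum>q2\<in>I. dl (T, h) (p2, q2) *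
      (mulB zero_form (bvec p1) (bvec p2) p * mulB zero_form (bvec q1) (bvec q2) q)))"
    unfolding dl_sum[OF sub(1) mem(1)] dl_sum[OF sub(2) mem(2)]
    by (simp add: sum_distrib_left mult.assoc)
  also have "\<dots> = (\<Sum>p1\<in>I. \<Sum>q1\<in>I. \<Sum>p2\<in>I. \<Sum>q2\<in>I.
         dl i (p1, q1) * dl j (p2, q2) * structc Sm p1 p2 p * structc Sm q1 q2 q)"
    by (simp add: structc_eq sum_distrib_left mult.assoc cong: sum.cong)
  finally show "(\<Sum>r\<in>basis H. structc H i j r * comulc H r (p, q)) = (\<Sum>p1\<in>basis H. \<Sum>q1\<in>basis H. \<Sum>p2\<in>basis H. \<Sum>q2\<in>basis H.
         comulc H i (p1, q1) * comulc H j (p2, q2) * structc H p1 p2 p * structc H q1 q2 q)"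
    unfolding basis_H structc_H using ij by (simp only: basis_H comulc_eq cong: sum.cong)
qed

sublocale fb: fin_bialg H "({}, \<one>)"
  by (rule fin_bialg_H)

notation fb.star1 (infixl \<open>\<star>\<^sub>1\<close> 70)
notation fb.star2 (infixl \<open>\<star>\<^sub>2\<close> 70)

lemma in_H: "(S, g) \<in> basis H \<longleftrightarrow> S \<subseteq> {..<n} \<and> g \<in> carrier G"
  by (simp add: basis_H)

lemma conv2_dl:
  assumes "S \<subseteq> {..<n}" "T \<subseteq> {..<n}" "g \<in> carrier G" "h \<in> carrier G"
  shows "(s \<star>\<^sub>2 t) ((S, g), (T, h)) = (\<Sum>P\<in>Pow S. \<Sum>Q\<in>Pow T. esign P (S - P) * esign Q (T - Q) *
    (s ((P, ushift (card (S - P)) g), (Q, ushift (card (T - Q)) h)) * t ((S - P, g), (T - Q, h))))"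
proof -
  have "(s \<star>\<^sub>2 t) ((S, g), (T, h)) = (\<Sum>p\<in>I. \<Sum>p'\<in>I. dl (S, g) (p, p') * (\<Sum>q\<in>I. \<Sum>q'\<in>I. dl (T, h) (q, q') *
      (s (p, q) * t (p', q'))))"
    using assms by (simp add: fb.C12.mult_tens_in in_H) (simp add: basis_H comulc_eq sum_distrib_left mult.assoc)
  then show ?thesis
    unfolding dl_sum[OF assms(1,3)] dl_sum[OF assms(2,4)]
    by (simp add: sum_distrib_left mult.assoc)
qed

lemma Pow_single: "Pow {i} = {{}, {i}}"
  by auto

lemma ushift_1: "ushift (Suc 0) g = u \<otimes> g"
  by (simp add: ushift_def)

lemma conv2_low:
  assumes "g \<in> carrier G" "h \<in> carrier G"
  shows "(s \<star>\<^sub>2 t) (({}, g), ({}, h)) = s (({}, g), ({}, h)) * t (({}, g), ({}, h))"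
    and "i < n \<Longrightarrow> (s \<star>\<^sub>2 t) (({}, g), ({i}, h)) =
      s (({}, g), ({}, u \<otimes> h)) * t (({}, g), ({i}, h)) + s (({}, g), ({i}, h)) * t (({}, g), ({}, h))"
    and "i < n \<Longrightarrow> (s \<star>\<^sub>2 t) (({i}, g), ({}, h)) =
      s (({}, u \<otimes> g), ({}, h)) * t (({i}, g), ({}, h)) + s (({i}, g), ({}, h)) * t (({}, g), ({}, h))"
    and "i < n \<Longrightarrow> j < n \<Longrightarrow> (s \<star>\<^sub>2 t) (({i}, g), ({j}, h)) =
      s (({}, u \<otimes> g), ({}, u \<otimes> h)) * t (({i}, g), ({j}, h)) +
      s (({}, u \<otimes> g), ({j}, h)) * t (({i}, g), ({}, h)) +
      s (({i}, g), ({}, u \<otimes> h)) * t (({}, g), ({j}, h)) +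
      s (({i}, g), ({j}, h)) * t (({}, g), ({}, h))"
  using assms by (simp_all add: conv2_dl Pow_single ushift_1 insert_Diff_if add_ac)

lemma structc_low:
  assumes "g \<in> carrier G" "h \<in> carrier G"
  shows "structc Sm ({}, g) ({}, h) = bvec ({}, g \<otimes> h)"
    and "i < n \<Longrightarrow> structc Sm ({i}, g) ({}, h) = bvec ({i}, g \<otimes> h)"
    and "i < n \<Longrightarrow> structc Sm ({}, g) ({i}, h) = (\<Sum>l<n. sc (\<rho> g $$ (l, i)) (bvec ({l}, g \<otimes> h)))"
    and "i < n \<Longrightarrow> j < n \<Longrightarrow> structc Sm ({i}, \<one>) ({j}, \<one>) = wdg i (wdg j (bvec ({}, \<one>)))"
proof -
  have op1: "opS F {i} w = F i w" for F :: "nat \<Rightarrow> (nat set \<times> 'g \<Rightarrow> 'k) \<Rightarrow> nat set \<times> 'g \<Rightarrow> 'k" and i w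
    using opS_insert[of "{}" i F w] by simp
  show "structc Sm ({}, g) ({}, h) = bvec ({}, g \<otimes> h)"
    using assms by (simp add: structc_eq mulB_bvec gam_bvec_empty)
  show "structc Sm ({i}, g) ({}, h) = bvec ({i}, g \<otimes> h)" if "i < n"
    using assms that by (simp add: structc_eq mulB_bvec gam_bvec_empty op1 lam_zero_form wdg_bvec)
  show "structc Sm ({}, g) ({i}, h) = (\<Sum>l<n. sc (\<rho> g $$ (l, i)) (bvec ({l}, g \<otimes> h)))" if "i < n"
    using assms that by (simp add: structc_eq mulB_bvec gam_bvec op1 lam_zero_form wdg_bvec comb_def)
  show "structc Sm ({i}, \<one>) ({j}, \<one>) = wdg i (wdg j (bvec ({}, \<one>)))" if "i < n" "j < n"
    using that by (simp add: structc_eq mulB_bvec gam_one good_zero vecs_bvec op1 lam_zero_form) (simp add: wdg_bvec)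
qed

text \<open>The last part expresses \<open>v\<^sub>i v\<^sub>j = - v\<^sub>j v\<^sub>i\<close>.\<close>

lemma pm_low:
  assumes "g \<in> carrier G" "h \<in> carrier G"
  shows "fb.pm f (({}, g), ({}, h)) = f ({}, g \<otimes> h)"
    and "i < n \<Longrightarrow> fb.pm f (({i}, g), ({}, h)) = f ({i}, g \<otimes> h)"
    and "i < n \<Longrightarrow> fb.pm f (({}, g), ({i}, h)) = (\<Sum>l<n. \<rho> g $$ (l, i) * f ({l}, g \<otimes> h))"
    and "i < n \<Longrightarrow> j < n \<Longrightarrow> fb.pm f (({i}, \<one>), ({j}, \<one>)) + fb.pm f (({j}, \<one>), ({i}, \<one>)) = 0"
proof -
  have pm: "fb.pm f (x, y) = (\<Sum>r\<in>I. structc Sm x y r * f r)" if "x \<in> I" "y \<in> I" for x y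
    using that by (simp add: fb.pm_ap basis_H structc_H)
  show "fb.pm f (({}, g), ({}, h)) = f ({}, g \<otimes> h)"
    using assms by (simp add: pm structc_low sum_bvec_left)
  show "fb.pm f (({i}, g), ({}, h)) = f ({i}, g \<otimes> h)" if "i < n"
    using assms that by (simp add: pm structc_low sum_bvec_left)
  show "fb.pm f (({}, g), ({i}, h)) = (\<Sum>l<n. \<rho> g $$ (l, i) * f ({l}, g \<otimes> h))" if "i < n"
  proof -
    have "fb.pm f (({}, g), ({i}, h)) = (\<Sum>r\<in>I. \<Sum>l<n. \<rho> g $$ (l, i) * (bvec ({l}, g \<otimes> h) r * f r))"
      using assms that by (simp add: pm structc_low sum_fun_ap sum_distrib_right mult.assoc)
    also have "\<dots> = (\<Sum>l<n. \<rho> g $$ (l, i) * (\<Sum>r\<in>I. bvec ({l}, g \<otimes> h) r * f r))"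
      by (subst sum.swap) (simp only: sum_distrib_left)
    also have "\<dots> = (\<Sum>l<n. \<rho> g $$ (l, i) * f ({l}, g \<otimes> h))"
      using assms by (intro sum.cong refl) (simp add: sum_bvec_left)
    finally show ?thesis .
  qed
  show "fb.pm f (({i}, \<one>), ({j}, \<one>)) + fb.pm f (({j}, \<one>), ({i}, \<one>)) = 0" if "i < n" "j < n"
  proof -
    have "fb.pm f (({i}, \<one>), ({j}, \<one>)) + fb.pm f (({j}, \<one>), ({i}, \<one>)) =
        (\<Sum>r\<in>I. (wdg i (wdg j (bvec ({}, \<one>))) + wdg j (wdg i (bvec ({}, \<one>)))) r * f r)"
      using that by (simp add: pm structc_low(4)[OF one_closed one_closed] sum.distrib distrib_right)
    then show ?thesis
      unfolding wdg_wdg by simp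
  qed
qed

lemma u_neq: "g \<in> carrier G \<Longrightarrow> u \<otimes> g \<noteq> g"
proof
  assume g: "g \<in> carrier G" "u \<otimes> g = g"
  then have "u = \<one>"
    using u_in r_cancel_one by blast
  then have "(1\<^sub>m n :: 'k mat) $$ (0, 0) = (- 1\<^sub>m n) $$ (0, 0)"
    using rho_u rho_one by simp
  then have "(2 :: 'k) = 0"
    using n_pos by (simp add: eq_neg_iff_add_eq_0)
  then show False
    using two by simp
qed

subsection \<open>Restrictions imposed by laziness\<close>

text \<open>Normalised two-cocycles on \<open>G\<close> that are inflated from \<open>G/U\<close>.\<close>

definition ucocycle :: "('g \<times> 'g \<Rightarrow> 'k) \<Rightarrow> bool" where
  "ucocycle c \<longleftrightarrow> (\<forall>g\<in>carrier G. c (\<one>, g) = 1 \<and> c (g, \<one>) = 1) \<and>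
     (\<forall>g\<in>carrier G. \<forall>h\<in>carrier G. c (g, h) \<noteq> 0 \<and> c (u \<otimes> g, h) = c (g, h) \<and> c (g, u \<otimes> h) = c (g, h) \<and>
       (\<forall>k\<in>carrier G. c (g, h) * c (g \<otimes> h, k) = c (h, k) * c (g, h \<otimes> k)))"

definition res :: "((nat set \<times> 'g) \<times> (nat set \<times> 'g) \<Rightarrow> 'k) \<Rightarrow> 'g \<times> 'g \<Rightarrow> 'k" where
  "res s = (\<lambda>(g, h). s (({}, g), ({}, h)))"

lemma lazy_at:
  assumes "s \<in> fb.Z" "x \<in> I" "y \<in> I"
  shows "(s \<star>\<^sub>2 fb.pm f) (x, y) = (fb.pm f \<star>\<^sub>2 s) (x, y)"
  using assms unfolding fb.Z_iff fb.lz_def by metis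

text \<open>The laziness condition for \<open>(g, v\<^sub>i h)\<close> and \<open>(v\<^sub>i g, h)\<close> has components in \<open>gh\<close>, \<open>u gh\<close> and \<open>V gh\<close>.
  Since \<open>gh\<close> and \<open>u gh\<close> are different, the component in \<open>gh\<close> yields the vanishing; the component
  in \<open>V gh\<close> yields the invariance under \<open>u\<close>.\<close>

lemma Z_mixed:
  assumes s: "s \<in> fb.Z" and g: "g \<in> carrier G" "h \<in> carrier G" and i: "i < n"
  shows "s (({}, g), ({i}, h)) = 0" "s (({i}, g), ({}, h)) = 0"
    "s (({}, u \<otimes> g), ({}, h)) = s (({}, g), ({}, h))"
    "s (({}, g), ({}, u \<otimes> h)) = s (({}, g), ({}, h))"
proof -
  have mem: "({}, g) \<in> I" "({}, h) \<in> I" "({i}, g) \<in> I" "({i}, h) \<in> I"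
    using g i by auto
  have ne: "g \<otimes> (u \<otimes> h) \<noteq> g \<otimes> h" "u \<otimes> g \<otimes> h \<noteq> g \<otimes> h"
    using g u_in u_neq[of h] u_neq[of "g \<otimes> h"] by (auto simp: m_assoc)
  note low = conv2_low pm_low
  show "s (({}, g), ({i}, h)) = 0"
    using lazy_at[OF s mem(1,4), of "bvec ({}, g \<otimes> h)"] g u_in i ne
    by (simp add: low bvec_ap)
  show "s (({i}, g), ({}, h)) = 0"
    using lazy_at[OF s mem(3,2), of "bvec ({}, g \<otimes> h)"] g u_in i ne
    by (simp add: low bvec_ap)
  show "s (({}, u \<otimes> g), ({}, h)) = s (({}, g), ({}, h))"
    using lazy_at[OF s mem(3,2), of "bvec ({i}, g \<otimes> h)"] g u_in i
    by (simp add: low bvec_ap)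
  \<comment> \<open>test with the functional that takes the value 1 on \<open>g v\<^sub>i h\<close>\<close>
  define f :: "nat set \<times> 'g \<Rightarrow> 'k" where
    "f = (\<lambda>(S, k). if k = g \<otimes> h \<and> S \<noteq> {} then \<rho> (inv g) $$ (i, Min S) else 0)"
  have "(\<Sum>l<n. \<rho> g $$ (l, i) * f ({l}, g \<otimes> h)) = (\<Sum>l<n. \<rho> (inv g) $$ (i, l) * \<rho> g $$ (l, i))"
    by (simp add: f_def mult.commute)
  also have "\<dots> = \<rho> (inv g \<otimes> g) $$ (i, i)"
    using g i by (intro rho_mult_entry[symmetric]) simp_all
  also have "\<dots> = 1"
    using g i by (simp add: rho_one)
  finally have f1: "(\<Sum>l<n. \<rho> g $$ (l, i) * f ({l}, g \<otimes> h)) = 1" .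
  show "s (({}, g), ({}, u \<otimes> h)) = s (({}, g), ({}, h))"
    using lazy_at[OF s mem(1,4), of f] g u_in i
    by (simp add: low f1) (simp add: f_def)
qed

lemma Z_one:
  assumes "s \<in> fb.Z" "g \<in> carrier G"
  shows "s (({}, \<one>), ({}, g)) = 1" "s (({}, g), ({}, \<one>)) = 1"
  using assms unfolding fb.Z_iff fb.nrm_def by (simp_all add: basis_H counitc_H)

text \<open>On grouplike elements convolution is pointwise and the cocycle condition is that of groups.\<close>

lemma res_ucocycle:
  assumes s: "s \<in> fb.Z"
  shows "ucocycle (res s)"
proof -
  obtain t where t: "s \<star>\<^sub>2 t = fb.e2"
    using fb.Z_has_inverse[OF s] by blast
  have nz: "s (({}, g), ({}, h)) \<noteq> 0" if "g \<in> carrier G" "h \<in> carrier G" for g h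
  proof -
    have "(s \<star>\<^sub>2 t) (({}, g), ({}, h)) = 1"
      unfolding t using that by (simp add: fb.C12.T.one_in in_H counitc_H)
    then show ?thesis
      using that by (auto simp: conv2_low)
  qed
  have "s (({}, g), ({}, h)) * s (({}, g \<otimes> h), ({}, k)) = s (({}, h), ({}, k)) * s (({}, g), ({}, h \<otimes> k))"
    if "g \<in> carrier G" "h \<in> carrier G" "k \<in> carrier G" for g h k
  proof -
    have mem: "({}, g) \<in> basis H" "({}, h) \<in> basis H" "({}, k) \<in> basis H"
      using that by (simp_all add: basis_H)
    have "(s \<star>\<^sub>2 fb.pm (\<lambda>r. s (r, ({}, k)))) (({}, g), ({}, h)) = (s \<star>\<^sub>2 fb.pm (\<lambda>r. s (({}, g), r))) (({}, h), ({}, k))"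
      using s mem unfolding fb.Z_iff fb.coc_def by blast
    then show ?thesis
      using that by (simp add: conv2_low pm_low)
  qed
  then show ?thesis
    using nz n_pos unfolding ucocycle_def res_def
    by (auto simp: Z_one[OF s] Z_mixed(3,4)[OF s _ _ n_pos])
qed

lemma Z_conv_low:
  assumes "s \<in> fb.Z" "t \<in> fb.Z" "g \<in> carrier G" "h \<in> carrier G" "i < n" "j < n"
  shows "res (s \<star>\<^sub>2 t) (g, h) = res s (g, h) * res t (g, h)"
    and "(s \<star>\<^sub>2 t) (({i}, \<one>), ({j}, \<one>)) = s (({i}, \<one>), ({j}, \<one>)) + t (({i}, \<one>), ({j}, \<one>))"
proof -
  show "res (s \<star>\<^sub>2 t) (g, h) = res s (g, h) * res t (g, h)"
    using assms by (simp add: res_def conv2_low)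
  have "s (({}, u), ({}, u)) = 1"
    using Z_mixed(3)[OF assms(1) one_closed u_in assms(5)] Z_one[OF assms(1)] u_in by simp
  then show "(s \<star>\<^sub>2 t) (({i}, \<one>), ({j}, \<one>)) = s (({i}, \<one>), ({j}, \<one>)) + t (({i}, \<one>), ({j}, \<one>))"
    using assms u_in by (simp add: conv2_low Z_mixed Z_one add_ac)
qed

subsection \<open>Values of coboundaries\<close>

lemma conv1_low:
  assumes "g \<in> carrier G"
  shows "(f \<star>\<^sub>1 f') ({}, g) = f ({}, g) * f' ({}, g)"
    and "i < n \<Longrightarrow> (f \<star>\<^sub>1 f') ({i}, g) = f ({}, u \<otimes> g) * f' ({i}, g) + f ({i}, g) * f' ({}, g)"
proof -
  have *: "(f \<star>\<^sub>1 f') (S, g) = (\<Sum>P\<in>Pow S. esign P (S - P) * (f (P, ushift (card (S - P)) g) * f' (S - P, g)))"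
    if "S \<subseteq> {..<n}" for S
    using that assms dl_sum[OF that assms, of "\<lambda>p q. f p * f' q"]
    by (simp add: fb.C1.mult_in in_H) (simp add: basis_H comulc_eq mult.assoc)
  show "(f \<star>\<^sub>1 f') ({}, g) = f ({}, g) * f' ({}, g)"
    by (simp add: *)
  show "(f \<star>\<^sub>1 f') ({i}, g) = f ({}, u \<otimes> g) * f' ({i}, g) + f ({i}, g) * f' ({}, g)" if "i < n"
    using that assms by (simp add: * Pow_single ushift_1 insert_Diff_if)
qed

text \<open>Commutation with the dual basis vectors of \<open>v\<^sub>i g\<close> and \<open>g\<close>, evaluated at \<open>v\<^sub>i g\<close>.\<close>

lemma central_low:
  assumes "fb.central f" "g \<in> carrier G" "i < n"
  shows "f ({}, u \<otimes> g) = f ({}, g)" "f ({i}, g) = 0"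
proof -
  have *: "(f \<star>\<^sub>1 f') ({i}, g) = (f' \<star>\<^sub>1 f) ({i}, g)" for f'
    using fb.centralD[OF assms(1), of f'] by simp
  show "f ({}, u \<otimes> g) = f ({}, g)"
    using *[of "bvec ({i}, g)"] assms by (simp add: conv1_low bvec_ap)
  show "f ({i}, g) = 0"
    using *[of "bvec ({}, g)"] assms u_neq[of g] by (simp add: conv1_low bvec_ap)
qed

text \<open>For central \<open>\<gamma>\<close> the value \<open>\<partial>(\<gamma>)(v\<^sub>i, v\<^sub>j)\<close> is \<open>\<gamma>\<^sup>-\<^sup>1(v\<^sub>i v\<^sub>j)\<close>, which is alternating in \<open>i\<close> and \<open>j\<close>.\<close>

lemma B2_low:
  assumes "s \<in> lazy_B2 H"
  shows "i < n \<Longrightarrow> j < n \<Longrightarrow> s (({i}, \<one>), ({j}, \<one>)) + s (({j}, \<one>), ({i}, \<one>)) = 0"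
    and "\<exists>\<chi>. \<chi> \<one> = 1 \<and> (\<forall>g\<in>carrier G. \<chi> g \<noteq> 0 \<and> \<chi> (u \<otimes> g) = \<chi> g) \<and>
      (\<forall>g\<in>carrier G. \<forall>h\<in>carrier G. res s (g, h) = \<chi> g * \<chi> h / \<chi> (g \<otimes> h))"
proof -
  obtain f where f: "f \<in> Units fb.C1.M" "f ({}, \<one>) = 1" "fb.central f"
    and s: "s = tens f f \<star>\<^sub>2 fb.pm (inv\<^bsub>fb.C1.M\<^esub> f)"
    using assms unfolding fb.B2_iff by blast
  define f' where "f' = inv\<^bsub>fb.C1.M\<^esub> f"
  have inv: "f ({}, g) * f' ({}, g) = 1" if "g \<in> carrier G" for g
  proof -
    have "(f \<star>\<^sub>1 f') ({}, g) = 1"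
      unfolding f'_def using that fb.inv1(3)[OF f(1)] by (simp add: fb.C1.one_in in_H counitc_H)
    then show ?thesis
      using that by (simp add: conv1_low)
  qed
  have fu: "f ({}, u) = 1"
    using central_low(1)[OF f(3) one_closed n_pos] f(2) u_in by simp
  show "s (({i}, \<one>), ({j}, \<one>)) + s (({j}, \<one>), ({i}, \<one>)) = 0" if "i < n" "j < n"
    using that u_in pm_low(4)[OF one_closed one_closed that, of f']
    by (simp add: s conv2_low fu f(2) central_low[OF f(3)] flip: f'_def)
  show "\<exists>\<chi>. \<chi> \<one> = 1 \<and> (\<forall>g\<in>carrier G. \<chi> g \<noteq> 0 \<and> \<chi> (u \<otimes> g) = \<chi> g) \<and>
      (\<forall>g\<in>carrier G. \<forall>h\<in>carrier G. res s (g, h) = \<chi> g * \<chi> h / \<chi> (g \<otimes> h))"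
  proof (intro exI[of _ "\<lambda>g. f ({}, g)"] conjI ballI)
    show "f ({}, \<one>) = 1" by (rule f(2))
    fix g assume g: "g \<in> carrier G"
    show "f ({}, g) \<noteq> 0"
      using inv[OF g] by auto
    show "f ({}, u \<otimes> g) = f ({}, g)"
      by (rule central_low[OF f(3) g n_pos])
    fix h assume h: "h \<in> carrier G"
    have "f' ({}, g \<otimes> h) = 1 / f ({}, g \<otimes> h)"
    proof -
      have *: "f ({}, g \<otimes> h) * f' ({}, g \<otimes> h) = 1"
        using g h by (intro inv) simp
      then have "f ({}, g \<otimes> h) \<noteq> 0"
        by auto
      with * show ?thesis
        by (simp add: nonzero_eq_divide_eq mult.commute)
    qed
    then show "res s (g, h) = f ({}, g) * f ({}, h) / f ({}, g \<otimes> h)"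
      using g h by (simp add: res_def s conv2_low pm_low flip: f'_def)
  qed
qed

section \<open>Construction of lazy cocycles\<close>

text \<open>The Clifford smash product with the group algebra twisted by \<open>c\<close>, and the functional obtained from
  it by applying the counit.\<close>

definition tp :: "(nat \<Rightarrow> nat \<Rightarrow> 'k) \<Rightarrow> ('g \<times> 'g \<Rightarrow> 'k) \<Rightarrow> nat set \<times> 'g \<Rightarrow> nat set \<times> 'g \<Rightarrow> nat set \<times> 'g \<Rightarrow> 'k" where
  "tp B c x y = sc (c (snd x, snd y)) (mulB B (bvec x) (bvec y))"

definition tc :: "(nat \<Rightarrow> nat \<Rightarrow> 'k) \<Rightarrow> ('g \<times> 'g \<Rightarrow> 'k) \<Rightarrow> (nat set \<times> 'g) \<times> (nat set \<times> 'g) \<Rightarrow> 'k" where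
  "tc B c = (\<lambda>(x, y). if x \<in> I \<and> y \<in> I then \<Sum>r\<in>I. tp B c x y r * cou r else 0)"

lemma tc_vecs: "tc B c \<in> vecs (I \<times> I)"
  by (rule vecsI) (auto simp: tc_def split: if_splits)

text \<open>The products are graded by \<open>G\<close>, so that they can be twisted by group cocycles.\<close>

lemma mulB_degree:
  assumes "good B" "S \<subseteq> {..<n}" "T \<subseteq> {..<n}" "g \<in> carrier G" "h \<in> carrier G"
  shows "mulB B (bvec (S, g)) (bvec (T, h)) \<in> vecs (Pow {..<n} \<times> {g \<otimes> h})"
proof -
  let ?W = "vecs (Pow {..<n} \<times> {g \<otimes> h}) :: (nat set \<times> 'g \<Rightarrow> 'k) set"
  have "opS (comb (lam n B) g) T (bvec ({}, g \<otimes> h)) \<in> ?W"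
    by (rule opS_closed) (use assms finite_sub in \<open>auto intro!: comb_vecs lam_vecs vecs_bvec\<close>)
  then have "opS (lam n B) S (opS (comb (lam n B) g) T (bvec ({}, g \<otimes> h))) \<in> ?W"
    by (rule opS_closed[rotated]) (use assms finite_sub in \<open>auto intro!: lam_vecs\<close>)
  then show ?thesis
    using assms by (simp add: mulB_bvec gam_bvec)
qed

lemma ucocycle_ushift:
  assumes "ucocycle c" "g \<in> carrier G" "h \<in> carrier G"
  shows "c (ushift k g, ushift l h) = c (g, h)"
  using assms by (simp add: ushift_def ucocycle_def u_in)

text \<open>The group elements in \<open>\<Delta>(v\<^sub>S g)\<close> are \<open>u\<^bsup>|Q|\<^esup> g\<close> and \<open>g\<close>, so \<open>U\<close>-invariance makes the factor from the
  group cocycles constant in the sum.\<close>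

lemma tp_compat:
  assumes "good B" "good B'" "ucocycle c" "ucocycle c'"
  shows "fb.compat (tp (\<lambda>i j. B i j + B' i j) (\<lambda>x. c x * c' x)) (tp B c) (tp B' c')"
  unfolding fb.compat_def basis_H
proof (intro ballI)
  fix i j p q assume ij: "i \<in> I" "j \<in> I" and pq: "p \<in> I" "q \<in> I"
  obtain S g T h where [simp]: "i = (S, g)" "j = (T, h)" and sub: "S \<subseteq> {..<n}" "T \<subseteq> {..<n}"
    and mem: "g \<in> carrier G" "h \<in> carrier G"
    using ij by auto
  have "(\<Sum>p1\<in>I. \<Sum>q1\<in>I. \<Sum>p2\<in>I. \<Sum>q2\<in>I. comulc H i (p1, q1) * comulc H j (p2, q2) * tp B c p1 p2 p * tp B' c' q1 q2 q) =
    (\<Sum>p1\<in>I. \<Sum>q1\<in>I. dl (S, g) (p1, q1) * (\<Sum>p2\<in>I. \<Sum>q2\<in>I. dl (T, h) (p2, q2) * (tp B c p1 p2 p * tp B' c' q1 q2 q)))"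
    using ij by (simp add: comulc_eq sum_distrib_left mult.assoc)
  also have "\<dots> = (\<Sum>P\<in>Pow S. esign P (S - P) * (\<Sum>Q\<in>Pow T. esign Q (T - Q) *
      (tp B c (P, ushift (card (S - P)) g) (Q, ushift (card (T - Q)) h) p * tp B' c' (S - P, g) (T - Q, h) q)))"
    unfolding dl_sum[OF sub(1) mem(1)] dl_sum[OF sub(2) mem(2)] ..
  also have "\<dots> = c (g, h) * c' (g, h) * (\<Sum>P\<in>Pow S. \<Sum>Q\<in>Pow T. esign P (S - P) * esign Q (T - Q) *
      (mulB B (bvec (P, ushift (card (S - P)) g)) (bvec (Q, ushift (card (T - Q)) h)) p *
       mulB B' (bvec (S - P, g)) (bvec (T - Q, h)) q))"
    by (simp add: tp_def ucocycle_ushift assms(3) mem sum_distrib_left mult_ac)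
  also have "\<dots> = c (g, h) * c' (g, h) * (\<Sum>r\<in>I. mulB (\<lambda>i j. B i j + B' i j) (bvec (S, g)) (bvec (T, h)) r * dl r (p, q))"
    unfolding coproduct_mulB[OF assms(1,2) sub mem] ..
  also have "\<dots> = (\<Sum>r\<in>I. tp (\<lambda>i j. B i j + B' i j) (\<lambda>x. c x * c' x) i j r * comulc H r (p, q))"
    by (simp add: tp_def comulc_eq sum_distrib_left mult.assoc)
  finally show "(\<Sum>r\<in>I. tp (\<lambda>i j. B i j + B' i j) (\<lambda>x. c x * c' x) i j r * comulc H r (p, q)) =
    (\<Sum>p1\<in>I. \<Sum>q1\<in>I. \<Sum>p2\<in>I. \<Sum>q2\<in>I. comulc H i (p1, q1) * comulc H j (p2, q2) * tp B c p1 p2 p * tp B' c' q1 q2 q)" ..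
qed

lemma tp_assoc:
  assumes B: "good B" and c: "ucocycle c" and mem: "x \<in> I" "y \<in> I" "z \<in> I"
  shows "(\<Sum>r\<in>I. tp B c x y r * tp B c r z t) = (\<Sum>r\<in>I. tp B c y z r * tp B c x r t)"
proof -
  obtain S g T h V k where [simp]: "x = (S, g)" "y = (T, h)" "z = (V, k)"
    and sub: "S \<subseteq> {..<n}" "T \<subseteq> {..<n}" "V \<subseteq> {..<n}"
    and G: "g \<in> carrier G" "h \<in> carrier G" "k \<in> carrier G"
    using mem by auto
  have v: "mulB B (bvec a) (bvec b) \<in> vecs I" if "a \<in> I" "b \<in> I" for a b
    using that by (intro mulB_vecs B vecs_bvec)
  have "(\<Sum>r\<in>I. tp B c x y r * tp B c r z t) =
      (\<Sum>r\<in>I. c (g, h) * c (g \<otimes> h, k) * (mulB B (bvec x) (bvec y) r * mulB B (bvec r) (bvec z) t))"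
  proof (intro sum.cong refl)
    fix r assume "r \<in> I"
    show "tp B c x y r * tp B c r z t = c (g, h) * c (g \<otimes> h, k) * (mulB B (bvec x) (bvec y) r * mulB B (bvec r) (bvec z) t)"
    proof (cases "snd r = g \<otimes> h")
      case True
      then show ?thesis
        by (simp add: tp_def)
    next
      case False
      then have "mulB B (bvec x) (bvec y) r = 0"
        using vecsD[OF mulB_degree[OF B sub(1,2) G(1,2)], of r] by (cases r) simp
      then show ?thesis
        by (simp add: tp_def)
    qed
  qed
  also have "\<dots> = c (g, h) * c (g \<otimes> h, k) * mulB B (mulB B (bvec x) (bvec y)) (bvec z) t"
    by (subst linop_expand[OF finI v[OF mem(1,2)] linop_mulB_left]) (simp add: sum_fun_ap sum_distrib_left)
  also have "c (g, h) * c (g \<otimes> h, k) = c (h, k) * c (g, h \<otimes> k)"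
    using c G by (simp add: ucocycle_def)
  also have "mulB B (mulB B (bvec x) (bvec y)) (bvec z) = mulB B (bvec x) (mulB B (bvec y) (bvec z))"
    by (rule mulB_assoc[OF B]) (rule vecs_bvec mem)+
  also have "c (h, k) * c (g, h \<otimes> k) * \<dots> t =
      (\<Sum>r\<in>I. c (h, k) * c (g, h \<otimes> k) * (mulB B (bvec y) (bvec z) r * mulB B (bvec x) (bvec r) t))"
    by (subst linop_expand[OF finI v[OF mem(2,3)] linop_mulB_right]) (simp add: sum_fun_ap sum_distrib_left)
  also have "\<dots> = (\<Sum>r\<in>I. tp B c y z r * tp B c x r t)"
  proof (intro sum.cong refl)
    fix r assume "r \<in> I"
    show "c (h, k) * c (g, h \<otimes> k) * (mulB B (bvec y) (bvec z) r * mulB B (bvec x) (bvec r) t) = tp B c y z r * tp B c x r t"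
    proof (cases "snd r = h \<otimes> k")
      case True
      then show ?thesis
        by (simp add: tp_def)
    next
      case False
      then have "mulB B (bvec y) (bvec z) r = 0"
        using vecsD[OF mulB_degree[OF B sub(2,3) G(2,3)], of r] by (cases r) simp
      then show ?thesis
        by (simp add: tp_def)
    qed
  qed
  finally show ?thesis .
qed

lemma ucocycle_one: "ucocycle (\<lambda>_. 1)"
  by (simp add: ucocycle_def)

lemma ucocycle_inverse: "ucocycle c \<Longrightarrow> ucocycle (\<lambda>x. inverse (c x))"
  unfolding ucocycle_def by (auto simp flip: inverse_mult_distrib)

lemma good_minus: "good B \<Longrightarrow> good (\<lambda>i j. - B i j)"
proof -
  assume B: "good B"
  have "(\<Sum>l<n. \<Sum>m<n. \<rho> g $$ (l, i) * \<rho> g $$ (m, j) * (- B l m + - B m l)) = - (\<Sum>l<n. \<Sum>m<n. \<rho> g $$ (l, i) * \<rho> g $$ (m, j) * (B l m + B m l))" for g i j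
    by (simp add: algebra_simps flip: sum_negf)
  with B show ?thesis
    by (simp add: good_def)
qed

text \<open>Applying the counit to the multiplicativity of the coproduct shows that the cocycles
  attached to \<open>B\<close> and \<open>c\<close> multiply like the pairs \<open>(B, c)\<close>.\<close>

lemma tc_conv:
  assumes "good B" "good B'" "ucocycle c" "ucocycle c'"
  shows "tc B c \<star>\<^sub>2 tc B' c' = tc (\<lambda>i j. B i j + B' i j) (\<lambda>x. c x * c' x)"
proof (rule fb.C12.T.conv_eqI[OF fb.C12.T.mult_vecs])
  show "tc (\<lambda>i j. B i j + B' i j) (\<lambda>x. c x * c' x) \<in> vecs (basis H \<times> basis H)"
    unfolding basis_H by (rule tc_vecs)
  fix z assume "z \<in> basis H \<times> basis H"
  then obtain x y where [simp]: "z = (x, y)" and x: "x \<in> basis H" and y: "y \<in> basis H"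
    by auto
  let ?P = "tp (\<lambda>i j. B i j + B' i j) (\<lambda>x. c x * c' x)"
  have 1: "?P x y q = (tc B c \<star>\<^sub>2 (\<lambda>(a, b). tp B' c' a b q)) (x, y)" if "q \<in> I" for q
    unfolding fb.compat_sum_left[OF tp_compat[OF assms] x y that[folded basis_H]]
    by (rule arg_cong[of _ _ "\<lambda>f. f (x, y)"], rule fb.conv2_cong) (simp_all add: tc_def basis_H counitc_eq)
  have "tc (\<lambda>i j. B i j + B' i j) (\<lambda>x. c x * c' x) (x, y) = (\<Sum>q\<in>I. ?P x y q * cou q)"
    using x y by (simp add: tc_def basis_H)
  also have "\<dots> = (\<Sum>q\<in>I. (tc B c \<star>\<^sub>2 (\<lambda>(a, b). tp B' c' a b q)) (x, y) * cou q)"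
    by (intro sum.cong refl) (simp only: 1)
  also have "\<dots> = (\<Sum>q\<in>I. \<Sum>p\<in>I. \<Sum>p'\<in>I. \<Sum>r\<in>I. \<Sum>r'\<in>I.
      comulc H x (p, p') * comulc H y (r, r') * tc B c (p, r) * (tp B' c' p' r' q * cou q))"
    unfolding fb.C12.mult_tens_in[OF x y] by (simp add: basis_H sum_distrib_right mult.assoc)
  also have "\<dots> = (\<Sum>p\<in>I. \<Sum>p'\<in>I. \<Sum>r\<in>I. \<Sum>r'\<in>I. \<Sum>q\<in>I.
      comulc H x (p, p') * comulc H y (r, r') * tc B c (p, r) * (tp B' c' p' r' q * cou q))"
    by (rule sum_rot5)
  also have "\<dots> = (\<Sum>p\<in>I. \<Sum>p'\<in>I. \<Sum>r\<in>I. \<Sum>r'\<in>I.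
      comulc H x (p, p') * comulc H y (r, r') * tc B c (p, r) * tc B' c' (p', r'))"
    by (intro sum.cong refl) (simp add: tc_def flip: sum_distrib_left)
  also have "\<dots> = (tc B c \<star>\<^sub>2 tc B' c') (x, y)"
    unfolding fb.C12.mult_tens_in[OF x y] by (simp add: basis_H)
  finally show "(tc B c \<star>\<^sub>2 tc B' c') z = tc (\<lambda>i j. B i j + B' i j) (\<lambda>x. c x * c' x) z"
    by simp
qed

lemma tc_low:
  assumes "good B" "g \<in> carrier G" "h \<in> carrier G"
  shows "tc B c (({}, g), ({}, h)) = c (g, h)"
    and "i < n \<Longrightarrow> j < n \<Longrightarrow> tc B c (({i}, \<one>), ({j}, \<one>)) = c (\<one>, \<one>) * B i j"
proof -
  have s: "(\<Sum>r\<in>I. bvec ({}, k) r * cou r) = 1" if "k \<in> carrier G" for k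
    using that by (simp add: sum_bvec_left)
  show "tc B c (({}, g), ({}, h)) = c (g, h)"
    using assms by (simp add: tc_def tp_def mulB_bvec gam_bvec_empty sum_distrib_left[symmetric] mult.assoc s)
  show "tc B c (({i}, \<one>), ({j}, \<one>)) = c (\<one>, \<one>) * B i j" if "i < n" "j < n"
  proof -
    have "mulB B (bvec ({i}, \<one>)) (bvec ({j}, \<one>)) = lam n B i (bvec ({j}, \<one>))"
      using that assms opS_insert[of "{}" i "lam n B"] by (simp add: mulB_bvec gam_one vecs_bvec)
    moreover have "(\<Sum>r\<in>I. lam n B i (bvec ({j}, \<one>)) r * cou r) = B i j"
    proof -
      have "(\<Sum>r\<in>I. lam n B i (bvec ({j}, \<one>)) r * cou r) = (\<Sum>k\<in>carrier G. lam n B i (bvec ({j}, \<one>)) ({}, k))"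
        by (rule sum_cou)
      also have "\<dots> = (\<Sum>k\<in>carrier G. if k = \<one> then B i j else 0)"
        by (intro sum.cong refl) (use that in \<open>auto simp: lam_bvec sg_insert bvec_ap\<close>)
      finally show ?thesis
        using finite_G by simp
    qed
    ultimately show ?thesis
      using that by (simp add: tc_def tp_def sum_distrib_left[symmetric] mult.assoc)
  qed
qed

lemma tc_zero: "tc zero_form (\<lambda>_. 1) = fb.e2"
proof (rule fb.C12.T.conv_eqI[OF _ fb.C12.T.one_vecs])
  show "tc zero_form (\<lambda>_. 1) \<in> vecs (basis H \<times> basis H)"
    unfolding basis_H by (rule tc_vecs)
  fix z assume "z \<in> basis H \<times> basis H"
  then obtain x y where [simp]: "z = (x, y)" and x: "x \<in> basis H" and y: "y \<in> basis H"
    by auto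
  then have "tc zero_form (\<lambda>_. 1) (x, y) = (\<Sum>r\<in>basis H. structc H x y r * counitc H r)"
    by (simp add: tc_def tp_def basis_H structc_H structc_eq counitc_eq)
  then show "tc zero_form (\<lambda>_. 1) z = fb.e2 z"
    using x y by (simp add: fb.counit_mult fb.C12.T.one_in)
qed

lemma tc_Z:
  assumes "good B" "ucocycle c"
  shows "tc B c \<in> fb.Z"
proof (rule fb.Z_of_product[where P = "tp B c"])
  have z: "structc Sm x y = tp zero_form (\<lambda>_. 1) x y" if "x \<in> I" "y \<in> I" for x y
    using that by (simp add: tp_def structc_eq)
  have "fb.compat (tp B c) (tp B c) (tp zero_form (\<lambda>_. 1))" "fb.compat (tp B c) (tp zero_form (\<lambda>_. 1)) (tp B c)"
    using tp_compat[OF assms(1) good_zero assms(2) ucocycle_one]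
      tp_compat[OF good_zero assms(1) ucocycle_one assms(2)] by simp_all
  then show "fb.compat (tp B c) (tp B c) (structc H)" "fb.compat (tp B c) (structc H) (tp B c)"
    unfolding fb.compat_def basis_H structc_H by (simp_all add: z cong: sum.cong)
  show "(\<Sum>x\<in>basis H. tp B c i j x * tp B c x k r) = (\<Sum>x\<in>basis H. tp B c j k x * tp B c i x r)"
    if "i \<in> basis H" "j \<in> basis H" "k \<in> basis H" for i j k r
    using that unfolding basis_H by (intro tp_assoc assms)
  show "tp B c ({}, \<one>) i = bvec i" "tp B c i ({}, \<one>) = bvec i" if "i \<in> basis H" for i
    using that assms unfolding basis_H
    by (auto simp: tp_def mulB_one_left mulB_one_right vecs_bvec ucocycle_def)
  show "tc B c (i, j) = (\<Sum>r\<in>basis H. tp B c i j r * counitc H r)" if "i \<in> basis H" "j \<in> basis H" for i j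
    using that by (simp add: tc_def basis_H counitc_eq)
  have nz: "c (g, h) \<noteq> 0" if "g \<in> carrier G" "h \<in> carrier G" for g h
    using assms that by (simp add: ucocycle_def)
  have e: "tc zero_form (\<lambda>x. c x * inverse (c x)) = fb.e2"
    unfolding tc_zero[symmetric] by (auto simp: tc_def tp_def fun_eq_iff nz)
  show "tc B c \<in> Units fb.C12.T.M"
  proof (rule fb.Units2I)
    show "tc B c \<in> vecs (basis H \<times> basis H)" "tc (\<lambda>i j. - B i j) (\<lambda>x. inverse (c x)) \<in> vecs (basis H \<times> basis H)"
      unfolding basis_H by (rule tc_vecs)+
    show "tc B c \<star>\<^sub>2 tc (\<lambda>i j. - B i j) (\<lambda>x. inverse (c x)) = fb.e2"
      using e by (simp add: tc_conv assms good_minus ucocycle_inverse)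
    show "tc (\<lambda>i j. - B i j) (\<lambda>x. inverse (c x)) \<star>\<^sub>2 tc B c = fb.e2"
      using e by (simp add: tc_conv assms good_minus ucocycle_inverse mult.commute)
  qed
qed

section \<open>Twisting the algebra by a lazy cocycle\<close>

text \<open>Left multiplication in the twisted algebra, as a linear operator.\<close>

definition twl :: "((nat set \<times> 'g) \<times> (nat set \<times> 'g) \<Rightarrow> 'k) \<Rightarrow> nat set \<times> 'g \<Rightarrow> (nat set \<times> 'g \<Rightarrow> 'k) \<Rightarrow> nat set \<times> 'g \<Rightarrow> 'k" where
  "twl s x b = (\<Sum>y\<in>I. sc (b y) (fb.tw s x y))"

lemma linop_twl: "linop (twl s x)"
  unfolding twl_def by (intro linop_setsum linop_coeff)

lemma twl_bvec: "y \<in> I \<Longrightarrow> twl s x (bvec y) = fb.tw s x y"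
proof -
  assume y: "y \<in> I"
  have "twl s x (bvec y) = (\<Sum>z\<in>I. if z = y then fb.tw s x y else 0)"
    unfolding twl_def by (intro sum.cong refl) (auto simp: bvec_def)
  then show ?thesis
    using y finI by simp
qed

lemma twl_vecs: "twl s x b \<in> vecs I"
  unfolding twl_def using fb.tw_vecs[unfolded basis_H] by (intro vecs_sum vecs_sc) blast

lemma tw_eq_bvec_sum:
  assumes "x \<in> I" "y \<in> I" "v \<in> vecs I" "\<And>r. r \<in> I \<Longrightarrow> (s \<star>\<^sub>2 fb.pm (bvec r)) (x, y) = v r"
  shows "fb.tw s x y = v"
proof
  fix r
  show "fb.tw s x y r = v r"
    using assms(4)[of r] vecsD[OF assms(3), of r] by (auto simp: fb.tw_def basis_H)
qed

lemma bvec_swap: "bvec x y = bvec y x"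
  by (simp add: bvec_def)

context
  fixes s
  assumes s: "s \<in> fb.Z"
begin

lemma twl_twl:
  assumes "x \<in> I" "y \<in> I" "b \<in> vecs I"
  shows "twl s x (twl s y b) = (\<Sum>r\<in>I. sc (fb.tw s x y r) (twl s r b))"
proof (rule linop_eqI[OF finI assms(3) linop_comp[OF linop_twl linop_twl]])
  show "linop (\<lambda>b. \<Sum>r\<in>I. sc (fb.tw s x y r) (twl s r b))"
    by (intro linop_setsum linop_scale linop_twl)
  fix z assume z: "z \<in> I"
  have coc: "fb.coc s"
    using s by (simp add: fb.Z_iff)
  have "twl s x (twl s y (bvec z)) = (\<Sum>r\<in>I. sc (fb.tw s y z r) (fb.tw s x r))"
    using z by (simp only: twl_bvec) (simp only: twl_def)
  also have "\<dots> = (\<Sum>r\<in>I. sc (fb.tw s x y r) (fb.tw s r z))"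
  proof (rule ext)
    fix t
    have *: "fb.tw s a b \<in> vecs I" for a b
      using fb.tw_vecs unfolding basis_H .
    show "(\<Sum>r\<in>I. sc (fb.tw s y z r) (fb.tw s x r)) t = (\<Sum>r\<in>I. sc (fb.tw s x y r) (fb.tw s r z)) t"
    proof (cases "t \<in> I")
      case True
      then show ?thesis
        using fb.tw_assoc[OF coc, unfolded basis_H, OF assms(1,2) z True] by (simp add: sum_fun_ap)
    next
      case False
      then show ?thesis
        by (simp add: sum_fun_ap vecsD[OF *])
    qed
  qed
  also have "\<dots> = (\<Sum>r\<in>I. sc (fb.tw s x y r) (twl s r (bvec z)))"
    using z by (simp only: twl_bvec)
  finally show "twl s x (twl s y (bvec z)) = (\<Sum>r\<in>I. sc (fb.tw s x y r) (twl s r (bvec z)))" .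
qed

abbreviation "form i j \<equiv> s (({i}, \<one>), ({j}, \<one>)) + s (({j}, \<one>), ({i}, \<one>))"
abbreviation "Tv i \<equiv> twl s ({i}, \<one>)"
abbreviation "Tg g \<equiv> twl s ({}, g)"

lemma s_u: "g \<in> carrier G \<Longrightarrow> s (({}, u), ({}, g)) = 1" "g \<in> carrier G \<Longrightarrow> s (({}, g), ({}, u)) = 1"
  using Z_mixed(3)[OF s one_closed _ n_pos, of g] Z_mixed(4)[OF s _ one_closed n_pos, of g] Z_one[OF s, of g] u_in
  by simp_all

text \<open>The relations between the generators of the twisted algebra.\<close>

lemma tw_low:
  assumes g: "g \<in> carrier G" "h \<in> carrier G"
  shows "fb.tw s ({}, g) ({}, h) = sc (res s (g, h)) (bvec ({}, g \<otimes> h))"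
    and "i < n \<Longrightarrow> fb.tw s ({}, g) ({i}, \<one>) = (\<Sum>l<n. sc (\<rho> g $$ (l, i)) (bvec ({l}, g)))"
    and "i < n \<Longrightarrow> fb.tw s ({i}, \<one>) ({}, g) = bvec ({i}, g)"
    and "i < n \<Longrightarrow> j < n \<Longrightarrow> fb.tw s ({i}, \<one>) ({j}, \<one>) + fb.tw s ({j}, \<one>) ({i}, \<one>) = sc (form i j) (bvec ({}, \<one>))"
proof -
  note mixed = Z_mixed[OF s]
  show "fb.tw s ({}, g) ({}, h) = sc (res s (g, h)) (bvec ({}, g \<otimes> h))"
    using g by (intro tw_eq_bvec_sum vecs_sc vecs_bvec) (simp_all add: conv2_low pm_low res_def bvec_swap)
  show "fb.tw s ({}, g) ({i}, \<one>) = (\<Sum>l<n. sc (\<rho> g $$ (l, i)) (bvec ({l}, g)))" if "i < n"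
    using g that
    by (intro tw_eq_bvec_sum vecs_sum vecs_sc vecs_bvec)
       (simp_all add: conv2_low pm_low mixed sum_fun_ap s_u u_in Z_one[OF s], simp add: bvec_swap)
  show "fb.tw s ({i}, \<one>) ({}, g) = bvec ({i}, g)" if "i < n"
    using g that
    by (intro tw_eq_bvec_sum vecs_bvec) (simp_all add: conv2_low pm_low mixed s_u u_in, simp add: bvec_swap)
  show "fb.tw s ({i}, \<one>) ({j}, \<one>) + fb.tw s ({j}, \<one>) ({i}, \<one>) = sc (form i j) (bvec ({}, \<one>))" if ij: "i < n" "j < n"
  proof
    fix r
    have *: "fb.tw s ({i}, \<one>) ({j}, \<one>) r = (if r \<in> I then fb.pm (bvec r) (({i}, \<one>), ({j}, \<one>)) + s (({i}, \<one>), ({j}, \<one>)) * bvec r ({}, \<one>) else 0)"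
      if "i < n" "j < n" for i j
      using that by (simp add: fb.tw_def basis_H[symmetric]) (simp add: conv2_low pm_low mixed s_u u_in)
    have "fb.pm (bvec r) (({i}, \<one>), ({j}, \<one>)) + fb.pm (bvec r) (({j}, \<one>), ({i}, \<one>)) = 0"
      by (rule pm_low(4)[OF one_closed one_closed ij])
    then have "fb.pm (bvec r) (({i}, \<one>), ({j}, \<one>)) = - fb.pm (bvec r) (({j}, \<one>), ({i}, \<one>))"
      by (simp add: eq_neg_iff_add_eq_0)
    then show "(fb.tw s ({i}, \<one>) ({j}, \<one>) + fb.tw s ({j}, \<one>) ({i}, \<one>)) r = sc (form i j) (bvec ({}, \<one>)) r"
      using ij by (auto simp: * algebra_simps bvec_swap[of r]) (auto simp: bvec_def)
  qed
qed

lemma Tg_one: "b \<in> vecs I \<Longrightarrow> Tg \<one> b = b"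
proof (rule linop_eqI[OF finI _ linop_twl linop_id])
  fix y assume y: "y \<in> I"
  have nrm: "fb.nrm s"
    using s by (simp add: fb.Z_iff)
  have "(s \<star>\<^sub>2 fb.pm (bvec r)) (({}, \<one>), y) = bvec y r" if r: "r \<in> I" for r
  proof -
    have "fb.e1 \<star>\<^sub>1 (\<lambda>p. fb.pm (bvec r) (({}, \<one>), p)) = fb.e1 \<star>\<^sub>1 bvec r"
      by (rule fb.conv1_cong) (simp_all add: fb.pm_at_one)
    also have "\<dots> = bvec r"
      using r by (intro fb.C1.one_conv vecs_bvec) (simp add: basis_H)
    finally show ?thesis
      using y by (simp add: fb.conv2_at_one basis_H[symmetric] fb.nrm_slices[OF nrm]) (simp add: bvec_swap)
  qed
  then have "fb.tw s ({}, \<one>) y = bvec y"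
    using y by (intro tw_eq_bvec_sum vecs_bvec) auto
  then show "Tg \<one> (bvec y) = bvec y"
    using y by (simp add: twl_bvec)
qed

lemma sum_bvec_sc: "x \<in> I \<Longrightarrow> (\<Sum>r\<in>I. sc (bvec x r) (F r)) = F x"
proof -
  assume x: "x \<in> I"
  have "(\<Sum>r\<in>I. sc (bvec x r) (F r)) = (\<Sum>r\<in>I. if r = x then F x else 0)"
    by (intro sum.cong refl) (auto simp: bvec_def)
  then show ?thesis
    using x finI by simp
qed

lemma Tv_Tg:
  assumes "g \<in> carrier G" "i < n" "b \<in> vecs I"
  shows "Tv i (Tg g b) = twl s ({i}, g) b"
  using assms sum_bvec_sc[of "({i}, g)" "\<lambda>r. twl s r b"] by (simp add: twl_twl tw_low)

lemma Tg_Tv: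
  assumes "g \<in> carrier G" "i < n" "b \<in> vecs I"
  shows "Tg g (Tv i b) = comb Tv g i (Tg g b)"
proof -
  have "Tg g (Tv i b) = (\<Sum>r\<in>I. \<Sum>l<n. sc (\<rho> g $$ (l, i)) (sc (bvec ({l}, g) r) (twl s r b)))"
    using assms by (simp add: twl_twl tw_low sum_fun_ap sc_sum_left)
  also have "\<dots> = (\<Sum>l<n. sc (\<rho> g $$ (l, i)) (\<Sum>r\<in>I. sc (bvec ({l}, g) r) (twl s r b)))"
    by (subst sum.swap) (simp only: sc_sum)
  also have "\<dots> = comb Tv g i (Tg g b)"
    unfolding comb_def using assms
    by (intro sum.cong refl arg_cong2[where f = sc]) (subst sum_bvec_sc, auto simp: Tv_Tg)
  finally show ?thesis .
qed

lemma Tv_rel: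
  assumes "i < n" "j < n" "b \<in> vecs I"
  shows "Tv i (Tv j b) + Tv j (Tv i b) = sc (form i j) b"
proof -
  have "Tv i (Tv j b) + Tv j (Tv i b) = (\<Sum>r\<in>I. sc ((fb.tw s ({i}, \<one>) ({j}, \<one>) + fb.tw s ({j}, \<one>) ({i}, \<one>)) r) (twl s r b))"
    using assms by (simp add: twl_twl sum.distrib sc_add_left)
  also have "\<dots> = sc (form i j) (\<Sum>r\<in>I. sc (bvec ({}, \<one>) r) (twl s r b))"
    unfolding tw_low(4)[OF one_closed one_closed assms(1,2)] sc_ap sc_sum sc_sc ..
  also have "(\<Sum>r\<in>I. sc (bvec ({}, \<one>) r) (twl s r b)) = b"
    by (subst sum_bvec_sc) (simp_all add: Tg_one assms)
  finally show ?thesis .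
qed

text \<open>Conjugation with \<open>g\<close> preserves the anticommutators of vectors.\<close>

lemma form_invariant:
  assumes "g \<in> carrier G" "i < n" "j < n"
  shows "(\<Sum>l<n. \<Sum>m<n. \<rho> g $$ (l, i) * \<rho> g $$ (m, j) * form l m) = form i j"
proof -
  let ?b = "bvec ({}, \<one>) :: nat set \<times> 'g \<Rightarrow> 'k"
  have b: "?b \<in> vecs I"
    by (simp add: bvec_empty_vecs)
  have Tgb: "Tg g ?b = bvec ({}, g)"
    using assms Z_one[OF s assms(1)] by (simp add: twl_bvec tw_low res_def)
  have "sc (form i j) (Tg g ?b) = Tg g (Tv i (Tv j ?b) + Tv j (Tv i ?b))"
    by (simp only: Tv_rel[OF assms(2,3) b] linop_sc[OF linop_twl])
  also have "\<dots> = comb Tv g i (comb Tv g j (Tg g ?b)) + comb Tv g j (comb Tv g i (Tg g ?b))"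
    by (simp only: linop_add[OF linop_twl] Tg_Tv[OF assms(1)] assms twl_vecs b)
  also have "\<dots> = sc (\<Sum>l<n. \<Sum>m<n. \<rho> g $$ (l, i) * \<rho> g $$ (m, j) * form l m) (Tg g ?b)"
    by (rule comb_anticommutator) (simp_all only: linop_twl Tv_rel twl_vecs)
  finally have "sc (form i j) (Tg g ?b) ({}, g) = sc (\<Sum>l<n. \<Sum>m<n. \<rho> g $$ (l, i) * \<rho> g $$ (m, j) * form l m) (Tg g ?b) ({}, g)"
    by simp
  then show ?thesis
    unfolding Tgb by simp
qed

end

section \<open>Trivialising lazy cocycles\<close>

text \<open>The coproduct as a linear map.\<close>

definition Dlin :: "(nat set \<times> 'g \<Rightarrow> 'k) \<Rightarrow> (nat set \<times> 'g) \<times> (nat set \<times> 'g) \<Rightarrow> 'k" where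
  "Dlin v = (\<Sum>r\<in>I. sc (v r) (dl r))"

lemma linop_Dlin: "linop Dlin"
proof -
  have "linop (\<lambda>v. \<Sum>r\<in>I. sc (v r) (dl r))"
    by (intro linop_setsum linop_coeff)
  then show ?thesis
    by (simp add: Dlin_def[abs_def])
qed

lemma Dlin_bvec: "x \<in> I \<Longrightarrow> Dlin (bvec x) = dl x"
proof -
  assume x: "x \<in> I"
  have "Dlin (bvec x) = (\<Sum>r\<in>I. if r = x then dl x else 0)"
    unfolding Dlin_def by (intro sum.cong refl) (auto simp: bvec_def)
  then show ?thesis
    using x finI by simp
qed

lemma dl_expand: "x \<in> I \<Longrightarrow> dl x = (\<Sum>p\<in>I. \<Sum>q\<in>I. sc (dl x (p, q)) (tens (bvec p) (bvec q)))"
proof -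
  assume "x \<in> I"
  then have "dl x = (\<Sum>z\<in>I \<times> I. sc (dl x z) (bvec z))"
    by (intro vec_expand dl_vecs finite_cartesian_product finI)
  then show ?thesis
    by (simp add: sum_prod_split finI bvec_pair)
qed

text \<open>A product that is compatible with the coproduct makes left multiplication by \<open>v\<^sub>i\<close> act on
  tensors through \<open>v\<^sub>i \<otimes> 1 + u \<otimes> v\<^sub>i\<close>.\<close>

lemma Dlin_mult_generator:
  assumes compat: "fb.compat P P1 P2" and i: "i < n"
    and lin: "linop f" "linop f1" "linop f1u" "linop f2"
    and f: "\<And>y. y \<in> I \<Longrightarrow> f (bvec y) = P ({i}, \<one>) y"
    and f1: "\<And>y. y \<in> I \<Longrightarrow> f1 (bvec y) = P1 ({i}, \<one>) y"
    and f1u: "\<And>y. y \<in> I \<Longrightarrow> f1u (bvec y) = P1 ({}, u) y"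
    and f2: "\<And>y. y \<in> I \<Longrightarrow> f2 (bvec y) = P2 ({i}, \<one>) y"
    and P2: "\<And>y. y \<in> I \<Longrightarrow> P2 ({}, \<one>) y = bvec y"
    and out: "\<And>x y. x \<in> I \<Longrightarrow> y \<in> I \<Longrightarrow> P1 x y \<in> vecs I" "\<And>x y. x \<in> I \<Longrightarrow> y \<in> I \<Longrightarrow> P2 x y \<in> vecs I"
    and b: "b \<in> vecs I"
  shows "Dlin (f b) = on_left f1 (Dlin b) + on_left f1u (on_right f2 (Dlin b))"
proof (rule linop_eqI[OF finI b linop_comp[OF linop_Dlin lin(1)]])
  let ?D = "\<lambda>w. on_left f1 w + on_left f1u (on_right f2 w)"
  have linD: "linop ?D"
    by (intro linop_plus linop_comp[OF linop_on_left linop_on_right] linop_on_left lin)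
  show "linop (\<lambda>b. ?D (Dlin b))"
    by (rule linop_comp[OF linD linop_Dlin])
  fix y assume y: "y \<in> I"
  have v: "({i}, \<one>) \<in> I"
    using i by simp
  have D: "?D (tens (bvec p) (bvec q)) = tens (P1 ({i}, \<one>) p) (bvec q) + tens (P1 ({}, u) p) (P2 ({i}, \<one>) q)"
    if "p \<in> I" "q \<in> I" for p q
    using that by (simp only: on_left_tens on_right_tens lin f1 f1u f2)
  have "?D (dl y) = (\<Sum>p\<in>I. \<Sum>q\<in>I. sc (dl y (p, q)) (tens (P1 ({i}, \<one>) p) (bvec q) + tens (P1 ({}, u) p) (P2 ({i}, \<one>) q)))"
    using arg_cong[OF dl_expand[OF y], of ?D]
    by (simp only: linop_sum[OF linD] linop_sc[OF linD] D cong: sum.cong)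
  moreover have "Dlin (P ({i}, \<one>) y) (r, t) =
     (\<Sum>p\<in>I. \<Sum>q\<in>I. sc (dl y (p, q)) (tens (P1 ({i}, \<one>) p) (bvec q) + tens (P1 ({}, u) p) (P2 ({i}, \<one>) q))) (r, t)" for r t
  proof (cases "r \<in> I \<and> t \<in> I")
    case True
    then have rt: "r \<in> I" "t \<in> I"
      by auto
    have "Dlin (P ({i}, \<one>) y) (r, t) = (\<Sum>z\<in>I. P ({i}, \<one>) y z * comulc H z (r, t))"
      by (simp add: Dlin_def sum_fun_ap comulc_eq)
    also have "\<dots> = (\<Sum>p1\<in>I. \<Sum>q1\<in>I. \<Sum>p2\<in>I. \<Sum>q2\<in>I.
        comulc H ({i}, \<one>) (p1, q1) * comulc H y (p2, q2) * P1 p1 p2 r * P2 q1 q2 t)"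
      using compat v y rt unfolding fb.compat_def basis_H by blast
    also have "\<dots> = (\<Sum>p1\<in>I. \<Sum>q1\<in>I. dl ({i}, \<one>) (p1, q1) * (\<Sum>p2\<in>I. \<Sum>q2\<in>I. dl y (p2, q2) * (P1 p1 p2 r * P2 q1 q2 t)))"
      using v y by (simp add: comulc_eq sum_distrib_left mult.assoc)
    also have "\<dots> = (\<Sum>p2\<in>I. \<Sum>q2\<in>I. dl y (p2, q2) * (P1 ({}, u) p2 r * P2 ({i}, \<one>) q2 t)) +
        (\<Sum>p2\<in>I. \<Sum>q2\<in>I. dl y (p2, q2) * (P1 ({i}, \<one>) p2 r * P2 ({}, \<one>) q2 t))"
      using i u_in by (subst dl_sum) (simp_all add: Pow_single ushift_1 insert_Diff_if)
    also have "\<dots> = (\<Sum>p\<in>I. \<Sum>q\<in>I. sc (dl y (p, q)) (tens (P1 ({i}, \<one>) p) (bvec q) + tens (P1 ({}, u) p) (P2 ({i}, \<one>) q))) (r, t)"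
      by (simp add: sum_fun_ap P2 distrib_left sum.distrib add.commute cong: sum.cong)
    finally show ?thesis .
  next
    case False
    have "dl z (r, t) = 0" if "z \<in> I" for z
      using vecsD[OF dl_vecs[OF that], of "(r, t)"] False by auto
    moreover have "(tens (P1 ({i}, \<one>) p) (bvec q) + tens (P1 ({}, u) p) (P2 ({i}, \<one>) q)) (r, t) = 0"
      if "p \<in> I" "q \<in> I" for p q
    proof -
      have "P1 ({i}, \<one>) p \<in> vecs I" "P1 ({}, u) p \<in> vecs I" "P2 ({i}, \<one>) q \<in> vecs I" "bvec q \<in> vecs I"
        using that v u_in by (auto intro!: out vecs_bvec)
      then have "tens (P1 ({i}, \<one>) p) (bvec q) + tens (P1 ({}, u) p) (P2 ({i}, \<one>) q) \<in> vecs (I \<times> I)"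
        by (intro vecs_add vecs_tens)
      from vecsD[OF this, of "(r, t)"] False show ?thesis
        by blast
    qed
    ultimately show ?thesis
      by (simp add: Dlin_def sum_fun_ap)
  qed
  ultimately have "Dlin (P ({i}, \<one>) y) = ?D (dl y)"
    by (auto simp only: fun_eq_iff split_paired_all)
  then show "Dlin (f (bvec y)) = ?D (Dlin (bvec y))"
    by (simp only: f[OF y] Dlin_bvec[OF y])
qed

text \<open>The element \<open>\<phi>(v\<^sub>S g)\<close> is the ordered product of the same generators in the twisted algebra,
  rescaled by \<open>\<chi>\<close>.\<close>

context
  fixes s \<chi>
  assumes s: "s \<in> fb.Z"
    and form0: "\<And>i j. i < n \<Longrightarrow> j < n \<Longrightarrow> s (({i}, \<one>), ({j}, \<one>)) + s (({j}, \<one>), ({i}, \<one>)) = 0"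
    and chi1: "\<chi> \<one> = 1"
    and chi0: "\<And>g. g \<in> carrier G \<Longrightarrow> \<chi> g \<noteq> 0"
    and chiu: "\<And>g. g \<in> carrier G \<Longrightarrow> \<chi> (u \<otimes> g) = \<chi> g"
    and chi: "\<And>g h. g \<in> carrier G \<Longrightarrow> h \<in> carrier G \<Longrightarrow> res s (g, h) = \<chi> g * \<chi> h / \<chi> (g \<otimes> h)"
begin

abbreviation "tv i \<equiv> twl s ({i}, \<one>)"
abbreviation "wg g \<equiv> sc (inverse (\<chi> g)) (bvec ({}, g))"
abbreviation "eg g b \<equiv> sc (inverse (\<chi> g)) (twl s ({}, g) b)"

lemma twl_grouplike: "g \<in> carrier G \<Longrightarrow> h \<in> carrier G \<Longrightarrow> twl s ({}, g) (bvec ({}, h)) = sc (res s (g, h)) (bvec ({}, g \<otimes> h))"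
  by (simp add: twl_bvec tw_low[OF s])

interpretation tr: clifford_rep G u n \<rho> zero_form tv I eg wg
proof
  fix i j and v :: "nat set \<times> 'g \<Rightarrow> 'k"
  show "tv i (tv j v) + tv j (tv i v) = sc (0 + 0) v" if "i < n" "j < n" "v \<in> vecs I"
    using Tv_rel[OF s that] form0 that by simp
next
  fix g i and v :: "nat set \<times> 'g \<Rightarrow> 'k"
  assume "g \<in> carrier G" "i < n" "v \<in> vecs I"
  then show "eg g (tv i v) = comb tv g i (eg g v)"
    by (simp add: Tg_Tv[OF s] comb_def linop_sc[OF linop_twl] sc_sum mult.commute)
next
  fix g h assume "g \<in> carrier G" "h \<in> carrier G"
  then show "eg g (wg h) = wg (g \<otimes> h)"
    by (simp add: linop_sc[OF linop_twl] twl_grouplike chi chi0 field_simps)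
qed (auto simp: linop_twl twl_vecs good_zero two intro: linop_scale vecs_sc bvec_empty_vecs)

abbreviation "phi \<equiv> tr.L"

lemma phi_bvec: "S \<subseteq> {..<n} \<Longrightarrow> g \<in> carrier G \<Longrightarrow> phi (bvec (S, g)) = opS tv S (wg g)"
  by (rule lift_bvec[OF finI]) simp

lemma phi_vecs: "x \<in> I \<Longrightarrow> phi (bvec x) \<in> vecs I"
  using tr.w_vecs by (cases x) (auto simp: phi_bvec intro!: tr.ordered_closed)

lemma twl_u_pow: "g \<in> carrier G \<Longrightarrow> (twl s ({}, u) ^^ k) (wg g) = wg (ushift k g)"
proof (induction k)
  case (Suc k)
  have "\<chi> (ushift (Suc k) g) = \<chi> (ushift k g)"
    using Suc(2) by (simp add: ushift_Suc chiu)
  moreover have "res s (u, ushift k g) = 1"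
    using s_u(1)[OF s] Suc(2) by (simp add: res_def)
  ultimately have "twl s ({}, u) (wg (ushift k g)) = wg (ushift (Suc k) g)"
    using Suc(2) by (simp only: linop_sc[OF linop_twl] twl_grouplike u_in ushift_in ushift_Suc sc_one)
  then show ?case
    by (simp only: funpow.simps comp_apply Suc(1)[OF Suc(2)])
qed simp

lemma twl_u_anti: "i < n \<Longrightarrow> a \<in> vecs I \<Longrightarrow> twl s ({}, u) (tv i a) = - tv i (twl s ({}, u) a)"
  by (simp add: Tg_Tv[OF s] u_in comb_u)

text \<open>The coproduct of \<open>\<phi>(v\<^sub>S g)\<close> is an ordered product of the operators of \<open>v\<^sub>i \<otimes> 1 + u \<otimes> v\<^sub>i\<close>, where the
  twisted product can be put into either tensor factor by right or left colinearity. The binomial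
  theorem turns this into \<open>(\<phi> \<otimes> id) \<Delta>\<close> and \<open>(id \<otimes> \<phi>) \<Delta>\<close>.\<close>

lemma Dlin_phi:
  assumes S: "S \<subseteq> {..<n}" and g: "g \<in> carrier G"
  shows "Dlin (phi (bvec (S, g))) = (\<Sum>P\<in>Pow S. sc (esign P (S - P)) (tens (phi (bvec (P, ushift (card (S - P)) g))) (bvec (S - P, g))))"
    and "Dlin (phi (bvec (S, g))) = (\<Sum>P\<in>Pow S. sc (esign P (S - P)) (tens (bvec (P, ushift (card (S - P)) g)) (phi (bvec (S - P, g)))))"
proof -
  have fin: "finite S"
    using S by (rule finite_sub)
  have lz: "fb.lz s"
    using s by (simp add: fb.Z_iff)
  have tw: "fb.tw s x y \<in> vecs I" and c: "x \<in> I \<Longrightarrow> y \<in> I \<Longrightarrow> structc H x y \<in> vecs I" for x y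
    using fb.tw_vecs fb.structc_vecs unfolding basis_H by blast+
  have wdg_c: "wdg i (bvec y) = structc H ({i}, \<one>) y" if "i < n" "y \<in> I" for i y
    using that amul_Sm_generators(3)[of "bvec y" i] finI
    by (simp add: vecs_bvec structc_H amul_bvec_bvec basis_Sm)
  have gam_c: "gam zero_form u (bvec y) = structc H ({}, u) y" if "y \<in> I" for y
    using that amul_Sm_generators(2)[of "bvec y"] finI u_in
    by (simp add: vecs_bvec structc_H amul_bvec_bvec basis_Sm)
  have one_c: "structc H ({}, \<one>) y = bvec y" if "y \<in> I" for y
    using fb.one_structc that unfolding basis_H by blast
  have one_t: "fb.tw s ({}, \<one>) y = bvec y" if "y \<in> I" for y
    using Tg_one[OF s, of "bvec y"] that by (simp add: twl_bvec vecs_bvec)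
  let ?R = "\<lambda>i w. on_left (tv i) w + on_left (twl s ({}, u)) (on_right (wdg i) w)"
  let ?L = "\<lambda>i w. on_left (wdg i) w + on_left (gam zero_form u) (on_right (tv i) w)"
  have R: "Dlin (tv i b) = ?R i (Dlin b)" if "i < n" "b \<in> vecs I" for i b
    by (rule Dlin_mult_generator[OF fb.tw_compat_right[of s]])
       (use that u_in in \<open>auto simp: linop_twl linop_wdg twl_bvec wdg_c one_c tw c\<close>)
  have L: "Dlin (tv i b) = ?L i (Dlin b)" if "i < n" "b \<in> vecs I" for i b
    by (rule Dlin_mult_generator[OF fb.tw_compat_left[OF lz]])
       (use that u_in in \<open>auto simp: linop_twl linop_wdg linop_gam twl_bvec wdg_c gam_c one_t tw c\<close>)
  have linR: "linop (?R i)" and linL: "linop (?L i)" for i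
    by (intro linop_plus linop_comp[OF linop_on_left linop_on_right] linop_on_left linop_twl linop_wdg linop_gam)+
  have w: "wg g \<in> vecs I" "bvec ({}, g) \<in> vecs I"
    using g by (auto intro: vecs_sc bvec_empty_vecs)
  have Dw: "Dlin (wg g) = tens (wg g) (bvec ({}, g))" "Dlin (wg g) = tens (bvec ({}, g)) (wg g)"
    using g by (simp_all add: linop_sc[OF linop_Dlin] Dlin_bvec dl_eq tens_sc)
  have wdgv: "wdg i v \<in> vecs I" if "i < n" "v \<in> vecs I" for i v
    using that lam_vecs[of i n v "carrier G" zero_form] by (simp add: lam_zero_form)
  have gamw: "gam zero_form u (wdg i v) = - wdg i (gam zero_form u v)" if "i < n" "v \<in> vecs I" for i v
    using gam_u_lam[OF good_zero that] by (simp add: lam_zero_form)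
  have wdgS: "opS wdg Q (bvec ({}, h)) = bvec (Q, h)" if "Q \<subseteq> {..<n}" for Q h
    using opS_lam_bvec[OF that, of zero_form h] by (simp add: lam_zero_form)
  have pm: "Dlin (opS tv S (wg g)) = opS ?R S (Dlin (wg g))" "Dlin (opS tv S (wg g)) = opS ?L S (Dlin (wg g))"
    by (rule opS_intertwine[OF fin w(1) twl_vecs], rule R, use S in auto)
       (rule opS_intertwine[OF fin w(1) twl_vecs], rule L, use S in auto)
  have "opS ?R S (tens (wg g) (bvec ({}, g))) = (\<Sum>P\<in>Pow S. sc (esign P (S - P))
     (tens (opS tv P ((twl s ({}, u) ^^ card (S - P)) (wg g))) (opS wdg (S - P) (bvec ({}, g)))))"
    by (rule binomial_tens[OF fin w linR])
       (use S in \<open>auto simp: linop_twl on_left_tens on_right_tens linop_wdg twl_vecs wdgv twl_u_anti\<close>)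
  also have "\<dots> = (\<Sum>P\<in>Pow S. sc (esign P (S - P)) (tens (phi (bvec (P, ushift (card (S - P)) g))) (bvec (S - P, g))))"
  proof (intro sum.cong refl)
    fix P assume "P \<in> Pow S"
    then have "P \<subseteq> {..<n}" "S - P \<subseteq> {..<n}"
      using S by auto
    then show "sc (esign P (S - P)) (tens (opS tv P ((twl s ({}, u) ^^ card (S - P)) (wg g))) (opS wdg (S - P) (bvec ({}, g)))) =
      sc (esign P (S - P)) (tens (phi (bvec (P, ushift (card (S - P)) g))) (bvec (S - P, g)))"
      using g by (simp only: phi_bvec twl_u_pow wdgS ushift_in)
  qed
  finally show "Dlin (phi (bvec (S, g))) = (\<Sum>P\<in>Pow S. sc (esign P (S - P)) (tens (phi (bvec (P, ushift (card (S - P)) g))) (bvec (S - P, g))))"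
    unfolding phi_bvec[OF S g] pm(1) Dw(1) .
  have "opS ?L S (tens (bvec ({}, g)) (wg g)) = (\<Sum>P\<in>Pow S. sc (esign P (S - P))
     (tens (opS wdg P ((gam zero_form u ^^ card (S - P)) (bvec ({}, g)))) (opS tv (S - P) (wg g))))"
    by (rule binomial_tens[OF fin w(2,1) linL])
       (use S in \<open>auto simp: linop_twl on_left_tens on_right_tens linop_wdg linop_gam twl_vecs wdgv gamw gam_vecs good_zero u_in\<close>)
  also have "\<dots> = (\<Sum>P\<in>Pow S. sc (esign P (S - P)) (tens (bvec (P, ushift (card (S - P)) g)) (phi (bvec (S - P, g)))))"
  proof (intro sum.cong refl)
    fix P assume "P \<in> Pow S"
    then have "P \<subseteq> {..<n}" "S - P \<subseteq> {..<n}"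
      using S by auto
    moreover have "(gam zero_form u ^^ k) (bvec ({}, g)) = bvec ({}, ushift k g)" for k
      using g by (induction k) (simp_all add: ushift_Suc gam_bvec_empty)
    ultimately show "sc (esign P (S - P)) (tens (opS wdg P ((gam zero_form u ^^ card (S - P)) (bvec ({}, g)))) (opS tv (S - P) (wg g))) =
      sc (esign P (S - P)) (tens (bvec (P, ushift (card (S - P)) g)) (phi (bvec (S - P, g))))"
      using g by (simp only: phi_bvec wdgS)
  qed
  finally show "Dlin (phi (bvec (S, g))) = (\<Sum>P\<in>Pow S. sc (esign P (S - P)) (tens (bvec (P, ushift (card (S - P)) g)) (phi (bvec (S - P, g)))))"
    unfolding phi_bvec[OF S g] pm(2) Dw(2) .
qed

text \<open>The functional \<open>\<epsilon> \<circ> \<phi>\<close>.\<close>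

definition char_fun :: "nat set \<times> 'g \<Rightarrow> 'k" where
  "char_fun x = (if x \<in> I then \<Sum>r\<in>I. phi (bvec x) r * cou r else 0)"

lemma char_fun_vecs: "char_fun \<in> vecs I"
  by (rule vecsI) (simp add: char_fun_def)

lemma dl_counit_expand:
  assumes "v \<in> vecs I" "q \<in> I"
  shows "(\<Sum>p\<in>I. Dlin v (p, q) * cou p) = v q" "(\<Sum>p\<in>I. Dlin v (q, p) * cou p) = v q"
proof -
  have "(\<Sum>p\<in>I. Dlin v (p, q) * cou p) = (\<Sum>r\<in>I. v r * (\<Sum>p\<in>I. dl r (p, q) * cou p))"
    unfolding Dlin_def sum_fun_ap sum_distrib_left sum_distrib_right sc_ap mult.assoc by (rule sum.swap)
  also have "\<dots> = (\<Sum>r\<in>I. if r = q then v q else 0)"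
    using assms by (intro sum.cong refl) (auto simp: dl_counit)
  finally show "(\<Sum>p\<in>I. Dlin v (p, q) * cou p) = v q"
    using assms finI by simp
  have "(\<Sum>p\<in>I. Dlin v (q, p) * cou p) = (\<Sum>r\<in>I. v r * (\<Sum>p\<in>I. dl r (q, p) * cou p))"
    unfolding Dlin_def sum_fun_ap sum_distrib_left sum_distrib_right sc_ap mult.assoc by (rule sum.swap)
  also have "\<dots> = (\<Sum>r\<in>I. if r = q then v q else 0)"
    using assms by (intro sum.cong refl) (auto simp: dl_counit)
  finally show "(\<Sum>p\<in>I. Dlin v (q, p) * cou p) = v q"
    using assms finI by simp
qed

text \<open>Apply the counit to one of the tensor factors in \<open>Dlin_phi\<close>.\<close>

lemma phi_conv:
  assumes x: "x \<in> I"
  shows "(\<Sum>r\<in>I. phi (bvec x) r * h r) = (char_fun \<star>\<^sub>1 h) x"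
    and "(\<Sum>r\<in>I. phi (bvec x) r * h r) = (h \<star>\<^sub>1 char_fun) x"
proof -
  obtain S g where xe: "x = (S, g)" and S: "S \<subseteq> {..<n}" and g: "g \<in> carrier G"
    using x by auto
  have conv: "(f \<star>\<^sub>1 f') x = (\<Sum>P\<in>Pow S. esign P (S - P) * (f (P, ushift (card (S - P)) g) * f' (S - P, g)))" for f f'
    using x dl_sum[OF S g, of "\<lambda>p q. f p * f' q"] unfolding xe
    by (simp add: fb.C1.mult_in in_H) (simp add: basis_H comulc_eq mult.assoc)
  have mem: "(P, ushift (card (S - P)) g) \<in> I" "(S - P, g) \<in> I" if "P \<in> Pow S" for P
    using that S g by auto
  have vx: "phi (bvec x) \<in> vecs I"
    using x by (rule phi_vecs)
  have "(\<Sum>r\<in>I. phi (bvec x) r * h r) = (\<Sum>r\<in>I. \<Sum>p\<in>I. Dlin (phi (bvec x)) (p, r) * cou p * h r)"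
    by (intro sum.cong refl) (simp only: dl_counit_expand(1)[OF vx] flip: sum_distrib_right)
  also have "\<dots> = (\<Sum>r\<in>I. \<Sum>p\<in>I. \<Sum>P\<in>Pow S. esign P (S - P) * (phi (bvec (P, ushift (card (S - P)) g)) p * cou p * (bvec (S - P, g) r * h r)))"
    unfolding xe Dlin_phi(1)[OF S g] by (simp only: sum_fun_ap sum_distrib_right sum_distrib_left sc_ap tens_ap mult_ac)
  also have "\<dots> = (\<Sum>P\<in>Pow S. \<Sum>r\<in>I. \<Sum>p\<in>I. esign P (S - P) * (phi (bvec (P, ushift (card (S - P)) g)) p * cou p * (bvec (S - P, g) r * h r)))"
    by (rule sum_rot3[symmetric])
  also have "\<dots> = (\<Sum>P\<in>Pow S. esign P (S - P) * (\<Sum>r\<in>I. (\<Sum>p\<in>I. phi (bvec (P, ushift (card (S - P)) g)) p * cou p) * (bvec (S - P, g) r * h r)))"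
    by (simp only: sum_distrib_left sum_distrib_right)
  also have "\<dots> = (char_fun \<star>\<^sub>1 h) x"
    unfolding conv
  proof (intro sum.cong refl arg_cong2[where f = "(*)"])
    fix P assume P: "P \<in> Pow S"
    have "(\<Sum>r\<in>I. char_fun (P, ushift (card (S - P)) g) * (bvec (S - P, g) r * h r)) = char_fun (P, ushift (card (S - P)) g) * h (S - P, g)"
      by (simp only: sum_bvec_left[OF mem(2)[OF P]] flip: sum_distrib_left)
    then show "(\<Sum>r\<in>I. (\<Sum>p\<in>I. phi (bvec (P, ushift (card (S - P)) g)) p * cou p) * (bvec (S - P, g) r * h r)) = char_fun (P, ushift (card (S - P)) g) * h (S - P, g)"
      by (simp only: char_fun_def mem[OF P] if_True)
  qed
  finally show "(\<Sum>r\<in>I. phi (bvec x) r * h r) = (char_fun \<star>\<^sub>1 h) x" .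
  have "(\<Sum>r\<in>I. phi (bvec x) r * h r) = (\<Sum>r\<in>I. \<Sum>p\<in>I. Dlin (phi (bvec x)) (r, p) * cou p * h r)"
    by (intro sum.cong refl) (simp only: dl_counit_expand(2)[OF vx] flip: sum_distrib_right)
  also have "\<dots> = (\<Sum>r\<in>I. \<Sum>p\<in>I. \<Sum>P\<in>Pow S. esign P (S - P) * (phi (bvec (S - P, g)) p * cou p * (bvec (P, ushift (card (S - P)) g) r * h r)))"
    unfolding xe Dlin_phi(2)[OF S g] by (simp only: sum_fun_ap sum_distrib_right sum_distrib_left sc_ap tens_ap mult_ac)
  also have "\<dots> = (\<Sum>P\<in>Pow S. \<Sum>r\<in>I. \<Sum>p\<in>I. esign P (S - P) * (phi (bvec (S - P, g)) p * cou p * (bvec (P, ushift (card (S - P)) g) r * h r)))"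
    by (rule sum_rot3[symmetric])
  also have "\<dots> = (\<Sum>P\<in>Pow S. esign P (S - P) * (\<Sum>r\<in>I. (\<Sum>p\<in>I. phi (bvec (S - P, g)) p * cou p) * (bvec (P, ushift (card (S - P)) g) r * h r)))"
    by (simp only: sum_distrib_left sum_distrib_right)
  also have "\<dots> = (h \<star>\<^sub>1 char_fun) x"
    unfolding conv
  proof (intro sum.cong refl arg_cong2[where f = "(*)"])
    fix P assume P: "P \<in> Pow S"
    have "(\<Sum>r\<in>I. char_fun (S - P, g) * (bvec (P, ushift (card (S - P)) g) r * h r)) = h (P, ushift (card (S - P)) g) * char_fun (S - P, g)"
      unfolding sum_distrib_left[symmetric] sum_bvec_left[OF mem(1)[OF P]] by (rule mult.commute)
    then show "(\<Sum>r\<in>I. (\<Sum>p\<in>I. phi (bvec (S - P, g)) p * cou p) * (bvec (P, ushift (card (S - P)) g) r * h r)) = h (P, ushift (card (S - P)) g) * char_fun (S - P, g)"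
      by (simp only: char_fun_def mem[OF P] if_True)
  qed
  finally show "(\<Sum>r\<in>I. phi (bvec x) r * h r) = (h \<star>\<^sub>1 char_fun) x" .
qed

lemma char_fun_central: "fb.central char_fun"
  unfolding fb.central_def
proof
  fix h
  show "char_fun \<star>\<^sub>1 h = h \<star>\<^sub>1 char_fun"
  proof (rule fb.C1.conv_eqI[OF fb.C1.mult_vecs fb.C1.mult_vecs])
    fix x assume "x \<in> basis H"
    then have x: "x \<in> I"
      by (simp only: basis_H)
    show "(char_fun \<star>\<^sub>1 h) x = (h \<star>\<^sub>1 char_fun) x"
      by (rule trans[OF phi_conv(1)[OF x, symmetric] phi_conv(2)[OF x]])
  qed
qed

text \<open>On generators the left multiplications of the twisted algebra satisfy the relations of \<open>H\<close>; since
  \<open>x\<close> is a product of generators, the associativity of the twisted product gives the rest.\<close>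

lemma phi_mult:
  assumes x: "x \<in> I" and b: "b \<in> vecs I"
  shows "phi (mulB zero_form (bvec x) b) = (\<Sum>r\<in>I. sc (phi (bvec x) r) (twl s r (phi b)))"
proof -
  obtain S g where xe: "x = (S, g)" and S: "S \<subseteq> {..<n}" and g: "g \<in> carrier G"
    using x by auto
  have pb: "phi b \<in> vecs I"
    by (rule linop_vecs[OF finI b linop_lift]) (rule phi_vecs)
  let ?m = "\<lambda>a. \<Sum>r\<in>I. sc (a r) (twl s r (phi b))"
  have lin: "linop ?m"
    by (intro linop_setsum linop_coeff)
  have m_bvec: "?m (bvec r) = twl s r (phi b)" if "r \<in> I" for r
    by (rule sum_bvec_sc[OF s that])
  have m_tv: "?m (tv i a) = tv i (?m a)" if i: "i < n" and a: "a \<in> vecs I" for i a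
  proof (rule linop_eqI[OF finI a linop_comp[OF lin linop_twl] linop_comp[OF linop_twl lin]])
    fix y assume y: "y \<in> I"
    have "?m (tv i (bvec y)) = tv i (twl s y (phi b))"
      using y i by (simp only: twl_bvec) (rule twl_twl[OF s _ y pb, symmetric], simp)
    then show "?m (tv i (bvec y)) = tv i (?m (bvec y))"
      by (simp only: m_bvec[OF y])
  qed
  have "phi (mulB zero_form (bvec x) b) = opS tv S (eg g (phi b))"
    unfolding xe by (rule tr.L_mulB[OF S g b])
  also have "eg g (phi b) = ?m (wg g)"
    using g m_bvec[of "({}, g)"] by (simp only: linop_sc[OF lin]) simp
  also have "opS tv S (?m (wg g)) = ?m (opS tv S (wg g))"
    by (rule opS_intertwine[OF finite_sub[OF S] tr.w_vecs[OF g] twl_vecs, symmetric], rule m_tv) (use S in auto)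
  also have "opS tv S (wg g) = phi (bvec x)"
    unfolding xe using S g by (rule phi_bvec[symmetric])
  finally show ?thesis .
qed

text \<open>Apply the counit to \<open>\<phi>(xy) = \<phi>(x) \<bullet> \<phi>(y)\<close>; on the right this gives \<open>\<sigma>\<close>, and \<open>\<phi>\<close> is a
  convolution with \<open>char_fun\<close> in each argument.\<close>

lemma char_fun_mult: "fb.pm char_fun = tens char_fun char_fun \<star>\<^sub>2 s"
proof (rule fb.C12.T.conv_eqI[OF fb.pm_vecs fb.C12.T.mult_vecs], clarify)
  fix x1 x2 y1 y2 assume xy': "(x1, x2) \<in> basis H" "(y1, y2) \<in> basis H"
  let ?x = "(x1, x2)" and ?y = "(y1, y2)"
  have xy: "?x \<in> I" "?y \<in> I"
    using xy' by (simp_all only: basis_H)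
  have sv: "s \<in> vecs (basis H \<times> basis H)"
    using s by (rule fb.Z_vecs)
  have "fb.pm char_fun (?x, ?y) = (\<Sum>r\<in>I. structc Sm ?x ?y r * char_fun r)"
    using xy' by (simp add: fb.pm_ap) (simp add: basis_H structc_H)
  also have "\<dots> = (\<Sum>r\<in>I. \<Sum>t\<in>I. structc Sm ?x ?y r * phi (bvec r) t * cou t)"
    by (intro sum.cong refl) (simp add: char_fun_def sum_distrib_left mult.assoc del: mem_Sigma_iff)
  also have "\<dots> = (\<Sum>t\<in>I. phi (structc Sm ?x ?y) t * cou t)"
  proof -
    have "structc Sm ?x ?y \<in> vecs I"
      using fb.structc_vecs[OF xy'] by (simp only: basis_H structc_H)
    then have "phi (structc Sm ?x ?y) = (\<Sum>r\<in>I. sc (structc Sm ?x ?y r) (phi (bvec r)))"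
      by (rule linop_expand[OF finI _ linop_lift])
    then show ?thesis
      by (subst sum.swap) (simp add: sum_fun_ap sum_distrib_right)
  qed
  also have "phi (structc Sm ?x ?y) = (\<Sum>r\<in>I. sc (phi (bvec ?x) r) (twl s r (phi (bvec ?y))))"
    using xy by (simp only: structc_eq phi_mult vecs_bvec)
  also have "(\<Sum>t\<in>I. (\<Sum>r\<in>I. sc (phi (bvec ?x) r) (twl s r (phi (bvec ?y)))) t * cou t) =
      (\<Sum>r\<in>I. phi (bvec ?x) r * (\<Sum>z\<in>I. phi (bvec ?y) z * s (r, z)))"
  proof -
    have "(\<Sum>t\<in>I. twl s r v t * cou t) = (\<Sum>z\<in>I. v z * s (r, z))" if r: "r \<in> I" for r v
    proof -
      have "(\<Sum>t\<in>I. twl s r v t * cou t) = (\<Sum>z\<in>I. v z * (\<Sum>t\<in>I. fb.tw s r z t * cou t))"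
        unfolding twl_def sum_fun_ap sum_distrib_left sum_distrib_right sc_ap mult.assoc by (rule sum.swap)
      also have "\<dots> = (\<Sum>z\<in>I. v z * s (r, z))"
        using fb.tw_counit[OF sv] r by (intro sum.cong refl) (simp add: basis_H counitc_eq)
      finally show ?thesis .
    qed
    note * = this
    have "(\<Sum>t\<in>I. (\<Sum>r\<in>I. sc (phi (bvec ?x) r) (twl s r (phi (bvec ?y)))) t * cou t) =
       (\<Sum>r\<in>I. phi (bvec ?x) r * (\<Sum>t\<in>I. twl s r (phi (bvec ?y)) t * cou t))"
      unfolding sum_fun_ap sum_distrib_left sum_distrib_right sc_ap mult.assoc by (rule sum.swap)
    then show ?thesis
      by (simp only: * cong: sum.cong)
  qed
  also have "\<dots> = (\<Sum>r\<in>I. phi (bvec ?x) r * (char_fun \<star>\<^sub>1 (\<lambda>z. s (r, z))) ?y)"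
    by (simp only: phi_conv(1)[OF xy(2)])
  also have "\<dots> = (char_fun \<star>\<^sub>1 (\<lambda>r. (char_fun \<star>\<^sub>1 (\<lambda>z. s (r, z))) ?y)) ?x"
    by (rule phi_conv(1)[OF xy(1)])
  also have "\<dots> = (tens char_fun char_fun \<star>\<^sub>2 s) (?x, ?y)"
    using xy' by (simp add: fb.C1.mult_in fb.C12.mult_tens_in sum_distrib_left mult_ac)
  finally show "fb.pm char_fun (?x, ?y) = (tens char_fun char_fun \<star>\<^sub>2 s) (?x, ?y)" .
qed

lemma char_fun_low:
  assumes "g \<in> carrier G"
  shows "char_fun ({}, g) = inverse (\<chi> g)" and "i < n \<Longrightarrow> char_fun ({i}, \<one>) = 0"
proof -
  show "char_fun ({}, g) = inverse (\<chi> g)"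
    using assms by (simp add: char_fun_def phi_bvec sum_bvec_left mult.assoc flip: sum_distrib_left)
  show "char_fun ({i}, \<one>) = 0" if "i < n"
  proof -
    have "phi (bvec ({i}, \<one>)) = bvec ({i}, \<one>)"
      using that opS_insert[of "{}" i tv] by (simp add: phi_bvec chi1 twl_bvec tw_low(3)[OF s one_closed one_closed])
    then show ?thesis
      using that by (simp add: char_fun_def sum_bvec_left)
  qed
qed

lemma twisted_character_exists:
  "\<exists>f. f \<in> vecs (basis H) \<and> fb.central f \<and> fb.pm f = tens f f \<star>\<^sub>2 s \<and>
    (\<forall>g\<in>carrier G. f ({}, g) = inverse (\<chi> g)) \<and> (\<forall>i<n. f ({i}, \<one>) = 0)"
  using char_fun_vecs char_fun_central char_fun_mult char_fun_low unfolding basis_H by blast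

end

text \<open>For \<open>S \<noteq> {}\<close> and \<open>m = Min S\<close>, \<open>v\<^sub>S g\<close> is the product of \<open>v\<^sub>m\<close> with another basis element, so a
  character that vanishes on the \<open>v\<^sub>i\<close> vanishes on it.\<close>

lemma character_trivial:
  assumes F: "F \<in> vecs (basis H)" "fb.pm F = tens F F"
    and g: "\<And>g. g \<in> carrier G \<Longrightarrow> F ({}, g) = 1" and v: "\<And>i. i < n \<Longrightarrow> F ({i}, \<one>) = 0"
  shows "F = fb.e1"
proof (rule fb.C1.conv_eqI[OF F(1) fb.C1.one_vecs])
  fix x assume x: "x \<in> basis H"
  then obtain S h where xe: "x = (S, h)" and S: "S \<subseteq> {..<n}" and h: "h \<in> carrier G"
    by (auto simp: basis_H)
  have "F (S, h) = 0" if "S \<noteq> {}"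
  proof -
    have fin: "finite S"
      using S by (rule finite_sub)
    define m A where "m = Min S" and "A = S - {m}"
    have SA: "S = insert m A"
      unfolding m_def A_def using Min_in[OF fin that] by blast
    have less: "m < s" if "s \<in> A" for s
      using that Min_le[OF fin, of s] unfolding A_def m_def by (auto simp: order_le_less)
    have A: "A \<subseteq> {..<n}" and m: "m < n"
      using S SA by auto
    have mA: "({m}, \<one>) \<in> basis H" "(A, h) \<in> basis H"
      using A m h by (simp_all add: in_H)
    have "structc Sm ({m}, \<one>) (A, h) = wdg m (bvec (A, h))"
      using amul_Sm_generators(3)[of "bvec (A, h)" m] A m h finI by (simp add: amul_bvec_bvec basis_Sm vecs_bvec)
    also have "\<dots> = bvec (S, h)"
      using lam_bvec_min[OF A less, of zero_form h] by (simp add: lam_zero_form SA)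
    finally have "fb.pm F (({m}, \<one>), (A, h)) = F (S, h)"
      using mA S h by (simp add: fb.pm_ap structc_H) (simp add: basis_H sum_bvec_left)
    moreover have "tens F F (({m}, \<one>), (A, h)) = 0"
      using v[OF m] by simp
    ultimately show ?thesis
      unfolding F(2) by simp
  qed
  then show "F x = fb.e1 x"
    using x h g[of h] unfolding xe by (simp add: fb.C1.one_in counitc_H)
qed

text \<open>The functional for the inverse cocycle inverts the functional for the cocycle: their product
  is a character of \<open>H\<close>.\<close>

lemma kernel_in_B2:
  assumes s: "s \<in> fb.Z"
    and form0: "\<And>i j. i < n \<Longrightarrow> j < n \<Longrightarrow> s (({i}, \<one>), ({j}, \<one>)) + s (({j}, \<one>), ({i}, \<one>)) = 0"
    and chi: "\<chi> \<one> = 1" "\<And>g. g \<in> carrier G \<Longrightarrow> \<chi> g \<noteq> 0" "\<And>g. g \<in> carrier G \<Longrightarrow> \<chi> (u \<otimes> g) = \<chi> g"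
      "\<And>g h. g \<in> carrier G \<Longrightarrow> h \<in> carrier G \<Longrightarrow> res s (g, h) = \<chi> g * \<chi> h / \<chi> (g \<otimes> h)"
  shows "s \<in> lazy_B2 H"
proof -
  obtain t where t: "t \<in> fb.Z" "s \<star>\<^sub>2 t = fb.e2" "t \<star>\<^sub>2 s = fb.e2"
    using fb.Z_has_inverse[OF s] .
  have res_t: "res t (g, h) = inverse (\<chi> g) * inverse (\<chi> h) / inverse (\<chi> (g \<otimes> h))"
    if "g \<in> carrier G" "h \<in> carrier G" for g h
  proof -
    have "res s (g, h) * res t (g, h) = 1"
      using Z_conv_low(1)[OF s t(1) that n_pos n_pos] that
      unfolding t(2) by (simp add: res_def fb.C12.T.one_in in_H counitc_H)
    then have "res t (g, h) = inverse (res s (g, h))"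
      by (metis inverse_unique)
    then show ?thesis
      using that by (simp add: chi(4) divide_simps)
  qed
  have form_t: "t (({i}, \<one>), ({j}, \<one>)) + t (({j}, \<one>), ({i}, \<one>)) = 0" if "i < n" "j < n" for i j
  proof -
    have *: "s (({i}, \<one>), ({j}, \<one>)) + t (({i}, \<one>), ({j}, \<one>)) = 0" if "i < n" "j < n" for i j
      using Z_conv_low(2)[OF s t(1) one_closed one_closed that] that
      unfolding t(2) by (simp add: fb.C12.T.one_in in_H counitc_H)
    have "t (({i}, \<one>), ({j}, \<one>)) + t (({j}, \<one>), ({i}, \<one>)) =
       (s (({i}, \<one>), ({j}, \<one>)) + t (({i}, \<one>), ({j}, \<one>))) + (s (({j}, \<one>), ({i}, \<one>)) + t (({j}, \<one>), ({i}, \<one>))) -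
       (s (({i}, \<one>), ({j}, \<one>)) + s (({j}, \<one>), ({i}, \<one>)))"
      by simp
    then show ?thesis
      unfolding *[OF that] *[OF that(2,1)] form0[OF that] by simp
  qed
  obtain f where f: "f \<in> vecs (basis H)" "fb.central f" "fb.pm f = tens f f \<star>\<^sub>2 s"
    "\<And>g. g \<in> carrier G \<Longrightarrow> f ({}, g) = inverse (\<chi> g)" "\<And>i. i < n \<Longrightarrow> f ({i}, \<one>) = 0"
    using twisted_character_exists[of s \<chi>] s form0 chi by blast
  obtain f' where f': "f' \<in> vecs (basis H)" "fb.central f'" "fb.pm f' = tens f' f' \<star>\<^sub>2 t"
    "\<And>g. g \<in> carrier G \<Longrightarrow> f' ({}, g) = inverse (inverse (\<chi> g))" "\<And>i. i < n \<Longrightarrow> f' ({i}, \<one>) = 0"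
    using twisted_character_exists[of t "\<lambda>g. inverse (\<chi> g)"] t(1) form_t chi res_t by force
  let ?F = "f \<star>\<^sub>1 f'"
  have "fb.pm ?F = (tens f f \<star>\<^sub>2 s) \<star>\<^sub>2 (tens f' f' \<star>\<^sub>2 t)"
    unfolding fb.pm_conv f(3) f'(3) ..
  also have "\<dots> = tens f f \<star>\<^sub>2 ((s \<star>\<^sub>2 tens f' f') \<star>\<^sub>2 t)"
    by (simp only: fb.C12.T.conv_assoc)
  also have "s \<star>\<^sub>2 tens f' f' = tens f' f' \<star>\<^sub>2 s"
    by (rule fb.tens_central[OF f'(2,1), symmetric])
  also have "tens f f \<star>\<^sub>2 (tens f' f' \<star>\<^sub>2 s \<star>\<^sub>2 t) = (tens f f \<star>\<^sub>2 tens f' f') \<star>\<^sub>2 (s \<star>\<^sub>2 t)"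
    by (simp only: fb.C12.T.conv_assoc)
  also have "\<dots> = tens ?F ?F"
    unfolding t(2) fb.C12.tens_conv by (rule fb.C12.T.conv_one) (rule vecs_tens fb.C1.mult_vecs)+
  finally have F: "fb.pm ?F = tens ?F ?F" .
  have 1: "?F = fb.e1"
    by (rule character_trivial[OF fb.C1.mult_vecs F])
       (use chi(2) in \<open>simp_all add: conv1_low f(4,5) f'(4,5) u_in\<close>)
  then have 2: "f' \<star>\<^sub>1 f = fb.e1"
    using fb.centralD[OF f(2), of f'] by simp
  show ?thesis
  proof (rule fb.cobound_if_twisted_character[OF _ _ f(2) fb.Z_vecs[OF s] f(3)])
    show "f \<in> Units fb.C1.M"
      by (rule fb.Units1I[OF f(1) f'(1) 1 2])
    show "f ({}, \<one>) = 1"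
      by (simp add: f(4) chi(1))
  qed
qed

end

section \<open>Second cohomology with values in the multiplicative group\<close>

abbreviation "kstar \<equiv> nonzero_group :: 'k::field monoid"

lemma nonzero_group_simps:
  "carrier (kstar :: 'k::field monoid) = UNIV - {0}" "x \<otimes>\<^bsub>kstar\<^esub> y = x * y" "\<one>\<^bsub>kstar\<^esub> = 1"
  by (simp_all add: nonzero_group_def)

lemma nonzero_comm_group: "comm_group (kstar :: 'k::field monoid)"
proof (rule comm_groupI)
  fix x assume "x \<in> carrier (kstar :: 'k monoid)"
  then show "\<exists>y\<in>carrier (kstar :: 'k monoid). y \<otimes>\<^bsub>kstar\<^esub> x = \<one>\<^bsub>kstar\<^esub>"
    by (intro bexI[of _ "inverse x"]) (simp_all add: nonzero_group_simps)
qed (auto simp: nonzero_group_simps)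

lemma inv_kstar: "x \<noteq> 0 \<Longrightarrow> inv\<^bsub>kstar\<^esub> x = inverse (x :: 'k::field)"
  by (rule group.inv_equality[OF comm_group.axioms(2)[OF nonzero_comm_group]]) (simp_all add: nonzero_group_simps)

lemma grp_Z2_simps:
  "f \<otimes>\<^bsub>grp_Z2 Q kstar\<^esub> g = (\<lambda>i\<in>carrier Q \<times> carrier Q. f i * g i)"
  "\<one>\<^bsub>grp_Z2 Q kstar\<^esub> = (\<lambda>i\<in>carrier Q \<times> carrier Q. 1)"
  by (simp_all add: grp_Z2_def product_group_def nonzero_group_simps)

lemma grp_Z2_iff: "f \<in> carrier (grp_Z2 Q (kstar :: 'k::field monoid)) \<longleftrightarrow>
    f \<in> extensional (carrier Q \<times> carrier Q) \<and>
    (\<forall>x\<in>carrier Q. \<forall>y\<in>carrier Q. f (x, y) \<noteq> 0) \<and>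
    (\<forall>x\<in>carrier Q. \<forall>y\<in>carrier Q. \<forall>z\<in>carrier Q. f (y, z) * f (x, y \<otimes>\<^bsub>Q\<^esub> z) = f (x \<otimes>\<^bsub>Q\<^esub> y, z) * f (x, y))"
  by (auto simp: grp_Z2_def nonzero_group_simps PiE_def)

lemma (in group) grp_Z2_comm_group: "comm_group (grp_Z2 G (kstar :: 'k::field monoid))"
proof (rule comm_groupI)
  let ?Z = "grp_Z2 G (kstar :: 'k monoid)"
  fix f g h
  assume f: "f \<in> carrier ?Z"
  show "\<one>\<^bsub>?Z\<^esub> \<otimes>\<^bsub>?Z\<^esub> f = f"
    using f by (auto simp: grp_Z2_simps grp_Z2_iff extensional_def fun_eq_iff)
  show "\<exists>g\<in>carrier ?Z. g \<otimes>\<^bsub>?Z\<^esub> f = \<one>\<^bsub>?Z\<^esub>"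
  proof
    let ?g = "\<lambda>i\<in>carrier G \<times> carrier G. inverse (f i)"
    show "?g \<in> carrier ?Z"
      using f by (auto simp: grp_Z2_iff simp flip: inverse_mult_distrib)
    show "?g \<otimes>\<^bsub>?Z\<^esub> f = \<one>\<^bsub>?Z\<^esub>"
      using f by (auto simp: grp_Z2_simps grp_Z2_iff fun_eq_iff)
  qed
  assume g: "g \<in> carrier ?Z"
  show "f \<otimes>\<^bsub>?Z\<^esub> g = g \<otimes>\<^bsub>?Z\<^esub> f"
    by (auto simp: grp_Z2_simps fun_eq_iff mult.commute)
  show "f \<otimes>\<^bsub>?Z\<^esub> g \<in> carrier ?Z"
    unfolding grp_Z2_iff
  proof (intro conjI ballI)
    fix x y z assume "x \<in> carrier G" "y \<in> carrier G" "z \<in> carrier G"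
    then have "(f (y, z) * f (x, y \<otimes> z)) * (g (y, z) * g (x, y \<otimes> z)) = (f (x \<otimes> y, z) * f (x, y)) * (g (x \<otimes> y, z) * g (x, y))"
      using f g by (simp add: grp_Z2_iff)
    with \<open>x \<in> carrier G\<close> \<open>y \<in> carrier G\<close> \<open>z \<in> carrier G\<close>
    show "(f \<otimes>\<^bsub>?Z\<^esub> g) (y, z) * (f \<otimes>\<^bsub>?Z\<^esub> g) (x, y \<otimes> z) = (f \<otimes>\<^bsub>?Z\<^esub> g) (x \<otimes> y, z) * (f \<otimes>\<^bsub>?Z\<^esub> g) (x, y)"
      by (simp add: grp_Z2_simps mult_ac)
  qed (use f g in \<open>auto simp: grp_Z2_simps grp_Z2_iff\<close>)
  assume h: "h \<in> carrier ?Z"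
  show "f \<otimes>\<^bsub>?Z\<^esub> g \<otimes>\<^bsub>?Z\<^esub> h = f \<otimes>\<^bsub>?Z\<^esub> (g \<otimes>\<^bsub>?Z\<^esub> h)"
    by (auto simp: grp_Z2_simps fun_eq_iff mult_ac)
qed (auto simp: grp_Z2_simps grp_Z2_iff)

lemma (in group) grp_B2_iff: "f \<in> grp_B2 G (kstar :: 'k::field monoid) \<longleftrightarrow>
    (\<exists>c. (\<forall>x\<in>carrier G. c x \<noteq> 0) \<and> f = (\<lambda>(x, y)\<in>carrier G \<times> carrier G. c x * c y / c (x \<otimes> y)))"
  (is "?L \<longleftrightarrow> ?R")
proof
  assume ?L
  then obtain c where c: "c \<in> carrier G \<rightarrow>\<^sub>E carrier (kstar :: 'k monoid)"
    and f: "f = (\<lambda>(x, y)\<in>carrier G \<times> carrier G. c x \<otimes>\<^bsub>kstar\<^esub> c y \<otimes>\<^bsub>kstar\<^esub> inv\<^bsub>kstar\<^esub> c (x \<otimes> y))"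
    by (auto simp: grp_B2_def)
  have nz: "c x \<noteq> 0" if "x \<in> carrier G" for x
    using PiE_mem[OF c that] by (simp add: nonzero_group_simps)
  show ?R
    unfolding f by (intro exI[of _ c]) (auto simp: nonzero_group_simps inv_kstar nz fun_eq_iff divide_inverse)
next
  assume ?R
  then obtain c where nz: "\<And>x. x \<in> carrier G \<Longrightarrow> c x \<noteq> 0"
    and f: "f = (\<lambda>(x, y)\<in>carrier G \<times> carrier G. c x * c y / c (x \<otimes> y))"
    by auto
  show ?L
    unfolding grp_B2_def f
    by (rule CollectI, intro exI[of _ "restrict c (carrier G)"])
       (auto simp: nonzero_group_simps inv_kstar nz fun_eq_iff divide_inverse)
qed

lemma (in group) grp_B2_subgroup: "subgroup (grp_B2 G (kstar :: 'k::field monoid)) (grp_Z2 G kstar)"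
proof -
  let ?Z = "grp_Z2 G (kstar :: 'k monoid)"
  interpret Z: comm_group ?Z
    by (rule grp_Z2_comm_group)
  show ?thesis
  proof (rule Z.subgroupI)
    show "grp_B2 G (kstar :: 'k monoid) \<subseteq> carrier ?Z"
    proof
      fix f :: "_ \<Rightarrow> 'k" assume "f \<in> grp_B2 G kstar"
      then obtain c where nz: "\<And>x. x \<in> carrier G \<Longrightarrow> c x \<noteq> 0"
        and f: "f = (\<lambda>(x, y)\<in>carrier G \<times> carrier G. c x * c y / c (x \<otimes> y))"
        unfolding grp_B2_iff by auto
      show "f \<in> carrier ?Z"
        unfolding grp_Z2_iff f by (auto simp: nz m_assoc)
    qed
    have "(\<lambda>(x, y)\<in>carrier G \<times> carrier G. 1) \<in> grp_B2 G (kstar :: 'k monoid)"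
      unfolding grp_B2_iff by (intro exI[of _ "\<lambda>_. 1"]) auto
    then show "grp_B2 G (kstar :: 'k monoid) \<noteq> {}"
      by blast
    fix f :: "_ \<Rightarrow> 'k" assume "f \<in> grp_B2 G kstar"
    then obtain c where c: "\<And>x. x \<in> carrier G \<Longrightarrow> c x \<noteq> 0"
      and f: "f = (\<lambda>(x, y)\<in>carrier G \<times> carrier G. c x * c y / c (x \<otimes> y))"
      unfolding grp_B2_iff by auto
    have "inv\<^bsub>?Z\<^esub> f = (\<lambda>(x, y)\<in>carrier G \<times> carrier G. inverse (c x) * inverse (c y) / inverse (c (x \<otimes> y)))"
    proof (rule Z.inv_equality)
      show "(\<lambda>(x, y)\<in>carrier G \<times> carrier G. inverse (c x) * inverse (c y) / inverse (c (x \<otimes> y))) \<otimes>\<^bsub>?Z\<^esub> f = \<one>\<^bsub>?Z\<^esub>"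
        unfolding f by (auto simp: grp_Z2_simps fun_eq_iff c field_simps)
      show "f \<in> carrier ?Z" "(\<lambda>(x, y)\<in>carrier G \<times> carrier G. inverse (c x) * inverse (c y) / inverse (c (x \<otimes> y))) \<in> carrier ?Z"
        unfolding grp_Z2_iff f by (auto simp: c m_assoc)
    qed
    then show "inv\<^bsub>?Z\<^esub> f \<in> grp_B2 G kstar"
      unfolding grp_B2_iff by (intro exI[of _ "\<lambda>x. inverse (c x)"]) (auto simp: c)
    fix g :: "_ \<Rightarrow> 'k" assume "g \<in> grp_B2 G kstar"
    then obtain c' where c': "\<And>x. x \<in> carrier G \<Longrightarrow> c' x \<noteq> 0"
      and g: "g = (\<lambda>(x, y)\<in>carrier G \<times> carrier G. c' x * c' y / c' (x \<otimes> y))"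
      unfolding grp_B2_iff by auto
    show "f \<otimes>\<^bsub>?Z\<^esub> g \<in> grp_B2 G kstar"
      unfolding grp_B2_iff f g by (intro exI[of _ "\<lambda>x. c x * c' x"]) (auto simp: c c' grp_Z2_simps fun_eq_iff)
  qed
qed

lemma (in group) grp_B2_normal: "grp_B2 G (kstar :: 'k::field monoid) \<lhd> grp_Z2 G kstar"
  by (rule comm_group.subgroup_imp_normal[OF grp_Z2_comm_group grp_B2_subgroup])

lemma (in group) grp_H2_group: "group (grp_H2 G (kstar :: 'k::field monoid))"
  unfolding grp_H2_def by (rule normal.factorgroup_is_group[OF grp_B2_normal])

declare mult_FactGroup [simp del] one_FactGroup [simp del]

context supergroup begin

section \<open>The isomorphism\<close>

abbreviation "U \<equiv> generate G {u}"
abbreviation "Q \<equiv> G Mod U"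

lemma U_eq: "U = {\<one>, u}"
proof
  have inv: "inv u = u"
    by (rule inv_equality) (simp_all add: u_square u_in)
  show "U \<subseteq> {\<one>, u}"
  proof
    fix x assume "x \<in> U"
    then show "x \<in> {\<one>, u}"
      by (induction rule: generate.induct) (auto simp: inv u_in u_square)
  qed
  show "{\<one>, u} \<subseteq> U"
    by (auto intro: generate.intros)
qed

lemma U_normal: "U \<lhd> G"
proof (rule normalI)
  show "subgroup U G"
    by (rule generate_is_subgroup) (simp add: u_in)
  show "\<forall>x\<in>carrier G. U #> x = x <# U"
    by (auto simp: U_eq r_coset_def l_coset_def u_in u_central)
qed

lemma coset_eq: "g \<in> carrier G \<Longrightarrow> U #> g = {g, u \<otimes> g}"
  by (auto simp: U_eq r_coset_def u_in)

lemma coset_u: "g \<in> carrier G \<Longrightarrow> U #> (u \<otimes> g) = U #> g"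
  by (auto simp: coset_eq u_in u_square m_assoc[symmetric])

lemma carrier_Q: "carrier Q = (\<lambda>g. U #> g) ` carrier G"
  by (auto simp: FactGroup_def RCOSETS_def)

lemma mult_Q: "g \<in> carrier G \<Longrightarrow> h \<in> carrier G \<Longrightarrow> (U #> g) \<otimes>\<^bsub>Q\<^esub> (U #> h) = U #> (g \<otimes> h)"
  by (simp add: FactGroup_def normal.rcos_sum[OF U_normal])

lemma one_Q: "\<one>\<^bsub>Q\<^esub> = U #> \<one>"
  by (simp add: FactGroup_def coset_eq U_eq u_in)

lemma group_Q: "group Q"
  by (rule normal.factorgroup_is_group[OF U_normal])

definition rep :: "'g set \<Rightarrow> 'g" where
  "rep A = (SOME g. g \<in> A)"

lemma rep_coset: "g \<in> carrier G \<Longrightarrow> rep (U #> g) = g \<or> rep (U #> g) = u \<otimes> g"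
  using someI[of "\<lambda>x. x \<in> U #> g" g] by (simp add: rep_def coset_eq)

lemma rep_in: "A \<in> carrier Q \<Longrightarrow> rep A \<in> carrier G"
  using rep_coset u_in by (auto simp: carrier_Q) (metis m_closed)

text \<open>The function on \<open>G/U\<close> induced by a \<open>U\<close>-invariant function on \<open>G\<close>, extensional outside \<open>G/U\<close>.\<close>

definition descend :: "('g \<times> 'g \<Rightarrow> 'k) \<Rightarrow> 'g set \<times> 'g set \<Rightarrow> 'k" where
  "descend c = (\<lambda>(A, B)\<in>carrier Q \<times> carrier Q. c (rep A, rep B))"

lemma descend_coset:
  assumes "ucocycle c" "g \<in> carrier G" "h \<in> carrier G"
  shows "descend c (U #> g, U #> h) = c (g, h)"
proof -
  have "c (rep (U #> g), rep (U #> h)) = c (g, h)"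
    using rep_coset[OF assms(2)] rep_coset[OF assms(3)] assms u_in by (auto simp: ucocycle_def)
  then show ?thesis
    using assms by (simp add: descend_def carrier_Q)
qed

lemma descend_Z2: assumes c: "ucocycle c" shows "descend c \<in> carrier (grp_Z2 Q kstar)"
  unfolding grp_Z2_iff
proof (intro conjI ballI)
  show "descend c \<in> extensional (carrier Q \<times> carrier Q)"
    by (simp add: descend_def)
  fix A B assume "A \<in> carrier Q" "B \<in> carrier Q"
  then obtain g h where AB: "A = U #> g" "B = U #> h" and g: "g \<in> carrier G" "h \<in> carrier G"
    by (auto simp: carrier_Q)
  show "descend c (A, B) \<noteq> 0"
    using c g by (simp add: AB descend_coset) (simp add: ucocycle_def)
  fix C assume "C \<in> carrier Q"
  then obtain k where C: "C = U #> k" and k: "k \<in> carrier G"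
    by (auto simp: carrier_Q)
  have "c (h, k) * c (g, h \<otimes> k) = c (g \<otimes> h, k) * c (g, h)"
    using c g k by (simp add: ucocycle_def mult.commute)
  then show "descend c (B, C) * descend c (A, B \<otimes>\<^bsub>Q\<^esub> C) = descend c (A \<otimes>\<^bsub>Q\<^esub> B, C) * descend c (A, B)"
    unfolding AB C mult_Q[OF g] mult_Q[OF g(2) k] using g k by (simp add: descend_coset[OF c])
qed

definition smat :: "((nat set \<times> 'g) \<times> (nat set \<times> 'g) \<Rightarrow> 'k) \<Rightarrow> 'k mat" where
  "smat s = mat n n (\<lambda>(i, j). (s (({i}, \<one>), ({j}, \<one>)) + s (({j}, \<one>), ({i}, \<one>))) / 2)"

abbreviation "SI \<equiv> sym_invariants G n \<rho>"

lemma invariant_entry: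
  assumes "M \<in> carrier_mat n n" "g \<in> carrier G" "i < n" "j < n"
  shows "(transpose_mat (\<rho> g) * M * \<rho> g) $$ (i, j) = (\<Sum>l<n. \<Sum>m<n. \<rho> g $$ (l, i) * \<rho> g $$ (m, j) * M $$ (l, m))"
proof -
  note R = rho_carrier[OF assms(2)]
  have entry: "(A * C) $$ (a, b) = (\<Sum>m<n. A $$ (a, m) * C $$ (m, b))"
    if "A \<in> carrier_mat n n" "C \<in> carrier_mat n n" "a < n" "b < n" for A C :: "'k mat" and a b
    using that by (simp add: scalar_prod_def atLeast0LessThan)
  have "(transpose_mat (\<rho> g) * M * \<rho> g) $$ (i, j) = (\<Sum>m<n. (transpose_mat (\<rho> g) * M) $$ (i, m) * \<rho> g $$ (m, j))"
    using R assms by (intro entry) auto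
  also have "\<dots> = (\<Sum>m<n. (\<Sum>l<n. \<rho> g $$ (l, i) * M $$ (l, m)) * \<rho> g $$ (m, j))"
    using R assms by (intro sum.cong refl) (simp add: scalar_prod_def atLeast0LessThan)
  also have "\<dots> = (\<Sum>m<n. \<Sum>l<n. \<rho> g $$ (l, i) * \<rho> g $$ (m, j) * M $$ (l, m))"
    by (simp add: sum_distrib_right sum_distrib_left mult_ac)
  also have "\<dots> = (\<Sum>l<n. \<Sum>m<n. \<rho> g $$ (l, i) * \<rho> g $$ (m, j) * M $$ (l, m))"
    by (rule sum.swap)
  finally show ?thesis .
qed

text \<open>Membership in terms of matrix entries, the form in which invariance enters \<open>good\<close>.\<close>

lemma SI_iff: "M \<in> carrier SI \<longleftrightarrow> M \<in> carrier_mat n n \<and> (\<forall>i<n. \<forall>j<n. M $$ (i, j) = M $$ (j, i)) \<and>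
    (\<forall>g\<in>carrier G. \<forall>i<n. \<forall>j<n. (\<Sum>l<n. \<Sum>m<n. \<rho> g $$ (l, i) * \<rho> g $$ (m, j) * M $$ (l, m)) = M $$ (i, j))"
proof (cases "M \<in> carrier_mat n n")
  case True
  have "transpose_mat M = M \<longleftrightarrow> (\<forall>i<n. \<forall>j<n. M $$ (i, j) = M $$ (j, i))"
    using True by (auto simp: mat_eq_iff)
  moreover have "transpose_mat (\<rho> g) * M * \<rho> g = M \<longleftrightarrow>
      (\<forall>i<n. \<forall>j<n. (\<Sum>l<n. \<Sum>m<n. \<rho> g $$ (l, i) * \<rho> g $$ (m, j) * M $$ (l, m)) = M $$ (i, j))"
    if g: "g \<in> carrier G" for g
  proof -
    have "transpose_mat (\<rho> g) * M * \<rho> g = M \<longleftrightarrow> (\<forall>i<n. \<forall>j<n. (transpose_mat (\<rho> g) * M * \<rho> g) $$ (i, j) = M $$ (i, j))"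
      using True rho_carrier[OF g] by (auto simp: mat_eq_iff simp del: index_mult_mat(1))
    then show ?thesis
      using invariant_entry[OF True g] by simp
  qed
  ultimately show ?thesis
    using True by (simp add: sym_invariants_def)
qed (simp add: sym_invariants_def)

lemma SI_simps: "M \<otimes>\<^bsub>SI\<^esub> N = M + N" "\<one>\<^bsub>SI\<^esub> = 0\<^sub>m n n"
  by (simp_all add: sym_invariants_def)

lemma SI_group: "group SI"
proof (rule groupI)
  fix M assume M: "M \<in> carrier SI"
  then have c: "M \<in> carrier_mat n n"
    by (simp add: SI_iff)
  show "\<exists>N\<in>carrier SI. N \<otimes>\<^bsub>SI\<^esub> M = \<one>\<^bsub>SI\<^esub>"
  proof
    show "- M \<in> carrier SI"
      using M c unfolding SI_iff by (auto simp: sum_negf)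
    show "- M \<otimes>\<^bsub>SI\<^esub> M = \<one>\<^bsub>SI\<^esub>"
      using c by (auto simp: SI_simps)
  qed
  show "\<one>\<^bsub>SI\<^esub> \<otimes>\<^bsub>SI\<^esub> M = M"
    using c by (simp add: SI_simps)
  fix N assume N: "N \<in> carrier SI"
  then have cN: "N \<in> carrier_mat n n"
    by (simp add: SI_iff)
  show "M \<otimes>\<^bsub>SI\<^esub> N \<in> carrier SI"
    using M N c cN unfolding SI_iff by (auto simp: SI_simps distrib_left sum.distrib)
  fix K assume "K \<in> carrier SI"
  then show "M \<otimes>\<^bsub>SI\<^esub> N \<otimes>\<^bsub>SI\<^esub> K = M \<otimes>\<^bsub>SI\<^esub> (N \<otimes>\<^bsub>SI\<^esub> K)"
    using c cN by (simp add: SI_simps SI_iff assoc_add_mat)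
qed (auto simp: SI_iff SI_simps)

lemma smat_SI: "s \<in> fb.Z \<Longrightarrow> smat s \<in> carrier SI"
proof -
  assume s: "s \<in> fb.Z"
  have "(\<Sum>l<n. \<Sum>m<n. \<rho> g $$ (l, i) * \<rho> g $$ (m, j) * smat s $$ (l, m)) = smat s $$ (i, j)"
    if "g \<in> carrier G" "i < n" "j < n" for g i j
    using form_invariant[OF s that] that by (simp add: smat_def flip: sum_divide_distrib)
  then show ?thesis
    unfolding SI_iff by (auto simp: smat_def add.commute)
qed

abbreviation "B2Q \<equiv> grp_B2 Q (kstar :: 'k monoid)"
abbreviation "Z2Q \<equiv> grp_Z2 Q (kstar :: 'k monoid)"
abbreviation "H2Q \<equiv> grp_H2 Q (kstar :: 'k monoid)"

definition Psi :: "((nat set \<times> 'g) \<times> (nat set \<times> 'g) \<Rightarrow> 'k) \<Rightarrow> 'k mat \<times> ('g set \<times> 'g set \<Rightarrow> 'k) set" where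
  "Psi s = (smat s, B2Q #>\<^bsub>Z2Q\<^esub> descend (res s))"

lemma H2Q_simps: "carrier H2Q = (\<lambda>f. B2Q #>\<^bsub>Z2Q\<^esub> f) ` carrier Z2Q" "\<one>\<^bsub>H2Q\<^esub> = B2Q"
  "f \<in> carrier Z2Q \<Longrightarrow> f' \<in> carrier Z2Q \<Longrightarrow>
    (B2Q #>\<^bsub>Z2Q\<^esub> f) \<otimes>\<^bsub>H2Q\<^esub> (B2Q #>\<^bsub>Z2Q\<^esub> f') = B2Q #>\<^bsub>Z2Q\<^esub> (f \<otimes>\<^bsub>Z2Q\<^esub> f')"
  unfolding grp_H2_def carrier_FactGroup one_FactGroup mult_FactGroup
    normal.rcos_sum[OF group.grp_B2_normal[OF group_Q]] by (rule refl)+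

lemma Psi_hom: "Psi \<in> hom (lazy_Z2 H) (SI \<times>\<times> H2Q)"
proof (rule homI)
  fix s assume "s \<in> carrier (lazy_Z2 H)"
  then have s: "s \<in> fb.Z"
    by (simp add: fb.carrier_Z2)
  then show "Psi s \<in> carrier (SI \<times>\<times> H2Q)"
    by (auto simp: Psi_def DirProd_def smat_SI H2Q_simps(1) descend_Z2 res_ucocycle)
  fix t assume "t \<in> carrier (lazy_Z2 H)"
  then have t: "t \<in> fb.Z"
    by (simp add: fb.carrier_Z2)
  have "smat (s \<star>\<^sub>2 t) = smat s + smat t"
    by (rule eq_matI) (simp_all add: smat_def Z_conv_low(2)[OF s t one_closed one_closed] add_ac flip: add_divide_distrib)
  moreover have "descend (res (s \<star>\<^sub>2 t)) = descend (res s) \<otimes>\<^bsub>Z2Q\<^esub> descend (res t)"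
    by (auto simp: descend_def grp_Z2_simps fun_eq_iff Z_conv_low(1)[OF s t _ _ n_pos n_pos] rep_in)
  ultimately show "Psi (s \<otimes>\<^bsub>lazy_Z2 H\<^esub> t) = Psi s \<otimes>\<^bsub>SI \<times>\<times> H2Q\<^esub> Psi t"
    by (simp add: Psi_def fb.mult_Z2 DirProd_def SI_simps H2Q_simps(3) descend_Z2 res_ucocycle s t)
qed

text \<open>A group cocycle is normalised by dividing by its constant value \<open>\<kappa>\<close> on pairs that contain the unit;
  the constant function \<open>\<kappa>\<close> is a coboundary. Together with a triangular form it defines a lazy cocycle by \<open>tc_Z\<close>.\<close>

lemma Psi_surj: "carrier (SI \<times>\<times> H2Q) \<subseteq> Psi ` fb.Z"
proof
  fix z assume "z \<in> carrier (SI \<times>\<times> H2Q)"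
  then obtain M f where z: "z = (M, B2Q #>\<^bsub>Z2Q\<^esub> f)" and M: "M \<in> carrier SI" and f: "f \<in> carrier Z2Q"
    by (auto simp: DirProd_def H2Q_simps(1))
  interpret Q: group Q
    by (rule group_Q)
  interpret Z2Q: comm_group Z2Q
    by (rule group.grp_Z2_comm_group[OF group_Q])
  \<comment> \<open>the lower triangular bilinear form whose symmetrisation is twice the given form\<close>
  define B where "B = (\<lambda>i j. if i < n \<and> j < n then (if i < j then 0 else if i = j then M $$ (i, j) else 2 * M $$ (i, j)) else 0)"
  have Bsum: "B i j + B j i = 2 * M $$ (i, j)" if "i < n" "j < n" for i j
    using that M by (auto simp: B_def SI_iff)
  have B: "good B"
    unfolding good_def
  proof (intro conjI ballI allI impI)
    show "B i j = 0" if "i < j" for i j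
      using that by (simp add: B_def)
    fix g i j assume g: "g \<in> carrier G" and ij: "i < n" "j < n"
    have "(\<Sum>l<n. \<Sum>m<n. \<rho> g $$ (l, i) * \<rho> g $$ (m, j) * (B l m + B m l)) =
        2 * (\<Sum>l<n. \<Sum>m<n. \<rho> g $$ (l, i) * \<rho> g $$ (m, j) * M $$ (l, m))"
      by (simp add: Bsum sum_distrib_left mult_ac)
    then show "(\<Sum>l<n. \<Sum>m<n. \<rho> g $$ (l, i) * \<rho> g $$ (m, j) * (B l m + B m l)) = B i j + B j i"
      using M g ij by (simp add: Bsum SI_iff)
  qed
  define \<kappa> where "\<kappa> = f (\<one>\<^bsub>Q\<^esub>, \<one>\<^bsub>Q\<^esub>)"
  have nz: "f (x, y) \<noteq> 0" if "x \<in> carrier Q" "y \<in> carrier Q" for x y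
    using f that by (simp add: grp_Z2_iff)
  have coc: "f (y, z) * f (x, y \<otimes>\<^bsub>Q\<^esub> z) = f (x \<otimes>\<^bsub>Q\<^esub> y, z) * f (x, y)"
    if "x \<in> carrier Q" "y \<in> carrier Q" "z \<in> carrier Q" for x y z
    using f that by (simp add: grp_Z2_iff)
  have k0: "\<kappa> \<noteq> 0"
    unfolding \<kappa>_def by (rule nz[OF Q.one_closed Q.one_closed])
  have f1: "f (\<one>\<^bsub>Q\<^esub>, x) = \<kappa>" "f (x, \<one>\<^bsub>Q\<^esub>) = \<kappa>" if x: "x \<in> carrier Q" for x
    using coc[OF Q.one_closed Q.one_closed x] coc[OF x Q.one_closed Q.one_closed] nz[OF Q.one_closed x] nz[OF x Q.one_closed] x
    by (simp_all add: \<kappa>_def)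
  define c where "c = (\<lambda>(g, h). f (U #> g, U #> h) / \<kappa>)"
  have in_Q: "U #> g \<in> carrier Q" if "g \<in> carrier G" for g
    using that by (simp add: carrier_Q)
  have c: "ucocycle c"
    unfolding ucocycle_def
  proof (intro conjI ballI)
    fix g assume g: "g \<in> carrier G"
    show "c (\<one>, g) = 1" "c (g, \<one>) = 1"
      using f1[OF in_Q[OF g]] k0 by (simp_all add: c_def one_Q)
    fix h assume h: "h \<in> carrier G"
    show "c (g, h) \<noteq> 0"
      using nz[OF in_Q[OF g] in_Q[OF h]] k0 by (simp add: c_def)
    show "c (u \<otimes> g, h) = c (g, h)" "c (g, u \<otimes> h) = c (g, h)"
      using g h by (simp_all add: c_def coset_u)
    fix k assume k: "k \<in> carrier G"
    show "c (g, h) * c (g \<otimes> h, k) = c (h, k) * c (g, h \<otimes> k)"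
      using coc[OF in_Q[OF g] in_Q[OF h] in_Q[OF k]] g h k by (simp add: c_def mult_Q mult.commute)
  qed
  let ?s = "tc B c"
  have s: "?s \<in> fb.Z"
    by (rule tc_Z[OF B c])
  have "smat ?s = M"
  proof (rule eq_matI)
    fix i j assume "i < dim_row M" "j < dim_col M"
    then have ij: "i < n" "j < n"
      using M by (auto simp: SI_iff)
    have "smat ?s $$ (i, j) = (B i j + B j i) / 2"
      using ij c by (simp add: smat_def tc_low(2)[OF B one_closed one_closed] ucocycle_def)
    then show "smat ?s $$ (i, j) = M $$ (i, j)"
      using two by (simp add: Bsum[OF ij])
  qed (use M in \<open>auto simp: smat_def SI_iff\<close>)
  moreover have "B2Q #>\<^bsub>Z2Q\<^esub> descend (res ?s) = B2Q #>\<^bsub>Z2Q\<^esub> f"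
  proof -
    let ?k = "\<lambda>(x, y)\<in>carrier Q \<times> carrier Q. \<kappa> * \<kappa> / \<kappa>"
    have rc: "ucocycle (res ?s)"
      by (rule res_ucocycle[OF s])
    have "f = ?k \<otimes>\<^bsub>Z2Q\<^esub> descend (res ?s)"
    proof
      fix z
      show "f z = (?k \<otimes>\<^bsub>Z2Q\<^esub> descend (res ?s)) z"
      proof (cases "z \<in> carrier Q \<times> carrier Q")
        case True
        then obtain g h where z: "z = (U #> g, U #> h)" and g: "g \<in> carrier G" "h \<in> carrier G"
          by (auto simp: carrier_Q)
        have "descend (res ?s) z = c (g, h)"
          unfolding z descend_coset[OF rc g] using g by (simp add: res_def tc_low(1)[OF B])
        then show ?thesis
          using True k0 unfolding z by (simp add: grp_Z2_simps c_def)
      next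
        case False
        then show ?thesis
          using f by (cases z) (auto simp: grp_Z2_simps grp_Z2_iff extensional_def)
      qed
    qed
    moreover have "?k \<in> B2Q"
      unfolding group.grp_B2_iff[OF group_Q] using k0 by (intro exI[of _ "\<lambda>_. \<kappa>"]) auto
    ultimately have "f \<in> B2Q #>\<^bsub>Z2Q\<^esub> descend (res ?s)"
      unfolding r_coset_def by blast
    then show ?thesis
      by (rule Z2Q.repr_independence[OF _ descend_Z2[OF rc] group.grp_B2_subgroup[OF group_Q]])
  qed
  ultimately show "z \<in> Psi ` fb.Z"
    using s by (auto simp: z Psi_def)
qed

text \<open>A coboundary on \<open>G/U\<close> pulls back to the function \<open>\<chi>\<close> that \<open>kernel_in_B2\<close> asks for; it is automatically
  normalised, as the restriction of a cocycle to \<open>G\<close> takes the value \<open>1\<close> at the unit.\<close>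

lemma Psi_kernel: "kernel (lazy_Z2 H) (SI \<times>\<times> H2Q) Psi = lazy_B2 H"
proof -
  interpret Z2Q: comm_group Z2Q
    by (rule group.grp_Z2_comm_group[OF group_Q])
  note sub = group.grp_B2_subgroup[OF group_Q]
  have in_Q: "U #> g \<in> carrier Q" if "g \<in> carrier G" for g
    using that by (simp add: carrier_Q)
  have "s \<in> lazy_B2 H \<longleftrightarrow> smat s = 0\<^sub>m n n \<and> B2Q #>\<^bsub>Z2Q\<^esub> descend (res s) = B2Q" if s: "s \<in> fb.Z" for s
  proof
    note rc = res_ucocycle[OF s]
    {
      assume B2: "s \<in> lazy_B2 H"
      have "smat s = 0\<^sub>m n n"
        by (rule eq_matI) (simp_all add: smat_def B2_low(1)[OF B2])
      moreover obtain \<chi> where chi: "\<And>g. g \<in> carrier G \<Longrightarrow> \<chi> g \<noteq> 0" "\<And>g. g \<in> carrier G \<Longrightarrow> \<chi> (u \<otimes> g) = \<chi> g"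
        "\<And>g h. g \<in> carrier G \<Longrightarrow> h \<in> carrier G \<Longrightarrow> res s (g, h) = \<chi> g * \<chi> h / \<chi> (g \<otimes> h)"
        using B2_low(2)[OF B2] by blast
      have chi_rep: "\<chi> (rep (U #> g)) = \<chi> g" if "g \<in> carrier G" for g
        using rep_coset[OF that] chi(2)[OF that] by auto
      have "descend (res s) = (\<lambda>(A, B)\<in>carrier Q \<times> carrier Q. \<chi> (rep A) * \<chi> (rep B) / \<chi> (rep (A \<otimes>\<^bsub>Q\<^esub> B)))"
      proof
        fix z
        show "descend (res s) z = (\<lambda>(A, B)\<in>carrier Q \<times> carrier Q. \<chi> (rep A) * \<chi> (rep B) / \<chi> (rep (A \<otimes>\<^bsub>Q\<^esub> B))) z"
        proof (cases "z \<in> carrier Q \<times> carrier Q")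
          case True
          then obtain g h where z: "z = (U #> g, U #> h)" and g: "g \<in> carrier G" "h \<in> carrier G"
            by (auto simp: carrier_Q)
          show ?thesis
            unfolding z descend_coset[OF rc g] using g by (simp add: in_Q mult_Q chi_rep chi(3))
        qed (simp add: descend_def)
      qed
      then have "descend (res s) \<in> B2Q"
        unfolding group.grp_B2_iff[OF group_Q] using chi(1) rep_in by (intro exI[of _ "\<lambda>A. \<chi> (rep A)"]) auto
      then have "B2Q #>\<^bsub>Z2Q\<^esub> descend (res s) = B2Q"
        by (rule subgroup.rcos_const[OF sub Z2Q.is_group])
      ultimately show "smat s = 0\<^sub>m n n \<and> B2Q #>\<^bsub>Z2Q\<^esub> descend (res s) = B2Q" ..
    }
    assume *: "smat s = 0\<^sub>m n n \<and> B2Q #>\<^bsub>Z2Q\<^esub> descend (res s) = B2Q"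
    then have "descend (res s) \<in> B2Q"
      using Z2Q.coset_join1[OF _ descend_Z2[OF rc] sub] by blast
    then obtain \<xi> where xi: "\<And>A. A \<in> carrier Q \<Longrightarrow> \<xi> A \<noteq> 0"
      and d: "descend (res s) = (\<lambda>(A, B)\<in>carrier Q \<times> carrier Q. \<xi> A * \<xi> B / \<xi> (A \<otimes>\<^bsub>Q\<^esub> B))"
      unfolding group.grp_B2_iff[OF group_Q] by blast
    have r: "res s (g, h) = \<xi> (U #> g) * \<xi> (U #> h) / \<xi> (U #> (g \<otimes> h))"
      if "g \<in> carrier G" "h \<in> carrier G" for g h
      using that unfolding descend_coset[OF rc that, symmetric] d by (simp add: in_Q mult_Q)
    have xi1: "\<xi> (U #> \<one>) = 1"
      using r[OF one_closed one_closed] rc xi[OF in_Q[OF one_closed]] by (simp add: ucocycle_def)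
    have form0: "s (({i}, \<one>), ({j}, \<one>)) + s (({j}, \<one>), ({i}, \<one>)) = 0" if "i < n" "j < n" for i j
    proof -
      have "smat s $$ (i, j) = 0"
        using * that by simp
      then show ?thesis
        using that two by (simp add: smat_def)
    qed
    show "s \<in> lazy_B2 H"
      by (rule kernel_in_B2[OF s form0, of "\<lambda>g. \<xi> (U #> g)"]) (simp_all add: xi1 xi in_Q coset_u r)
  qed
  then show ?thesis
    using fb.B2_subset_Z by (auto simp: kernel_def fb.carrier_Z2 Psi_def DirProd_def SI_simps H2Q_simps(2))
qed

text \<open>The first isomorphism theorem for \<open>Psi\<close>.\<close>

theorem lazy_H2_iso: "group (lazy_H2 H) \<and> lazy_H2 H \<cong> SI \<times>\<times> H2Q"
proof -
  have "group (SI \<times>\<times> H2Q)"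
    by (rule DirProd_group[OF SI_group group.grp_H2_group[OF group_Q]])
  then interpret group_hom "lazy_Z2 H" "SI \<times>\<times> H2Q" Psi
    by (intro group_hom.intro group_hom_axioms.intro fb.group_Z2 Psi_hom)
  have "Psi ` carrier (lazy_Z2 H) = carrier (SI \<times>\<times> H2Q)"
    using Psi_surj hom_closed by (intro equalityI image_subsetI) (simp_all only: fb.carrier_Z2)
  from FactGroup_iso[OF this] normal.factorgroup_is_group[OF normal_kernel]
  show ?thesis
    unfolding Psi_kernel lazy_H2_def by blast
qed

end

text \<open>Coordinates of \<open>gh.v\<^sub>i\<close>, of \<open>1.v\<^sub>i\<close> and of \<open>u.v\<^sub>i\<close> with respect to the given basis.\<close>

lemma supergroup_of_rep:
  fixes G :: "('g, 'm) monoid_scheme" and scale :: "'k::field \<Rightarrow> 'v::ab_group_add \<Rightarrow> 'v"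
  assumes rep: "linear_rep G scale act" and fin: "finite (carrier G)" and u: "u \<in> carrier G"
    and central: "\<forall>g\<in>carrier G. u \<otimes>\<^bsub>G\<^esub> g = g \<otimes>\<^bsub>G\<^esub> u" and square: "u \<otimes>\<^bsub>G\<^esub> u = \<one>\<^bsub>G\<^esub>"
    and basis: "is_ordered_basis scale vs" and pos: "0 < length vs" and act_u: "\<forall>v. act u v = - v"
    and two: "(2::'k) \<noteq> 0"
  shows "supergroup G u (length vs) (rep_matrix scale act vs)"
proof -
  interpret linear_rep G scale act
    by (rule rep)
  let ?n = "length vs" and ?B = "set vs"
  have dist: "distinct vs" and ind: "independent ?B" and span: "span ?B = UNIV"
    using basis by (auto simp: is_ordered_basis_def)
  have bij: "bij_betw ((!) vs) {..<?n} ?B"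
    by (rule bij_betw_nth[OF dist refl refl])
  define r where "r = representation ?B"
  have expand: "(\<Sum>i<?n. scale (r v (vs ! i)) (vs ! i)) = v" for v
    using sum_representation_eq[OF ind, of v ?B] span
      sum.reindex_bij_betw[OF bij, of "\<lambda>b. scale (r v b) b"] by (simp add: r_def)
  have entry: "rep_matrix scale act vs g $$ (j, i) = r (act g (vs ! i)) (vs ! j)" if "i < ?n" "j < ?n" for g i j
    using that by (simp add: rep_matrix_def r_def)
  have carr: "rep_matrix scale act vs g \<in> carrier_mat ?n ?n" for g
    by (simp add: rep_matrix_def)
  show ?thesis
  proof
    show "rep_matrix scale act vs (g \<otimes>\<^bsub>G\<^esub> h) = rep_matrix scale act vs g * rep_matrix scale act vs h"
      if g: "g \<in> carrier G" "h \<in> carrier G" for g h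
    proof (rule eq_matI)
      fix j i assume "j < dim_row (rep_matrix scale act vs g * rep_matrix scale act vs h)"
        "i < dim_col (rep_matrix scale act vs g * rep_matrix scale act vs h)"
      then have ji: "j < ?n" "i < ?n"
        using carrier_matD[OF carr[of g]] carrier_matD[OF carr[of h]] by simp_all
      interpret lin: Vector_Spaces.linear scale scale "act g"
        by (rule act_linear[OF g(1)])
      have "act (g \<otimes>\<^bsub>G\<^esub> h) (vs ! i) = act g (\<Sum>m<?n. scale (r (act h (vs ! i)) (vs ! m)) (vs ! m))"
        unfolding expand by (rule act_mult[OF g])
      also have "\<dots> = (\<Sum>m<?n. scale (r (act h (vs ! i)) (vs ! m)) (act g (vs ! m)))"
        by (simp add: lin.sum lin.scale)
      finally have "r (act (g \<otimes>\<^bsub>G\<^esub> h) (vs ! i)) = (\<lambda>b. \<Sum>m<?n. r (act h (vs ! i)) (vs ! m) * r (act g (vs ! m)) b)"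
        unfolding r_def by (simp add: representation_sum[OF ind] representation_scale[OF ind] span)
      then show "rep_matrix scale act vs (g \<otimes>\<^bsub>G\<^esub> h) $$ (j, i) = (rep_matrix scale act vs g * rep_matrix scale act vs h) $$ (j, i)"
        using ji carr[of g] carr[of h]
        by (simp add: entry scalar_prod_def atLeast0LessThan mult.commute)
    qed (simp_all add: rep_matrix_def)
    have rb: "r (vs ! i) (vs ! j) = (if j = i then 1 else 0)" if "i < ?n" "j < ?n" for i j
      using that unfolding r_def by (simp add: representation_basis[OF ind] nth_eq_iff_index_eq[OF dist])
    have rn: "r (- v) b = - r v b" for v b
      unfolding r_def using representation_neg[OF ind, of v] span by simp
    show "rep_matrix scale act vs \<one>\<^bsub>G\<^esub> = 1\<^sub>m ?n"
      by (rule eq_matI) (simp_all add: rep_matrix_def act_one rb flip: r_def)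
    show "rep_matrix scale act vs u = - 1\<^sub>m ?n"
      by (rule eq_matI) (simp_all add: rep_matrix_def act_u rn rb flip: r_def)
    show "u \<otimes>\<^bsub>G\<^esub> g = g \<otimes>\<^bsub>G\<^esub> u" if "g \<in> carrier G" for g
      using central that by blast
  qed (use fin u square two carr pos in auto)
qed

lemma ordered_basis_nonempty:
  fixes scale :: "'k::field \<Rightarrow> 'v::ab_group_add \<Rightarrow> 'v" and v :: 'v
  assumes "vector_space scale" "is_ordered_basis scale vs" "v \<noteq> 0"
  shows "0 < length vs"
proof (rule ccontr)
  interpret vector_space scale
    by (rule assms(1))
  assume "\<not> 0 < length vs"
  moreover have "v \<in> span (set vs)"
    using assms(2) by (simp add: is_ordered_basis_def)
  ultimately show False
    using assms(3) by simp
qed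

lemma dim_supergroup_alg: "dim_alg (supergroup_alg G u n \<rho>) = 2 ^ n * card (carrier G)"
  by (simp add: dim_alg_def supergroup_alg_def smash_alg_def alg.defs Let_def card_cartesian_product card_Pow)

theorem theorem4p4:
  fixes G :: "('g, 'm) monoid_scheme"
    and u :: 'g
    and scale :: "'k::field \<Rightarrow> 'v::ab_group_add \<Rightarrow> 'v"
    and act :: "'g \<Rightarrow> 'v \<Rightarrow> 'v"
    and vs :: "'v list"
  defines "\<rho> \<equiv> rep_matrix scale act vs"
    and "n \<equiv> length vs"
  defines "H \<equiv> supergroup_alg G u n \<rho>"
    and "U \<equiv> generate G {u}"
  assumes "linear_rep G scale act"
    and "finite (carrier G)"
    and "u \<in> carrier G"
    and "\<forall>g\<in>carrier G. u \<otimes>\<^bsub>G\<^esub> g = g \<otimes>\<^bsub>G\<^esub> u"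
    and "u \<otimes>\<^bsub>G\<^esub> u = \<one>\<^bsub>G\<^esub>"
    and "is_ordered_basis scale vs"
    and "\<exists>v::'v. v \<noteq> 0"
    and "\<forall>v. act u v = - v"
    and "CHAR('k) = 0 \<or> \<not> CHAR('k) dvd dim_alg H"
  shows "group (lazy_H2 H) \<and>
    lazy_H2 H \<cong> sym_invariants G n \<rho> \<times>\<times> grp_H2 (G Mod U) (nonzero_group :: 'k monoid)"
proof -
  have pos: "0 < length vs"
    using assms(11) ordered_basis_nonempty[OF linear_rep.axioms(2)[OF assms(5)] assms(10)] by blast
  \<comment> \<open>\<open>dim H = 2\<^sup>n |G|\<close> with \<open>n > 0\<close>, so the characteristic is not \<open>2\<close>\<close>
  have two: "(2 :: 'k) \<noteq> 0"
  proof
    assume "(2 :: 'k) = 0"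
    then have "CHAR('k) dvd 2"
      using of_nat_eq_0_iff_char_dvd[of 2, where 'a = 'k] by simp
    moreover have "2 dvd dim_alg H"
      using pos by (simp add: H_def n_def dim_supergroup_alg)
    ultimately have "CHAR('k) dvd dim_alg H" "CHAR('k) \<noteq> 0"
      by (rule dvd_trans) (use \<open>CHAR('k) dvd 2\<close> in \<open>metis dvd_0_left_iff zero_neq_numeral\<close>)
    then show False
      using assms(13) by simp
  qed
  interpret supergroup G u n \<rho>
    unfolding n_def \<rho>_def by (rule supergroup_of_rep[OF assms(5-10) pos assms(12) two])
  show ?thesis
    unfolding H_def U_def by (rule lazy_H2_iso)
qed

end
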